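(* Let $\beta \in \mathscr{C}^1(\mathcal{M})$ satisfy $\|W\beta\|_{\infty} < |c|$, and let $\{\widetilde{h}_t\}_{t\in\mathbb{R}}$ be the flow on $\mathcal{M}$ induced by the vector field $\widetilde{U} = U + \beta Z$. Suppose that $\{\widetilde{h}_t\}_{t\in\mathbb{R}}$ preserves a measure $\widetilde{\omega} = \lambda\omega$ equivalent to Haar, with a density $\lambda \in \mathscr{C}^1(\mathcal{M})$, $\lambda>0$. Then $\{\widetilde{h}_t\}_{t\in\mathbb{R}}$ is parabolic, namely $\|D\widetilde{h}_t\|_{\infty} = O(|t|^4)$ as $|t|\to\infty$, and it is ergodic and mixing (with respect to $\widetilde{\omega}$).
   Context: Let $\mathcal{M} = \Gamma\backslash \mathrm{SL}(3,\mathbb{R})$ be a compact connected homogeneous manifold ($\Gamma$ a cocompact lattice) and let $\omega$ be (the volume form inducing) the normalised Haar measure on $\mathcal{M}$. Elements of $\mathfrak{sl}(3,\mathbb{R})$ are identified with left-invariant vector fields on $\mathcal{M}$; the flow of $X\in\mathfrak{sl}(3,\mathbb{R})$ is $\varphi^X_t(\Gamma g) = \Gamma g\exp(tX)$. Let $E_{i,j}$ be the $3\times 3$ matrix with $1$ in position $(i,j)$ and $0$ elsewhere, and $\mathfrak{n} = \mathrm{span}\{E_{1,2},E_{2,3},E_{1,3}\}$. Put $Z = E_{1,3}$, which generates the centre of $\mathfrak{n}$. Fix $U = c_{1,2}E_{1,2}+c_{2,3}E_{2,3}+c_{1,3}E_{1,3}\in\mathfrak{n}\setminus\mathbb{R}Z$,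 and fix $W\in\{E_{1,2},E_{2,3}\}$ such that $[U,W] = -cZ$ for some real $c\neq 0$. For a function $\beta$, $W\beta$ denotes the derivative of $\beta$ along $W$. A smooth flow $\{\varphi_t\}$ on $\mathcal{M}$ is called parabolic if there is $n\in\mathbb{N}$ with $\|D\varphi_t\|_{\infty} = O(|t|^n)$ as $|t|\to\infty$, where $D\varphi_t$ is the differential of $\varphi_t$. *)

theory Defs
  imports "HOL-Analysis.Analysis" "HOL-Algebra.Coset"
begin

section \<open>The homogeneous space\<close>

definition SL3 :: "(real^3^3) monoid"
  where "SL3 = \<lparr>carrier = {A. det A = 1}, mult = (**), one = mat 1\<rparr>"

lemma carrier_SL3: "carrier SL3 = {A. det A = 1}"
  and mult_SL3: "A \<otimes>\<^bsub>SL3\<^esub> B = A ** B"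
  and one_SL3: "\<one>\<^bsub>SL3\<^esub> = mat 1"
  by (simp_all add: SL3_def)

lemma group_SL3: "group SL3"
proof (rule groupI)
  fix A assume "A \<in> carrier SL3"
  then have d: "det A = 1" by (simp add: carrier_SL3)
  then obtain B where B: "B ** A = mat 1"
    using invertible_det_nz[of A] by (auto simp: invertible_def)
  have "det B * det A = 1" using arg_cong[OF B, of det] by (simp add: det_mul)
  with d B show "\<exists>B\<in>carrier SL3. B \<otimes>\<^bsub>SL3\<^esub> A = \<one>\<^bsub>SL3\<^esub>"
    by (auto simp: carrier_SL3 mult_SL3 one_SL3)
qed (simp_all add: carrier_SL3 mult_SL3 one_SL3 det_mul matrix_mul_assoc)

text \<open>
  Points of \<open>\<Gamma>\SL(3,\<real>)\<close> are the cosets \<open>\<Gamma>g\<close>, written \<open>\<Gamma> #> g\<close> in HOL-Algebra.  Since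
  \<open>(\<Gamma> #> g) #> k = \<Gamma> #> gk\<close>, right translation of a point \<open>x\<close> by \<open>k\<close> is \<open>x #> k\<close>.
\<close>

definition hspace :: "(real^3^3) set \<Rightarrow> (real^3^3) set set"
  where "hspace \<Gamma> = rcosets\<^bsub>SL3\<^esub> \<Gamma>"

definition hspace_topology :: "(real^3^3) set \<Rightarrow> (real^3^3) set topology"
  where "hspace_topology \<Gamma> = topology (\<lambda>S. S \<subseteq> hspace \<Gamma> \<and>
    openin (top_of_set (carrier SL3)) {g \<in> carrier SL3. \<Gamma> #>\<^bsub>SL3\<^esub> g \<in> S})"

lemma openin_hspace_topology:
  "openin (hspace_topology \<Gamma>) S \<longleftrightarrow> S \<subseteq> hspace \<Gamma> \<and>
    openin (top_of_set (carrier SL3)) {g \<in> carrier SL3. \<Gamma> #>\<^bsub>SL3\<^esub> g \<in> S}"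
proof -
  let ?P = "\<lambda>S. {g \<in> carrier SL3. \<Gamma> #>\<^bsub>SL3\<^esub> g \<in> S}"
  have i: "?P (S \<inter> T) = ?P S \<inter> ?P T" for S T by blast
  have u: "?P (\<Union>K) = \<Union>(?P ` K)" for K by blast
  have "istopology (\<lambda>S. S \<subseteq> hspace \<Gamma> \<and> openin (top_of_set (carrier SL3)) (?P S))"
    unfolding istopology_def i u by (auto intro!: openin_Int openin_Union)
  then show ?thesis
    by (simp add: hspace_topology_def topology_inverse')
qed

lemma topspace_hspace_topology: "topspace (hspace_topology \<Gamma>) = hspace \<Gamma>"
proof -
  have "{g \<in> carrier SL3. \<Gamma> #>\<^bsub>SL3\<^esub> g \<in> hspace \<Gamma>} = carrier SL3"
    by (auto simp: hspace_def RCOSETS_def)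
  then have "openin (hspace_topology \<Gamma>) (hspace \<Gamma>)"
    by (simp add: openin_hspace_topology)
  then show ?thesis
    by (metis openin_hspace_topology openin_subset openin_topspace subset_antisym)
qed

lemma quotient_map_hspace:
  "quotient_map (top_of_set (carrier SL3)) (hspace_topology \<Gamma>) (\<lambda>g. \<Gamma> #>\<^bsub>SL3\<^esub> g)"
  by (auto simp: quotient_map_def topspace_hspace_topology openin_hspace_topology
        hspace_def RCOSETS_def)

definition cocompact_lattice :: "(real^3^3) set \<Rightarrow> bool"
  where "cocompact_lattice \<Gamma> \<longleftrightarrow>
    subgroup \<Gamma> SL3 \<and> discrete \<Gamma> \<and> compact_space (hspace_topology \<Gamma>)"

definition normalised_haar :: "(real^3^3) set \<Rightarrow> (real^3^3) set measure \<Rightarrow> bool"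
  where "normalised_haar \<Gamma> \<omega> \<longleftrightarrow>
    space \<omega> = hspace \<Gamma> \<and>
    sets \<omega> = sigma_sets (hspace \<Gamma>) {S. openin (hspace_topology \<Gamma>) S} \<and>
    emeasure \<omega> (hspace \<Gamma>) = 1 \<and>
    (\<forall>k\<in>carrier SL3. \<forall>A\<in>sets \<omega>. emeasure \<omega> ((\<lambda>x. x #>\<^bsub>SL3\<^esub> k) ` A) = emeasure \<omega> A)"


section \<open>The Lie algebra\<close>

definition sl3 :: "(real^3^3) set"
  where "sl3 = {X. trace X = 0}"

definition E :: "3 \<Rightarrow> 3 \<Rightarrow> real^3^3"
  where "E i j = (\<chi> k l. if k = i \<and> l = j then 1 else 0)"

definition nilp :: "(real^3^3) set"
  where "nilp = span {E 1 2, E 2 3, E 1 3}"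

definition lie_bracket :: "real^3^3 \<Rightarrow> real^3^3 \<Rightarrow> real^3^3"
  where "lie_bracket X Y = X ** Y - Y ** X"

text \<open>
  The library's \<open>*\<close> (hence \<open>^\<close>) on \<open>real^3^3\<close> is componentwise,
  so powers are taken by iterating \<open>**\<close>.
\<close>

definition mexp :: "real^3^3 \<Rightarrow> real^3^3"
  where "mexp X = (\<Sum>n. (1 / fact n) *\<^sub>R (((**) X ^^ n) (mat 1)))"

definition lflow :: "real^3^3 \<Rightarrow> real \<Rightarrow> (real^3^3) set \<Rightarrow> (real^3^3) set"
  where "lflow X t x = x #>\<^bsub>SL3\<^esub> mexp (t *\<^sub>R X)"

definition lie_deriv :: "real^3^3 \<Rightarrow> ((real^3^3) set \<Rightarrow> real) \<Rightarrow> (real^3^3) set \<Rightarrow> real"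
  where "lie_deriv X f x = deriv (\<lambda>s. f (lflow X s x)) 0"


section \<open>Differential calculus on the homogeneous space\<close>

definition C1_on :: "(real^3^3) set \<Rightarrow> (real^3^3 \<Rightarrow> 'b::real_normed_vector) \<Rightarrow> bool"
  where "C1_on V F \<longleftrightarrow> open V \<and> (\<exists>F'.
    (\<forall>a\<in>V. (F has_derivative blinfun_apply (F' a)) (at a)) \<and> continuous_on V F')"

text \<open>
  The projection from \<open>SL(3,\<real>)\<close> is a local diffeomorphism, so regularity is tested on lifts to
  \<open>SL(3,\<real>)\<close>; a map on this embedded submanifold of \<open>real^3^3\<close> is \<open>C\<^sup>1\<close> when it extends
  locally to a \<open>C\<^sup>1\<close> map on an open subset of \<open>real^3^3\<close>.
\<close>

definition C1_fun :: "(real^3^3) set \<Rightarrow> ((real^3^3) set \<Rightarrow> 'b::real_normed_vector) \<Rightarrow> bool"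
  where "C1_fun \<Gamma> f \<longleftrightarrow> (\<forall>g\<in>carrier SL3. \<exists>V F. g \<in> V \<and> C1_on V F \<and>
    (\<forall>a\<in>V \<inter> carrier SL3. f (\<Gamma> #>\<^bsub>SL3\<^esub> a) = F a))"

definition C1_map :: "(real^3^3) set \<Rightarrow> ((real^3^3) set \<Rightarrow> (real^3^3) set) \<Rightarrow> bool"
  where "C1_map \<Gamma> \<phi> \<longleftrightarrow> (\<forall>g\<in>carrier SL3. \<exists>V F. g \<in> V \<and> C1_on V F \<and>
    (\<forall>a\<in>V \<inter> carrier SL3. F a \<in> carrier SL3 \<and> \<phi> (\<Gamma> #>\<^bsub>SL3\<^esub> a) = \<Gamma> #>\<^bsub>SL3\<^esub> F a))"

text \<open>
  Tangent vectors are written in the frame of left-invariant fields: \<open>Y \<in> sl3\<close> stands for the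
  vector at \<open>\<Gamma>g\<close> that is the projection of \<open>gY\<close>.  The velocity of a curve is computed on a
  local lift; the lift is unique up to a left factor in the discrete group \<open>\<Gamma>\<close>, which cancels.
\<close>

definition has_velocity ::
    "(real^3^3) set \<Rightarrow> (real \<Rightarrow> (real^3^3) set) \<Rightarrow> real^3^3 \<Rightarrow> real \<Rightarrow> bool"
  where "has_velocity \<Gamma> c Y t \<longleftrightarrow> (\<exists>\<gamma>.
    (\<forall>\<^sub>F s in nhds t. \<gamma> s \<in> carrier SL3 \<and> c s = \<Gamma> #>\<^bsub>SL3\<^esub> \<gamma> s) \<and>
    (\<gamma> has_vector_derivative \<gamma> t ** Y) (at t))"

definition flow_of ::
    "(real^3^3) set \<Rightarrow> ((real^3^3) set \<Rightarrow> real^3^3) \<Rightarrow> (real \<Rightarrow> (real^3^3) set \<Rightarrow> (real^3^3) set) \<Rightarrow> bool"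
  where "flow_of \<Gamma> V \<phi> \<longleftrightarrow> (\<forall>x\<in>hspace \<Gamma>.
    \<phi> 0 x = x \<and> (\<forall>t. has_velocity \<Gamma> (\<lambda>s. \<phi> s x) (V (\<phi> t x)) t))"

definition differential ::
    "(real^3^3) set \<Rightarrow> ((real^3^3) set \<Rightarrow> (real^3^3) set) \<Rightarrow> (real^3^3) set \<Rightarrow> real^3^3 \<Rightarrow> real^3^3"
  where "differential \<Gamma> \<phi> x X = (THE Y. has_velocity \<Gamma> (\<lambda>s. \<phi> (lflow X s x)) Y 0)"

text \<open>
  The tangent spaces carry the Euclidean norm of \<open>sl3 \<subseteq> real^3^3\<close> in the left-invariant frame;
  by compactness any other Riemannian metric gives the same growth rates.  The value is in
  \<open>ennreal\<close>, so an upper bound on it includes finiteness of the supremum.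
\<close>

definition differential_sup_norm ::
    "(real^3^3) set \<Rightarrow> ((real^3^3) set \<Rightarrow> (real^3^3) set) \<Rightarrow> ennreal"
  where "differential_sup_norm \<Gamma> \<phi> =
    (SUP x\<in>hspace \<Gamma>. SUP X\<in>{X \<in> sl3. norm X \<le> 1}. ennreal (norm (differential \<Gamma> \<phi> x X)))"

definition differential_growth ::
    "(real^3^3) set \<Rightarrow> (real \<Rightarrow> (real^3^3) set \<Rightarrow> (real^3^3) set) \<Rightarrow> nat \<Rightarrow> bool"
  where "differential_growth \<Gamma> \<phi> n \<longleftrightarrow>
    (\<exists>C::real. \<forall>\<^sub>F t in at_infinity. differential_sup_norm \<Gamma> (\<phi> t) \<le> ennreal (C * \<bar>t\<bar> ^ n))"

text \<open>A one-parameter group of \<open>C\<^sup>1\<close> maps generated by a \<open>C\<^sup>1\<close> vector field.\<close>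

definition C1_flow ::
    "(real^3^3) set \<Rightarrow> (real \<Rightarrow> (real^3^3) set \<Rightarrow> (real^3^3) set) \<Rightarrow> bool"
  where "C1_flow \<Gamma> \<phi> \<longleftrightarrow>
    (\<forall>t. \<phi> t \<in> hspace \<Gamma> \<rightarrow> hspace \<Gamma> \<and> C1_map \<Gamma> (\<phi> t)) \<and>
    (\<forall>x\<in>hspace \<Gamma>. \<forall>s t. \<phi> (s + t) x = \<phi> s (\<phi> t x)) \<and>
    (\<exists>V. V \<in> hspace \<Gamma> \<rightarrow> sl3 \<and> C1_fun \<Gamma> V \<and> flow_of \<Gamma> V \<phi>)"

definition parabolic ::
    "(real^3^3) set \<Rightarrow> (real \<Rightarrow> (real^3^3) set \<Rightarrow> (real^3^3) set) \<Rightarrow> bool"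
  where "parabolic \<Gamma> \<phi> \<longleftrightarrow> C1_flow \<Gamma> \<phi> \<and> (\<exists>n. differential_growth \<Gamma> \<phi> n)"


section \<open>Ergodic theory of flows on finite measure spaces\<close>

definition preserves_measure :: "'a measure \<Rightarrow> (real \<Rightarrow> 'a \<Rightarrow> 'a) \<Rightarrow> bool"
  where "preserves_measure \<mu> \<phi> \<longleftrightarrow>
    (\<forall>t. \<phi> t \<in> measurable \<mu> \<mu> \<and> distr \<mu> \<mu> (\<phi> t) = \<mu>)"

definition ergodic_flow :: "'a measure \<Rightarrow> (real \<Rightarrow> 'a \<Rightarrow> 'a) \<Rightarrow> bool"
  where "ergodic_flow \<mu> \<phi> \<longleftrightarrow>
    (\<forall>A\<in>sets \<mu>. (\<forall>t. \<phi> t -` A \<inter> space \<mu> = A) \<longrightarrow> emeasure \<mu> A = 0 \<or> emeasure \<mu> (space \<mu> - A) = 0)"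

text \<open>The total mass is not assumed to be \<open>1\<close>, whence the normalising factor.\<close>

definition mixing_flow :: "'a measure \<Rightarrow> (real \<Rightarrow> 'a \<Rightarrow> 'a) \<Rightarrow> bool"
  where "mixing_flow \<mu> \<phi> \<longleftrightarrow> finite_measure \<mu> \<and> (\<forall>A\<in>sets \<mu>. \<forall>B\<in>sets \<mu>.
    ((\<lambda>t. measure \<mu> (\<phi> t -` A \<inter> B)) \<longlongrightarrow> measure \<mu> A * measure \<mu> B / measure \<mu> (space \<mu>)) at_top)"

end

theory Submission
  imports Defs
begin

text \<open>
  The flow is \<open>h\<^sub>t x = x exp(tU) exp(\<rho>Z)\<close> with \<open>\<rho> = \<rho>(t, x)\<close> the integral of \<open>\<beta>\<close> along the orbit.
  Invariance of the measure with density \<open>\<kappa>\<close> amounts to \<open>U\<kappa> + Z(\<beta>\<kappa>) = 0\<close>, that is, \<open>\<kappa>\<close> times arc length on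
  the central orbits is a length form preserved by \<open>h\<close>.  Hence \<open>\<kappa>\<close> is an integrating factor of the scalar
  linear equation for the derivative of \<open>\<rho>\<close>, and integrating entries of \<open>exp(tU)\<close> gives the growth \<open>t\<^sup>4\<close>.

  For mixing, an arc of length \<open>\<sigma>/t\<close> in the direction \<open>W\<close> is sheared by \<open>h\<^sub>t\<close> along \<open>Z\<close>; measured by the
  invariant length form the displacement is \<open>\<sigma>\<close> times the time average of \<open>\<kappa> (c + W\<beta>)\<close> over \<open>[0, t]\<close>,
  up to an error \<open>o(\<sigma>)\<close>, and \<open>|W\<beta>| < |c|\<close> keeps this average away from \<open>0\<close>.  Since small
  translations do not change integrals much, and the averages converge in mean, the functions
  \<open>Zf / \<kappa>\<close> become weakly null along the flow.  By the Mautner phenomenon \<open>exp Z\<close> acts ergodically, so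
  the derivatives \<open>Zf\<close> are dense in the functions of mean zero; thus all observables decorrelate.
\<close>

section \<open>Matrices\<close>

text \<open>Gronwall's inequality alone bounds the derivative of the flow exponentially. A positive
  continuous integrating factor on a compact space is bounded above and away from zero, and this
  makes the growth polynomial. The exponent needs one more cancellation: conjugation by exp(tU)
  exp(\<rho>Z) has entries of degree at most 3 in t, except for degree 4 in position (1,3), and
  integrating that entry would give degree 5. Its contribution to the integral is minus the entry
  times the derivative of \<kappa> along the orbit, so the product rule absorbs it and only cubic
  terms are integrated.

  In mixing, the obstacle is that the slope of the sheared arc varies with the point. The mean
  ergodic theorem makes the slopes converge without identifying the limit, so ergodicity of the flow
  is not presupposed; the second observable is divided by the slope at one large fixed time. The
  parameter \<sigma> is fixed before t, since the error must be small compared with \<sigma> itself.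

  Two measures share the work: \<omega> is invariant under right translations, \<mu> under the flow,
  and two-sided bounds on \<kappa> pass between them.\<close>

abbreviation rtrans :: "(real^3^3) set \<Rightarrow> real^3^3 \<Rightarrow> (real^3^3) set" (infixl "\<star>" 70)
  where "x \<star> k \<equiv> x #>\<^bsub>SL3\<^esub> k"

abbreviation SL :: "(real^3^3) set" where "SL \<equiv> carrier SL3"

lemma matrix_scaleR_left: "(r *\<^sub>R A) ** B = r *\<^sub>R (A ** (B :: real^'n^'m))"
  by (simp add: matrix_matrix_mult_def vec_eq_iff sum_distrib_left mult_ac)

lemma matrix_scaleR_right: "A ** (r *\<^sub>R B) = r *\<^sub>R (A ** (B :: real^'n^'m))"
  by (simp add: matrix_matrix_mult_def vec_eq_iff sum_distrib_left mult_ac)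

lemma bounded_linear_entry: "bounded_linear (\<lambda>A :: real^3^3. A $ i $ j)"
  using bounded_linear_compose[OF bounded_linear_vec_nth bounded_linear_vec_nth] .

lemma bounded_bilinear_matrix_mult:
  "bounded_bilinear ((**) :: real^'n^'m \<Rightarrow> real^'k^'n \<Rightarrow> real^'k^'m)"
  by (subst bilinear_conv_bounded_bilinear[symmetric])
     (auto simp: bilinear_def linear_iff matrix_matrix_mult_def vec_eq_iff
        sum.distrib sum_distrib_left algebra_simps)

lemmas bounded_linear_mmult_left = bounded_bilinear.bounded_linear_left[OF bounded_bilinear_matrix_mult]
lemmas bounded_linear_mmult_right = bounded_bilinear.bounded_linear_right[OF bounded_bilinear_matrix_mult]
lemmas continuous_on_mmult [continuous_intros] = bounded_bilinear.continuous_on[OF bounded_bilinear_matrix_mult]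
lemmas tendsto_mmult [tendsto_intros] = bounded_bilinear.tendsto[OF bounded_bilinear_matrix_mult]
lemmas has_derivative_mmult = bounded_bilinear.FDERIV[OF bounded_bilinear_matrix_mult]
lemmas has_vector_derivative_mmult = bounded_bilinear.has_vector_derivative[OF bounded_bilinear_matrix_mult]

lemma matrix_mult_norm_bound:
  obtains K where "K \<ge> 1" "\<And>(A :: real^3^3) (B :: real^3^3). norm (A ** B) \<le> K * norm A * norm B"
proof -
  obtain K where "\<And>(A :: real^3^3) (B :: real^3^3). norm (A ** B) \<le> norm A * norm B * K"
    using bounded_bilinear.bounded[OF bounded_bilinear_matrix_mult] by metis
  moreover have "norm A * norm B * K \<le> max K 1 * norm A * norm B" for A B :: "real^3^3"
    using mult_right_mono[of K "max K 1" "norm A * norm B"] by (simp add: mult_ac)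
  ultimately have "norm (A ** B) \<le> max K 1 * norm A * norm B" for A B :: "real^3^3"
    using order_trans by blast
  then show ?thesis using that[of "max K 1"] by auto
qed

lemma continuous_on_det3 [continuous_intros]:
  fixes f :: "'a::topological_space \<Rightarrow> real^3^3"
  assumes "continuous_on S f" shows "continuous_on S (\<lambda>x. det (f x))"
  unfolding det_3 by (intro continuous_intros assms)

lemma closed_SL: "closed SL"
proof -
  have "closed ((\<lambda>A::real^3^3. det A) -` {1})"
    by (rule closed_vimage[OF closed_singleton]) (intro continuous_intros)
  then show ?thesis by (simp add: carrier_SL3 vimage_def)
qed

lemma SL_mult: "a \<in> SL \<Longrightarrow> b \<in> SL \<Longrightarrow> a ** b \<in> SL"
  by (simp add: carrier_SL3 det_mul)

lemma SL_one: "mat 1 \<in> SL"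
  by (simp add: carrier_SL3)

section \<open>Inversion on SL(3,R) as a polynomial map\<close>

definition minv :: "real^3^3 \<Rightarrow> real^3^3" where "minv g = inv\<^bsub>SL3\<^esub> g"

lemma minv: assumes "g \<in> SL" shows "minv g \<in> SL" "minv g ** g = mat 1" "g ** minv g = mat 1"
  using group.inv_closed[OF group_SL3 assms] group.l_inv[OF group_SL3 assms] group.r_inv[OF group_SL3 assms]
  by (auto simp: minv_def mult_SL3 one_SL3)

lemma minv_eqI: assumes "g \<in> SL" "h ** g = mat 1" shows "minv g = h"
proof -
  have "h = h ** (g ** minv g)" using assms by (simp add: minv)
  also have "\<dots> = minv g" using assms by (simp add: matrix_mul_assoc)
  finally show ?thesis by simp
qed

lemma minv_minv: "g \<in> SL \<Longrightarrow> minv (minv g) = g"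
  by (rule minv_eqI) (auto simp: minv)

lemma minv_cancel:
  assumes "g \<in> SL" shows "g ** (minv g ** A) = A" "minv g ** (g ** A) = A"
  using assms by (simp_all add: matrix_mul_assoc minv)

lemma minv_cancel':
  assumes "g \<in> SL" shows "A ** g ** minv g = A" "A ** minv g ** g = A"
  by (simp_all only: matrix_mul_assoc[symmetric] minv[OF assms] matrix_mul_rid)

lemma minv_mult:
  assumes "g \<in> SL" "k \<in> SL" shows "minv (g ** k) = minv k ** minv g"
proof (rule minv_eqI)
  have "minv k ** minv g ** (g ** k) = minv k ** (minv g ** g) ** k"
    by (simp only: matrix_mul_assoc)
  then show "minv k ** minv g ** (g ** k) = mat 1" using assms by (simp add: minv)
qed (use assms SL_mult in auto)

text \<open>The adjugate, written out: on matrices of determinant 1 it is the inverse, and its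
  polynomial entries give continuity of \<open>minv\<close>.\<close>

definition adj3 :: "real^3^3 \<Rightarrow> real^3^3" where
  "adj3 A = vector [
     vector [A$2$2*A$3$3 - A$2$3*A$3$2, A$1$3*A$3$2 - A$1$2*A$3$3, A$1$2*A$2$3 - A$1$3*A$2$2],
     vector [A$2$3*A$3$1 - A$2$1*A$3$3, A$1$1*A$3$3 - A$1$3*A$3$1, A$1$3*A$2$1 - A$1$1*A$2$3],
     vector [A$2$1*A$3$2 - A$2$2*A$3$1, A$1$2*A$3$1 - A$1$1*A$3$2, A$1$1*A$2$2 - A$1$2*A$2$1]]"

lemma adj3_mult: "adj3 A ** A = det A *\<^sub>R mat 1"
  by (simp add: adj3_def vec_eq_iff forall_3 matrix_matrix_mult_def sum_3 mat_def det_3 algebra_simps)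

lemma minv_adj3: "g \<in> SL \<Longrightarrow> minv g = adj3 g"
  by (rule minv_eqI) (auto simp: adj3_mult carrier_SL3)

lemma continuous_on_vector3 [continuous_intros]:
  fixes f g h :: "'a::topological_space \<Rightarrow> 'b::{zero,topological_space}"
  assumes "continuous_on S f" "continuous_on S g" "continuous_on S h"
  shows "continuous_on S (\<lambda>x. vector [f x, g x, h x] :: 'b^3)"
proof -
  have *: "(\<lambda>x. vector [f x, g x, h x] :: 'b^3) = (\<lambda>x. \<chi> i. if i = 1 then f x else if i = 2 then g x else h x)"
    by (auto simp: vec_eq_iff forall_3)
  have "continuous_on S (\<lambda>x. if i = 1 then f x else if i = 2 then g x else h x)" for i :: 3
    using assms by (cases "i = 1"; cases "i = 2") auto
  then show ?thesis unfolding * by (rule continuous_on_vec_lambda)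
qed

lemma continuous_on_minv: "continuous_on SL minv"
proof -
  have "continuous_on SL adj3" unfolding adj3_def by (intro continuous_intros)
  then show ?thesis by (rule continuous_on_eq) (simp add: minv_adj3)
qed

lemma rtrans_SL: "(x \<star> g) = (\<lambda>h. h ** g) ` x"
  by (auto simp: r_coset_def mult_SL3)

text \<open>The Heisenberg group in matrix entries rather than exponential coordinates: exp(aE12 +
  bE23 + cE13) is \<open>u3 a b (c + a * b / 2)\<close>. Products and inverses are polynomial in
  these coordinates.\<close>

definition u3 :: "real \<Rightarrow> real \<Rightarrow> real \<Rightarrow> real^3^3" where
  "u3 a b c = vector [vector [1, a, c], vector [0, 1, b], vector [0, 0, 1]]"

lemma u3_mult: "u3 a b c ** u3 a' b' c' = u3 (a + a') (b + b') (c + c' + a * b')"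
  by (simp add: u3_def vec_eq_iff forall_3 matrix_matrix_mult_def sum_3 algebra_simps)

lemma u3_SL: "u3 a b c \<in> SL"
  by (simp add: carrier_SL3 det_3 u3_def)

lemma u3_zero: "u3 0 0 0 = mat 1"
  by (simp add: u3_def vec_eq_iff forall_3 mat_def)

lemma minv_u3: "minv (u3 a b c) = u3 (- a) (- b) (a * b - c)"
  by (rule minv_eqI) (auto simp: u3_SL u3_mult u3_zero)

lemma u3_eq: "u3 a b c = mat 1 + a *\<^sub>R E 1 2 + b *\<^sub>R E 2 3 + c *\<^sub>R E 1 3"
  by (simp add: u3_def vec_eq_iff forall_3 mat_def E_def)

lemma continuous_on_u3 [continuous_intros]:
  assumes "continuous_on S f" "continuous_on S g" "continuous_on S h"
  shows "continuous_on S (\<lambda>x. u3 (f x) (g x) (h x))"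
  unfolding u3_eq by (intro continuous_intros assms)

lemma has_derivative_u3 [derivative_intros]:
  assumes "(f has_derivative f') F" "(g has_derivative g') F" "(h has_derivative h') F"
  shows "((\<lambda>x. u3 (f x) (g x) (h x)) has_derivative
     (\<lambda>y. f' y *\<^sub>R E 1 2 + g' y *\<^sub>R E 2 3 + h' y *\<^sub>R E 1 3)) F"
  unfolding u3_eq by (auto intro!: derivative_eq_intros assms)

lemma has_vector_derivative_u3:
  assumes "(f has_real_derivative f') F" "(g has_real_derivative g') F" "(h has_real_derivative h') F"
  shows "((\<lambda>x. u3 (f x) (g x) (h x)) has_vector_derivative (f' *\<^sub>R E 1 2 + g' *\<^sub>R E 2 3 + h' *\<^sub>R E 1 3)) F"
proof -
  have *: "((\<lambda>x. k x *\<^sub>R (A :: real^3^3)) has_vector_derivative k' *\<^sub>R A) F"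
    if "(k has_real_derivative k') F" for k k' A
    using bounded_linear.has_vector_derivative[OF bounded_linear_scaleR_left, of k k' F A] that
    by (simp add: has_real_derivative_iff_has_vector_derivative)
  show ?thesis unfolding u3_eq
    by (intro has_vector_derivative_add_const[THEN iffD2] has_vector_derivative_add * assms)
       (auto intro!: derivative_eq_intros * assms)
qed

subsection \<open>The exponential\<close>

lemma matrix_funpow_mult: "((**) X ^^ n) (mat 1) ** X = X ** ((**) X ^^ n) (mat 1 :: real^3^3)"
  by (induction n) (auto simp: matrix_mul_assoc[symmetric])

lemma mexp_summable:
  fixes X :: "real^3^3" shows
  "summable (\<lambda>n. norm ((1 / fact n) *\<^sub>R (((**) X ^^ n) (mat 1 :: real^3^3))))"
proof -
  obtain K where K: "K \<ge> 1" "\<And>(A :: real^3^3) (B :: real^3^3). norm (A ** B) \<le> K * norm A * norm B"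
    using matrix_mult_norm_bound by blast
  have b: "norm (((**) X ^^ n) (mat 1 :: real^3^3)) \<le> (K * norm X) ^ n * norm (mat 1 :: real^3^3)" for n
  proof (induction n)
    case (Suc n)
    have "norm (((**) X ^^ Suc n) (mat 1 :: real^3^3)) \<le> K * norm X * norm (((**) X ^^ n) (mat 1 :: real^3^3))"
      using K(2)[of X "((**) X ^^ n) (mat 1)"] by simp
    also have "\<dots> \<le> K * norm X * ((K * norm X) ^ n * norm (mat 1 :: real^3^3))"
      using Suc K(1) by (intro mult_left_mono) auto
    finally show ?case by (simp add: mult_ac)
  qed simp
  have "summable (\<lambda>n. inverse (fact n) * (K * norm X) ^ n * norm (mat 1 :: real^3^3))"
    by (intro summable_mult2 summable_exp)
  then show ?thesis
    by (rule summable_comparison_test')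
       (use b in \<open>simp add: divide_simps mult.commute mult_left_mono\<close>)
qed

lemma mexp_scaleR_component:
  "mexp (s *\<^sub>R X) $ i $ j = (\<Sum>n. ((((**) X ^^ n) (mat 1)) $ i $ j / fact n) * s ^ n)"
  and mexp_summable_real: "summable (\<lambda>n. ((((**) X ^^ n) (mat 1 :: real^3^3)) $ i $ j / fact n) * s ^ n)"
proof -
  have p: "((**) (s *\<^sub>R X) ^^ n) (mat 1) = s ^ n *\<^sub>R ((**) X ^^ n) (mat 1 :: real^3^3)" for n
    by (induction n) (auto simp: matrix_scaleR_left matrix_scaleR_right)
  have bl: "bounded_linear (\<lambda>A :: real^3^3. A $ i $ j)"
    by (rule bounded_linear_entry)
  have s: "summable (\<lambda>n. (1 / fact n) *\<^sub>R (((**) (s *\<^sub>R X) ^^ n) (mat 1 :: real^3^3)))"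
    by (rule summable_norm_cancel[OF mexp_summable])
  have e: "((1 / fact n) *\<^sub>R (((**) (s *\<^sub>R X) ^^ n) (mat 1 :: real^3^3))) $ i $ j
     = ((((**) X ^^ n) (mat 1)) $ i $ j / fact n) * s ^ n" for n
    by (simp add: p)
  show "mexp (s *\<^sub>R X) $ i $ j = (\<Sum>n. ((((**) X ^^ n) (mat 1)) $ i $ j / fact n) * s ^ n)"
    unfolding mexp_def using bounded_linear.suminf[OF bl s] by (simp only: e)
  show "summable (\<lambda>n. ((((**) X ^^ n) (mat 1)) $ i $ j / fact n) * s ^ n)"
    using bounded_linear.summable[OF bl s] by (simp only: e)
qed

text \<open>Each entry is a power series in \<open>s\<close> converging everywhere, so it is
  differentiated term by term; the shifted coefficients \<open>diffs\<close> are the entries of the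
  coefficient matrices multiplied by \<open>X\<close> on the right.\<close>

lemma has_vector_derivative_mexp:
  "((\<lambda>s. mexp (s *\<^sub>R X)) has_vector_derivative mexp (s *\<^sub>R X) ** X) (at s)"
proof -
  have "((\<lambda>s. mexp (s *\<^sub>R X) $ i $ j) has_real_derivative (mexp (s *\<^sub>R X) ** X) $ i $ j) (at s)" for i j
  proof -
    define c where "c i j = (\<lambda>n. (((**) X ^^ n) (mat 1 :: real^3^3)) $ i $ j / fact n)" for i j
    have "((\<lambda>s. \<Sum>n. c i j n * s ^ n) has_real_derivative (\<Sum>n. diffs (c i j) n * s ^ n)) (at s)"
      by (rule termdiffs_strong_converges_everywhere)
         (use mexp_summable_real[where X = X and i = i and j = j] in \<open>auto simp: c_def\<close>)
    moreover have "(\<Sum>n. diffs (c i j) n * s ^ n) = (mexp (s *\<^sub>R X) ** X) $ i $ j"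
    proof -
      have d: "diffs (c i j) n = (\<Sum>k\<in>UNIV. c i k n * X $ k $ j)" for n
      proof -
        have "diffs (c i j) n = (((**) X ^^ n) (mat 1) ** X) $ i $ j / fact n"
          by (simp add: diffs_def c_def matrix_funpow_mult field_simps del: of_nat_Suc)
        then show ?thesis
          by (simp add: matrix_matrix_mult_def c_def sum_divide_distrib)
      qed
      have sm: "summable (\<lambda>n. c i k n * s ^ n)" for k
        using mexp_summable_real[where X = X and i = i and j = k] by (simp add: c_def)
      have "(mexp (s *\<^sub>R X) ** X) $ i $ j = (\<Sum>k\<in>UNIV. (\<Sum>n. c i k n * s ^ n) * X $ k $ j)"
        by (simp add: matrix_matrix_mult_def mexp_scaleR_component c_def)
      also have "\<dots> = (\<Sum>k\<in>UNIV. (\<Sum>n. c i k n * s ^ n * X $ k $ j))"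
        by (intro sum.cong refl suminf_mult2 sm)
      also have "\<dots> = (\<Sum>n. \<Sum>k\<in>UNIV. c i k n * s ^ n * X $ k $ j)"
        by (rule suminf_sum[symmetric]) (intro summable_mult2 sm)
      also have "\<dots> = (\<Sum>n. diffs (c i j) n * s ^ n)"
        by (simp add: d sum_distrib_right sum_distrib_left mult_ac)
      finally show ?thesis by simp
    qed
    ultimately show ?thesis
      by (simp add: mexp_scaleR_component c_def)
  qed
  then show ?thesis
    unfolding has_vector_derivative_def has_field_derivative_def
    apply (subst has_derivative_componentwise_within)
    by (auto simp: Basis_vec_def inner_axis mult.commute[of _ "_ $ _ $ _"])
qed

lemma mexp_zero: "mexp 0 = mat 1"
proof -
  have "((**) 0 ^^ n) (mat 1) = (0 :: real^3^3)" if "n \<notin> {0}" for n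
    using that by (cases n) auto
  then have "mexp 0 = (\<Sum>n\<in>{0}. (1 / fact n) *\<^sub>R (((**) 0 ^^ n) (mat 1)))"
    unfolding mexp_def by (intro suminf_finite) auto
  then show ?thesis by simp
qed

text \<open>Jacobi's formula, with the velocity read in the left-invariant frame. For trace 0 it
  keeps exponentials inside \<open>SL\<close>.\<close>

lemma has_derivative_det3:
  assumes "(g has_vector_derivative g s ** Y) (at s within S)"
  shows "((\<lambda>s. det (g s :: real^3^3)) has_real_derivative trace Y * det (g s)) (at s within S)"
proof -
  have c: "((\<lambda>s. g s $ i $ j) has_real_derivative (g s ** Y) $ i $ j) (at s within S)" for i j
  proof -
    have "bounded_linear (\<lambda>A :: real^3^3. A $ i $ j)"
      by (rule bounded_linear_entry)
    from bounded_linear.has_vector_derivative[OF this assms] show ?thesis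
      by (simp add: has_real_derivative_iff_has_vector_derivative)
  qed
  show ?thesis unfolding det_3
    by (rule derivative_eq_intros c refl)+
       (simp add: matrix_matrix_mult_def sum_3 trace_def algebra_simps)
qed

lemma mexp_SL: assumes "X \<in> sl3" shows "mexp (s *\<^sub>R X) \<in> SL"
proof -
  have t: "trace X = 0" using assms by (simp add: sl3_def)
  have "((\<lambda>s. det (mexp (s *\<^sub>R X))) has_real_derivative 0) (at s)" for s
    using has_derivative_det3[OF has_vector_derivative_mexp, of X s] t by simp
  then have "det (mexp (s *\<^sub>R X)) = det (mexp (0 *\<^sub>R X))"
    using DERIV_isconst_all[of "\<lambda>s. det (mexp (s *\<^sub>R X))"] by blast
  then show ?thesis by (simp add: carrier_SL3 mexp_zero)
qed

section \<open>The compact quotient\<close>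

locale cocompact =
  fixes \<Gamma> :: "(real^3^3) set"
  assumes lattice: "cocompact_lattice \<Gamma>"
begin

abbreviation M :: "(real^3^3) set set" where "M \<equiv> hspace \<Gamma>"
abbreviation pr :: "real^3^3 \<Rightarrow> (real^3^3) set" where "pr g \<equiv> \<Gamma> \<star> g"

text \<open>Continuity for the quotient topology, expressed on lifts so that the continuity rules
  for subsets of \<open>real^3^3\<close> apply.\<close>

definition cM :: "((real^3^3) set \<Rightarrow> real) \<Rightarrow> bool" where
  "cM f \<longleftrightarrow> continuous_on SL (\<lambda>g. f (pr g))"

lemma subgroup_\<Gamma>: "subgroup \<Gamma> SL3" and discrete_\<Gamma>: "discrete \<Gamma>"
  and compact_M: "compact_space (hspace_topology \<Gamma>)"
  using lattice by (auto simp: cocompact_lattice_def)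

lemma \<Gamma>_SL: "\<Gamma> \<subseteq> SL" using subgroup.subset[OF subgroup_\<Gamma>] .

lemma pr_M: "g \<in> SL \<Longrightarrow> pr g \<in> M"
  by (auto simp: hspace_def RCOSETS_def)

lemma M_cases: assumes "x \<in> M" obtains g where "g \<in> SL" "x = pr g"
  using assms by (auto simp: hspace_def RCOSETS_def)

lemma M_not_empty: "M \<noteq> {}" using pr_M SL_one by blast

lemma pr_act: "g \<in> SL \<Longrightarrow> k \<in> SL \<Longrightarrow> pr g \<star> k = pr (g ** k)"
  using group.coset_mult_assoc[OF group_SL3 \<Gamma>_SL] by (simp add: mult_SL3)

lemma act_M: "x \<in> M \<Longrightarrow> k \<in> SL \<Longrightarrow> x \<star> k \<in> M"
  by (metis M_cases SL_mult pr_M pr_act)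

lemma act_act: "x \<in> M \<Longrightarrow> k \<in> SL \<Longrightarrow> l \<in> SL \<Longrightarrow> x \<star> k \<star> l = x \<star> (k ** l)"
  by (smt (verit) M_cases SL_mult matrix_mul_assoc pr_act)

lemma act_one: "x \<in> M \<Longrightarrow> x \<star> mat 1 = x"
  by (metis M_cases SL_one matrix_mul_rid pr_act)

lemma act_minv: assumes "x \<in> M" "k \<in> SL" shows "x \<star> k \<star> minv k = x" "x \<star> minv k \<star> k = x"
  using assms by (simp_all add: act_act minv act_one)

lemma act_u3: "x \<in> M \<Longrightarrow> x \<star> u3 a b c \<star> u3 a' b' c' = x \<star> u3 (a + a') (b + b') (c + c' + a * b')"
  by (simp add: act_act u3_SL u3_mult)

lemma transitive: assumes "x \<in> M" "y \<in> M" obtains k where "k \<in> SL" "y = x \<star> k"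
proof -
  obtain g h where g: "g \<in> SL" "x = pr g" and h: "h \<in> SL" "y = pr h"
    using assms M_cases by metis
  show ?thesis
    by (rule that[of "minv g ** h"]) (use g h in \<open>auto simp: SL_mult minv pr_act minv_cancel\<close>)
qed

lemma pr_eq: assumes "g \<in> SL" "h \<in> SL" "pr g = pr h" shows "g ** minv h \<in> \<Gamma>"
proof -
  have "mat 1 \<in> \<Gamma>" using subgroup.one_closed[OF subgroup_\<Gamma>] by (simp add: one_SL3)
  then have "g \<in> pr g" by (force simp: rtrans_SL)
  then obtain \<gamma> where \<gamma>: "\<gamma> \<in> \<Gamma>" "g = \<gamma> ** h" using assms by (auto simp: rtrans_SL)
  then have "g ** minv h = \<gamma>" using assms minv_cancel' by simp
  then show ?thesis using \<gamma> by simp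
qed

lemma pr_\<Gamma>: assumes "\<gamma> \<in> \<Gamma>" "g \<in> SL" shows "pr (\<gamma> ** g) = pr g"
proof -
  have "pr \<gamma> = \<Gamma>" using group.coset_join2[OF group_SL3 _ subgroup_\<Gamma>] assms \<Gamma>_SL by blast
  then show ?thesis using pr_act[of \<gamma> g] assms \<Gamma>_SL by auto
qed

text \<open>The images of the balls \<open>norm g < n\<close> form an increasing open cover, so one
  of them is everything. Boundedness, uniform continuity and derivative bounds on the quotient are
  all reduced through this to a compact ball in \<open>SL\<close>.\<close>

lemma bounded_representatives:
  obtains R where "R > 0" "\<And>x. x \<in> M \<Longrightarrow> \<exists>g\<in>SL. norm g \<le> R \<and> x = pr g"
proof -
  define S where "S n = pr ` {g \<in> SL. norm g < real n}" for n
  have op: "openin (hspace_topology \<Gamma>) (S n)" for n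
  proof -
    \<comment> \<open>The saturation of a ball under the lattice is the union of its translates,
      hence open.\<close>
    have "{g \<in> SL. pr g \<in> S n} = (\<Union>\<gamma>\<in>\<Gamma>. {g \<in> SL. norm (\<gamma> ** g) < real n})"
    proof (rule Set.set_eqI, rule iffI)
      fix g assume "g \<in> {g \<in> SL. pr g \<in> S n}"
      then obtain h where h: "g \<in> SL" "h \<in> SL" "norm h < real n" "pr h = pr g"
        by (auto simp: S_def)
      then have "h ** minv g \<in> \<Gamma>" "h ** minv g ** g = h" using pr_eq minv_cancel' by auto
      then show "g \<in> (\<Union>\<gamma>\<in>\<Gamma>. {g \<in> SL. norm (\<gamma> ** g) < real n})" using h by force
    next
      fix g assume "g \<in> (\<Union>\<gamma>\<in>\<Gamma>. {g \<in> SL. norm (\<gamma> ** g) < real n})"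
      then obtain \<gamma> where g: "\<gamma> \<in> \<Gamma>" "g \<in> SL" "norm (\<gamma> ** g) < real n" by auto
      then have "pr g = pr (\<gamma> ** g)" "\<gamma> ** g \<in> SL" using pr_\<Gamma> \<Gamma>_SL SL_mult by auto
      then show "g \<in> {g \<in> SL. pr g \<in> S n}" using g by (auto simp: S_def)
    qed
    moreover have "openin (top_of_set SL) {g \<in> SL. norm (\<gamma> ** g) < real n}" for \<gamma>
    proof -
      have c: "continuous_on SL (\<lambda>g. norm (\<gamma> ** g))" by (intro continuous_intros)
      have "{g \<in> SL. norm (\<gamma> ** g) < real n} = SL \<inter> (\<lambda>g. norm (\<gamma> ** g)) -` {..<real n}" by auto
      then show ?thesis using continuous_openin_preimage_gen[OF c open_lessThan] by simp
    qed
    ultimately show ?thesis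
      using pr_M by (auto simp: openin_hspace_topology S_def intro!: openin_Union)
  qed
  have cov: "M \<subseteq> \<Union>(range S)"
  proof
    fix x assume "x \<in> M"
    then obtain g where g: "g \<in> SL" "x = pr g" using M_cases by blast
    obtain n where "norm g < real n" using reals_Archimedean2 by blast
    then have "x \<in> S n" using g by (auto simp: S_def)
    then show "x \<in> \<Union>(range S)" by blast
  qed
  obtain F where F: "finite F" "F \<subseteq> range S" "M \<subseteq> \<Union>F"
    using compact_M[unfolded compact_space_alt, rule_format, of "range S"] op cov
    by (auto simp: topspace_hspace_topology)
  obtain N where N: "finite N" "F = S ` N" using F finite_subset_image by metis
  show ?thesis
  proof (rule that[of "real (Max (insert 1 N))"])
    show "0 < real (Max (insert 1 N))" using N by (simp add: Max_gr_iff)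
  next
    fix x assume "x \<in> M"
    then obtain n where n: "n \<in> N" "x \<in> S n" using F N by auto
    then obtain g where g: "g \<in> SL" "norm g < real n" "x = pr g" by (auto simp: S_def)
    have "real n \<le> real (Max (insert 1 N))" using n N by (simp add: Max_ge_iff)
    then show "\<exists>g\<in>SL. norm g \<le> real (Max (insert 1 N)) \<and> x = pr g" using g by force
  qed
qed

lemma compact_SL_ball: "compact (SL \<inter> cball 0 R)"
  using closed_SL by (simp add: closed_Int_compact)

lemma cM_bounded:
  assumes "cM f" obtains B where "B > 0" "\<And>x. x \<in> M \<Longrightarrow> \<bar>f x\<bar> \<le> B"
proof -
  obtain R where R: "R > 0" "\<And>x. x \<in> M \<Longrightarrow> \<exists>g\<in>SL. norm g \<le> R \<and> x = pr g"
    using bounded_representatives by blast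
  have "compact ((\<lambda>g. f (pr g)) ` (SL \<inter> cball 0 R))"
    using assms continuous_on_subset unfolding cM_def
    by (intro compact_continuous_image[OF _ compact_SL_ball]) blast
  then obtain B where B: "B > 0" "\<And>g. g \<in> SL \<inter> cball 0 R \<Longrightarrow> norm (f (pr g)) \<le> B"
    using compact_imp_bounded bounded_pos by (metis (no_types, lifting) imageI)
  show ?thesis
  proof (rule that[OF B(1)])
    fix x assume "x \<in> M"
    then obtain g where "g \<in> SL" "norm g \<le> R" "x = pr g" using R by blast
    then show "\<bar>f x\<bar> \<le> B" using B(2)[of g] by simp
  qed
qed

section \<open>The algebra of continuous functions on the quotient\<close>

lemma cM_const: "cM (\<lambda>x. c)" by (simp add: cM_def)
lemma cM_add: "cM f \<Longrightarrow> cM g \<Longrightarrow> cM (\<lambda>x. f x + g x)" unfolding cM_def by (intro continuous_intros)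
lemma cM_diff: "cM f \<Longrightarrow> cM g \<Longrightarrow> cM (\<lambda>x. f x - g x)" unfolding cM_def by (intro continuous_intros)
lemma cM_minus: "cM f \<Longrightarrow> cM (\<lambda>x. - f x)" unfolding cM_def by (intro continuous_intros)
lemma cM_mult: "cM f \<Longrightarrow> cM g \<Longrightarrow> cM (\<lambda>x. f x * g x)" unfolding cM_def by (intro continuous_intros)
lemma cM_abs: "cM f \<Longrightarrow> cM (\<lambda>x. \<bar>f x\<bar>)" unfolding cM_def by (intro continuous_intros)
lemma cM_max: "cM f \<Longrightarrow> cM g \<Longrightarrow> cM (\<lambda>x. max (f x) (g x))" unfolding cM_def by (intro continuous_intros)
lemma cM_min: "cM f \<Longrightarrow> cM g \<Longrightarrow> cM (\<lambda>x. min (f x) (g x))" unfolding cM_def by (intro continuous_intros)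
lemma cM_power: "cM f \<Longrightarrow> cM (\<lambda>x. f x ^ n)" unfolding cM_def by (intro continuous_intros)
lemma cM_sum: "(\<And>i. i \<in> I \<Longrightarrow> cM (f i)) \<Longrightarrow> cM (\<lambda>x. \<Sum>i\<in>I. f i x)"
  unfolding cM_def by (intro continuous_intros)
lemma cM_divide: "cM f \<Longrightarrow> cM g \<Longrightarrow> (\<And>x. x \<in> M \<Longrightarrow> g x \<noteq> 0) \<Longrightarrow> cM (\<lambda>x. f x / g x)"
  unfolding cM_def by (intro continuous_intros) (auto simp: pr_M)
lemma cM_cong: "cM f \<Longrightarrow> (\<And>x. x \<in> M \<Longrightarrow> f x = g x) \<Longrightarrow> cM g"
  unfolding cM_def by (rule continuous_on_eq) (auto simp: pr_M)

lemma cM_act: assumes "cM f" "k \<in> SL" shows "cM (\<lambda>x. f (x \<star> k))"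
proof -
  have "continuous_on SL (\<lambda>g. f (pr (g ** k)))"
    using assms(1) unfolding cM_def
    by (rule continuous_on_compose2) (auto intro!: continuous_intros SL_mult assms)
  then show ?thesis unfolding cM_def
    by (rule continuous_on_eq) (simp add: pr_act assms)
qed

lemmas cM_intros = cM_const cM_add cM_diff cM_minus cM_mult cM_abs cM_max cM_min cM_power cM_sum cM_act

lemma cM_pos_lower:
  assumes "cM f" "\<And>x. x \<in> M \<Longrightarrow> f x > 0" obtains m where "m > 0" "\<And>x. x \<in> M \<Longrightarrow> m \<le> f x"
proof -
  have "cM (\<lambda>x. 1 / f x)" using assms by (intro cM_divide cM_const) force+
  then obtain B where B: "B > 0" "\<And>x. x \<in> M \<Longrightarrow> \<bar>1 / f x\<bar> \<le> B" using cM_bounded by blast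
  show ?thesis
  proof (rule that[of "1 / B"])
    show "1 / B \<le> f x" if "x \<in> M" for x using B(2)[OF that] assms(2)[OF that] B(1) by (simp add: field_simps)
  qed (use B in simp)
qed

text \<open>A representative of norm at most \<open>R\<close> is moved by \<open>k\<close> by at
  most \<open>K * R * norm (k - mat 1)\<close>, so uniform continuity on a compact ball gives a
  modulus independent of \<open>x\<close>.\<close>

lemma cM_uniform:
  assumes "cM f" "e > 0"
  obtains d where "d > 0" "\<And>x k. x \<in> M \<Longrightarrow> k \<in> SL \<Longrightarrow> norm (k - mat 1) < d \<Longrightarrow> \<bar>f (x \<star> k) - f x\<bar> < e"
proof -
  obtain R where R: "R > 0" "\<And>x. x \<in> M \<Longrightarrow> \<exists>g\<in>SL. norm g \<le> R \<and> x = pr g"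
    using bounded_representatives by blast
  obtain K where K: "K \<ge> 1" "\<And>(A :: real^3^3) (B :: real^3^3). norm (A ** B) \<le> K * norm A * norm B"
    using matrix_mult_norm_bound by blast
  define C where "C = SL \<inter> cball 0 (R + 1)"
  have "uniformly_continuous_on C (\<lambda>g. f (pr g))"
    using assms(1) unfolding cM_def C_def
    by (intro compact_uniformly_continuous compact_SL_ball) (auto elim: continuous_on_subset)
  then obtain d where d: "d > 0" "\<And>g h. g \<in> C \<Longrightarrow> h \<in> C \<Longrightarrow> dist h g < d \<Longrightarrow> \<bar>f (pr h) - f (pr g)\<bar> < e"
    using assms(2) unfolding uniformly_continuous_on_def dist_real_def by metis
  show ?thesis
  proof (rule that[of "min d 1 / (K * R)"])
    show "0 < min d 1 / (K * R)" using d K R by simp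
  next
    fix x k assume x: "x \<in> M" and k: "k \<in> SL" "norm (k - mat 1) < min d 1 / (K * R)"
    obtain g where g: "g \<in> SL" "norm g \<le> R" "x = pr g" using R x by blast
    have e: "g ** k - g = g ** (k - mat 1)"
      by (simp add: bounded_bilinear.diff_right[OF bounded_bilinear_matrix_mult])
    have "norm (g ** k - g) \<le> K * norm g * norm (k - mat 1)" unfolding e by (rule K(2))
    also have "\<dots> \<le> K * R * norm (k - mat 1)"
      using g K by (intro mult_right_mono mult_left_mono) auto
    also have "\<dots> < min d 1" using k K R by (simp add: field_simps)
    finally have n: "norm (g ** k - g) < min d 1" .
    have "norm (g ** k) \<le> norm g + norm (g ** k - g)" by (metis add.commute diff_add_cancel norm_triangle_ineq)
    then have "g ** k \<in> C" "g \<in> C" using n g k SL_mult by (auto simp: C_def)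
    then show "\<bar>f (x \<star> k) - f x\<bar> < e"
      using d(2)[of g "g ** k"] n g k by (simp add: pr_act dist_norm)
  qed
qed

text \<open>If \<open>k\<close> and \<open>l\<close> move the class of \<open>g\<close> to the same
  point, then \<open>g ** k ** minv l ** minv g\<close> lies in \<Gamma>. For \<open>k\<close> and
  \<open>l\<close> near 1 it is near 1, and discreteness forces it to be 1.\<close>

lemma locally_injective:
  assumes "x \<in> M"
  obtains d where "d > 0" "\<And>k l. k \<in> SL \<Longrightarrow> l \<in> SL \<Longrightarrow> norm (k - mat 1) < d \<Longrightarrow> norm (l - mat 1) < d \<Longrightarrow>
    x \<star> k = x \<star> l \<Longrightarrow> k = l"
proof -
  obtain g where g: "g \<in> SL" "x = pr g" using assms M_cases by blast
  have "mat 1 \<in> \<Gamma>" using subgroup.one_closed[OF subgroup_\<Gamma>] by (simp add: one_SL3)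
  then obtain e where e: "e > 0" "\<And>\<gamma>. \<gamma> \<in> \<Gamma> \<Longrightarrow> dist (mat 1) \<gamma> < e \<Longrightarrow> \<gamma> = mat 1"
    using discrete_\<Gamma> unfolding discrete_def isolated_in_dist_Ex_iff by metis
  define F where "F = (\<lambda>(k, l). g ** k ** minv l ** minv g)"
  have "continuous_on (SL \<times> SL) (\<lambda>z. g ** fst z ** minv (snd z) ** minv g)"
    by (intro continuous_intros continuous_on_compose2[OF continuous_on_minv]) auto
  then have c: "continuous_on (SL \<times> SL) F" by (simp add: F_def case_prod_beta)
  have F1: "F (mat 1, mat 1) = mat 1"
    using g SL_one minv_eqI[of "mat 1" "mat 1"] by (simp add: F_def minv)
  obtain d where d: "d > 0" "\<And>z. z \<in> SL \<times> SL \<Longrightarrow> dist z (mat 1, mat 1) < d \<Longrightarrow> dist (F z) (mat 1) < e"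
    using c[unfolded continuous_on_iff, rule_format, of "(mat 1, mat 1)" e] e SL_one F1 by auto
  show ?thesis
  proof (rule that[of "d / 2"])
    show "d / 2 > 0" using d by simp
  next
    fix k l assume k: "k \<in> SL" "norm (k - mat 1) < d / 2" and l: "l \<in> SL" "norm (l - mat 1) < d / 2"
      and eq: "x \<star> k = x \<star> l"
    have "dist (k, l) (mat 1, mat 1) \<le> norm (k - mat 1) + norm (l - mat 1)"
      by (simp add: dist_norm norm_Pair sqrt_sum_squares_le_sum)
    then have 1: "dist (F (k, l)) (mat 1) < e" using d(2)[of "(k, l)"] k l by auto
    have "pr (g ** k) = pr (g ** l)" using eq g k l by (simp add: pr_act)
    then have "g ** k ** minv (g ** l) \<in> \<Gamma>" using pr_eq g k l SL_mult by blast
    then have "F (k, l) \<in> \<Gamma>" using g l by (simp add: F_def minv_mult matrix_mul_assoc)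
    then have F: "F (k, l) = mat 1" using e(2) 1 by (simp add: dist_commute)
    have "k = minv g ** F (k, l) ** g ** l"
      using g k l by (simp add: F_def matrix_mul_assoc[symmetric] minv_cancel minv del: matrix_mul_assoc)
    also have "\<dots> = l" using F g by (simp add: minv)
    finally show "k = l" .
  qed
qed

text \<open>A substitute for the distance from \<open>x\<close> to \<open>C\<close>: the size of the
  smallest right translation carrying \<open>x\<close> into \<open>C\<close>. Inserting 1 caps it
  and keeps the infimum meaningful when \<open>C\<close> is empty.\<close>

definition dC :: "(real^3^3) set set \<Rightarrow> (real^3^3) set \<Rightarrow> real" where
  "dC C x = Inf (insert 1 {norm (k - mat 1) | k. k \<in> SL \<and> x \<star> k \<in> C})"

lemma dC_bdd: "bdd_below (insert 1 {norm (k - mat 1) | k. k \<in> SL \<and> x \<star> k \<in> C})"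
  by (rule bdd_belowI[of _ 0]) auto

lemma dC_le_1: "dC C x \<le> 1" and dC_nonneg: "0 \<le> dC C x"
  and dC_le: "k \<in> SL \<Longrightarrow> x \<star> k \<in> C \<Longrightarrow> dC C x \<le> norm (k - mat 1)"
  unfolding dC_def by (auto intro!: cInf_lower cInf_greatest dC_bdd)

lemma dC_lessE:
  assumes "dC C x < r" "r \<le> 1"
  obtains k where "k \<in> SL" "x \<star> k \<in> C" "norm (k - mat 1) < r"
  using assms cInf_lessD[of "insert 1 {norm (k - mat 1) | k. k \<in> SL \<and> x \<star> k \<in> C}" r]
  unfolding dC_def by auto

lemma dC_zero: "x \<in> M \<Longrightarrow> x \<in> C \<Longrightarrow> dC C x = 0"
  using dC_le[of "mat 1" x C] dC_nonneg[of C x] by (simp add: SL_one act_one)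

text \<open>If \<open>m\<close> nearly realises the infimum at \<open>x\<close>, then
  \<open>minv l ** m\<close> carries the translate of \<open>x\<close> by \<open>l\<close> into
  \<open>C\<close>; this is why the bound involves the inverse of \<open>l\<close>.\<close>

lemma dC_lipschitz:
  obtains L where "L > 0" "\<And>C x l. x \<in> M \<Longrightarrow> l \<in> SL \<Longrightarrow> dC C (x \<star> l) \<le> dC C x + L * norm (minv l - mat 1)"
proof -
  obtain K where K: "K \<ge> 1" "\<And>(A :: real^3^3) (B :: real^3^3). norm (A ** B) \<le> K * norm A * norm B"
    using matrix_mult_norm_bound by blast
  define L where "L = K * (1 + norm (mat 1 :: real^3^3))"
  have L: "L > 0" using K by (auto simp: L_def intro!: mult_pos_pos add_pos_nonneg)
  show ?thesis
  proof (rule that[OF L])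
    fix C x l assume x: "x \<in> M" and l: "l \<in> SL"
    show "dC C (x \<star> l) \<le> dC C x + L * norm (minv l - mat 1)"
    proof (rule field_le_epsilon)
      fix e :: real assume e: "e > 0"
      show "dC C (x \<star> l) \<le> dC C x + L * norm (minv l - mat 1) + e"
      \<comment> \<open>Only below the cap does the infimum come from actual translations.\<close>
      proof (cases "dC C x < 1")
        case True
        then obtain m where m: "m \<in> SL" "x \<star> m \<in> C" "norm (m - mat 1) < min 1 (dC C x + e)"
          using dC_lessE[of C x "min 1 (dC C x + e)"] e by auto
        have "x \<star> l \<star> (minv l ** m) = x \<star> m"
          using x l m by (simp add: act_act minv SL_mult minv_cancel)
        then have 1: "dC C (x \<star> l) \<le> norm (minv l ** m - mat 1)"
          using dC_le[of "minv l ** m" "x \<star> l" C] m l by (simp add: SL_mult minv)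
        have e: "minv l ** m - mat 1 = (minv l - mat 1) ** m + (m - mat 1)"
          by (simp add: bounded_bilinear.diff_left[OF bounded_bilinear_matrix_mult])
        have "norm m \<le> norm (m - mat 1) + norm (mat 1 :: real^3^3)"
          by (metis diff_add_cancel norm_triangle_ineq)
        then have "norm m \<le> 1 + norm (mat 1 :: real^3^3)" using m by linarith
        then have "norm ((minv l - mat 1) ** m) \<le> K * norm (minv l - mat 1) * (1 + norm (mat 1 :: real^3^3))"
          using K by (intro order_trans[OF K(2)] mult_left_mono) auto
        then show ?thesis using 1 m norm_triangle_ineq[of "(minv l - mat 1) ** m" "m - mat 1"]
          unfolding e by (simp add: L_def mult_ac)
      next
        case False
        then show ?thesis using dC_le_1[of C "x \<star> l"] e L
          by (smt (verit) mult_nonneg_nonneg norm_ge_zero)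
      qed
    qed
  qed
qed

text \<open>The one-sided estimate is used for \<open>l\<close> and for its inverse. Near the
  identity \<open>minv\<close> is bounded, so the displacement of the inverse is at most a constant
  times that of \<open>l\<close>.\<close>

lemma dC_lipschitz2:
  obtains L d where "L > 0" "d > 0" "\<And>C x l. x \<in> M \<Longrightarrow> l \<in> SL \<Longrightarrow> norm (l - mat 1) < d \<Longrightarrow>
    \<bar>dC C (x \<star> l) - dC C x\<bar> \<le> L * norm (l - mat 1)"
proof -
  obtain L where L: "L > 0" "\<And>C x l. x \<in> M \<Longrightarrow> l \<in> SL \<Longrightarrow> dC C (x \<star> l) \<le> dC C x + L * norm (minv l - mat 1)"
    using dC_lipschitz by blast
  obtain K where K: "K \<ge> 1" "\<And>(A :: real^3^3) (B :: real^3^3). norm (A ** B) \<le> K * norm A * norm B"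
    using matrix_mult_norm_bound by blast
  have m1: "minv (mat 1) = mat 1" by (rule minv_eqI) (simp_all add: SL_one)
  obtain d where d: "d > 0" "\<And>l. l \<in> SL \<Longrightarrow> dist l (mat 1) < d \<Longrightarrow> dist (minv l) (mat 1) < 1"
    using continuous_on_minv[unfolded continuous_on_iff, rule_format, OF SL_one zero_less_one] m1 by auto
  define Q where "Q = K * (1 + norm (mat 1 :: real^3^3)) + 1"
  have Q: "Q \<ge> 1" using K by (auto simp: Q_def)
  show ?thesis
  proof (rule that[of "L * Q" d])
    show "L * Q > 0" using L Q by simp
    fix C x l assume x: "x \<in> M" and l: "l \<in> SL" and ld: "norm (l - mat 1) < d"
    have "norm (minv l) \<le> norm (minv l - mat 1) + norm (mat 1 :: real^3^3)"
      by (metis diff_add_cancel norm_triangle_ineq)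
    then have ml: "norm (minv l) \<le> 1 + norm (mat 1 :: real^3^3)"
      using d(2)[OF l] ld by (simp add: dist_norm)
    have "minv l - mat 1 = minv l ** (mat 1 - l)"
      using l by (simp add: bounded_bilinear.diff_right[OF bounded_bilinear_matrix_mult] minv)
    then have "norm (minv l - mat 1) \<le> K * norm (minv l) * norm (mat 1 - l)" using K(2) by metis
    also have "\<dots> \<le> K * (1 + norm (mat 1 :: real^3^3)) * norm (mat 1 - l)"
      using K ml by (intro mult_right_mono mult_left_mono) auto
    also have "\<dots> \<le> Q * norm (l - mat 1)" by (simp add: Q_def norm_minus_commute distrib_right)
    finally have 3: "L * norm (minv l - mat 1) \<le> L * Q * norm (l - mat 1)" using L by simp
    have 1: "dC C (x \<star> l) \<le> dC C x + L * norm (minv l - mat 1)" using L x l by blast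
    have 2: "dC C x \<le> dC C (x \<star> l) + L * norm (l - mat 1)"
      using L(2)[OF act_M[OF x l] minv(1)[OF l], of C] x l by (simp add: act_minv minv_minv)
    have 4: "L * norm (l - mat 1) \<le> L * Q * norm (l - mat 1)"
      using L Q by (intro mult_right_mono) auto
    show "\<bar>dC C (x \<star> l) - dC C x\<bar> \<le> L * Q * norm (l - mat 1)"
      using 1 2 3 4 by linarith
  qed (use d in auto)
qed

lemma cM_dC: "cM (dC C)"
  unfolding cM_def continuous_on_iff
proof (intro ballI allI impI)
  fix g and e :: real assume g: "g \<in> SL" and e: "e > 0"
  obtain L d where L: "L > 0" "d > 0" "\<And>C x l. x \<in> M \<Longrightarrow> l \<in> SL \<Longrightarrow> norm (l - mat 1) < d \<Longrightarrow>
    \<bar>dC C (x \<star> l) - dC C x\<bar> \<le> L * norm (l - mat 1)"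
    using dC_lipschitz2 by metis
  have "continuous_on SL (\<lambda>h. minv g ** h)" by (intro continuous_intros)
  then obtain d' where d': "d' > 0" "\<And>h. h \<in> SL \<Longrightarrow> dist h g < d' \<Longrightarrow> dist (minv g ** h) (minv g ** g) < min d (e / L)"
    unfolding continuous_on_iff using g L e by (metis divide_pos_pos min_less_iff_conj)
  show "\<exists>d'>0. \<forall>h\<in>SL. dist h g < d' \<longrightarrow> dist (dC C (pr h)) (dC C (pr g)) < e"
  proof (intro exI[of _ d'] conjI ballI impI d'(1))
    fix h assume h: "h \<in> SL" "dist h g < d'"
    have n: "norm (minv g ** h - mat 1) < min d (e / L)" using d'(2)[OF h] g by (simp add: dist_norm minv)
    have "\<bar>dC C (pr h) - dC C (pr g)\<bar> \<le> L * norm (minv g ** h - mat 1)"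
      using L(3)[of "pr g" "minv g ** h" C] n h g by (simp add: pr_M SL_mult minv pr_act minv_cancel)
    also have "\<dots> < e" using n L(1) by (simp add: field_simps)
    finally show "dist (dC C (pr h)) (dC C (pr g)) < e" by (simp add: dist_real_def)
  qed
qed

text \<open>Some neighbourhood of 1 keeps \<open>x\<close> inside the open set. Truncated multiples
  of this function will approximate the indicator of \<open>S\<close>.\<close>

lemma dC_pos:
  assumes "openin (hspace_topology \<Gamma>) S" "x \<in> S" shows "dC (M - S) x > 0"
proof (rule ccontr)
  assume "\<not> dC (M - S) x > 0"
  then have z: "dC (M - S) x = 0" using dC_nonneg[of "M - S" x] by simp
  have SM: "S \<subseteq> M" and op: "openin (top_of_set SL) {g \<in> SL. pr g \<in> S}"
    using assms(1) by (auto simp: openin_hspace_topology)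
  obtain g where g: "g \<in> SL" "x = pr g" using assms(2) SM M_cases by blast
  have c: "continuous_on SL (\<lambda>k. g ** k)" by (intro continuous_intros)
  have "openin (top_of_set SL) (SL \<inter> (\<lambda>k. g ** k) -` {g \<in> SL. pr g \<in> S})"
    by (rule continuous_openin_preimage[OF c _ op]) (auto simp: SL_mult g)
  moreover have "mat 1 \<in> SL \<inter> (\<lambda>k. g ** k) -` {g \<in> SL. pr g \<in> S}" using g assms by (simp add: SL_one)
  ultimately obtain d where d: "d > 0" "\<And>k. k \<in> SL \<Longrightarrow> dist k (mat 1) < d \<Longrightarrow> pr (g ** k) \<in> S"
    unfolding openin_euclidean_subtopology_iff by (smt (verit) IntD2 mem_Collect_eq vimage_eq dist_commute)
  obtain k where "k \<in> SL" "x \<star> k \<in> M - S" "norm (k - mat 1) < min d 1"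
    using dC_lessE[of "M - S" x "min d 1"] z d by auto
  then show False using d(2)[of k] g by (simp add: pr_act dist_norm)
qed

text \<open>At displacement 0 there would be two small translations carrying \<open>x\<close> to
  \<open>y\<close>, the second strictly smaller than the first, against local injectivity.\<close>

lemma dC_singleton_pos: assumes "x \<in> M" "y \<in> M" "x \<noteq> y" shows "dC {y} x > 0"
proof (rule ccontr)
  assume "\<not> dC {y} x > 0"
  then have z: "dC {y} x = 0" using dC_nonneg[of "{y}" x] by simp
  obtain d where d: "d > 0" "\<And>k l. k \<in> SL \<Longrightarrow> l \<in> SL \<Longrightarrow> norm (k - mat 1) < d \<Longrightarrow> norm (l - mat 1) < d \<Longrightarrow>
    x \<star> k = x \<star> l \<Longrightarrow> k = l" using locally_injective[OF assms(1)] by metis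
  obtain k where k: "k \<in> SL" "x \<star> k = y" "norm (k - mat 1) < min d 1"
    using dC_lessE[of "{y}" x "min d 1"] z d by auto
  have "k \<noteq> mat 1" using k assms act_one by auto
  obtain l where l: "l \<in> SL" "x \<star> l = y" "norm (l - mat 1) < min (min d 1) (norm (k - mat 1))"
  proof (rule dC_lessE[of "{y}" x "min (min d 1) (norm (k - mat 1))"])
    show "dC {y} x < min (min d 1) (norm (k - mat 1))" using z d \<open>k \<noteq> mat 1\<close> by simp
  qed auto
  have "k = l" using d(2) k l by simp
  then show False using l by simp
qed

lemma openin_M_vimage:
  assumes "cM f" "open T" shows "openin (hspace_topology \<Gamma>) {x \<in> M. f x \<in> T}"
proof -
  have "{g \<in> SL. pr g \<in> {x \<in> M. f x \<in> T}} = SL \<inter> (\<lambda>g. f (pr g)) -` T" by (auto simp: pr_M)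
  then show ?thesis
    using continuous_openin_preimage_gen[of SL "\<lambda>g. f (pr g)" T] assms
    by (auto simp: openin_hspace_topology cM_def)
qed

lemma openin_M_act:
  assumes "openin (hspace_topology \<Gamma>) S" "k \<in> SL" shows "openin (hspace_topology \<Gamma>) {x \<in> M. x \<star> k \<in> S}"
proof -
  have op: "openin (top_of_set SL) {g \<in> SL. pr g \<in> S}"
    using assms(1) by (auto simp: openin_hspace_topology)
  have "openin (top_of_set SL) (SL \<inter> (\<lambda>g. g ** k) -` {g \<in> SL. pr g \<in> S})"
    by (rule continuous_openin_preimage[OF _ _ op]) (auto intro!: continuous_intros SL_mult assms)
  moreover have "{g \<in> SL. pr g \<in> {x \<in> M. x \<star> k \<in> S}} = SL \<inter> (\<lambda>g. g ** k) -` {g \<in> SL. pr g \<in> S}"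
    using assms(2) by (auto simp: pr_M pr_act SL_mult)
  ultimately show ?thesis by (auto simp: openin_hspace_topology)
qed

subsection \<open>Velocities\<close>

text \<open>Dividing a lift by its value at \<open>t\<close> gives a curve through 1 that acts on
  \<open>c t\<close>; two such curves agree near \<open>t\<close> by local injectivity. So the
  choice of lift drops out, and the description in \<open>differential\<close> picks out one
  vector.\<close>

lemma velocity_unique:
  assumes "has_velocity \<Gamma> c Y t" "has_velocity \<Gamma> c Y' t" shows "Y = Y'"
proof -
  have *: "\<exists>k. (\<forall>\<^sub>F s in nhds t. k s \<in> SL \<and> c s = c t \<star> k s) \<and> k t = mat 1 \<and> c t \<in> M \<and> (k has_vector_derivative Y) (at t)"
    if hv: "has_velocity \<Gamma> c Y t" for Y
  proof -
    obtain \<gamma> where ev: "\<forall>\<^sub>F s in nhds t. \<gamma> s \<in> SL \<and> c s = pr (\<gamma> s)"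
      and der: "(\<gamma> has_vector_derivative \<gamma> t ** Y) (at t)"
      using hv by (auto simp: has_velocity_def)
    have t: "\<gamma> t \<in> SL" "c t = pr (\<gamma> t)" using eventually_nhds_x_imp_x[OF ev] by auto
    define k where "k s = minv (\<gamma> t) ** \<gamma> s" for s
    have "\<forall>\<^sub>F s in nhds t. k s \<in> SL \<and> c s = c t \<star> k s"
      using ev by eventually_elim (use t in \<open>auto simp: k_def SL_mult minv pr_act minv_cancel\<close>)
    moreover have "k t = mat 1" using t by (simp add: k_def minv)
    moreover have "(k has_vector_derivative Y) (at t)"
      using bounded_linear.has_vector_derivative[OF bounded_linear_mmult_right der, of "minv (\<gamma> t)"] t
      by (simp add: k_def[abs_def] minv_cancel)
    ultimately show ?thesis using t pr_M[of "\<gamma> t"] by auto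
  qed
  obtain k where k: "\<forall>\<^sub>F s in nhds t. k s \<in> SL \<and> c s = c t \<star> k s" "k t = mat 1" "(k has_vector_derivative Y) (at t)"
    and ct: "c t \<in> M" using *[OF assms(1)] by blast
  obtain l where l: "\<forall>\<^sub>F s in nhds t. l s \<in> SL \<and> c s = c t \<star> l s" "l t = mat 1" "(l has_vector_derivative Y') (at t)"
    using *[OF assms(2)] by blast
  obtain d where d: "d > 0" "\<And>k l. k \<in> SL \<Longrightarrow> l \<in> SL \<Longrightarrow> norm (k - mat 1) < d \<Longrightarrow> norm (l - mat 1) < d \<Longrightarrow>
    c t \<star> k = c t \<star> l \<Longrightarrow> k = l" using locally_injective[OF ct] by metis
  have near: "\<forall>\<^sub>F s in nhds t. norm (k s - mat 1) < d"
    if "k t = mat 1" "(k has_vector_derivative Y) (at t)" for k Y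
  proof -
    have "(k \<longlongrightarrow> k t) (nhds t)"
      using has_vector_derivative_continuous[OF that(2)]
      by (simp add: tendsto_at_iff_tendsto_nhds[symmetric] continuous_at)
    then show ?thesis using d(1) that(1) by (auto simp: tendsto_iff dist_norm)
  qed
  have "\<forall>\<^sub>F s in nhds t. k s = l s"
    using k(1) l(1) near[OF k(2,3)] near[OF l(2,3)]
    by eventually_elim (use d(2) in metis)
  then have "(k has_vector_derivative Y') (at t)"
    using l(3) k(2) l(2) has_derivative_transform_eventually[of l "\<lambda>x. x *\<^sub>R Y'" t UNIV k]
    by (simp add: has_vector_derivative_def eventually_nhds_conv_at eq_commute)
  then show ?thesis using k(3) vector_derivative_unique_at by blast
qed

lemma velocity_M: assumes "has_velocity \<Gamma> c Y t" shows "c t \<in> M"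
proof -
  obtain \<gamma> where "\<forall>\<^sub>F s in nhds t. \<gamma> s \<in> SL \<and> c s = pr (\<gamma> s)" using assms by (auto simp: has_velocity_def)
  from eventually_nhds_x_imp_x[OF this] show ?thesis using pr_M by simp
qed

text \<open>Lifts exist only locally, so a global scalar function is used instead:
  \<open>dC {c t}\<close> is Lipschitz under small translations, hence has derivative 0 along the
  curve, and it vanishes only at \<open>c t\<close>.\<close>

lemma zero_velocity_constant:
  assumes "\<And>t. has_velocity \<Gamma> c 0 t" shows "c s = c t"
proof (rule ccontr)
  assume ne: "c s \<noteq> c t"
  have cM: "c t \<in> M" for t
    by (rule velocity_M[OF assms])
  define f where "f = dC {c t}"
  obtain L d where L: "L > 0" "d > 0" "\<And>C x l. x \<in> M \<Longrightarrow> l \<in> SL \<Longrightarrow> norm (l - mat 1) < d \<Longrightarrow>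
    \<bar>dC C (x \<star> l) - dC C x\<bar> \<le> L * norm (l - mat 1)"
    using dC_lipschitz2 by metis
  have "((\<lambda>r. f (c r)) has_real_derivative 0) (at r)" for r
  proof -
    obtain \<gamma> where ev: "\<forall>\<^sub>F s in nhds r. \<gamma> s \<in> SL \<and> c s = pr (\<gamma> s)"
      and der: "(\<gamma> has_vector_derivative 0) (at r)"
      using assms[of r] by (auto simp: has_velocity_def)
    have t: "\<gamma> r \<in> SL" "c r = pr (\<gamma> r)" using eventually_nhds_x_imp_x[OF ev] by auto
    define k where "k s = minv (\<gamma> r) ** \<gamma> s" for s
    have ev2: "\<forall>\<^sub>F s in nhds r. k s \<in> SL \<and> c s = c r \<star> k s"
      using ev by eventually_elim (use t in \<open>auto simp: k_def SL_mult minv pr_act minv_cancel\<close>)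
    have k1: "k r = mat 1" using t by (simp add: k_def minv)
    have dk: "(k has_vector_derivative 0) (at r)"
      using bounded_linear.has_vector_derivative[OF bounded_linear_mmult_right der, of "minv (\<gamma> r)"] t
      by (simp add: k_def[abs_def])
    have "((\<lambda>s. norm ((k s - mat 1) /\<^sub>R \<bar>s - r\<bar>)) \<longlongrightarrow> 0) (at r)"
      using dk k1 by (intro tendsto_norm_zero) (simp add: has_vector_derivative_def has_derivative_at_within)
    then have "((\<lambda>s. L * norm ((k s - mat 1) /\<^sub>R \<bar>s - r\<bar>)) \<longlongrightarrow> 0) (at r)"
      by (rule tendsto_mult_right_zero)
    then have T: "((\<lambda>s. L * norm (k s - mat 1) / \<bar>s - r\<bar>) \<longlongrightarrow> 0) (at r)"
      by (simp add: divide_inverse mult_ac)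
    have "(k \<longlongrightarrow> k r) (at r)"
      using has_vector_derivative_continuous[OF dk] by (simp add: continuous_at)
    then have ev3: "\<forall>\<^sub>F s in at r. norm (k s - mat 1) < d"
      using L(2) k1 by (auto simp: tendsto_iff dist_norm)
    have "((\<lambda>s. (f (c s) - f (c r)) / (s - r)) \<longlongrightarrow> 0) (at r)"
    proof (rule Lim_null_comparison[OF _ T])
      have "\<forall>\<^sub>F s in at r. k s \<in> SL \<and> c s = c r \<star> k s"
        using ev2 by (simp add: eventually_nhds_conv_at)
      then show "\<forall>\<^sub>F s in at r. norm ((f (c s) - f (c r)) / (s - r)) \<le> L * norm (k s - mat 1) / \<bar>s - r\<bar>"
        using ev3
      proof eventually_elim
        case (elim s)
        then have "\<bar>f (c s) - f (c r)\<bar> \<le> L * norm (k s - mat 1)"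
          using L(3)[of "c r" "k s" "{c t}"] cM by (simp add: f_def)
        then show ?case by (simp add: abs_divide divide_right_mono)
      qed
    qed
    then show ?thesis by (simp add: has_field_derivative_iff)
  qed
  then have "f (c s) = f (c t)" using DERIV_isconst_all[of "\<lambda>r. f (c r)"] by blast
  moreover have "f (c t) = 0" using dC_zero cM by (simp add: f_def)
  moreover have "f (c s) > 0" using dC_singleton_pos[OF cM cM ne] by (simp add: f_def)
  ultimately show False by simp
qed

end

section \<open>Differential calculus in the left-invariant frame\<close>

text \<open>In finite dimension, continuity of the derivative in operator norm follows from
  continuity in each fixed direction, so derivatives can be given as plain functions.\<close>

lemma C1_onI:
  assumes "open V" "\<And>a. a \<in> V \<Longrightarrow> (F has_derivative D a) (at a)" "\<And>H. continuous_on V (\<lambda>a. D a H)"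
  shows "C1_on V F"
  unfolding C1_on_def
proof (intro conjI exI[of _ "\<lambda>a. Blinfun (D a)"] ballI assms(1))
  have b: "blinfun_apply (Blinfun (D a)) = D a" if "a \<in> V" for a
    using bounded_linear_Blinfun_apply has_derivative_bounded_linear[OF assms(2)[OF that]] by blast
  show "(F has_derivative blinfun_apply (Blinfun (D a))) (at a)" if "a \<in> V" for a
    using assms(2)[OF that] b[OF that] by simp
  show "continuous_on V (\<lambda>a. Blinfun (D a))"
  proof (rule continuous_on_blinfun_componentwise)
    fix i :: "real^3^3"
    show "continuous_on V (\<lambda>a. blinfun_apply (Blinfun (D a)) i)"
      by (rule continuous_on_eq[OF assms(3)]) (simp add: b)
  qed
qed

lemma C1_onE:
  assumes "C1_on V F"
  obtains F' where "open V" "\<And>a. a \<in> V \<Longrightarrow> (F has_derivative blinfun_apply (F' a)) (at a)" "continuous_on V F'"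
  using assms by (auto simp: C1_on_def)

lemma C1_on_continuous: "C1_on V F \<Longrightarrow> continuous_on V F"
  by (auto simp: C1_on_def continuous_on_eq_continuous_at intro: has_derivative_continuous)

lemma C1_on_bilinear:
  assumes "bounded_bilinear p" "C1_on V F" "C1_on V G"
  shows "C1_on V (\<lambda>a. p (F a) (G a))"
proof -
  obtain F' where F: "open V" "\<And>a. a \<in> V \<Longrightarrow> (F has_derivative blinfun_apply (F' a)) (at a)" "continuous_on V F'"
    using assms(2) C1_onE by metis
  obtain G' where G: "\<And>a. a \<in> V \<Longrightarrow> (G has_derivative blinfun_apply (G' a)) (at a)" "continuous_on V G'"
    using assms(3) C1_onE by metis
  show ?thesis
  proof (rule C1_onI[where D = "\<lambda>a H. p (F a) (G' a H) + p (F' a H) (G a)"])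
    show "((\<lambda>a. p (F a) (G a)) has_derivative (\<lambda>H. p (F a) (G' a H) + p (F' a H) (G a))) (at a)" if "a \<in> V" for a
      using bounded_bilinear.FDERIV[OF assms(1) F(2)[OF that] G(1)[OF that]] .
    show "continuous_on V (\<lambda>a. p (F a) (G' a H) + p (F' a H) (G a))" for H
      by (intro continuous_intros bounded_bilinear.continuous_on[OF assms(1)] C1_on_continuous assms F G)
  qed (rule F(1))
qed

lemma C1_on_linear: "open V \<Longrightarrow> bounded_linear F \<Longrightarrow> C1_on V F"
  by (rule C1_onI[where D = "\<lambda>a. F"]) (auto intro: bounded_linear_imp_has_derivative)

lemma C1_on_const: "open V \<Longrightarrow> C1_on V (\<lambda>a. c)"
  by (rule C1_onI[where D = "\<lambda>a H. 0"]) auto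

lemma C1_on_add:
  assumes "C1_on V F" "C1_on V G" shows "C1_on V (\<lambda>a. F a + G a)"
proof -
  obtain F' where F: "open V" "\<And>a. a \<in> V \<Longrightarrow> (F has_derivative blinfun_apply (F' a)) (at a)" "continuous_on V F'"
    using assms(1) C1_onE by metis
  obtain G' where G: "\<And>a. a \<in> V \<Longrightarrow> (G has_derivative blinfun_apply (G' a)) (at a)" "continuous_on V G'"
    using assms(2) C1_onE by metis
  show ?thesis
    by (rule C1_onI[where D = "\<lambda>a H. F' a H + G' a H"]) (auto intro!: F G has_derivative_add continuous_intros)
qed

lemma C1_on_mult: "C1_on V F \<Longrightarrow> C1_on V G \<Longrightarrow> C1_on V (\<lambda>a. F a * G a :: real)"
  by (rule C1_on_bilinear[OF bounded_bilinear_mult])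

lemma C1_on_scaleR: "C1_on V F \<Longrightarrow> C1_on V G \<Longrightarrow> C1_on V (\<lambda>a. F a *\<^sub>R G a)"
  by (rule C1_on_bilinear[OF bounded_bilinear_scaleR])

lemma C1_on_diff: assumes "C1_on V F" "C1_on V G" shows "C1_on V (\<lambda>a. F a - G a :: real)"
proof -
  have o: "open V" using assms by (simp add: C1_on_def)
  have "C1_on V (\<lambda>a. F a + (-1) * G a)" by (intro C1_on_add C1_on_mult C1_on_const o assms)
  then show ?thesis by simp
qed

lemma C1_on_powr:
  fixes F :: "real^3^3 \<Rightarrow> real"
  assumes "C1_on V F" "\<And>a. a \<in> V \<Longrightarrow> F a > 0" shows "C1_on V (\<lambda>a. F a powr r)"
proof -
  obtain F' where F: "open V" "\<And>a. a \<in> V \<Longrightarrow> (F has_derivative blinfun_apply (F' a)) (at a)" "continuous_on V F'"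
    using assms(1) C1_onE by metis
  show ?thesis
  proof (rule C1_onI[where D = "\<lambda>a H. (r * F a powr (r - 1)) * F' a H", OF F(1)])
    fix a assume a: "a \<in> V"
    have "((\<lambda>y. y powr r) has_field_derivative r * F a powr (r - 1)) (at (F a))"
      by (rule has_real_derivative_powr) (rule assms(2)[OF a])
    from has_derivative_compose[OF F(2)[OF a] this[unfolded has_field_derivative_def]]
    show "((\<lambda>a. F a powr r) has_derivative (\<lambda>H. (r * F a powr (r - 1)) * F' a H)) (at a)" .
  next
    show "continuous_on V (\<lambda>a. (r * F a powr (r - 1)) * F' a H)" for H
      by (intro continuous_intros F C1_on_continuous assms) (use assms in force)
  qed
qed

lemma C1_on_compose:
  fixes G :: "real^3^3 \<Rightarrow> real^3^3"
  assumes "C1_on V F" "C1_on W G" "\<And>a. a \<in> W \<Longrightarrow> G a \<in> V"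
  shows "C1_on W (\<lambda>a. F (G a))"
proof -
  obtain F' where F: "open V" "\<And>a. a \<in> V \<Longrightarrow> (F has_derivative blinfun_apply (F' a)) (at a)" "continuous_on V F'"
    using assms(1) C1_onE by metis
  obtain G' where G: "open W" "\<And>a. a \<in> W \<Longrightarrow> (G has_derivative blinfun_apply (G' a)) (at a)" "continuous_on W G'"
    using assms(2) C1_onE by metis
  show ?thesis
  proof (rule C1_onI[where D = "\<lambda>a H. F' (G a) (G' a H)", OF G(1)])
    show "((\<lambda>a. F (G a)) has_derivative (\<lambda>H. F' (G a) (G' a H))) (at a)" if "a \<in> W" for a
      using has_derivative_compose[OF G(2)[OF that] F(2)[OF assms(3)[OF that]]] .
    show "continuous_on W (\<lambda>a. F' (G a) (G' a H))" for H
      by (intro continuous_intros continuous_on_compose2[OF F(3) C1_on_continuous[OF assms(2)]] G) (use assms in auto)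
  qed
qed

text \<open>The derivative at a point of an open set is unique, so the local derivatives agree on
  overlaps and glue.\<close>

lemma C1_on_local:
  assumes "open V" "\<And>a. a \<in> V \<Longrightarrow> \<exists>W G. a \<in> W \<and> C1_on W G \<and> (\<forall>b\<in>W. F b = G b)"
  shows "C1_on V F"
proof -
  have loc: "\<exists>W G'. a \<in> W \<and> open W \<and> (\<forall>b\<in>W. (F has_derivative blinfun_apply (G' b)) (at b)) \<and> continuous_on W G'"
    if av: "a \<in> V" for a
  proof -
    obtain W G where W: "a \<in> W" "C1_on W G" "\<forall>b\<in>W. F b = G b" using assms(2)[OF av] by blast
    obtain G' where G: "open W" "\<And>b. b \<in> W \<Longrightarrow> (G has_derivative blinfun_apply (G' b)) (at b)" "continuous_on W G'"
      using C1_onE[OF W(2)] by metis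
    have "(F has_derivative blinfun_apply (G' b)) (at b)" if "b \<in> W" for b
      using has_derivative_transform_within_open[OF G(2)[OF that] G(1) that] W(3) by metis
    then show ?thesis using W G by blast
  qed
  define D where "D a = (THE d. (F has_derivative d) (at a))" for a
  have D: "D a = d" if "(F has_derivative d) (at a)" for a d
    unfolding D_def using that has_derivative_unique[OF _ that] by (intro the_equality)
  show ?thesis
  proof (rule C1_onI[where D = D, OF assms(1)])
    show "(F has_derivative D a) (at a)" if "a \<in> V" for a
      using loc[OF that] D by metis
    fix H
    show "continuous_on V (\<lambda>a. D a H)"
      unfolding continuous_on_eq_continuous_at[OF assms(1)]
    proof
      fix a assume "a \<in> V"
      then obtain W G' where W: "a \<in> W" "open W" "\<forall>b\<in>W. (F has_derivative blinfun_apply (G' b)) (at b)" "continuous_on W G'"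
        using loc by blast
      have "continuous_on W (\<lambda>b. G' b H)" by (intro continuous_intros W)
      then have "continuous_on W (\<lambda>b. D b H)" by (rule continuous_on_eq) (use W D in auto)
      then show "isCont (\<lambda>a. D a H) a" using W continuous_on_eq_continuous_at by blast
    qed
  qed
qed

lemma C1_on_det: "open V \<Longrightarrow> C1_on V (\<lambda>a. det (a :: real^3^3))"
  unfolding det_3 by (intro C1_on_add C1_on_diff C1_on_mult C1_on_linear bounded_linear_entry)

section \<open>Lifting from the quotient to matrices of positive determinant\<close>

definition GP :: "(real^3^3) set" where "GP = {a. det a > 0}"

text \<open>Functions on the quotient are lifted to \<open>det > 0\<close> as constants along rays, so that the library derivative applies.\<close>
definition nrm :: "real^3^3 \<Rightarrow> real^3^3" where "nrm a = (det a powr (-1/3)) *\<^sub>R a"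

lemma open_GP: "open GP"
  unfolding GP_def by (rule open_Collect_less) (intro continuous_intros)+

lemma SL_GP: "g \<in> SL \<Longrightarrow> g \<in> GP" by (simp add: GP_def carrier_SL3)

lemma GP_mult: "a \<in> GP \<Longrightarrow> k \<in> SL \<Longrightarrow> a ** k \<in> GP" "a \<in> GP \<Longrightarrow> k \<in> SL \<Longrightarrow> k ** a \<in> GP"
  by (simp_all add: GP_def carrier_SL3 det_mul)

lemma det_scaleR3: "det (r *\<^sub>R (a :: real^3^3)) = r ^ 3 * det a"
  by (simp add: det_3 power3_eq_cube algebra_simps)

lemma nrm_SL: assumes "a \<in> GP" shows "nrm a \<in> SL"
proof -
  have "(det a powr (-1/3)) ^ 3 = det a powr (-1)"
    using assms by (simp add: GP_def powr_power)
  then show ?thesis using assms by (simp add: nrm_def det_scaleR3 carrier_SL3 GP_def powr_minus)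
qed

lemma nrm_id: "g \<in> SL \<Longrightarrow> nrm g = g" by (simp add: nrm_def carrier_SL3)

lemma nrm_mult: "k \<in> SL \<Longrightarrow> nrm (a ** k) = nrm a ** k" "k \<in> SL \<Longrightarrow> nrm (k ** a) = k ** nrm a"
  by (simp_all add: nrm_def det_mul carrier_SL3 matrix_scaleR_left matrix_scaleR_right)

lemma C1_on_nrm: "C1_on GP nrm"
  unfolding nrm_def by (intro C1_on_scaleR C1_on_powr C1_on_det C1_on_linear open_GP bounded_linear_ident)
    (simp add: GP_def)

definition N3 :: "real \<Rightarrow> real \<Rightarrow> real \<Rightarrow> real^3^3" where
  "N3 p q w = p *\<^sub>R E 1 2 + q *\<^sub>R E 2 3 + w *\<^sub>R E 1 3"

lemma N3_sl3: "N3 p q w \<in> sl3"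
  by (simp add: N3_def sl3_def trace_def sum_3 E_def)

lemma N3_nilp: "U \<in> nilp \<longleftrightarrow> (\<exists>p q w. U = N3 p q w)"
  by (auto simp: nilp_def span_insert N3_def span_breakdown_eq algebra_simps)

text \<open>The term \<open>a t * B\<close> in the third hypothesis converts the matrix entry into
  the left-invariant frame; it comes from E12 E23 = E13.\<close>

lemma u3_curve:
  assumes "(a has_real_derivative A) (at t)" "(b has_real_derivative B) (at t)"
    "(c has_real_derivative C + a t * B) (at t)"
  shows "((\<lambda>s. u3 (a s) (b s) (c s)) has_vector_derivative u3 (a t) (b t) (c t) ** N3 A B C) (at t)"
proof -
  have "u3 (a t) (b t) (c t) ** N3 A B C = A *\<^sub>R E 1 2 + B *\<^sub>R E 2 3 + (C + a t * B) *\<^sub>R E 1 3"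
    by (simp add: u3_def N3_def E_def vec_eq_iff forall_3 matrix_matrix_mult_def sum_3)
  then show ?thesis using has_vector_derivative_u3[OF assms] by simp
qed

section \<open>Derivatives on the quotient along left-invariant fields\<close>

context cocompact begin

definition lift :: "((real^3^3) set \<Rightarrow> real) \<Rightarrow> real^3^3 \<Rightarrow> real" where
  "lift f a = f (pr (nrm a))"

lemma lift_SL: "g \<in> SL \<Longrightarrow> lift f g = f (pr g)" by (simp add: lift_def nrm_id)

lemma lift_mult: "a \<in> GP \<Longrightarrow> k \<in> SL \<Longrightarrow> lift f (a ** k) = f (pr (nrm a) \<star> k)"
  by (simp add: lift_def nrm_mult pr_act nrm_SL)

lemma lift_\<Gamma>: "\<gamma> \<in> \<Gamma> \<Longrightarrow> a \<in> GP \<Longrightarrow> lift f (\<gamma> ** a) = lift f a"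
  using \<Gamma>_SL by (auto simp: lift_def nrm_mult pr_\<Gamma> nrm_SL)

lemma C1_lift: assumes "C1_fun \<Gamma> f" shows "C1_on GP (lift f)"
proof (rule C1_on_local[OF open_GP])
  fix a assume a: "a \<in> GP"
  then obtain V F where V: "nrm a \<in> V" "C1_on V F" "\<forall>a\<in>V \<inter> SL. f (pr a) = F a"
    using assms nrm_SL unfolding C1_fun_def by metis
  define W where "W = GP \<inter> nrm -` V"
  have "open V" using V by (simp add: C1_on_def)
  then have W: "open W" unfolding W_def
    using continuous_open_preimage[OF C1_on_continuous[OF C1_on_nrm] open_GP] by blast
  have "C1_on W nrm"
    using C1_on_nrm W by (auto simp: C1_on_def W_def elim: continuous_on_subset)
  then have "C1_on W (\<lambda>a. F (nrm a))" by (rule C1_on_compose[OF V(2)]) (simp add: W_def)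
  moreover have "a \<in> W" using a V by (simp add: W_def)
  moreover have "\<forall>b\<in>W. lift f b = F (nrm b)" using V nrm_SL by (simp add: W_def lift_def)
  ultimately show "\<exists>W G. a \<in> W \<and> C1_on W G \<and> (\<forall>b\<in>W. lift f b = G b)" by blast
qed

definition Dl :: "((real^3^3) set \<Rightarrow> real) \<Rightarrow> real^3^3 \<Rightarrow> (real^3^3) \<Rightarrow>\<^sub>L real" where
  "Dl f = (SOME F'. (\<forall>a\<in>GP. (lift f has_derivative blinfun_apply (F' a)) (at a)) \<and> continuous_on GP F')"

lemma
  assumes "C1_fun \<Gamma> f"
  shows Dl: "a \<in> GP \<Longrightarrow> (lift f has_derivative blinfun_apply (Dl f a)) (at a)"
    and continuous_on_Dl: "continuous_on GP (Dl f)"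
proof -
  have "\<exists>F'. (\<forall>a\<in>GP. (lift f has_derivative blinfun_apply (F' a)) (at a)) \<and> continuous_on GP F'"
    using C1_lift[OF assms] by (simp add: C1_on_def)
  from someI_ex[OF this]
  show "a \<in> GP \<Longrightarrow> (lift f has_derivative blinfun_apply (Dl f a)) (at a)" "continuous_on GP (Dl f)"
    by (auto simp: Dl_def)
qed

text \<open>Lifts are invariant under \<Gamma>, so their derivatives are equivariant; the value of
  \<open>dM\<close> is therefore independent of the representative that \<open>SOME\<close>
  picks.\<close>

lemma Dl_\<Gamma>:
  assumes "C1_fun \<Gamma> f" "\<gamma> \<in> \<Gamma>" "a \<in> GP" shows "Dl f (\<gamma> ** a) (\<gamma> ** H) = Dl f a H"
proof -
  have "((\<lambda>b. \<gamma> ** b) has_derivative (\<lambda>H. \<gamma> ** H)) (at a)"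
    by (rule bounded_linear_imp_has_derivative[OF bounded_linear_mmult_right])
  then have "((\<lambda>b. lift f (\<gamma> ** b)) has_derivative (\<lambda>H. Dl f (\<gamma> ** a) (\<gamma> ** H))) (at a)"
    by (rule has_derivative_compose) (use assms \<Gamma>_SL GP_mult in \<open>auto intro!: Dl\<close>)
  then have "(lift f has_derivative (\<lambda>H. Dl f (\<gamma> ** a) (\<gamma> ** H))) (at a)"
    by (rule has_derivative_transform_within_open[OF _ open_GP assms(3)]) (simp add: lift_\<Gamma> assms)
  then show ?thesis using has_derivative_unique[OF _ Dl[OF assms(1,3)]] by metis
qed

definition dM :: "((real^3^3) set \<Rightarrow> real) \<Rightarrow> (real^3^3) set \<Rightarrow> real^3^3 \<Rightarrow> real" where
  "dM f x Y = (let g = SOME g. g \<in> SL \<and> x = pr g in Dl f g (g ** Y))"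

lemma dM_pr: assumes "C1_fun \<Gamma> f" "g \<in> SL" shows "dM f (pr g) Y = Dl f g (g ** Y)"
proof -
  define h where "h = (SOME h. h \<in> SL \<and> pr g = pr h)"
  have h: "h \<in> SL" "pr g = pr h" using someI_ex[of "\<lambda>h. h \<in> SL \<and> pr g = pr h"] assms by (auto simp: h_def)
  define \<gamma> where "\<gamma> = g ** minv h"
  have \<gamma>: "\<gamma> \<in> \<Gamma>" "g = \<gamma> ** h" using pr_eq h assms by (auto simp: \<gamma>_def minv_cancel')
  have "Dl f g (g ** Y) = Dl f (\<gamma> ** h) (\<gamma> ** (h ** Y))" using \<gamma>(2) by (metis matrix_mul_assoc)
  also have "\<dots> = Dl f h (h ** Y)" using Dl_\<Gamma> assms \<gamma> h SL_GP by blast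
  finally show ?thesis by (simp add: dM_def h_def[symmetric])
qed

lemma C1_cM: assumes "C1_fun \<Gamma> f" shows "cM f"
proof -
  have "continuous_on SL (lift f)"
    using C1_on_continuous[OF C1_lift[OF assms]] SL_GP by (auto elim: continuous_on_subset)
  then show ?thesis unfolding cM_def by (rule continuous_on_eq) (simp add: lift_SL)
qed

lemma cM_dM: assumes "C1_fun \<Gamma> f" shows "cM (\<lambda>x. dM f x Y)"
proof -
  have "continuous_on SL (\<lambda>g. Dl f g (g ** Y))"
    using continuous_on_subset[OF continuous_on_Dl[OF assms]] SL_GP by (intro continuous_intros) blast
  then show ?thesis unfolding cM_def by (rule continuous_on_eq) (simp add: dM_pr assms)
qed

lemma dM_add: "C1_fun \<Gamma> f \<Longrightarrow> x \<in> M \<Longrightarrow> dM f x (Y + Y') = dM f x Y + dM f x Y'"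
  and dM_scaleR: "C1_fun \<Gamma> f \<Longrightarrow> x \<in> M \<Longrightarrow> dM f x (r *\<^sub>R Y) = r * dM f x Y"
  by (erule M_cases, simp add: dM_pr matrix_add_ldistrib matrix_scaleR_right blinfun.add_right blinfun.scaleR_right)+

lemma dM_bound:
  assumes "C1_fun \<Gamma> f" obtains B where "B > 0" "\<And>x Y. x \<in> M \<Longrightarrow> \<bar>dM f x Y\<bar> \<le> B * norm Y"
proof -
  obtain R where R: "R > 0" "\<And>x. x \<in> M \<Longrightarrow> \<exists>g\<in>SL. norm g \<le> R \<and> x = pr g"
    using bounded_representatives by blast
  obtain K where K: "K \<ge> 1" "\<And>(A :: real^3^3) (B :: real^3^3). norm (A ** B) \<le> K * norm A * norm B"
    using matrix_mult_norm_bound by blast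
  have "compact (Dl f ` (SL \<inter> cball 0 R))"
    using continuous_on_subset[OF continuous_on_Dl[OF assms]] SL_GP
    by (intro compact_continuous_image[OF _ compact_SL_ball]) blast
  then obtain B where B: "B > 0" "\<And>g. g \<in> SL \<inter> cball 0 R \<Longrightarrow> norm (Dl f g) \<le> B"
    using compact_imp_bounded bounded_pos by (metis (no_types, lifting) imageI)
  show ?thesis
  proof (rule that[of "B * (K * R)"])
    show "B * (K * R) > 0" using B K R by simp
    fix x Y assume "x \<in> M"
    then obtain g where g: "g \<in> SL" "norm g \<le> R" "x = pr g" using R by blast
    have "\<bar>dM f x Y\<bar> \<le> norm (Dl f g) * norm (g ** Y)"
      using norm_blinfun[of "Dl f g" "g ** Y"] g by (simp add: dM_pr assms)
    also have "\<dots> \<le> B * (K * R * norm Y)"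
    proof (intro mult_mono B(2))
      have "norm (g ** Y) \<le> K * norm g * norm Y" by (rule K(2))
      also have "\<dots> \<le> K * R * norm Y" using g K by (intro mult_right_mono mult_left_mono) auto
      finally show "norm (g ** Y) \<le> K * R * norm Y" .
    qed (use g B in auto)
    finally show "\<bar>dM f x Y\<bar> \<le> B * (K * R) * norm Y" by (simp add: mult_ac)
  qed
qed

lemma dM_curve:
  assumes f: "C1_fun \<Gamma> f" and x: "x \<in> M" and k: "\<And>s. k s \<in> SL"
    and d: "(k has_vector_derivative k t ** Y) (at t)"
  shows "((\<lambda>s. f (x \<star> k s)) has_real_derivative dM f (x \<star> k t) Y) (at t)"
proof -
  obtain g where g: "g \<in> SL" "x = pr g" using x M_cases by blast
  have 1: "((\<lambda>s. g ** k s) has_derivative (\<lambda>r. r *\<^sub>R (g ** (k t ** Y)))) (at t)"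
    using bounded_linear.has_vector_derivative[OF bounded_linear_mmult_right d, of g]
    by (simp add: has_vector_derivative_def)
  have "((\<lambda>s. lift f (g ** k s)) has_derivative (\<lambda>r. Dl f (g ** k t) (r *\<^sub>R (g ** (k t ** Y))))) (at t)"
    by (rule has_derivative_compose[OF 1]) (use Dl[OF f] SL_GP SL_mult g k in auto)
  moreover have "lift f (g ** k s) = f (x \<star> k s)" for s using g k by (simp add: lift_SL SL_mult pr_act)
  moreover have "Dl f (g ** k t) (r *\<^sub>R (g ** (k t ** Y))) = dM f (x \<star> k t) Y * r" for r
    using g k by (simp add: pr_act dM_pr[OF f] SL_mult blinfun.scaleR_right matrix_mul_assoc)
  ultimately show ?thesis by (simp add: has_field_derivative_def)
qed

lemma dM_u3:
  assumes f: "C1_fun \<Gamma> f" and x: "x \<in> M"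
    and d: "(a has_real_derivative A) (at t)" "(b has_real_derivative B) (at t)"
    "(c has_real_derivative C + a t * B) (at t)"
  shows "((\<lambda>s. f (x \<star> u3 (a s) (b s) (c s))) has_real_derivative dM f (x \<star> u3 (a t) (b t) (c t)) (N3 A B C)) (at t)"
  by (rule dM_curve[OF f x u3_SL u3_curve[OF d]])

lemma lie_deriv_dM:
  assumes f: "C1_fun \<Gamma> f" and x: "x \<in> M" and X: "X \<in> sl3" shows "lie_deriv X f x = dM f x X"
proof -
  have "((\<lambda>s. f (x \<star> mexp (s *\<^sub>R X))) has_real_derivative dM f (x \<star> mexp (0 *\<^sub>R X)) X) (at 0)"
    by (rule dM_curve[OF f x mexp_SL[OF X] has_vector_derivative_mexp])
  then show ?thesis unfolding lie_deriv_def lflow_def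
    using x by (intro DERIV_imp_deriv) (simp add: mexp_zero act_one)
qed

end

section \<open>Oriented integrals and a Gronwall estimate\<close>

text \<open>The substitution \<open>s = \<theta>t\<close> makes the integral from \<open>0\<close> to \<open>t\<close> oriented for every sign of \<open>t\<close>.\<close>
definition oint :: "(real \<Rightarrow> real) \<Rightarrow> real \<Rightarrow> real" where
  "oint f t = t * integral {0..1} (\<lambda>\<theta>. f (\<theta> * t))"

lemma oint_0 [simp]: "oint f 0 = 0" by (simp add: oint_def)

lemma oint_eq:
  assumes "\<And>t. (F has_real_derivative f t) (at t)"
  shows "oint f t = F t - F 0"
proof -
  have "((\<lambda>\<theta>. F (\<theta> * t)) has_real_derivative f (\<theta> * t) * t) (at \<theta>)" for \<theta>
    by (rule DERIV_chain2[OF assms]) (auto intro!: derivative_eq_intros)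
  then have "((\<lambda>\<theta>. F (\<theta> * t)) has_vector_derivative f (\<theta> * t) * t) (at \<theta> within {0..1})" for \<theta>
    by (intro has_vector_derivative_at_within[OF has_real_derivative_iff_has_vector_derivative[THEN iffD1]])
  then have "((\<lambda>\<theta>. f (\<theta> * t) * t) has_integral F (1 * t) - F (0 * t)) {0..1}"
    by (intro fundamental_theorem_of_calculus) simp_all
  then have "integral {0..1} (\<lambda>\<theta>. f (\<theta> * t) * t) = F (1 * t) - F (0 * t)" by (rule integral_unique)
  then show ?thesis by (simp add: oint_def mult.commute)
qed

lemma oint_deriv:
  assumes "continuous_on UNIV f" shows "(oint f has_real_derivative f t) (at t)"
proof -
  have "\<exists>F. \<forall>x::real. (F has_vector_derivative f x) (at x)"
    using einterval_antiderivative[of "-\<infinity>" "\<infinity>" f] assms by (auto simp: continuous_on_eq_continuous_at)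
  then obtain F where F: "\<And>t. (F has_real_derivative f t) (at t)"
    by (auto simp: has_real_derivative_iff_has_vector_derivative)
  have "oint f = (\<lambda>t. F t - F 0)" using oint_eq[OF F] by auto
  then show ?thesis using F by (auto intro!: derivative_eq_intros)
qed

lemma MVT_abs:
  fixes f :: "real \<Rightarrow> real"
  assumes "\<And>s. (f has_real_derivative f' s) (at s)" "\<And>s. \<bar>s\<bar> \<le> \<bar>t\<bar> \<Longrightarrow> \<bar>f' s\<bar> \<le> B"
  shows "\<bar>f t - f 0\<bar> \<le> B * \<bar>t\<bar>"
proof -
  have "norm (f t - f 0) \<le> B * norm (t - 0)"
  proof (rule field_differentiable_bound[of "{-\<bar>t\<bar>..\<bar>t\<bar>}"])
    show "(f has_field_derivative f' s) (at s within {- \<bar>t\<bar>..\<bar>t\<bar>})" for s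
      by (rule has_field_derivative_at_within[OF assms(1)])
  qed (use assms(2) in auto)
  then show ?thesis by simp
qed

text \<open>Comparing with \<open>sqrt (D\<^sup>2 + K\<^sup>2)\<close> keeps the argument differentiable where \<open>D\<close> vanishes.\<close>
lemma gronwall_pos:
  fixes D :: "real \<Rightarrow> real"
  assumes D: "\<And>s. (D has_real_derivative D' s) (at s)" and "D 0 = 0" "m \<ge> 0" "K > 0" "t \<ge> 0"
    and b: "\<And>s. 0 \<le> s \<Longrightarrow> s \<le> t \<Longrightarrow> \<bar>D' s\<bar> \<le> m * \<bar>D s\<bar> + K"
  shows "\<bar>D t\<bar> \<le> K * exp ((m + 1) * t)"
proof -
  define v where "v s = sqrt ((D s)\<^sup>2 + K\<^sup>2)" for s
  have pos: "(D s)\<^sup>2 + K\<^sup>2 > 0" for s using assms by (simp add: add_nonneg_pos)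
  have vd: "(v has_real_derivative (D s * D' s / v s)) (at s)" for s
    unfolding v_def using pos[of s]
    by (auto intro!: derivative_eq_intros D simp: field_simps)
  have vD: "\<bar>D s\<bar> \<le> v s" for s unfolding v_def using assms by (simp add: real_le_rsqrt)
  have vK: "K \<le> v s" for s unfolding v_def using assms by (simp add: real_le_rsqrt)
  have v0: "v s > 0" for s using pos by (simp add: v_def)
  \<comment> \<open>Since \<open>v\<close> dominates both the absolute value of \<open>D\<close> and
    \<open>K\<close>, the inhomogeneous term is absorbed by raising \<open>m\<close> to
    \<open>m + 1\<close>.\<close>
  have vb: "D s * D' s / v s \<le> (m + 1) * v s" if "0 \<le> s" "s \<le> t" for s
  proof -
    have "D s * D' s / v s \<le> \<bar>D' s\<bar>"
    proof -
      have "D s * D' s \<le> \<bar>D s\<bar> * \<bar>D' s\<bar>" by (metis abs_ge_self abs_mult)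
      also have "\<dots> \<le> v s * \<bar>D' s\<bar>" by (intro mult_right_mono vD) auto
      finally show ?thesis using v0[of s] by (simp add: field_simps)
    qed
    also have "\<dots> \<le> m * v s + v s"
      using b[OF that] mult_left_mono[OF vD[of s] assms(3)] vK[of s] by linarith
    finally show ?thesis by (simp add: algebra_simps)
  qed
  define u where "u s = v s * exp (- (m + 1) * s)" for s
  have "u t \<le> u 0"
  proof (rule DERIV_nonpos_imp_nonincreasing[OF assms(5)])
    fix s assume s: "0 \<le> s" "s \<le> t"
    have "(u has_real_derivative ((D s * D' s / v s) - (m + 1) * v s) * exp (- (m + 1) * s)) (at s)"
      unfolding u_def by (rule derivative_eq_intros vd refl)+ (simp add: algebra_simps)
    moreover have "((D s * D' s / v s) - (m + 1) * v s) * exp (- (m + 1) * s) \<le> 0"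
      using vb[OF s] by (intro mult_nonpos_nonneg) auto
    ultimately show "\<exists>y. (u has_real_derivative y) (at s) \<and> y \<le> 0" by blast
  qed
  moreover have "u 0 = K" using assms by (simp add: u_def v_def)
  ultimately have "v t * exp (- (m + 1) * t) \<le> K" by (simp add: u_def)
  then have "v t * exp (- (m + 1) * t) * exp ((m + 1) * t) \<le> K * exp ((m + 1) * t)"
    by (intro mult_right_mono) auto
  moreover have "v t * exp (- (m + 1) * t) * exp ((m + 1) * t) = v t"
    by (simp only: mult.assoc exp_add[symmetric]) (simp add: algebra_simps)
  ultimately have "v t \<le> K * exp ((m + 1) * t)" by (simp only:)
  then show ?thesis using vD[of t] by linarith
qed

text \<open>Uniqueness of the flow uses the case \<open>K = 0\<close>, which is reached by letting a
  larger \<open>K'\<close> decrease to \<open>K\<close>. Negative times follow by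
  reflection.\<close>

lemma gronwall:
  fixes D :: "real \<Rightarrow> real"
  assumes D: "\<And>s. (D has_real_derivative D' s) (at s)" and "D 0 = 0" "m \<ge> 0" "K \<ge> 0"
    and b: "\<And>s. \<bar>s\<bar> \<le> \<bar>t\<bar> \<Longrightarrow> \<bar>D' s\<bar> \<le> m * \<bar>D s\<bar> + K"
  shows "\<bar>D t\<bar> \<le> K * exp ((m + 1) * \<bar>t\<bar>)"
proof -
  have *: "\<bar>D t\<bar> \<le> K' * exp ((m + 1) * \<bar>t\<bar>)" if "K' > K" for K'
  proof (cases "t \<ge> 0")
    case True
    have "\<bar>D t\<bar> \<le> K' * exp ((m + 1) * t)"
    proof (rule gronwall_pos[OF D])
      show "\<bar>D' s\<bar> \<le> m * \<bar>D s\<bar> + K'" if "0 \<le> s" "s \<le> t" for s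
        using b[of s] that \<open>K' > K\<close> by auto
    qed (use assms that True in auto)
    then show ?thesis using True by simp
  next
    case False
    have "\<bar>D (- (- t))\<bar> \<le> K' * exp ((m + 1) * (- t))"
    proof (rule gronwall_pos[where D = "\<lambda>s. D (- s)" and D' = "\<lambda>s. - D' (- s)"])
      show "((\<lambda>s. D (- s)) has_real_derivative - D' (- s)) (at s)" for s
        using DERIV_mirror[THEN iffD1, of D "D' (- s)" s] D[of "- s"] by simp
      show "\<bar>- D' (- s)\<bar> \<le> m * \<bar>D (- s)\<bar> + K'" if "0 \<le> s" "s \<le> - t" for s
        using b[of "- s"] that \<open>K' > K\<close> by auto
    qed (use assms that False in auto)
    then show ?thesis using False by simp
  qed
  show ?thesis
  proof (rule field_le_epsilon)
    fix e :: real assume e: "e > 0"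
    define X where "X = exp ((m + 1) * \<bar>t\<bar>)"
    have X: "X > 0" by (simp add: X_def)
    have "\<bar>D t\<bar> \<le> (K + e / X) * X" using *[of "K + e / X"] e X by (simp add: X_def)
    also have "\<dots> = K * X + e" using X by (simp add: distrib_right)
    finally show "\<bar>D t\<bar> \<le> K * exp ((m + 1) * \<bar>t\<bar>) + e" by (simp add: X_def)
  qed
qed

section \<open>The structure of the perturbed flow\<close>

locale perturbed = cocompact +
  fixes p q w :: real and \<beta> :: "(real^3^3) set \<Rightarrow> real" and h :: "real \<Rightarrow> (real^3^3) set \<Rightarrow> (real^3^3) set"
  assumes C1_\<beta>: "C1_fun \<Gamma> \<beta>"
    and flow: "flow_of \<Gamma> (\<lambda>x. N3 p q w + \<beta> x *\<^sub>R E 1 3) h"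
begin

lemma h_0: "x \<in> M \<Longrightarrow> h 0 x = x"
  and h_velocity: "x \<in> M \<Longrightarrow> has_velocity \<Gamma> (\<lambda>s. h s x) (N3 p q w + \<beta> (h t x) *\<^sub>R E 1 3) t"
  using flow by (auto simp: flow_of_def)

lemma h_M: "x \<in> M \<Longrightarrow> h t x \<in> M"
  using velocity_M[OF h_velocity] .

lemma h_continuous: assumes "cM f" "x \<in> M" shows "continuous_on UNIV (\<lambda>t. f (h t x))"
  unfolding continuous_on_eq_continuous_at[OF open_UNIV]
proof
  fix t
  obtain \<gamma> where ev: "\<forall>\<^sub>F s in nhds t. \<gamma> s \<in> SL \<and> h s x = pr (\<gamma> s)"
    and der: "(\<gamma> has_vector_derivative \<gamma> t ** (N3 p q w + \<beta> (h t x) *\<^sub>R E 1 3)) (at t)"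
    using h_velocity[OF assms(2), of t] by (auto simp: has_velocity_def)
  have t: "\<gamma> t \<in> SL" "h t x = pr (\<gamma> t)" using eventually_nhds_x_imp_x[OF ev] by auto
  have ev': "\<forall>\<^sub>F s in at t. \<gamma> s \<in> SL \<and> h s x = pr (\<gamma> s)" using ev by (simp add: eventually_nhds_conv_at)
  have "(\<gamma> \<longlongrightarrow> \<gamma> t) (at t)"
    using has_vector_derivative_continuous[OF der] by (simp add: continuous_at)
  then have "((\<lambda>s. f (pr (\<gamma> s))) \<longlongrightarrow> f (pr (\<gamma> t))) (at t)"
    by (rule continuous_on_tendsto_compose[OF assms(1)[unfolded cM_def] _ t(1)])
       (use ev' in \<open>auto elim: eventually_mono\<close>)
  then show "isCont (\<lambda>t. f (h t x)) t"
    unfolding isCont_def t(2)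
    by (rule Lim_transform_eventually) (use ev' in \<open>auto elim: eventually_mono\<close>)
qed

definition \<rho> :: "real \<Rightarrow> (real^3^3) set \<Rightarrow> real" where "\<rho> t x = oint (\<lambda>s. \<beta> (h s x)) t"

text \<open>The product exp(tU) exp(rZ); the term \<open>t\<^sup>2 * p * q / 2\<close> is the corner
  entry of half the square of tU.\<close>

definition Ef :: "real \<Rightarrow> real \<Rightarrow> real^3^3" where "Ef t r = u3 (t * p) (t * q) (t * w + t\<^sup>2 * p * q / 2 + r)"

lemma Ef_SL: "Ef t r \<in> SL" by (simp add: Ef_def u3_SL)

lemma Ef_mult: "Ef t r ** Ef s r' = Ef (t + s) (r + r')"
proof -
  have "t * w + t\<^sup>2 * p * q / 2 + r + (s * w + s\<^sup>2 * p * q / 2 + r') + t * p * (s * q)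
    = (t + s) * w + (t + s)\<^sup>2 * p * q / 2 + (r + r')"
    by (simp add: power2_eq_square field_simps)
  then show ?thesis by (simp only: Ef_def u3_mult distrib_right[of t s, symmetric])
qed

lemma Ef_u3: "Ef t r ** u3 0 0 r' = Ef t (r + r')"
  by (simp add: Ef_def u3_mult add.assoc)

lemma Ef_00: "Ef 0 0 = mat 1" by (simp add: Ef_def u3_zero)

lemma \<rho>_deriv: "x \<in> M \<Longrightarrow> (((\<lambda>t. \<rho> t x)) has_real_derivative \<beta> (h t x)) (at t)"
  unfolding \<rho>_def by (rule oint_deriv[OF h_continuous[OF C1_cM[OF C1_\<beta>]]])

lemma \<rho>_0 [simp]: "\<rho> 0 x = 0" by (simp add: \<rho>_def)

text \<open>Undoing the flow of \<open>U\<close> and the accumulated central displacement leaves a curve of zero velocity.\<close>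
lemma h_eq: assumes "x \<in> M" shows "h t x = x \<star> Ef t (\<rho> t x)"
proof -
  define k where "k s = u3 (- (s * p)) (- (s * q)) (s\<^sup>2 * p * q / 2 - s * w - \<rho> s x)" for s
  have k: "k s = minv (Ef s (\<rho> s x))" for s
    by (simp add: k_def Ef_def minv_u3 power2_eq_square field_simps)
  have "has_velocity \<Gamma> (\<lambda>s. h s x \<star> k s) 0 t" for t
  proof -
    obtain \<gamma> where ev: "\<forall>\<^sub>F s in nhds t. \<gamma> s \<in> SL \<and> h s x = pr (\<gamma> s)"
      and der: "(\<gamma> has_vector_derivative \<gamma> t ** (N3 p q w + \<beta> (h t x) *\<^sub>R E 1 3)) (at t)"
      using h_velocity[OF assms, of t] by (auto simp: has_velocity_def)
    have dk: "(k has_vector_derivative ((- p) *\<^sub>R E 1 2 + (- q) *\<^sub>R E 2 3 + (t * p * q - w - \<beta> (h t x)) *\<^sub>R E 1 3)) (at t)"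
      unfolding k_def
      by (rule has_vector_derivative_u3) (auto intro!: derivative_eq_intros \<rho>_deriv assms)
    have dk0: "(- p) *\<^sub>R E 1 2 + (- q) *\<^sub>R E 2 3 + (t * p * q - w - \<beta> (h t x)) *\<^sub>R E 1 3
       = - ((N3 p q w + \<beta> (h t x) *\<^sub>R E 1 3) ** k t)"
      by (simp add: k_def u3_def N3_def E_def vec_eq_iff forall_3 matrix_matrix_mult_def sum_3)
    have "((\<lambda>s. \<gamma> s ** k s) has_vector_derivative
       (\<gamma> t ** (- ((N3 p q w + \<beta> (h t x) *\<^sub>R E 1 3) ** k t)) + (\<gamma> t ** (N3 p q w + \<beta> (h t x) *\<^sub>R E 1 3)) ** k t)) (at t)"
      by (rule has_vector_derivative_mmult[OF der dk[unfolded dk0]])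
    moreover have "\<gamma> t ** (- ((N3 p q w + \<beta> (h t x) *\<^sub>R E 1 3) ** k t)) + (\<gamma> t ** (N3 p q w + \<beta> (h t x) *\<^sub>R E 1 3)) ** k t
      = (\<gamma> t ** k t) ** 0"
      by (simp add: bounded_bilinear.minus_right[OF bounded_bilinear_matrix_mult] matrix_mul_assoc
          bounded_bilinear.zero_right[OF bounded_bilinear_matrix_mult])
    moreover have "\<forall>\<^sub>F s in nhds t. \<gamma> s ** k s \<in> SL \<and> h s x \<star> k s = pr (\<gamma> s ** k s)"
      using ev by eventually_elim (auto simp: SL_mult k Ef_SL minv pr_act)
    ultimately show ?thesis by (auto simp: has_velocity_def)
  qed
  then have "h t x \<star> k t = h 0 x \<star> k 0" by (rule zero_velocity_constant)
  also have "\<dots> = x" using assms by (simp add: h_0 k_def u3_zero act_one)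
  finally have "h t x \<star> k t \<star> Ef t (\<rho> t x) = x \<star> Ef t (\<rho> t x)" by simp
  then show ?thesis using act_minv h_M[OF assms] Ef_SL by (simp add: k)
qed

lemma \<beta>_lipschitz:
  obtains B where "B > 0" "\<And>x r r'. x \<in> M \<Longrightarrow> \<bar>\<beta> (x \<star> u3 0 0 r) - \<beta> (x \<star> u3 0 0 r')\<bar> \<le> B * \<bar>r - r'\<bar>"
proof -
  obtain B where B: "B > 0" "\<And>x Y. x \<in> M \<Longrightarrow> \<bar>dM \<beta> x Y\<bar> \<le> B * norm Y" using dM_bound[OF C1_\<beta>] by blast
  show ?thesis
  proof (rule that[of "B * norm (N3 0 0 1) + 1"])
    show "B * norm (N3 0 0 1) + 1 > 0" using B by (simp add: add_nonneg_pos)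
    fix x and r r' :: real assume x: "x \<in> M"
    have "norm (\<beta> (x \<star> u3 0 0 r) - \<beta> (x \<star> u3 0 0 r')) \<le> (B * norm (N3 0 0 1) + 1) * norm (r - r')"
    proof (rule field_differentiable_bound[of UNIV])
      show "((\<lambda>r. \<beta> (x \<star> u3 0 0 r)) has_field_derivative dM \<beta> (x \<star> u3 0 0 s) (N3 0 0 1)) (at s within UNIV)" for s
        by (rule has_field_derivative_at_within, rule dM_u3[OF C1_\<beta> x]) (auto intro!: derivative_eq_intros)
      show "norm (dM \<beta> (x \<star> u3 0 0 s) (N3 0 0 1)) \<le> B * norm (N3 0 0 1) + 1" for s
        using B(2)[OF act_M[OF x u3_SL], of 0 0 s "N3 0 0 1"] by simp
    qed auto
    then show "\<bar>\<beta> (x \<star> u3 0 0 r) - \<beta> (x \<star> u3 0 0 r')\<bar> \<le> (B * norm (N3 0 0 1) + 1) * \<bar>r - r'\<bar>" by simp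
  qed
qed

text \<open>The central displacement solves a scalar equation that is Lipschitz in the unknown, so
  Gronwall with \<open>K = 0\<close> identifies it.\<close>

lemma h_unique:
  assumes "y \<in> M" "r 0 = 0" "\<And>s. (r has_real_derivative \<beta> (y \<star> Ef s (r s))) (at s)"
  shows "h t y = y \<star> Ef t (r t)"
proof -
  obtain B where B: "B > 0" "\<And>x r r'. x \<in> M \<Longrightarrow> \<bar>\<beta> (x \<star> u3 0 0 r) - \<beta> (x \<star> u3 0 0 r')\<bar> \<le> B * \<bar>r - r'\<bar>"
    using \<beta>_lipschitz by metis
  have "\<bar>\<rho> t y - r t\<bar> \<le> 0 * exp ((B + 1) * \<bar>t\<bar>)"
  proof (rule gronwall[where D = "\<lambda>t. \<rho> t y - r t"])
    show "((\<lambda>t. \<rho> t y - r t) has_real_derivative \<beta> (h s y) - \<beta> (y \<star> Ef s (r s))) (at s)" for s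
      by (intro derivative_intros \<rho>_deriv assms)
    show "\<bar>\<beta> (h s y) - \<beta> (y \<star> Ef s (r s))\<bar> \<le> B * \<bar>\<rho> s y - r s\<bar> + 0" for s
      using B(2)[OF act_M[OF assms(1) Ef_SL[of s 0]], of "\<rho> s y" "r s"] assms(1)
      by (simp add: h_eq act_act Ef_SL u3_SL Ef_u3)
  qed (use assms B in auto)
  then show ?thesis using assms by (simp add: h_eq)
qed

text \<open>\<open>flow_of\<close> prescribes only starting points and velocities; the group law
  comes from uniqueness, applied to the displacement accumulated after time
  \<open>t\<close>.\<close>

lemma h_add: assumes "x \<in> M" shows "h (s + t) x = h s (h t x)"
proof -
  define r where "r s = \<rho> (s + t) x - \<rho> t x" for s
  have e: "h t x \<star> Ef s (r s) = h (s + t) x" for s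
    using assms by (simp add: h_eq act_act Ef_SL Ef_mult r_def add.commute)
  have "h s (h t x) = h t x \<star> Ef s (r s)"
  proof (rule h_unique[OF h_M[OF assms]])
    fix s
    have "((\<lambda>s. \<rho> (s + t) x) has_real_derivative \<beta> (h (s + t) x) * 1) (at s)"
      by (rule DERIV_chain2[OF \<rho>_deriv[OF assms]]) (auto intro!: derivative_eq_intros)
    then show "(r has_real_derivative \<beta> (h t x \<star> Ef s (r s))) (at s)"
      unfolding e using DERIV_diff[OF _ DERIV_const, of "\<lambda>s. \<rho> (s + t) x" _ s UNIV "\<rho> t x"]
      by (simp add: r_def[abs_def])
  qed (simp add: r_def)
  then show ?thesis by (simp add: e)
qed

lemma dM_flow:
  assumes f: "C1_fun \<Gamma> f" and x: "x \<in> M"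
  shows "((\<lambda>t. f (h t x)) has_real_derivative dM f (h t x) (N3 p q (w + \<beta> (h t x)))) (at t)"
proof -
  have "((\<lambda>t. f (x \<star> Ef t (\<rho> t x))) has_real_derivative dM f (x \<star> Ef t (\<rho> t x)) (N3 p q (w + \<beta> (h t x)))) (at t)"
    unfolding Ef_def
    by (rule dM_u3[OF f x]) (auto intro!: derivative_eq_intros \<rho>_deriv x simp: field_simps)
  then show ?thesis using x by (simp add: h_eq)
qed

end

section \<open>Invariant integration\<close>

locale haar = cocompact +
  fixes \<omega> :: "(real^3^3) set measure"
  assumes haar: "normalised_haar \<Gamma> \<omega>"
begin

lemma space_\<omega>: "space \<omega> = M" and sets_\<omega>: "sets \<omega> = sigma_sets M {S. openin (hspace_topology \<Gamma>) S}"
  and emeasure_\<omega>: "emeasure \<omega> M = 1"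
  and emeasure_act: "k \<in> SL \<Longrightarrow> A \<in> sets \<omega> \<Longrightarrow> emeasure \<omega> ((\<lambda>x. x \<star> k) ` A) = emeasure \<omega> A"
  using haar by (auto simp: normalised_haar_def)

lemma opens_Pow: "{S. openin (hspace_topology \<Gamma>) S} \<subseteq> Pow M"
  by (auto simp: openin_hspace_topology)

lemma open_sets: "openin (hspace_topology \<Gamma>) S \<Longrightarrow> S \<in> sets \<omega>"
  unfolding sets_\<omega> by (rule sigma_sets.Basic) simp

sublocale \<omega>: finite_measure \<omega>
  by (rule finite_measureI) (simp add: space_\<omega> emeasure_\<omega>)

lemma measure_\<omega>: "measure \<omega> M = 1" by (simp add: measure_def emeasure_\<omega>)

lemma cM_measurable [measurable_dest]: assumes "cM f" shows "f \<in> borel_measurable \<omega>"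
proof (rule borel_measurableI)
  fix S :: "real set" assume "open S"
  then have "openin (hspace_topology \<Gamma>) {x \<in> M. f x \<in> S}" using openin_M_vimage assms by blast
  moreover have "f -` S \<inter> space \<omega> = {x \<in> M. f x \<in> S}" by (auto simp: space_\<omega>)
  ultimately show "f -` S \<inter> space \<omega> \<in> sets \<omega>" using open_sets by simp
qed

lemma act_measurable: assumes "k \<in> SL" shows "(\<lambda>x. x \<star> k) \<in> measurable \<omega> \<omega>"
proof (rule measurable_sigma_sets[OF sets_\<omega> opens_Pow])
  show "(\<lambda>x. x \<star> k) \<in> space \<omega> \<rightarrow> M" using act_M assms by (auto simp: space_\<omega>)
  fix S assume "S \<in> {S. openin (hspace_topology \<Gamma>) S}"
  then have "openin (hspace_topology \<Gamma>) {x \<in> M. x \<star> k \<in> S}" using openin_M_act assms by blast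
  moreover have "(\<lambda>x. x \<star> k) -` S \<inter> space \<omega> = {x \<in> M. x \<star> k \<in> S}" by (auto simp: space_\<omega>)
  ultimately show "(\<lambda>x. x \<star> k) -` S \<inter> space \<omega> \<in> sets \<omega>" using open_sets by simp
qed

lemma distr_act: assumes "k \<in> SL" shows "distr \<omega> \<omega> (\<lambda>x. x \<star> k) = \<omega>"
proof (rule measure_eqI)
  fix A assume "A \<in> sets (distr \<omega> \<omega> (\<lambda>x. x \<star> k))"
  then have A: "A \<in> sets \<omega>" by simp
  then have AM: "A \<subseteq> M" using sets.sets_into_space space_\<omega> by blast
  have "(\<lambda>x. x \<star> k) -` A \<inter> space \<omega> = (\<lambda>x. x \<star> minv k) ` A"
  proof (rule Set.set_eqI, rule iffI)
    fix x assume "x \<in> (\<lambda>x. x \<star> k) -` A \<inter> space \<omega>"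
    then have "x \<star> k \<in> A" "x = x \<star> k \<star> minv k" using act_minv assms by (auto simp: space_\<omega>)
    then show "x \<in> (\<lambda>x. x \<star> minv k) ` A" by (rule rev_image_eqI)
  next
    fix x assume "x \<in> (\<lambda>x. x \<star> minv k) ` A"
    then obtain y where "y \<in> A" "x = y \<star> minv k" by blast
    then show "x \<in> (\<lambda>x. x \<star> k) -` A \<inter> space \<omega>"
      using act_minv assms AM act_M minv(1) by (auto simp: space_\<omega>)
  qed
  then show "emeasure (distr \<omega> \<omega> (\<lambda>x. x \<star> k)) A = emeasure \<omega> A"
    using A act_measurable assms by (simp add: emeasure_distr emeasure_act minv)
qed simp

lemma integral_act:
  assumes "k \<in> SL" "f \<in> borel_measurable \<omega>"
  shows "(\<integral>x. f (x \<star> k) \<partial>\<omega>) = (\<integral>x. (f x :: real) \<partial>\<omega>)"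
  using integral_distr[OF act_measurable[OF assms(1)], of f] assms by (simp add: distr_act)

lemma bounded_integrable:
  assumes "f \<in> borel_measurable \<omega>" "\<And>x. x \<in> M \<Longrightarrow> \<bar>f x\<bar> \<le> (B :: real)" shows "integrable \<omega> f"
  by (rule \<omega>.integrable_const_bound[of _ B]) (use assms in \<open>auto simp: space_\<omega>\<close>)

lemma cM_integrable: assumes "cM f" shows "integrable \<omega> f"
proof -
  obtain B where "\<And>x. x \<in> M \<Longrightarrow> \<bar>f x\<bar> \<le> B" using cM_bounded[OF assms] by blast
  then show ?thesis by (rule bounded_integrable[OF cM_measurable[OF assms]])
qed

lemma integral_bounded:
  assumes "f \<in> borel_measurable \<omega>" "\<And>x. x \<in> M \<Longrightarrow> \<bar>f x\<bar> \<le> (B :: real)" shows "\<bar>\<integral>x. f x \<partial>\<omega>\<bar> \<le> B"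
proof -
  have "\<bar>\<integral>x. f x \<partial>\<omega>\<bar> \<le> (\<integral>x. \<bar>f x\<bar> \<partial>\<omega>)" by (rule integral_abs_bound)
  also have "\<dots> \<le> (\<integral>x. B \<partial>\<omega>)"
    by (rule integral_mono) (use assms bounded_integrable[OF assms] in \<open>auto simp: space_\<omega>\<close>)
  also have "\<dots> = B" by (simp add: space_\<omega> measure_\<omega>)
  finally show ?thesis .
qed

text \<open>If \<open>f\<close> were nonzero at \<open>x\<close>, the open set where it is nonzero
  would be null. Its translates are null by invariance and cover the space by transitivity; finitely
  many suffice by compactness, against total mass 1.\<close>

lemma full_support:
  assumes "cM f" "(\<integral>x. (f x)\<^sup>2 \<partial>\<omega>) = 0" "x \<in> M" shows "f x = 0"
proof (rule ccontr)
  assume nz: "f x \<noteq> 0"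
  define S where "S = {y \<in> M. (f y)\<^sup>2 \<in> {0<..}}"
  have S: "openin (hspace_topology \<Gamma>) S"
    unfolding S_def by (intro openin_M_vimage cM_intros assms) auto
  have Sk: "openin (hspace_topology \<Gamma>) {y \<in> M. y \<star> k \<in> S}" if "k \<in> SL" for k
    using openin_M_act[OF S that] .
  have "AE y in \<omega>. (f y)\<^sup>2 = 0"
    using assms(2) integral_nonneg_eq_0_iff_AE[OF cM_integrable[OF cM_power[OF assms(1)]], of 2] by simp
  then have "AE y in \<omega>. y \<notin> S" by eventually_elim (simp add: S_def)
  then have S0: "emeasure \<omega> S = 0"
    using AE_iff_measurable[OF open_sets[OF S], of "\<lambda>y. y \<notin> S"] S by (auto simp: S_def space_\<omega>)
  have Sk0: "emeasure \<omega> {y \<in> M. y \<star> k \<in> S} = 0" if k: "k \<in> SL" for k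
  proof -
    have "{y \<in> M. y \<star> k \<in> S} = (\<lambda>x. x \<star> k) -` S \<inter> space \<omega>" by (auto simp: space_\<omega>)
    then have "emeasure \<omega> {y \<in> M. y \<star> k \<in> S} = emeasure (distr \<omega> \<omega> (\<lambda>x. x \<star> k)) S"
      using act_measurable[OF k] open_sets[OF S] by (simp add: emeasure_distr)
    then show ?thesis using S0 by (simp add: distr_act k)
  qed
  have cov: "M \<subseteq> \<Union>((\<lambda>k. {y \<in> M. y \<star> k \<in> S}) ` SL)"
  proof
    fix y assume y: "y \<in> M"
    then obtain k where "k \<in> SL" "x = y \<star> k" using transitive assms(3) by metis
    then show "y \<in> \<Union>((\<lambda>k. {y \<in> M. y \<star> k \<in> S}) ` SL)" using y nz assms(3) by (auto simp: S_def)
  qed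
  obtain F where F: "finite F" "F \<subseteq> (\<lambda>k. {y \<in> M. y \<star> k \<in> S}) ` SL" "M \<subseteq> \<Union>F"
    using compact_M[unfolded compact_space_alt, rule_format, of "(\<lambda>k. {y \<in> M. y \<star> k \<in> S}) ` SL"] Sk cov
    by (auto simp: topspace_hspace_topology)
  have Fs: "\<And>A. A \<in> F \<Longrightarrow> A \<in> sets \<omega> \<and> emeasure \<omega> A = 0" using F(2) Sk0 open_sets[OF Sk] by auto
  have "emeasure \<omega> M \<le> emeasure \<omega> (\<Union>F)" using F Fs by (intro emeasure_mono) auto
  also have "\<dots> \<le> (\<Sum>A\<in>F. emeasure \<omega> A)"
    using emeasure_subadditive_finite[OF F(1), of "\<lambda>A. A" \<omega>] Fs by auto
  also have "\<dots> = 0" using Fs by simp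
  finally show False by (simp add: emeasure_\<omega>)
qed

end

section \<open>Functions differentiable along the centre\<close>

context cocompact begin

text \<open>A larger class than \<open>C1_fun\<close>: it contains central averages of merely
  continuous functions, which serve as test functions and as coboundaries.\<close>

definition hasZ :: "((real^3^3) set \<Rightarrow> real) \<Rightarrow> ((real^3^3) set \<Rightarrow> real) \<Rightarrow> bool" where
  "hasZ f f' \<longleftrightarrow> cM f \<and> cM f' \<and>
    (\<forall>x\<in>M. \<forall>s. ((\<lambda>s. f (x \<star> u3 0 0 s)) has_real_derivative f' (x \<star> u3 0 0 s)) (at s))"

lemma hasZ_cM: "hasZ f f' \<Longrightarrow> cM f" "hasZ f f' \<Longrightarrow> cM f'"
  and hasZ_deriv: "hasZ f f' \<Longrightarrow> x \<in> M \<Longrightarrow> ((\<lambda>s. f (x \<star> u3 0 0 s)) has_real_derivative f' (x \<star> u3 0 0 s)) (at s)"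
  by (auto simp: hasZ_def)

lemma hasZ_mult: "hasZ f f' \<Longrightarrow> hasZ g g' \<Longrightarrow> hasZ (\<lambda>x. f x * g x) (\<lambda>x. f' x * g x + f x * g' x)"
  by (auto simp: hasZ_def intro!: cM_intros derivative_eq_intros)

lemma hasZ_sum: "(\<And>i. i \<in> I \<Longrightarrow> hasZ (f i) (f' i)) \<Longrightarrow> hasZ (\<lambda>x. \<Sum>i\<in>I. f i x) (\<lambda>x. \<Sum>i\<in>I. f' i x)"
  by (auto simp: hasZ_def intro!: cM_intros DERIV_sum)

lemma hasZ_cmult: "hasZ f f' \<Longrightarrow> hasZ (\<lambda>x. c * f x) (\<lambda>x. c * f' x)"
  by (auto simp: hasZ_def intro!: cM_intros DERIV_cmult)

lemma hasZ_C1: assumes "C1_fun \<Gamma> f" shows "hasZ f (\<lambda>x. dM f x (N3 0 0 1))"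
  unfolding hasZ_def using C1_cM[OF assms] cM_dM[OF assms]
  by (auto intro!: dM_u3[OF assms] derivative_eq_intros)

lemma hasZ_lipschitz:
  assumes "hasZ f f'" "\<And>x. x \<in> M \<Longrightarrow> \<bar>f' x\<bar> \<le> B" "x \<in> M"
  shows "\<bar>f (x \<star> u3 0 0 r) - f x\<bar> \<le> B * \<bar>r\<bar>"
  using MVT_abs[OF hasZ_deriv[OF assms(1,3)], of r B] assms(2) act_M[OF assms(3) u3_SL] assms(3)
  by (simp add: u3_zero act_one)

text \<open>An integral over a central arc, not divided by \<tau>. For \<open>f = \<kappa>\<close>
  it is the signed length of the arc in the form that the flow preserves.\<close>

definition Zav :: "real \<Rightarrow> ((real^3^3) set \<Rightarrow> real) \<Rightarrow> (real^3^3) set \<Rightarrow> real" where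
  "Zav \<tau> f x = oint (\<lambda>s. f (x \<star> u3 0 0 s)) \<tau>"

lemma u3_continuous: "cM f \<Longrightarrow> x \<in> M \<Longrightarrow> continuous_on UNIV a \<Longrightarrow> continuous_on UNIV b \<Longrightarrow> continuous_on UNIV c
  \<Longrightarrow> continuous_on UNIV (\<lambda>s::real. f (x \<star> u3 (a s) (b s) (c s)))"
proof (erule M_cases)
  fix g assume f: "cM f" and g: "g \<in> SL" "x = pr g" and
    c: "continuous_on UNIV a" "continuous_on UNIV b" "continuous_on UNIV c"
  have "continuous_on UNIV (\<lambda>s::real. f (pr (g ** u3 (a s) (b s) (c s))))"
    by (rule continuous_on_compose2[OF f[unfolded cM_def]]) (auto intro!: continuous_intros c SL_mult g u3_SL)
  then show ?thesis using g by (simp add: pr_act u3_SL)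
qed

text \<open>On a central orbit this is an integral over the moving window from s to s + \<tau>,
  whose derivative is the difference of the end values. So every difference between a continuous
  function translated by exp(\<tau>Z) and the function itself is a Z-derivative.\<close>

lemma hasZ_Zav:
  assumes "cM f" shows "hasZ (Zav \<tau> f) (\<lambda>x. f (x \<star> u3 0 0 \<tau>) - f x)"
  unfolding hasZ_def
proof (intro conjI ballI allI)
  have "continuous_on (SL \<times> cbox 0 1) (\<lambda>z. f (pr (fst z ** u3 0 0 (snd z * \<tau>))))"
    by (rule continuous_on_compose2[OF assms[unfolded cM_def]]) (auto intro!: continuous_intros SL_mult u3_SL)
  then have "continuous_on SL (\<lambda>g. integral (cbox 0 1) (\<lambda>\<theta>. f (pr (g ** u3 0 0 (\<theta> * \<tau>)))))"
    by (intro integral_continuous_on_param) (simp add: case_prod_beta)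
  then have "continuous_on SL (\<lambda>g. \<tau> * integral (cbox 0 1) (\<lambda>\<theta>. f (pr (g ** u3 0 0 (\<theta> * \<tau>)))))"
    by (intro continuous_intros)
  then show "cM (Zav \<tau> f)" unfolding cM_def
    by (rule continuous_on_eq) (simp add: Zav_def oint_def pr_act u3_SL)
  show "cM (\<lambda>x. f (x \<star> u3 0 0 \<tau>) - f x)" by (intro cM_intros assms u3_SL)
  fix x s assume x: "x \<in> M"
  define \<phi> where "\<phi> s = f (x \<star> u3 0 0 s)" for s
  have c: "continuous_on UNIV \<phi>" unfolding \<phi>_def by (intro u3_continuous assms x continuous_intros)
  have e: "Zav \<tau> f (x \<star> u3 0 0 s) = oint \<phi> (s + \<tau>) - oint \<phi> s" for s
  proof -
    have "Zav \<tau> f (x \<star> u3 0 0 s) = oint (\<lambda>r. \<phi> (s + r)) \<tau>"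
      using x by (simp add: Zav_def \<phi>_def act_u3)
    also have "\<dots> = oint \<phi> (s + \<tau>) - oint \<phi> (s + 0)"
    proof (rule oint_eq)
      show "((\<lambda>a. oint \<phi> (s + a)) has_real_derivative \<phi> (s + t)) (at t)" for t
        using DERIV_shift[THEN iffD1, OF oint_deriv[OF c], of s t] by (simp add: add.commute)
    qed
    finally show ?thesis by simp
  qed
  have "((\<lambda>s. oint \<phi> (s + \<tau>)) has_real_derivative \<phi> (s + \<tau>)) (at s)"
    by (rule DERIV_shift[THEN iffD1, OF oint_deriv[OF c]])
  then have "((\<lambda>s. oint \<phi> (s + \<tau>) - oint \<phi> s) has_real_derivative \<phi> (s + \<tau>) - \<phi> s) (at s)"
    by (intro derivative_intros oint_deriv c)
  then show "((\<lambda>s. Zav \<tau> f (x \<star> u3 0 0 s)) has_real_derivative f (x \<star> u3 0 0 s \<star> u3 0 0 \<tau>) - f (x \<star> u3 0 0 s)) (at s)"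
    using x by (simp add: e \<phi>_def act_u3)
qed

end

section \<open>The invariant density as a cocycle\<close>

lemma norm_E: "norm (E i j) = 1"
proof -
  have "E i j = axis i (axis j 1)" by (simp add: E_def axis_def vec_eq_iff)
  then show ?thesis by simp
qed

lemma norm_u3: "norm (u3 a b c - mat 1) \<le> \<bar>a\<bar> + \<bar>b\<bar> + \<bar>c\<bar>"
proof -
  have "u3 a b c - mat 1 = a *\<^sub>R E 1 2 + b *\<^sub>R E 2 3 + c *\<^sub>R E 1 3" by (simp add: u3_eq)
  also have "norm \<dots> \<le> norm (a *\<^sub>R E 1 2) + norm (b *\<^sub>R E 2 3) + norm (c *\<^sub>R E 1 3)"
    by (meson add_right_mono norm_triangle_ineq order_trans)
  finally show ?thesis by (simp add: norm_E)
qed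

text \<open>Difference quotients along the sequence 1/(n + 1), as the convergence theorem for
  integrals works with sequences.\<close>

lemma seq_deriv:
  assumes "(f has_real_derivative D) (at 0)"
  shows "(\<lambda>n. real (Suc n) * (f (1 / real (Suc n)) - f 0)) \<longlonglongrightarrow> D"
proof -
  have "((\<lambda>h. (f h - f 0) / h) \<longlongrightarrow> D) (at 0)" using assms by (simp add: DERIV_def)
  moreover have "filterlim (\<lambda>n. 1 / real (Suc n)) (at 0) sequentially"
    unfolding filterlim_at using LIMSEQ_inverse_real_of_nat by (simp add: inverse_eq_divide)
  ultimately have "(\<lambda>n. (f (1 / real (Suc n)) - f 0) / (1 / real (Suc n))) \<longlonglongrightarrow> D"
    by (rule filterlim_compose)
  then show ?thesis by (simp add: mult.commute)
qed

section \<open>Integration by parts along the centre\<close>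

context haar begin

lemma bounded_convergence:
  assumes "\<And>n. s n \<in> borel_measurable \<omega>" "\<And>n x. x \<in> M \<Longrightarrow> \<bar>s n x\<bar> \<le> B" "\<And>x. x \<in> M \<Longrightarrow> (\<lambda>n. s n x) \<longlonglongrightarrow> f x"
  shows "(\<lambda>n. \<integral>x. s n x \<partial>\<omega>) \<longlonglongrightarrow> (\<integral>x. (f x :: real) \<partial>\<omega>)"
proof (rule integral_dominated_convergence[where w = "\<lambda>x. B"])
  show "f \<in> borel_measurable \<omega>"
    by (rule borel_measurable_LIMSEQ_real[where u = s]) (simp_all add: space_\<omega> assms)
qed (use assms in \<open>auto simp: space_\<omega>\<close>)

text \<open>Invariance of \<omega> under exp(sZ) makes every difference quotient integrate to 0, and
  the quotients are bounded by the supremum of \<open>f'\<close>.\<close>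

lemma integral_Z: assumes "hasZ f f'" shows "(\<integral>x. f' x \<partial>\<omega>) = 0"
proof -
  obtain B where B: "B > 0" "\<And>x. x \<in> M \<Longrightarrow> \<bar>f' x\<bar> \<le> B" using cM_bounded hasZ_cM(2)[OF assms] by blast
  define s where "s n x = real (Suc n) * (f (x \<star> u3 0 0 (1 / real (Suc n))) - f x)" for n x
  have sm: "cM (s n)" for n
    unfolding s_def by (intro cM_intros hasZ_cM[OF assms] u3_SL)
  have "(\<lambda>n. \<integral>x. s n x \<partial>\<omega>) \<longlonglongrightarrow> (\<integral>x. f' x \<partial>\<omega>)"
  proof (rule bounded_convergence[where B = B])
    fix n x assume x: "x \<in> M"
    have "\<bar>f (x \<star> u3 0 0 (1 / real (Suc n))) - f x\<bar> \<le> B * (1 / real (Suc n))"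
      using hasZ_lipschitz[OF assms B(2) x, of "1 / real (Suc n)"] by simp
    then have "real (Suc n) * \<bar>f (x \<star> u3 0 0 (1 / real (Suc n))) - f x\<bar> \<le> real (Suc n) * (B * (1 / real (Suc n)))"
      by (rule mult_left_mono) simp
    then show "\<bar>s n x\<bar> \<le> B" unfolding s_def by (simp add: abs_mult)
  next
    fix x assume x: "x \<in> M"
    show "(\<lambda>n. s n x) \<longlonglongrightarrow> f' x"
      using seq_deriv[OF hasZ_deriv[OF assms x, of 0]] x by (simp add: s_def u3_zero act_one)
  qed (rule cM_measurable[OF sm])
  moreover have "(\<integral>x. s n x \<partial>\<omega>) = 0" for n
    unfolding s_def
    using integral_act[OF u3_SL[of 0 0 "1 / real (Suc n)"] cM_measurable[OF hasZ_cM(1)[OF assms]]]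
    by (simp add: Bochner_Integration.integral_diff cM_integrable cM_act hasZ_cM[OF assms] u3_SL)
  ultimately show ?thesis by (simp add: LIMSEQ_const_iff)
qed

end

section \<open>The first-order equation satisfied by the invariant density\<close>

locale perturbed_measure = perturbed \<Gamma> p q w \<beta> h + haar \<Gamma> \<omega>
  for \<Gamma> p q w \<beta> h \<omega> +
  fixes \<kappa> :: "(real^3^3) set \<Rightarrow> real"
  assumes C1_\<kappa>: "C1_fun \<Gamma> \<kappa>" and \<kappa>_pos: "\<And>x. x \<in> M \<Longrightarrow> \<kappa> x > 0"
    and preserved: "preserves_measure (density \<omega> (\<lambda>x. ennreal (\<kappa> x))) h"
begin

abbreviation \<mu> :: "(real^3^3) set measure" where "\<mu> \<equiv> density \<omega> (\<lambda>x. ennreal (\<kappa> x))"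

lemma h_measurable: "h t \<in> measurable \<omega> \<omega>"
proof -
  have "h t \<in> measurable \<mu> \<mu>" using preserved by (simp add: preserves_measure_def)
  moreover have "measurable \<mu> \<mu> = measurable \<omega> \<omega>" by (rule measurable_cong_sets) simp_all
  ultimately show ?thesis by simp
qed

lemma \<kappa>_measurable: "\<kappa> \<in> borel_measurable \<omega>" by (rule cM_measurable[OF C1_cM[OF C1_\<kappa>]])

lemma integral_\<mu>:
  assumes "f \<in> borel_measurable \<omega>" shows "(\<integral>x. f x \<partial>\<mu>) = (\<integral>x. (f x :: real) * \<kappa> x \<partial>\<omega>)"
proof -
  have "AE x in \<omega>. 0 \<le> \<kappa> x" using \<kappa>_pos by (intro AE_I2) (simp add: space_\<omega> less_imp_le)
  then show ?thesis using integral_density[OF assms \<kappa>_measurable] by (simp add: mult.commute)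
qed

lemma integral_h:
  assumes "f \<in> borel_measurable \<omega>"
  shows "(\<integral>x. f (h t x) * \<kappa> x \<partial>\<omega>) = (\<integral>x. (f x :: real) * \<kappa> x \<partial>\<omega>)"
proof -
  have m: "h t \<in> measurable \<mu> \<mu>" "distr \<mu> \<mu> (h t) = \<mu>" using preserved by (auto simp: preserves_measure_def)
  have "f \<in> borel_measurable \<mu>" using assms by simp
  from integral_distr[OF m(1) this] have "(\<integral>x. f (h t x) \<partial>\<mu>) = (\<integral>x. f x \<partial>\<mu>)" by (simp add: m)
  then show ?thesis using assms measurable_compose[OF h_measurable assms] by (simp add: integral_\<mu>)
qed

text \<open>
  Differentiating the invariance of \<open>\<mu>\<close> at time \<open>0\<close>, with the \<open>U\<close>-derivative moved to the density,
  shows \<open>U\<kappa> + Z(\<beta>\<kappa>) = 0\<close> weakly; only test functions that are smooth along \<open>Z\<close> are needed.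
\<close>
lemma weak_cohomological_equation:
  assumes f: "hasZ f f'"
  shows "(\<integral>x. \<beta> x * f' x * \<kappa> x - f x * dM \<kappa> x (N3 p q w) \<partial>\<omega>) = 0"
proof -
  note cf = hasZ_cM[OF f]
  obtain Bf where Bf: "Bf > 0" "\<And>x. x \<in> M \<Longrightarrow> \<bar>f x\<bar> \<le> Bf" using cM_bounded cf by blast
  obtain B' where B': "B' > 0" "\<And>x. x \<in> M \<Longrightarrow> \<bar>f' x\<bar> \<le> B'" using cM_bounded cf by blast
  obtain Bb where Bb: "Bb > 0" "\<And>x. x \<in> M \<Longrightarrow> \<bar>\<beta> x\<bar> \<le> Bb" using cM_bounded C1_cM[OF C1_\<beta>] by blast
  obtain Bk where Bk: "Bk > 0" "\<And>x. x \<in> M \<Longrightarrow> \<bar>\<kappa> x\<bar> \<le> Bk" using cM_bounded C1_cM[OF C1_\<kappa>] by blast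
  obtain Bd where Bd: "Bd > 0" "\<And>x. x \<in> M \<Longrightarrow> \<bar>dM \<kappa> x (N3 p q w)\<bar> \<le> Bd"
    using cM_bounded cM_dM[OF C1_\<kappa>] by blast
  define T where "T n = 1 / real (Suc n)" for n
  have T: "T n > 0" "T n \<le> 1" "real (Suc n) * T n = 1" for n by (auto simp: T_def)
  have T0: "T \<longlonglongrightarrow> 0" unfolding T_def using LIMSEQ_inverse_real_of_nat by (simp add: inverse_eq_divide)
  have rb: "\<bar>\<rho> t x\<bar> \<le> Bb * \<bar>t\<bar>" if "x \<in> M" for t x
    using MVT_abs[OF \<rho>_deriv[OF that], of t Bb] Bb h_M[OF that] by simp
  have kd: "((\<lambda>t. \<kappa> (x \<star> Ef t 0)) has_real_derivative dM \<kappa> (x \<star> Ef t 0) (N3 p q w)) (at t)" if "x \<in> M" for x t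
    unfolding Ef_def by (rule dM_u3[OF C1_\<kappa> that]) (auto intro!: derivative_eq_intros)
  \<comment> \<open>Since \<open>f\<close> need not be differentiable along U, the increment is
    split: \<open>s1\<close> keeps its central part, and the translation by exp(tU) is moved onto
    \<kappa> by invariance of \<omega>, where it becomes \<open>s2\<close>.\<close>
  define s1 where "s1 n x = real (Suc n) * (f (h (T n) x) - f (x \<star> Ef (T n) 0))" for n x
  define s2 where "s2 n x = real (Suc n) * (\<kappa> (x \<star> Ef (- T n) 0) - \<kappa> x)" for n x
  have m1: "s1 n \<in> borel_measurable \<omega>" for n unfolding s1_def
    using measurable_compose[OF h_measurable cM_measurable[OF cf(1)]] cM_measurable[OF cM_act[OF cf(1) Ef_SL]] by measurable
  have m2: "s2 n \<in> borel_measurable \<omega>" for n unfolding s2_def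
    by (intro cM_measurable cM_intros C1_cM[OF C1_\<kappa>] Ef_SL)
  have b1: "\<bar>s1 n x\<bar> \<le> B' * Bb" if x: "x \<in> M" for n x
  proof -
    have "\<bar>f (x \<star> Ef (T n) 0 \<star> u3 0 0 (\<rho> (T n) x)) - f (x \<star> Ef (T n) 0)\<bar> \<le> B' * \<bar>\<rho> (T n) x\<bar>"
      using hasZ_lipschitz[OF f B'(2) act_M[OF x Ef_SL]] .
    also have "\<dots> \<le> B' * (Bb * T n)" using rb[OF x, of "T n"] B' T(1)[of n] by (intro mult_left_mono) auto
    finally have "\<bar>f (h (T n) x) - f (x \<star> Ef (T n) 0)\<bar> \<le> B' * Bb * T n"
      using x by (simp add: h_eq act_act Ef_SL u3_SL Ef_u3)
    then have "real (Suc n) * \<bar>f (h (T n) x) - f (x \<star> Ef (T n) 0)\<bar> \<le> real (Suc n) * (B' * Bb * T n)"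
      by (rule mult_left_mono) simp
    also have "\<dots> = B' * Bb * (real (Suc n) * T n)" by simp
    finally show ?thesis unfolding s1_def abs_mult T by simp
  qed
  have b2: "\<bar>s2 n x\<bar> \<le> Bd" if x: "x \<in> M" for n x
  proof -
    have "\<bar>\<kappa> (x \<star> Ef (- T n) 0) - \<kappa> (x \<star> Ef 0 0)\<bar> \<le> Bd * \<bar>- T n\<bar>"
      by (rule MVT_abs[OF kd[OF x]]) (rule Bd(2)[OF act_M[OF x Ef_SL]])
    then have "real (Suc n) * \<bar>\<kappa> (x \<star> Ef (- T n) 0) - \<kappa> x\<bar> \<le> real (Suc n) * (Bd * T n)"
      using T(1)[of n] x by (intro mult_left_mono) (auto simp: Ef_00 act_one)
    also have "\<dots> = Bd * (real (Suc n) * T n)" by simp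
    finally show ?thesis unfolding s2_def abs_mult T by simp
  qed
  have l1: "(\<lambda>n. s1 n x) \<longlonglongrightarrow> \<beta> x * f' x" if x: "x \<in> M" for x
  proof -
    have r: "(\<lambda>n. real (Suc n) * \<rho> (T n) x) \<longlonglongrightarrow> \<beta> x"
      using seq_deriv[OF \<rho>_deriv[OF x, of 0]] x by (simp add: T_def h_0)
    have "(\<lambda>n. s1 n x - real (Suc n) * \<rho> (T n) x * f' x) \<longlonglongrightarrow> 0"
    proof (rule LIMSEQ_I)
      fix e :: real assume e: "e > 0"
      \<comment> \<open>\<open>Bb\<close> appears in the tolerance because the error is multiplied
        by a central displacement of at most \<open>Bb * T n\<close>.\<close>
      obtain d where d: "d > 0" "\<And>y k. y \<in> M \<Longrightarrow> k \<in> SL \<Longrightarrow> norm (k - mat 1) < d \<Longrightarrow> \<bar>f' (y \<star> k) - f' y\<bar> < e / (2 * Bb)"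
        using cM_uniform[OF cf(2), of "e / (2 * Bb)"] e Bb by auto
      \<comment> \<open>With \<open>T n \<le> 1\<close>, the element \<open>Ef (T n) s\<close> is
        within \<open>c * T n\<close> of the identity for all central displacements \<open>s\<close>
        up to \<open>Bb * T n\<close>.\<close>
      define c where "c = \<bar>p\<bar> + \<bar>q\<bar> + \<bar>w\<bar> + \<bar>p * q\<bar> + Bb"
      have c: "c > 0" using Bb by (simp add: c_def add_nonneg_pos)
      have "eventually (\<lambda>n. T n < d / c) sequentially" using T0 d c by (intro order_tendstoD) auto
      then obtain N where N: "\<And>n. n \<ge> N \<Longrightarrow> T n < d / c" by (auto simp: eventually_sequentially)
      show "\<exists>N. \<forall>n\<ge>N. norm (s1 n x - real (Suc n) * \<rho> (T n) x * f' x - 0) < e"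
      proof (intro exI[of _ N] allI impI)
        fix n assume n: "n \<ge> N"
        define y where "y = x \<star> Ef (T n) 0"
        have y: "y \<in> M" using x by (simp add: y_def act_M Ef_SL)
        have "\<bar>(f (y \<star> u3 0 0 (\<rho> (T n) x)) - \<rho> (T n) x * f' x) - (f (y \<star> u3 0 0 0) - 0 * f' x)\<bar>
          \<le> e / (2 * Bb) * \<bar>\<rho> (T n) x\<bar>"
        proof (rule MVT_abs[where f' = "\<lambda>s. f' (y \<star> u3 0 0 s) - 1 * f' x"])
          show "((\<lambda>s. f (y \<star> u3 0 0 s) - s * f' x) has_real_derivative f' (y \<star> u3 0 0 s) - 1 * f' x) (at s)" for s
            by (rule DERIV_diff[OF hasZ_deriv[OF f y] DERIV_cmult_right[OF DERIV_ident]])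
          fix s assume s: "\<bar>s\<bar> \<le> \<bar>\<rho> (T n) x\<bar>"
          have ts: "\<bar>s\<bar> \<le> Bb * T n" using s rb[OF x, of "T n"] T(1)[of n] by simp
          have "norm (Ef (T n) s - mat 1) \<le> \<bar>T n * p\<bar> + \<bar>T n * q\<bar> + \<bar>T n * w + (T n)\<^sup>2 * p * q / 2 + s\<bar>"
            unfolding Ef_def by (rule norm_u3)
          also have "\<dots> \<le> \<bar>T n * p\<bar> + \<bar>T n * q\<bar> + \<bar>T n * w\<bar> + \<bar>(T n)\<^sup>2 * p * q / 2\<bar> + \<bar>s\<bar>" by linarith
          also have "\<dots> \<le> T n * \<bar>p\<bar> + T n * \<bar>q\<bar> + T n * \<bar>w\<bar> + T n * \<bar>p * q\<bar> + Bb * T n"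
          proof -
            have "(T n)\<^sup>2 \<le> T n" using T(1,2)[of n] by (simp add: power2_eq_square mult_left_le)
            then have "(T n)\<^sup>2 * (\<bar>p\<bar> * \<bar>q\<bar>) \<le> T n * (\<bar>p\<bar> * \<bar>q\<bar>)" by (intro mult_right_mono) auto
            moreover have "0 \<le> (T n)\<^sup>2 * (\<bar>p\<bar> * \<bar>q\<bar>)" by simp
            moreover have "\<bar>(T n)\<^sup>2 * p * q / 2\<bar> = (T n)\<^sup>2 * (\<bar>p\<bar> * \<bar>q\<bar>) / 2" by (simp add: abs_mult mult.assoc)
            ultimately have "\<bar>(T n)\<^sup>2 * p * q / 2\<bar> \<le> T n * \<bar>p * q\<bar>" unfolding abs_mult[of p q] by linarith
            moreover have "\<bar>T n * p\<bar> = T n * \<bar>p\<bar>" "\<bar>T n * q\<bar> = T n * \<bar>q\<bar>" "\<bar>T n * w\<bar> = T n * \<bar>w\<bar>"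
              using T(1)[of n] by (simp_all add: abs_mult)
            ultimately show ?thesis using ts by linarith
          qed
          also have "\<dots> = T n * c" by (simp add: c_def algebra_simps)
          also have "\<dots> < d" using N[OF n] c by (simp add: field_simps)
          finally have "\<bar>f' (x \<star> Ef (T n) s) - f' x\<bar> < e / (2 * Bb)" using d(2)[OF x Ef_SL] by blast
          then show "\<bar>f' (y \<star> u3 0 0 s) - 1 * f' x\<bar> \<le> e / (2 * Bb)"
            using x by (simp add: y_def act_act Ef_SL u3_SL Ef_u3)
        qed
        also have "\<dots> \<le> e / (2 * Bb) * (Bb * T n)"
          using rb[OF x, of "T n"] e Bb T(1)[of n] by (intro mult_left_mono) auto
        finally have "\<bar>f (h (T n) x) - f (x \<star> Ef (T n) 0) - \<rho> (T n) x * f' x\<bar> \<le> e / 2 * T n"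
          using x y Bb by (simp add: y_def h_eq act_act Ef_SL u3_SL Ef_u3 algebra_simps)
        then have "real (Suc n) * \<bar>f (h (T n) x) - f (x \<star> Ef (T n) 0) - \<rho> (T n) x * f' x\<bar> \<le> real (Suc n) * (e / 2 * T n)"
          by (rule mult_left_mono) simp
        also have "\<dots> = e / 2 * (real (Suc n) * T n)" by simp
        finally have 1: "real (Suc n) * \<bar>f (h (T n) x) - f (x \<star> Ef (T n) 0) - \<rho> (T n) x * f' x\<bar> \<le> e / 2"
          unfolding T by simp
        have "s1 n x - real (Suc n) * \<rho> (T n) x * f' x = real (Suc n) * (f (h (T n) x) - f (x \<star> Ef (T n) 0) - \<rho> (T n) x * f' x)"
          by (simp add: s1_def algebra_simps)
        then have "norm (s1 n x - real (Suc n) * \<rho> (T n) x * f' x - 0) \<le> e / 2"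
          using 1 by (simp only: real_norm_def diff_zero abs_mult abs_of_nat)
        then show "norm (s1 n x - real (Suc n) * \<rho> (T n) x * f' x - 0) < e" using e by simp
      qed
    qed
    from tendsto_add[OF this tendsto_mult_right[OF r, of "f' x"]] show ?thesis by simp
  qed
  have l2: "(\<lambda>n. s2 n x) \<longlonglongrightarrow> - dM \<kappa> x (N3 p q w)" if x: "x \<in> M" for x
  proof -
    have "((\<lambda>t. \<kappa> (x \<star> Ef (- t) 0)) has_real_derivative - dM \<kappa> x (N3 p q w)) (at 0)"
      using DERIV_mirror[THEN iffD1, of "\<lambda>t. \<kappa> (x \<star> Ef t 0)" _ 0] kd[OF x, of 0] x by (simp add: Ef_00 act_one)
    from seq_deriv[OF this] show ?thesis using x by (simp add: s2_def T_def Ef_00 act_one)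
  qed
  have "(\<lambda>n. \<integral>x. s1 n x * \<kappa> x + f x * s2 n x \<partial>\<omega>) \<longlonglongrightarrow> (\<integral>x. \<beta> x * f' x * \<kappa> x + f x * (- dM \<kappa> x (N3 p q w)) \<partial>\<omega>)"
  proof (rule bounded_convergence[where B = "B' * Bb * Bk + Bf * Bd"])
    show "(\<lambda>x. s1 n x * \<kappa> x + f x * s2 n x) \<in> borel_measurable \<omega>" for n
      using m1 m2 \<kappa>_measurable cM_measurable[OF cf(1)] by measurable
    show "\<bar>s1 n x * \<kappa> x + f x * s2 n x\<bar> \<le> B' * Bb * Bk + Bf * Bd" if x: "x \<in> M" for n x
    proof -
      have "\<bar>s1 n x * \<kappa> x\<bar> \<le> B' * Bb * Bk" "\<bar>f x * s2 n x\<bar> \<le> Bf * Bd"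
        unfolding abs_mult using b1[OF x] b2[OF x] Bk(2)[OF x] Bf(2)[OF x] B'(1) Bb(1) Bf(1)
        by (auto intro!: mult_mono)
      then show ?thesis by linarith
    qed
    show "(\<lambda>n. s1 n x * \<kappa> x + f x * s2 n x) \<longlonglongrightarrow> \<beta> x * f' x * \<kappa> x + f x * (- dM \<kappa> x (N3 p q w))" if "x \<in> M" for x
      by (intro tendsto_intros l1 l2 that)
  qed
  \<comment> \<open>Four integrals cancel in pairs: \<open>a\<close> against \<open>d\<close> by
    invariance of \<mu> under the flow, \<open>b\<close> against \<open>b'\<close> by invariance of
    \<omega> under translations.\<close>
  moreover have "(\<integral>x. s1 n x * \<kappa> x + f x * s2 n x \<partial>\<omega>) = 0" for n
  proof -
    define a where "a x = f (h (T n) x) * \<kappa> x" for x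
    define b where "b x = f (x \<star> Ef (T n) 0) * \<kappa> x" for x
    define b' where "b' x = f x * \<kappa> (x \<star> Ef (- T n) 0)" for x
    define d where "d x = f x * \<kappa> x" for x
    have cb: "cM b" "cM b'" "cM d" unfolding b_def b'_def d_def
      by (intro cM_intros cf C1_cM[OF C1_\<kappa>] Ef_SL)+
    have am: "a \<in> borel_measurable \<omega>" unfolding a_def
      using measurable_compose[OF h_measurable cM_measurable[OF cf(1)]] \<kappa>_measurable by measurable
    have ai: "integrable \<omega> a"
    proof (rule bounded_integrable[OF am, where B = "Bf * Bk"])
      show "\<bar>a x\<bar> \<le> Bf * Bk" if "x \<in> M" for x
        unfolding a_def abs_mult using Bf Bk h_M[OF that] that by (intro mult_mono) auto
    qed
    have 1: "(\<integral>x. a x \<partial>\<omega>) = (\<integral>x. d x \<partial>\<omega>)"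
      unfolding a_def d_def by (rule integral_h[OF cM_measurable[OF cf(1)]])
    have "(\<integral>x. b' (x \<star> Ef (T n) 0) \<partial>\<omega>) = (\<integral>x. b' x \<partial>\<omega>)"
      by (rule integral_act[OF Ef_SL cM_measurable[OF cb(2)]])
    moreover have "(\<integral>x. b' (x \<star> Ef (T n) 0) \<partial>\<omega>) = (\<integral>x. b x \<partial>\<omega>)"
      by (rule Bochner_Integration.integral_cong)
         (simp_all add: space_\<omega> b_def b'_def act_act Ef_SL Ef_mult Ef_00 act_one)
    ultimately have 2: "(\<integral>x. b x \<partial>\<omega>) = (\<integral>x. b' x \<partial>\<omega>)" by simp
    have "(\<integral>x. s1 n x * \<kappa> x + f x * s2 n x \<partial>\<omega>) = (\<integral>x. real (Suc n) * ((a x - b x) + (b' x - d x)) \<partial>\<omega>)"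
      by (rule Bochner_Integration.integral_cong) (simp_all add: s1_def s2_def a_def b_def b'_def d_def algebra_simps)
    also have "\<dots> = 0" using ai cb[THEN cM_integrable] 1 2 by simp
    finally show ?thesis .
  qed
  ultimately show ?thesis by (simp add: LIMSEQ_const_iff)
qed

text \<open>Integration by parts turns the weak equation into orthogonality of \<open>F\<close> to
  every function in \<open>hasZ\<close>. As \<open>F\<close> is known only to be continuous, it is
  tested against its own short central averages; they converge to \<open>F\<close>, so its square
  integrates to 0, and full support gives the pointwise claim.\<close>

lemma cohomological_equation:
  assumes "x \<in> M"
  shows "dM \<kappa> x (N3 p q w) + \<beta> x * dM \<kappa> x (N3 0 0 1) + \<kappa> x * dM \<beta> x (N3 0 0 1) = 0"
proof -
  define F where "F x = dM \<kappa> x (N3 p q w) + \<beta> x * dM \<kappa> x (N3 0 0 1) + \<kappa> x * dM \<beta> x (N3 0 0 1)" for x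
  have cF: "cM F" unfolding F_def
    by (intro cM_intros C1_cM[OF C1_\<kappa>] C1_cM[OF C1_\<beta>] cM_dM[OF C1_\<kappa>] cM_dM[OF C1_\<beta>])
  have orth: "(\<integral>x. f x * F x \<partial>\<omega>) = 0" if f: "hasZ f f'" for f f'
  proof -
    define u where "u x = \<beta> x * f' x * \<kappa> x - f x * dM \<kappa> x (N3 p q w)" for x
    define v where "v x = f' x * (\<beta> x * \<kappa> x) + f x * (dM \<beta> x (N3 0 0 1) * \<kappa> x + \<beta> x * dM \<kappa> x (N3 0 0 1))" for x
    have "hasZ (\<lambda>x. f x * (\<beta> x * \<kappa> x)) v"
      unfolding v_def by (intro hasZ_mult f hasZ_C1 C1_\<kappa> C1_\<beta>)
    then have v: "cM v" "(\<integral>x. v x \<partial>\<omega>) = 0" using integral_Z hasZ_cM by blast+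
    have u: "cM u" "(\<integral>x. u x \<partial>\<omega>) = 0"
      unfolding u_def using weak_cohomological_equation[OF f]
      by (auto intro!: cM_intros hasZ_cM[OF f] C1_cM[OF C1_\<kappa>] C1_cM[OF C1_\<beta>] cM_dM[OF C1_\<kappa>])
    have "(\<integral>x. f x * F x \<partial>\<omega>) = (\<integral>x. v x - u x \<partial>\<omega>)"
      by (rule Bochner_Integration.integral_cong) (simp_all add: F_def u_def v_def algebra_simps)
    also have "\<dots> = 0" using u v cM_integrable by simp
    finally show ?thesis .
  qed
  obtain B where B: "B > 0" "\<And>x. x \<in> M \<Longrightarrow> \<bar>F x\<bar> \<le> B" using cM_bounded[OF cF] by blast
  define s where "s n x = real (Suc n) * Zav (1 / real (Suc n)) F x" for n x
  have hs: "hasZ (s n) (\<lambda>x. real (Suc n) * (F (x \<star> u3 0 0 (1 / real (Suc n))) - F x))" for n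
    unfolding s_def[abs_def] by (rule hasZ_cmult[OF hasZ_Zav[OF cF]])
  have d: "(Zav' has_real_derivative F (x \<star> u3 0 0 t)) (at t)"
    if "x \<in> M" "Zav' = (\<lambda>t. Zav t F x)" for Zav' x t
    unfolding that(2) Zav_def by (rule oint_deriv) (intro u3_continuous cF that continuous_intros)
  have "(\<lambda>n. \<integral>x. s n x * F x \<partial>\<omega>) \<longlonglongrightarrow> (\<integral>x. F x * F x \<partial>\<omega>)"
  proof (rule bounded_convergence[where B = "B * B"])
    show "(\<lambda>x. s n x * F x) \<in> borel_measurable \<omega>" for n
      by (intro cM_measurable cM_intros hasZ_cM[OF hs] cF)
    fix x assume x: "x \<in> M"
    show "\<bar>s n x * F x\<bar> \<le> B * B" for n
    proof -
      have "\<bar>Zav (1 / real (Suc n)) F x - Zav 0 F x\<bar> \<le> B * \<bar>1 / real (Suc n)\<bar>"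
        by (rule MVT_abs[OF d[OF x refl]]) (rule B(2)[OF act_M[OF x u3_SL]])
      then have "real (Suc n) * \<bar>Zav (1 / real (Suc n)) F x\<bar> \<le> real (Suc n) * (B * (1 / real (Suc n)))"
        by (intro mult_left_mono) (simp_all add: Zav_def)
      then have "\<bar>s n x\<bar> \<le> B" unfolding s_def by (simp add: abs_mult)
      then show ?thesis unfolding abs_mult using B x by (intro mult_mono) auto
    qed
    have "(\<lambda>n. s n x) \<longlonglongrightarrow> F x"
      using seq_deriv[OF d[OF x refl, of 0]] x by (simp add: s_def u3_zero act_one) (simp add: Zav_def)
    then show "(\<lambda>n. s n x * F x) \<longlonglongrightarrow> F x * F x" by (intro tendsto_intros)
  qed
  then have "(\<integral>x. F x * F x \<partial>\<omega>) = 0" using orth[OF hs] by (simp add: LIMSEQ_const_iff)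
  then have "F x = 0" using full_support[OF cF _ assms] by (simp add: power2_eq_square)
  then show ?thesis by (simp add: F_def)
qed

lemma N3_split: "N3 a b (c + d) = N3 a b c + d *\<^sub>R N3 0 0 1"
  by (simp add: N3_def algebra_simps)

text \<open>The cohomological equation read along an orbit, where the direction of motion is U +
  \<beta>Z. This makes \<kappa> an integrating factor for linear equations with coefficient
  Z\<beta>.\<close>

lemma \<kappa>_flow:
  assumes "x \<in> M"
  shows "((\<lambda>t. \<kappa> (h t x)) has_real_derivative - (\<kappa> (h t x) * dM \<beta> (h t x) (N3 0 0 1))) (at t)"
  using dM_flow[OF C1_\<kappa> assms, of t] cohomological_equation[OF h_M[OF assms], of t] h_M[OF assms, of t]
  by (simp add: N3_split dM_add C1_\<kappa> dM_scaleR add_eq_0_iff2)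

end

section \<open>Differentiability of the flow\<close>

context cocompact begin

lemma nrm_scaleR: assumes "c > 0" "a \<in> GP" shows "nrm (c *\<^sub>R a) = nrm a"
proof -
  have d: "det a > 0" using assms by (simp add: GP_def)
  have "(c ^ 3 * det a) powr (-1/3) = (c ^ 3) powr (-1/3) * det a powr (-1/3)"
    using assms d by (simp add: powr_mult)
  also have "(c ^ 3) powr (-1/3) = inverse c"
    using assms by (simp add: powr_numeral[symmetric] powr_powr powr_minus del: powr_numeral)
  finally show ?thesis using assms by (simp add: nrm_def det_scaleR3)
qed

text \<open>Extends the formula for \<open>dM\<close> from \<open>SL\<close> to \<open>GP\<close>:
  the lift is constant along rays, so scaling both the point and the tangent vector leaves the
  derivative unchanged.\<close>

lemma Dl_nrm:
  assumes f: "C1_fun \<Gamma> f" and a: "a \<in> GP" shows "Dl f a (a ** Y) = dM f (pr (nrm a)) Y"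
proof -
  define c where "c = det a powr (-1/3)"
  have c: "c > 0" "nrm a = c *\<^sub>R a" using a by (auto simp: c_def nrm_def GP_def)
  have na: "nrm a \<in> SL" using nrm_SL[OF a] .
  have "((\<lambda>b. lift f (c *\<^sub>R b)) has_derivative (\<lambda>H. Dl f (c *\<^sub>R a) (c *\<^sub>R H))) (at a)"
    by (rule has_derivative_compose[OF bounded_linear_imp_has_derivative[OF bounded_linear_scaleR_right]])
       (use Dl[OF f SL_GP[OF na]] c in simp)
  then have "(lift f has_derivative (\<lambda>H. Dl f (c *\<^sub>R a) (c *\<^sub>R H))) (at a)"
    by (rule has_derivative_transform_within_open[OF _ open_GP a]) (simp add: lift_def nrm_scaleR c)
  then have "Dl f (c *\<^sub>R a) (c *\<^sub>R (a ** Y)) = Dl f a (a ** Y)"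
    using has_derivative_unique[OF _ Dl[OF f a]] by metis
  moreover have "c *\<^sub>R a \<in> SL" using na c(2) by simp
  ultimately show ?thesis by (simp add: c(2) dM_pr[OF f] matrix_scaleR_left)
qed

text \<open>The Taylor remainder will be integrated over time and must be small uniformly along an
  orbit segment. Uniform continuity of the derivative on a compact neighbourhood of \<open>K\<close>
  provides this.\<close>

lemma uniform_differentiability:
  assumes f: "C1_fun \<Gamma> f" and K: "compact K" "K \<subseteq> GP" and e: "e > 0"
  obtains d where "d > 0" "\<And>g q. g \<in> K \<Longrightarrow> norm (q - g) < d \<Longrightarrow>
    \<bar>lift f q - lift f g - Dl f g (q - g)\<bar> \<le> e * norm (q - g)"
proof (cases "K = {}")
  case True
  then show ?thesis using that[of 1] by auto
next
  case False
  obtain e0 where e0: "e0 > 0" "{x. infdist x K \<le> e0} \<subseteq> GP"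
    using compact_in_open_separated[OF False K(1) open_GP K(2)] by metis
  define K' where "K' = {x. infdist x K \<le> e0}"
  have K': "compact K'" unfolding K'_def by (rule compact_infdist_le[OF False K(1) e0(1)])
  have "uniformly_continuous_on K' (Dl f)"
    using continuous_on_subset[OF continuous_on_Dl[OF f] e0(2)]
    by (intro compact_uniformly_continuous K') (simp add: K'_def)
  then obtain d where d: "d > 0" "\<And>x y. x \<in> K' \<Longrightarrow> y \<in> K' \<Longrightarrow> dist y x < d \<Longrightarrow> dist (Dl f y) (Dl f x) < e"
    using e unfolding uniformly_continuous_on_def by metis
  show ?thesis
  proof (rule that[of "min d e0"])
    show "min d e0 > 0" using d e0 by simp
    fix g q assume g: "g \<in> K" and q: "norm (q - g) < min d e0"
    define S where "S = ball g (min d e0)"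
    have SK: "S \<subseteq> K'"
    proof
      fix b assume "b \<in> S"
      then have "dist b g \<le> e0" by (simp add: S_def dist_commute)
      then show "b \<in> K'" using infdist_le[OF g, of b] by (simp add: K'_def)
    qed
    have gS: "g \<in> S" using d e0 by (simp add: S_def)
    have "norm (lift f q - lift f g - Dl f g (q - g)) \<le> norm (q - g) * e"
    proof (rule differentiable_bound_linearization[where f' = "\<lambda>a. blinfun_apply (Dl f a)" and S = S])
      fix t :: real assume t: "t \<in> {0..1}"
      have "norm (t *\<^sub>R (q - g)) \<le> norm (q - g)" using t by (simp add: mult_left_le_one_le)
      then show "g + t *\<^sub>R (q - g) \<in> S" using q by (simp add: S_def dist_norm)
    next
      fix b assume b: "b \<in> S"
      show "(lift f has_derivative blinfun_apply (Dl f b)) (at b within S)"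
        using Dl[OF f] b SK e0(2) K'_def has_derivative_at_withinI by blast
      have "blinfun_apply (Dl f b) - blinfun_apply (Dl f g) = blinfun_apply (Dl f b - Dl f g)"
        by (auto simp: blinfun.diff_left)
      moreover have "norm (Dl f b - Dl f g) < e"
      proof -
        have "g \<in> K'" "b \<in> K'" using b gS SK by blast+
        moreover have "dist b g < d" using b by (simp add: S_def dist_commute)
        ultimately show ?thesis using d(2)[of g b] by (simp add: dist_norm)
      qed
      ultimately show "onorm (blinfun_apply (Dl f b) - blinfun_apply (Dl f g)) \<le> e"
        by (simp add: norm_blinfun.rep_eq)
    qed (rule gS)
    then show "\<bar>lift f q - lift f g - Dl f g (q - g)\<bar> \<le> e * norm (q - g)" by (simp add: mult.commute)
  qed
qed

end

lemma compact_image_norm_bound: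
  fixes f :: "'a \<Rightarrow> 'b::real_normed_vector"
  assumes "compact (f ` S)" shows "\<exists>C>0. \<forall>x\<in>S. norm (f x) \<le> C"
proof -
  obtain C where "C > 0" "\<forall>y\<in>f ` S. norm y \<le> C"
    using compact_imp_bounded[OF assms] unfolding bounded_pos by blast
  then show ?thesis by blast
qed

lemma oint_continuous_on:
  fixes F :: "real \<Rightarrow> 'a::topological_space \<Rightarrow> real"
  assumes "continuous_on (UNIV \<times> U) (\<lambda>z. F (fst z) (snd z))"
  shows "continuous_on U (\<lambda>a. oint (\<lambda>s. F s a) t)"
proof -
  have "continuous_on (U \<times> cbox 0 1) (\<lambda>z. F (snd z * t) (fst z))"
    by (rule continuous_on_compose2[OF assms, of _ "\<lambda>z. (snd z * t, fst z)", simplified])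
       (auto intro!: continuous_intros)
  then have "continuous_on U (\<lambda>a. integral (cbox 0 1) (\<lambda>\<theta>. F (\<theta> * t) a))"
    by (intro integral_continuous_on_param) (simp add: case_prod_beta)
  then show ?thesis unfolding oint_def by (intro continuous_intros) simp
qed

lemma N3_E13: "N3 0 0 1 = E 1 3" by (simp add: N3_def)

lemma u3_E13: "u3 a b c ** E 1 3 = E 1 3"
  by (simp add: u3_def E_def vec_eq_iff forall_3 matrix_matrix_mult_def sum_3)

section \<open>Lipschitz dependence and joint continuity of the central displacement\<close>

context perturbed begin

definition rh :: "real \<Rightarrow> real^3^3 \<Rightarrow> real" where "rh t a = \<rho> t (pr (nrm a))"

text \<open>A lift of \<open>h t\<close> to an open set of matrices, where ordinary derivatives are
  available.\<close>

definition gf :: "real \<Rightarrow> real^3^3 \<Rightarrow> real^3^3" where "gf t a = a ** Ef t (rh t a)"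

lemma gf_GP: "a \<in> GP \<Longrightarrow> gf t a \<in> GP" by (simp add: gf_def GP_mult Ef_SL)

lemma pr_gf: "a \<in> GP \<Longrightarrow> pr (nrm (gf t a)) = h t (pr (nrm a))"
  by (simp add: gf_def nrm_mult Ef_SL rh_def h_eq pr_M nrm_SL pr_act)

lemma lift_gf: "a \<in> GP \<Longrightarrow> lift f (gf t a) = f (h t (pr (nrm a)))"
  by (simp add: lift_def pr_gf)

lemma rh_deriv: "a \<in> GP \<Longrightarrow> ((\<lambda>t. rh t a) has_real_derivative lift \<beta> (gf t a)) (at t)"
  unfolding rh_def lift_gf by (rule \<rho>_deriv) (simp add: pr_M nrm_SL)

lemma rh_0 [simp]: "rh 0 a = 0" by (simp add: rh_def)

lemma rh_continuous: "a \<in> GP \<Longrightarrow> continuous_on S (\<lambda>t. rh t a)"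
  using DERIV_continuous_on[OF has_field_derivative_at_within[OF rh_deriv]] .

lemma Ef_continuous [continuous_intros]:
  "continuous_on S f \<Longrightarrow> continuous_on S g \<Longrightarrow> continuous_on S (\<lambda>x. Ef (f x) (g x))"
  unfolding Ef_def by (intro continuous_intros) auto

text \<open>The increment of \<beta> between two lifted orbits is split at the point with base
  \<open>b\<close> and the central coordinate of \<open>a\<close>. Changing the base costs
  \<open>C1 * norm (b - a)\<close>, changing the central coordinate at most \<open>B\<close> times
  the unknown, and Gronwall applies. The constant is uniform for times up to
  \<open>T\<close>.\<close>

lemma rh_lipschitz:
  assumes a: "a \<in> GP"
  obtains e C where "e > 0" "C > 0" "cball a e \<subseteq> GP"
    "\<And>b t. b \<in> cball a e \<Longrightarrow> \<bar>t\<bar> \<le> T \<Longrightarrow> \<bar>rh t b - rh t a\<bar> \<le> C * norm (b - a)"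
proof -
  obtain B where B: "B > 0" "\<And>x r r'. x \<in> M \<Longrightarrow> \<bar>\<beta> (x \<star> u3 0 0 r) - \<beta> (x \<star> u3 0 0 r')\<bar> \<le> B * \<bar>r - r'\<bar>"
    using \<beta>_lipschitz by metis
  obtain K where K: "K \<ge> 1" "\<And>(A :: real^3^3) (B :: real^3^3). norm (A ** B) \<le> K * norm A * norm B"
    using matrix_mult_norm_bound by blast
  obtain e where e: "e > 0" "cball a e \<subseteq> GP" using open_GP a open_contains_cball by metis
  define \<K> where "\<K> = (\<lambda>s. Ef s (rh s a)) ` {-T..T}"
  have c\<K>: "compact \<K>" unfolding \<K>_def
    by (intro compact_continuous_image continuous_intros rh_continuous a) simp
  define S where "S = (\<lambda>z. fst z ** snd z) ` (cball a e \<times> \<K>)"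
  have cS: "compact S" unfolding S_def
    by (intro compact_continuous_image continuous_intros compact_Times c\<K> compact_cball)
  have SGP: "S \<subseteq> GP" using e GP_mult Ef_SL by (auto simp: S_def \<K>_def)
  have "compact (Dl \<beta> ` S)"
    using continuous_on_subset[OF continuous_on_Dl[OF C1_\<beta>] SGP] by (intro compact_continuous_image cS)
  then obtain C0 where C0: "C0 > 0" "\<And>b. b \<in> S \<Longrightarrow> norm (Dl \<beta> b) \<le> C0"
    using compact_imp_bounded bounded_pos by (metis (no_types, lifting) imageI)
  obtain CK where CK: "CK > 0" "\<And>k. k \<in> \<K> \<Longrightarrow> norm k \<le> CK"
    using compact_imp_bounded[OF c\<K>] bounded_pos by metis
  define C1 where "C1 = C0 * (K * CK)"
  have C1: "C1 > 0" using C0 K CK by (simp add: C1_def)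
  have lip: "\<bar>lift \<beta> (b ** k) - lift \<beta> (a ** k)\<bar> \<le> C1 * norm (b - a)" if b: "b \<in> cball a e" and k: "k \<in> \<K>" for b k
  proof -
    have "norm (lift \<beta> (b ** k) - lift \<beta> (a ** k)) \<le> C1 * norm (b - a)"
    proof (rule differentiable_bound[of "cball a e" _ "\<lambda>b H. Dl \<beta> (b ** k) (H ** k)"])
      fix b assume b: "b \<in> cball a e"
      have bS: "b ** k \<in> S" using b k by (force simp: S_def)
      have "((\<lambda>b. lift \<beta> (b ** k)) has_derivative (\<lambda>H. Dl \<beta> (b ** k) (H ** k))) (at b)"
        by (rule has_derivative_compose[OF bounded_linear_imp_has_derivative[OF bounded_linear_mmult_left]])
           (use Dl[OF C1_\<beta>] bS SGP in blast)
      then show "((\<lambda>b. lift \<beta> (b ** k)) has_derivative (\<lambda>H. Dl \<beta> (b ** k) (H ** k))) (at b within cball a e)"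
        by (rule has_derivative_at_withinI)
      show "onorm (\<lambda>H. Dl \<beta> (b ** k) (H ** k)) \<le> C1"
      proof (rule onorm_le)
        fix H
        have "norm (Dl \<beta> (b ** k) (H ** k)) \<le> norm (Dl \<beta> (b ** k)) * norm (H ** k)" by (rule norm_blinfun)
        also have "\<dots> \<le> C0 * (K * norm H * CK)"
        proof (intro mult_mono C0(2) bS)
          show "norm (H ** k) \<le> K * norm H * CK"
            using K CK(2)[OF k] by (intro order_trans[OF K(2)] mult_left_mono) auto
        qed (use C0 in auto)
        finally show "norm (Dl \<beta> (b ** k) (H ** k)) \<le> C1 * norm H" by (simp add: C1_def mult_ac)
      qed
    qed (use b e in auto)
    then show ?thesis by simp
  qed
  define C where "C = C1 * exp ((B + 1) * \<bar>T\<bar>)"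
  show ?thesis
  proof (rule that[OF e(1) _ e(2)])
    show "C > 0" using C1 by (simp add: C_def)
    fix b t assume b: "b \<in> cball a e" and t: "\<bar>t\<bar> \<le> T"
    have bG: "b \<in> GP" using b e by blast
    have "\<bar>rh t b - rh t a\<bar> \<le> (C1 * norm (b - a)) * exp ((B + 1) * \<bar>t\<bar>)"
    proof (rule gronwall[where D = "\<lambda>t. rh t b - rh t a"])
      show "((\<lambda>t. rh t b - rh t a) has_real_derivative lift \<beta> (gf s b) - lift \<beta> (gf s a)) (at s)" for s
        by (intro derivative_intros rh_deriv a bG)
      fix s assume s: "\<bar>s\<bar> \<le> \<bar>t\<bar>"
      have "Ef s (rh s a) \<in> \<K>" unfolding \<K>_def using s t by (intro imageI) auto
      then have 1: "\<bar>lift \<beta> (b ** Ef s (rh s a)) - lift \<beta> (gf s a)\<bar> \<le> C1 * norm (b - a)"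
        using lip[OF b] by (simp add: gf_def)
      have e: "lift \<beta> (b ** Ef s r) = \<beta> (pr (nrm b) \<star> Ef s 0 \<star> u3 0 0 r)" for r
        using bG by (simp add: lift_mult Ef_SL act_act pr_M nrm_SL u3_SL Ef_u3)
      have 2: "\<bar>lift \<beta> (gf s b) - lift \<beta> (b ** Ef s (rh s a))\<bar> \<le> B * \<bar>rh s b - rh s a\<bar>"
        unfolding gf_def e by (rule B(2)) (simp add: act_M pr_M nrm_SL bG Ef_SL)
      show "\<bar>lift \<beta> (gf s b) - lift \<beta> (gf s a)\<bar> \<le> B * \<bar>rh s b - rh s a\<bar> + C1 * norm (b - a)"
        using 1 2 by linarith
    qed (use B C1 in auto)
    also have "\<dots> \<le> (C1 * norm (b - a)) * exp ((B + 1) * \<bar>T\<bar>)"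
      using t C1 B by (intro mult_left_mono) auto
    finally show "\<bar>rh t b - rh t a\<bar> \<le> C * norm (b - a)" by (simp add: C_def mult_ac)
  qed
qed

lemma rh_joint_continuous: "continuous_on (UNIV \<times> GP) (\<lambda>z. rh (fst z) (snd z))"
  unfolding continuous_on_iff
proof (intro ballI allI impI)
  fix z :: "real \<times> (real^3^3)" and e :: real assume z: "z \<in> UNIV \<times> GP" and e: "e > 0"
  obtain t0 a where za: "z = (t0, a)" "a \<in> GP" using z by auto
  obtain e1 C where C: "e1 > 0" "C > 0" "cball a e1 \<subseteq> GP"
    "\<And>b t. b \<in> cball a e1 \<Longrightarrow> \<bar>t\<bar> \<le> \<bar>t0\<bar> + 1 \<Longrightarrow> \<bar>rh t b - rh t a\<bar> \<le> C * norm (b - a)"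
    using rh_lipschitz[OF za(2), of "\<bar>t0\<bar> + 1"] by metis
  have "continuous_on UNIV (\<lambda>t. rh t a)" by (rule rh_continuous[OF za(2)])
  then obtain d where d: "d > 0" "\<And>t. dist t t0 < d \<Longrightarrow> dist (rh t a) (rh t0 a) < e / 2"
    using e unfolding continuous_on_iff by (metis UNIV_I half_gt_zero)
  show "\<exists>d>0. \<forall>z'\<in>UNIV \<times> GP. dist z' z < d \<longrightarrow> dist (rh (fst z') (snd z')) (rh (fst z) (snd z)) < e"
  proof (intro exI[of _ "min (min d 1) (min e1 (e / (2 * C)))"] conjI ballI impI)
    show "min (min d 1) (min e1 (e / (2 * C))) > 0" using d C e by simp
    fix z' assume z': "z' \<in> UNIV \<times> GP" "dist z' z < min (min d 1) (min e1 (e / (2 * C)))"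
    obtain t b where tb: "z' = (t, b)" by (cases z')
    have dt: "dist t t0 < min (min d 1) (min e1 (e / (2 * C)))" and db: "dist b a < min (min d 1) (min e1 (e / (2 * C)))"
      using dist_fst_le[of z' z] dist_snd_le[of z' z] z'(2) by (auto simp: za tb)
    have "dist t t0 < 1" using dt by simp
    then have "\<bar>t\<bar> \<le> \<bar>t0\<bar> + 1" unfolding dist_real_def by linarith
    then have "\<bar>rh t b - rh t a\<bar> \<le> C * norm (b - a)" using C(4)[of b t] db by (simp add: dist_commute)
    also have "\<dots> < e / 2" using db C by (simp add: dist_norm field_simps)
    finally have "\<bar>rh t b - rh t a\<bar> < e / 2" .
    moreover have "\<bar>rh t a - rh t0 a\<bar> < e / 2" using d(2)[of t] dt by (simp add: dist_real_def)
    ultimately have "\<bar>rh t b - rh t0 a\<bar> < e" by linarith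
    then show "dist (rh (fst z') (snd z')) (rh (fst z) (snd z)) < e" by (simp add: za tb dist_real_def)
  qed
qed

lemma gf_joint_continuous: "continuous_on (UNIV \<times> GP) (\<lambda>z. gf (fst z) (snd z))"
  unfolding gf_def by (intro continuous_intros rh_joint_continuous)

lemma Dl_gf_joint_continuous:
  assumes "C1_fun \<Gamma> f"
  shows "continuous_on (UNIV \<times> GP) (\<lambda>z. Dl f (gf (fst z) (snd z)) (H ** Ef (fst z) (rh (fst z) (snd z))))"
  by (intro continuous_intros rh_joint_continuous continuous_on_compose2[OF continuous_on_Dl[OF assms] gf_joint_continuous])
     (auto simp: gf_GP)

lemma lift_gf_joint_continuous:
  assumes "C1_fun \<Gamma> f" shows "continuous_on (UNIV \<times> GP) (\<lambda>z. lift f (gf (fst z) (snd z)))"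
  by (rule continuous_on_compose2[OF C1_on_continuous[OF C1_lift[OF assms]] gf_joint_continuous]) (auto simp: gf_GP)

lemma h_joint_continuous:
  assumes "cM f" shows "continuous_on (UNIV \<times> SL) (\<lambda>z. f (h (fst z) (pr (snd z))))"
proof -
  have "continuous_on (UNIV \<times> SL) (\<lambda>z. f (pr (gf (fst z) (snd z))))"
    by (rule continuous_on_compose2[OF assms[unfolded cM_def] continuous_on_subset[OF gf_joint_continuous]])
       (auto simp: SL_GP gf_def SL_mult Ef_SL)
  then show ?thesis
    by (rule continuous_on_eq) (auto simp: gf_def pr_act[symmetric] Ef_SL rh_def nrm_id h_eq pr_M)
qed

lemma cM_h: assumes "cM f" shows "cM (\<lambda>x. f (h t x))"
  unfolding cM_def
  by (rule continuous_on_compose2[OF h_joint_continuous[OF assms], of _ "\<lambda>g. (t, g)", simplified])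
     (auto intro!: continuous_intros)

lemma cM_oint_h: assumes "cM f" shows "cM (\<lambda>x. oint (\<lambda>s. f (h s x)) t)"
  unfolding cM_def by (rule oint_continuous_on[where F = "\<lambda>s g. f (h s (pr g))", OF h_joint_continuous[OF assms]])

end

section \<open>The derivative of the flow in terms of the invariant density\<close>

context perturbed_measure begin

text \<open>
  The derivative of \<open>rh t\<close> solves a scalar linear equation whose integrating factor is the invariant
  density along the orbit.
\<close>
definition \<delta> :: "real \<Rightarrow> real^3^3 \<Rightarrow> real^3^3 \<Rightarrow> real" where
  "\<delta> t a H = oint (\<lambda>s. lift \<kappa> (gf s a) * Dl \<beta> (gf s a) (H ** Ef s (rh s a))) t / lift \<kappa> (gf t a)"

lemma \<delta>_integrand_continuous:
  "continuous_on (UNIV \<times> GP) (\<lambda>z. lift \<kappa> (gf (fst z) (snd z)) * Dl \<beta> (gf (fst z) (snd z)) (H ** Ef (fst z) (rh (fst z) (snd z))))"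
  by (intro continuous_on_mult lift_gf_joint_continuous Dl_gf_joint_continuous C1_\<kappa> C1_\<beta>)

lemma \<delta>_integrand_continuous1:
  assumes "a \<in> GP" shows "continuous_on UNIV (\<lambda>s. lift \<kappa> (gf s a) * Dl \<beta> (gf s a) (H ** Ef s (rh s a)))"
  by (rule continuous_on_compose2[OF \<delta>_integrand_continuous, of _ "\<lambda>s. (s, a)", simplified])
     (use assms in \<open>auto intro!: continuous_intros\<close>)

lemma lift_\<kappa>_pos: "a \<in> GP \<Longrightarrow> lift \<kappa> (gf t a) > 0"
  by (simp add: lift_gf \<kappa>_pos h_M pr_M nrm_SL)

lemma \<delta>_continuous: "continuous_on GP (\<lambda>a. \<delta> t a H)"
proof -
  have "continuous_on GP (\<lambda>a. lift \<kappa> (gf t a))"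
    by (rule continuous_on_compose2[OF lift_gf_joint_continuous[OF C1_\<kappa>], of _ "\<lambda>a. (t, a)", simplified])
       (auto intro!: continuous_intros)
  moreover have "\<forall>a\<in>GP. lift \<kappa> (gf t a) \<noteq> 0" using lift_\<kappa>_pos by (metis less_irrefl)
  ultimately show ?thesis unfolding \<delta>_def
    by (intro continuous_on_divide oint_continuous_on \<delta>_integrand_continuous)
qed

lemma \<delta>_bounded_linear: assumes a: "a \<in> GP" shows "bounded_linear (\<delta> t a)"
proof -
  define f where "f H s = lift \<kappa> (gf s a) * Dl \<beta> (gf s a) (H ** Ef s (rh s a))" for H s
  have i: "(\<lambda>\<theta>. f H (\<theta> * t)) integrable_on {0..1}" for H
    by (intro integrable_continuous_real continuous_on_compose2[OF \<delta>_integrand_continuous1[OF a, folded f_def]] continuous_intros) auto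
  have "f (H + H') s = f H s + f H' s" for H H' s
    by (simp add: f_def bounded_bilinear.add_left[OF bounded_bilinear_matrix_mult] blinfun.add_right distrib_left)
  then have 1: "oint (f (H + H')) t = oint (f H) t + oint (f H') t" for H H'
    using i by (simp add: oint_def integral_add distrib_left)
  have "f (r *\<^sub>R H) s = r * f H s" for H r s
    by (simp add: f_def matrix_scaleR_left blinfun.scaleR_right)
  then have 2: "oint (f (r *\<^sub>R H)) t = r * oint (f H) t" for r H by (simp add: oint_def)
  have "linear (\<delta> t a)"
    by (rule linearI) (simp_all add: \<delta>_def f_def[symmetric, abs_def] 1 2 add_divide_distrib)
  then show ?thesis by (simp add: linear_conv_bounded_linear)
qed

lemma lift_\<kappa>_deriv:
  assumes "a \<in> GP"
  shows "((\<lambda>s. lift \<kappa> (gf s a)) has_real_derivative - (lift \<kappa> (gf s a) * Dl \<beta> (gf s a) (gf s a ** E 1 3))) (at s)"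
  using \<kappa>_flow[of "pr (nrm a)" s] assms
  by (simp add: lift_gf Dl_nrm[OF C1_\<beta> gf_GP] pr_gf pr_M nrm_SL N3_E13)

text \<open>The candidate is compared with the true increment \<open>D\<close> through
  \<open>y\<close>, the increment times \<kappa> minus the integral defining \<delta>. The equation
  for \<kappa> cancels the linear terms of the derivative of \<open>y\<close>, and only the Taylor
  remainder of \<beta> has to be integrated.\<close>

lemma rh_has_derivative:
  assumes a: "a \<in> GP" shows "(rh t has_derivative \<delta> t a) (at a)"
  unfolding has_derivative_at_alt
proof (intro conjI allI impI \<delta>_bounded_linear[OF a])
  fix e :: real assume e: "e > 0"
  define T where "T = \<bar>t\<bar>"
  obtain K where K: "K \<ge> 1" "\<And>(A :: real^3^3) (B :: real^3^3). norm (A ** B) \<le> K * norm A * norm B"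
    using matrix_mult_norm_bound by blast
  obtain e1 C where C: "e1 > 0" "C > 0" "cball a e1 \<subseteq> GP"
    "\<And>b t. b \<in> cball a e1 \<Longrightarrow> \<bar>t\<bar> \<le> T \<Longrightarrow> \<bar>rh t b - rh t a\<bar> \<le> C * norm (b - a)"
    using rh_lipschitz[OF a, of T] by metis
  obtain Bk where Bk: "Bk > 0" "\<And>x. x \<in> M \<Longrightarrow> \<bar>\<kappa> x\<bar> \<le> Bk" using cM_bounded C1_cM[OF C1_\<kappa>] by blast
  define l0 where "l0 = lift \<kappa> (gf t a)"
  have l0: "l0 > 0" using lift_\<kappa>_pos[OF a] by (simp add: l0_def)
  have cE: "compact ((\<lambda>s. Ef s (rh s a)) ` {-T..T})"
    by (intro compact_continuous_image continuous_intros rh_continuous a) simp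
  obtain CE where CE: "CE > 0" "\<And>s. \<bar>s\<bar> \<le> T \<Longrightarrow> norm (Ef s (rh s a)) \<le> CE"
    using compact_imp_bounded[OF cE] unfolding bounded_pos by force
  define G where "G = (\<lambda>s. gf s a) ` {-T..T}"
  have cG: "compact G" unfolding G_def gf_def
    by (intro compact_continuous_image continuous_intros rh_continuous a) simp
  have GGP: "G \<subseteq> GP" using gf_GP[OF a] by (auto simp: G_def)
  have inG: "gf s a \<in> G" if "\<bar>s\<bar> \<le> T" for s unfolding G_def using that by (intro imageI) auto
  obtain Cg where Cg: "Cg > 0" "\<And>s. \<bar>s\<bar> \<le> T \<Longrightarrow> norm (gf s a) \<le> Cg"
    using compact_imp_bounded[OF cG] inG unfolding bounded_pos by blast
  have "compact (Dl \<beta> ` G)"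
    using continuous_on_subset[OF continuous_on_Dl[OF C1_\<beta>] GGP] by (intro compact_continuous_image cG)
  from compact_image_norm_bound[OF this]
  obtain CD where CD': "CD > 0" "\<forall>g\<in>G. norm (Dl \<beta> g) \<le> CD" by (elim exE conjE)
  note CD = CD'(1) bspec[OF CD'(2) inG]
  \<comment> \<open>A Lipschitz constant for \<open>gf s\<close> at \<open>a\<close>; the last
    summand covers the term quadratic in \<open>H\<close>, where \<open>norm H < 1\<close> is
    used.\<close>
  define Q where "Q = K * CE + K * Cg * C + K * K * CE * C"
  have Q: "Q > 0" using K CE Cg C by (simp add: Q_def add_pos_pos)
  \<comment> \<open>Tuned to the final estimate: the remainder is integrated over time at most
    \<open>T\<close> with weight at most \<open>Bk\<close>, then divided by
    \<open>l0\<close>.\<close>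
  define e3 where "e3 = e * l0 / (Bk * (T + 1))"
  have T0: "T \<ge> 0" by (simp add: T_def)
  have e3: "e3 > 0" using e l0 Bk T0 by (simp add: e3_def)
  \<comment> \<open>Coefficient of the mixed term, quadratic in \<open>H\<close>; the last member of
    the minimum in \<open>d'\<close> makes it small.\<close>
  define Q2 where "Q2 = C * CD * (K * K * CE)"
  have Q2: "Q2 > 0" using K CE CD C by (simp add: Q2_def)
  obtain d where d: "d > 0" "\<And>g q. g \<in> G \<Longrightarrow> norm (q - g) < d \<Longrightarrow>
    \<bar>lift \<beta> q - lift \<beta> g - Dl \<beta> g (q - g)\<bar> \<le> e3 / (2 * Q) * norm (q - g)"
    using uniform_differentiability[OF C1_\<beta> cG GGP, of "e3 / (2 * Q)"] e3 Q by (metis divide_pos_pos mult_pos_pos zero_less_numeral)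
  define d' where "d' = min (min e1 1) (min (d / Q) (e3 / (2 * Q2)))"
  show "\<exists>d>0. \<forall>b. norm (b - a) < d \<longrightarrow> norm (rh t b - rh t a - \<delta> t a (b - a)) \<le> e * norm (b - a)"
  proof (intro exI[of _ d'] conjI allI impI)
    show "d' > 0" using C d Q e3 Q2 by (simp add: d'_def)
    fix b assume b: "norm (b - a) < d'"
    define H where "H = b - a"
    have Hd: "norm H < e1" "norm H < 1" "norm H < d / Q" "norm H < e3 / (2 * Q2)" using b by (auto simp: d'_def H_def)
    have ba: "b = a + H" by (simp add: H_def)
    have bA: "b ** A = a ** A + H ** A" for A
      unfolding ba by (rule bounded_bilinear.add_left[OF bounded_bilinear_matrix_mult])
    have be: "b \<in> cball a e1" using Hd by (simp add: H_def dist_norm norm_minus_commute)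
    have bG: "b \<in> GP" using be C by blast
    define D where "D s = rh s b - rh s a" for s
    have Db: "\<bar>D s\<bar> \<le> C * norm H" if "\<bar>s\<bar> \<le> T" for s using C(4)[OF be that] by (simp add: D_def H_def)
    define J where "J s = lift \<kappa> (gf s a) * Dl \<beta> (gf s a) (H ** Ef s (rh s a))" for s
    define y where "y s = lift \<kappa> (gf s a) * D s - oint J s" for s
    define m where "m s = Dl \<beta> (gf s a) (gf s a ** E 1 3)" for s
    define n where "n s = Dl \<beta> (gf s a) (H ** Ef s (rh s a))" for s
    have main: "\<bar>lift \<beta> (gf s b) - lift \<beta> (gf s a) - m s * D s - n s\<bar> \<le> e3 * norm H" if s: "\<bar>s\<bar> \<le> T" for s
    proof -
      have E: "Ef s (rh s b) = Ef s (rh s a) + D s *\<^sub>R (Ef s (rh s a) ** E 1 3)"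
      proof -
        have "Ef s (rh s b) = Ef s (rh s a) ** u3 0 0 (D s)" by (simp add: Ef_u3 D_def)
        also have "u3 0 0 (D s) = mat 1 + D s *\<^sub>R E 1 3" by (simp add: u3_eq)
        finally show ?thesis by (simp add: matrix_add_ldistrib matrix_scaleR_right)
      qed
      have g: "gf s b - gf s a = H ** Ef s (rh s a) + D s *\<^sub>R (gf s a ** E 1 3) + D s *\<^sub>R (H ** Ef s (rh s a) ** E 1 3)"
        unfolding gf_def E
        by (simp add: matrix_add_ldistrib bA matrix_scaleR_right matrix_mul_assoc scaleR_add_right
            bounded_bilinear.add_left[OF bounded_bilinear_matrix_mult])
      have n1: "norm (H ** Ef s (rh s a)) \<le> K * CE * norm H"
      proof -
        have "norm (H ** Ef s (rh s a)) \<le> K * norm H * norm (Ef s (rh s a))" by (rule K(2))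
        also have "\<dots> \<le> K * norm H * CE" using K CE(2)[OF s] by (intro mult_left_mono) auto
        finally show ?thesis by (simp add: mult_ac)
      qed
      have n2: "norm (gf s a ** E 1 3) \<le> K * Cg"
      proof -
        have "norm (gf s a ** E 1 3) \<le> K * norm (gf s a) * norm (E 1 3)" by (rule K(2))
        also have "\<dots> \<le> K * Cg" using K Cg(2)[OF s] by (simp add: norm_E mult_left_mono)
        finally show ?thesis .
      qed
      have n3: "norm (H ** Ef s (rh s a) ** E 1 3) \<le> K * K * CE * norm H"
      proof -
        have "norm (H ** Ef s (rh s a) ** E 1 3) \<le> K * norm (H ** Ef s (rh s a)) * norm (E 1 3)" by (rule K(2))
        also have "\<dots> \<le> K * (K * CE * norm H)" using K n1 by (simp add: norm_E mult_left_mono)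
        finally show ?thesis by (simp add: mult_ac)
      qed
      have ng: "norm (gf s b - gf s a) \<le> Q * norm H"
      proof -
        have "norm (gf s b - gf s a) \<le> norm (H ** Ef s (rh s a)) + norm (D s *\<^sub>R (gf s a ** E 1 3)) + norm (D s *\<^sub>R (H ** Ef s (rh s a) ** E 1 3))"
          unfolding g by (meson add_right_mono norm_triangle_ineq order_trans)
        moreover have "norm (D s *\<^sub>R (gf s a ** E 1 3)) \<le> C * norm H * (K * Cg)"
          unfolding norm_scaleR using Db[OF s] n2 C by (intro mult_mono) auto
        moreover have "norm (D s *\<^sub>R (H ** Ef s (rh s a) ** E 1 3)) \<le> C * norm H * (K * K * CE * 1)"
        proof -
          have "K * K * CE * norm H \<le> K * K * CE * 1" using Hd K CE by (intro mult_left_mono) auto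
          then have "norm (H ** Ef s (rh s a) ** E 1 3) \<le> K * K * CE * 1" using n3 by linarith
          then show ?thesis unfolding norm_scaleR using Db[OF s] C by (intro mult_mono) auto
        qed
        ultimately show ?thesis using n1 by (simp add: Q_def algebra_simps)
      qed
      have nd: "norm (gf s b - gf s a) < d" using ng Hd(3) Q by (simp add: field_simps)
      have 1: "\<bar>lift \<beta> (gf s b) - lift \<beta> (gf s a) - Dl \<beta> (gf s a) (gf s b - gf s a)\<bar> \<le> e3 / 2 * norm H"
      proof -
        have "\<bar>lift \<beta> (gf s b) - lift \<beta> (gf s a) - Dl \<beta> (gf s a) (gf s b - gf s a)\<bar> \<le> e3 / (2 * Q) * norm (gf s b - gf s a)"
          by (rule d(2)[OF inG[OF s] nd])
        also have "\<dots> \<le> e3 / (2 * Q) * (Q * norm H)" using ng e3 Q by (intro mult_left_mono) auto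
        finally show ?thesis using Q by simp
      qed
      have 2: "Dl \<beta> (gf s a) (gf s b - gf s a) = n s + D s * m s + D s * Dl \<beta> (gf s a) (H ** Ef s (rh s a) ** E 1 3)"
        unfolding g n_def m_def by (simp add: blinfun.add_right blinfun.scaleR_right)
      have 3: "\<bar>D s * Dl \<beta> (gf s a) (H ** Ef s (rh s a) ** E 1 3)\<bar> \<le> e3 / 2 * norm H"
      proof -
        have "\<bar>Dl \<beta> (gf s a) (H ** Ef s (rh s a) ** E 1 3)\<bar> \<le> norm (Dl \<beta> (gf s a)) * norm (H ** Ef s (rh s a) ** E 1 3)"
          using norm_blinfun[of "Dl \<beta> (gf s a)" "H ** Ef s (rh s a) ** E 1 3"] by simp
        also have "\<dots> \<le> CD * (K * K * CE * norm H)" using CD(2)[OF s] n3 CD(1) by (intro mult_mono) auto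
        finally have "\<bar>D s * Dl \<beta> (gf s a) (H ** Ef s (rh s a) ** E 1 3)\<bar> \<le> (C * norm H) * (CD * (K * K * CE * norm H))"
          unfolding abs_mult using Db[OF s] C by (intro mult_mono) auto
        also have "\<dots> = (Q2 * norm H) * norm H" by (simp add: Q2_def)
        also have "\<dots> \<le> (e3 / 2) * norm H"
          using Hd(4) Q2 by (intro mult_right_mono) (auto simp: field_simps)
        finally show ?thesis .
      qed
      have "m s * D s = D s * m s" by simp
      then show ?thesis using 1 2 3 by linarith
    qed
    have Jc: "continuous_on UNIV J" unfolding J_def by (rule \<delta>_integrand_continuous1[OF a])
    \<comment> \<open>The derivative of \<kappa> along the orbit contributes minus
      \<open>m s * D s\<close>, which cancels the feedback of the displacement on itself.\<close>
    have yd: "(y has_real_derivative lift \<kappa> (gf s a) * (lift \<beta> (gf s b) - lift \<beta> (gf s a) - m s * D s - n s)) (at s)" for s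
      unfolding y_def D_def
      by (rule derivative_eq_intros lift_\<kappa>_deriv[OF a] rh_deriv[OF a] rh_deriv[OF bG] oint_deriv[OF Jc] refl)+
         (simp add: J_def m_def n_def algebra_simps)
    have "\<bar>y t - y 0\<bar> \<le> (Bk * (e3 * norm H)) * \<bar>t\<bar>"
    proof (rule MVT_abs[OF yd])
      fix s assume s: "\<bar>s\<bar> \<le> \<bar>t\<bar>"
      have "\<bar>lift \<kappa> (gf s a)\<bar> \<le> Bk" using Bk(2) by (simp add: lift_gf a h_M pr_M nrm_SL)
      then show "\<bar>lift \<kappa> (gf s a) * (lift \<beta> (gf s b) - lift \<beta> (gf s a) - m s * D s - n s)\<bar> \<le> Bk * (e3 * norm H)"
        unfolding abs_mult using main[of s] s Bk(1) by (intro mult_mono) (auto simp: T_def)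
    qed
    then have "\<bar>y t\<bar> \<le> Bk * e3 * T * norm H" by (simp add: y_def D_def T_def mult_ac)
    also have "\<dots> \<le> (e * l0) * norm H"
    proof (intro mult_right_mono)
      have "Bk * e3 * T \<le> Bk * e3 * (T + 1)" using Bk e3 by (intro mult_left_mono) auto
      also have "\<dots> = e * l0"
      proof -
        have "Bk * (T + 1) \<noteq> 0" using Bk T0 by simp
        then show ?thesis unfolding e3_def by (metis mult.commute mult.left_commute nonzero_eq_divide_eq)
      qed
      finally show "Bk * e3 * T \<le> e * l0" .
    qed simp
    finally have yb: "\<bar>y t\<bar> \<le> e * l0 * norm H" .
    have "rh t b - rh t a - \<delta> t a (b - a) = y t / l0"
      using l0 by (simp add: y_def D_def \<delta>_def J_def[abs_def] H_def l0_def diff_divide_distrib)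
    moreover have "\<bar>y t / l0\<bar> \<le> e * norm H" using yb l0 by (simp add: abs_divide pos_divide_le_eq mult_ac)
    ultimately show "norm (rh t b - rh t a - \<delta> t a (b - a)) \<le> e * norm (b - a)"
      by (simp only: real_norm_def H_def)
  qed
qed

lemma C1_rh: "C1_on GP (rh t)"
  by (rule C1_onI[where D = "\<delta> t"]) (auto intro: open_GP rh_has_derivative \<delta>_continuous)

lemma C1_gf: "C1_on GP (gf t)"
  unfolding gf_def Ef_def u3_eq
  by (intro C1_on_bilinear[OF bounded_bilinear_matrix_mult] C1_on_linear C1_on_add C1_on_scaleR C1_on_const C1_rh
      open_GP bounded_linear_ident)

lemma h_gf: "g \<in> SL \<Longrightarrow> h t (pr g) = pr (gf t g)"
  by (simp add: gf_def pr_act[symmetric] Ef_SL rh_def nrm_id h_eq pr_M)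

lemma gf_SL: "g \<in> SL \<Longrightarrow> gf t g \<in> SL" by (simp add: gf_def SL_mult Ef_SL)

lemma C1_map_h: "C1_map \<Gamma> (h t)"
  unfolding C1_map_def
proof
  fix g assume g: "g \<in> SL"
  show "\<exists>V F. g \<in> V \<and> C1_on V F \<and> (\<forall>a\<in>V \<inter> SL. F a \<in> SL \<and> h t (pr a) = pr (F a))"
    using g C1_gf SL_GP h_gf gf_SL by (intro exI[of _ GP] exI[of _ "gf t"]) auto
qed

lemma C1_flow_h: "C1_flow \<Gamma> h"
  unfolding C1_flow_def
proof (intro conjI allI ballI exI[of _ "\<lambda>x. N3 p q w + \<beta> x *\<^sub>R E 1 3"])
  show "h t \<in> M \<rightarrow> M" for t using h_M by blast
  show "C1_map \<Gamma> (h t)" for t by (rule C1_map_h)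
  show "h (s + t) x = h s (h t x)" if "x \<in> M" for x s t by (rule h_add[OF that])
  show "flow_of \<Gamma> (\<lambda>x. N3 p q w + \<beta> x *\<^sub>R E 1 3) h" by (rule flow)
  have "N3 p q w + \<beta> x *\<^sub>R E 1 3 = N3 p q (w + \<beta> x)" for x by (simp add: N3_def algebra_simps)
  then show "(\<lambda>x. N3 p q w + \<beta> x *\<^sub>R E 1 3) \<in> M \<rightarrow> sl3" by (simp add: N3_sl3)
  show "C1_fun \<Gamma> (\<lambda>x. N3 p q w + \<beta> x *\<^sub>R E 1 3)"
    unfolding C1_fun_def
  proof
    fix g assume g: "g \<in> SL"
    then obtain V F where V: "g \<in> V" "C1_on V F" "\<forall>a\<in>V \<inter> SL. \<beta> (pr a) = F a"
      using C1_\<beta> unfolding C1_fun_def by blast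
    have "open V" using V by (simp add: C1_on_def)
    then have "C1_on V (\<lambda>a. N3 p q w + F a *\<^sub>R E 1 3)"
      by (intro C1_on_add C1_on_scaleR C1_on_const V)
    then show "\<exists>V F. g \<in> V \<and> C1_on V F \<and> (\<forall>a\<in>V \<inter> SL. N3 p q w + \<beta> (pr a) *\<^sub>R E 1 3 = F a)"
      using V by (intro exI[of _ V] exI[of _ "\<lambda>a. N3 p q w + F a *\<^sub>R E 1 3"]) auto
  qed
qed

text \<open>Right translation by a fixed element conjugates vectors of the left-invariant frame, and
  \<delta> adds the variation of the displacement with the point. The latter stays along Z because
  \<open>Ef\<close> leaves \<open>E 1 3\<close> fixed under left multiplication.\<close>

lemma differential_h:
  assumes g: "g \<in> SL" and X: "X \<in> sl3"
  shows "differential \<Gamma> (h t) (pr g) X =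
    minv (Ef t (\<rho> t (pr g))) ** X ** Ef t (\<rho> t (pr g)) + \<delta> t g (g ** X) *\<^sub>R E 1 3"
proof -
  define n where "n = Ef t (\<rho> t (pr g))"
  have n: "n \<in> SL" "rh t g = \<rho> t (pr g)"
    using g by (auto simp: n_def Ef_SL rh_def nrm_id)
  have "n ** E 1 3 = E 1 3" by (simp add: n_def Ef_def u3_E13)
  then have n3: "g ** n ** E 1 3 = g ** E 1 3" by (simp only: matrix_mul_assoc[symmetric])
  define Y where "Y = minv n ** X ** n + \<delta> t g (g ** X) *\<^sub>R E 1 3"
  have gG: "g \<in> GP" using SL_GP g by blast
  have dE: "((\<lambda>a. Ef t (rh t a)) has_derivative (\<lambda>H. \<delta> t g H *\<^sub>R E 1 3)) (at g)"
    unfolding Ef_def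
    by (rule derivative_eq_intros rh_has_derivative[OF gG] refl)+ simp
  have dg: "(gf t has_derivative (\<lambda>H. g ** (\<delta> t g H *\<^sub>R E 1 3) + H ** n)) (at g)"
    unfolding gf_def using has_derivative_mmult[OF has_derivative_ident dE] by (simp add: n n_def)
  have dc: "((\<lambda>s. g ** mexp (s *\<^sub>R X)) has_derivative (\<lambda>r. r *\<^sub>R (g ** X))) (at 0)"
    using bounded_linear.has_vector_derivative[OF bounded_linear_mmult_right has_vector_derivative_mexp, of g X 0]
    by (simp add: has_vector_derivative_def mexp_zero)
  have "((\<lambda>s. gf t (g ** mexp (s *\<^sub>R X))) has_derivative
     (\<lambda>r. g ** (\<delta> t g (r *\<^sub>R (g ** X)) *\<^sub>R E 1 3) + (r *\<^sub>R (g ** X)) ** n)) (at 0)"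
    by (rule has_derivative_compose[OF dc]) (use dg in \<open>simp add: mexp_zero\<close>)
  moreover have "g ** (\<delta> t g (r *\<^sub>R (g ** X)) *\<^sub>R E 1 3) + (r *\<^sub>R (g ** X)) ** n = r *\<^sub>R (gf t g ** Y)" for r
  proof -
    have "\<delta> t g (r *\<^sub>R (g ** X)) = r * \<delta> t g (g ** X)"
      using linear_cmul[OF bounded_linear.linear[OF \<delta>_bounded_linear[OF gG]]] by simp
    moreover have "gf t g ** Y = g ** n ** (minv n ** (X ** n)) + \<delta> t g (g ** X) *\<^sub>R (g ** E 1 3)"
      by (simp add: gf_def n n_def[symmetric] Y_def matrix_add_ldistrib matrix_scaleR_right matrix_mul_assoc n3)
    moreover have "g ** n ** (minv n ** (X ** n)) = g ** X ** n"
      using n minv_cancel(1)[of n "X ** n"] by (simp only: matrix_mul_assoc[symmetric])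
    ultimately show ?thesis by (simp add: n matrix_scaleR_right matrix_scaleR_left scaleR_add_right add.commute)
  qed
  ultimately have "((\<lambda>s. gf t (g ** mexp (s *\<^sub>R X))) has_vector_derivative gf t (g ** mexp (0 *\<^sub>R X)) ** Y) (at 0)"
    by (simp add: has_vector_derivative_def mexp_zero)
  moreover have "\<forall>s. gf t (g ** mexp (s *\<^sub>R X)) \<in> SL \<and> h t (lflow X s (pr g)) = pr (gf t (g ** mexp (s *\<^sub>R X)))"
    using g mexp_SL[OF X] by (simp add: lflow_def gf_SL SL_mult pr_act h_gf)
  ultimately have "has_velocity \<Gamma> (\<lambda>s. h t (lflow X s (pr g))) Y 0"
    unfolding has_velocity_def by (intro exI[of _ "\<lambda>s. gf t (g ** mexp (s *\<^sub>R X))"]) auto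
  then show ?thesis unfolding differential_def
    using velocity_unique by (intro the_equality) (auto simp: Y_def n_def)
qed

end

section \<open>Polynomial growth of the differential\<close>

lemma norm_matrix_le: "norm (A :: real^3^3) \<le> (\<Sum>i\<in>UNIV. \<Sum>j\<in>UNIV. \<bar>A $ i $ j\<bar>)"
proof -
  have "norm A \<le> (\<Sum>i\<in>UNIV. norm (A $ i))" unfolding norm_vec_def[of A] by (rule L2_set_le_sum) simp
  also have "\<dots> \<le> (\<Sum>i\<in>UNIV. \<Sum>j\<in>UNIV. \<bar>A $ i $ j\<bar>)" by (intro sum_mono norm_le_l1_cart)
  finally show ?thesis .
qed

text \<open>Conjugation of \<open>X\<close> by \<open>u3 P Q S\<close> when
  \<open>R = P * Q - S\<close>, which makes the left factor the inverse. Keeping \<open>R\<close> as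
  an argument of its own lets it be bounded and differentiated like \<open>S\<close>.\<close>

definition conj3 :: "real^3^3 \<Rightarrow> real \<Rightarrow> real \<Rightarrow> real \<Rightarrow> real \<Rightarrow> real^3^3" where
  "conj3 X P Q R S = u3 (- P) (- Q) R ** X ** u3 P Q S"

lemma conj3_13: "conj3 X P Q R S $ 1 $ 3 =
  (X$1$1 - P * X$2$1 + R * X$3$1) * S + (X$1$2 - P * X$2$2 + R * X$3$2) * Q + (X$1$3 - P * X$2$3 + R * X$3$3)"
  by (simp add: conj3_def u3_def matrix_matrix_mult_def sum_3 algebra_simps)

lemma abs_mult_le: "\<bar>a\<bar> \<le> A \<Longrightarrow> \<bar>b\<bar> \<le> B \<Longrightarrow> \<bar>a * b :: real\<bar> \<le> A * B"
  unfolding abs_mult by (rule mult_mono) auto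

text \<open>Rows of the left factor have sizes v, u, 1 and columns of the right factor 1, u, v, with
  u linear and v quadratic in \<tau>. Only position (1,3) meets v twice, which would be quartic. The
  factor 9 counts the terms of the double sum.\<close>

lemma conj3_bound:
  assumes c: "c \<ge> 1" and tau: "\<tau> \<ge> 1"
    and b: "\<bar>P\<bar> \<le> c * \<tau>" "\<bar>Q\<bar> \<le> c * \<tau>" "\<bar>S\<bar> \<le> c * \<tau>\<^sup>2" "\<bar>R\<bar> \<le> c * \<tau>\<^sup>2"
    and X: "\<And>i j. \<bar>X $ i $ j\<bar> \<le> 1" and ij: "(i, j) \<noteq> (1, 3)"
  shows "\<bar>conj3 X P Q R S $ i $ j\<bar> \<le> 9 * (c\<^sup>2 * \<tau> ^ 3)"
proof -
  define u where "u = c * \<tau>"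
  define v where "v = c * \<tau>\<^sup>2"
  define r where "r k = (if k = 1 then v else if k = 2 then u else 1)" for k :: 3
  define s where "s k = (if k = 1 then 1 else if k = 2 then u else v)" for k :: 3
  have t1: "1 \<le> c * \<tau>" using mult_mono[OF c tau] c tau by simp
  have t2: "\<tau> \<le> \<tau>\<^sup>2" "1 \<le> \<tau>\<^sup>2" using tau by (simp_all add: self_le_power)
  have t3: "c * \<tau> \<le> c * \<tau>\<^sup>2" "1 \<le> c * \<tau>\<^sup>2" using t2 c t1 by (auto intro: order_trans[OF t1] mult_left_mono)
  have N: "\<bar>u3 (- P) (- Q) R $ k $ l\<bar> \<le> r k" for k l
    using exhaust_3[of k] exhaust_3[of l] b t1 t3 by (auto simp: u3_def r_def u_def v_def)
  have N': "\<bar>u3 P Q S $ k $ l\<bar> \<le> s l" for k l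
    using exhaust_3[of k] exhaust_3[of l] b t1 t3 by (auto simp: u3_def s_def u_def v_def)
  have "conj3 X P Q R S $ i $ j = (\<Sum>l\<in>UNIV. (\<Sum>k\<in>UNIV. u3 (- P) (- Q) R $ i $ k * X $ k $ l) * u3 P Q S $ l $ j)"
    by (simp add: conj3_def matrix_matrix_mult_def)
  also have "\<bar>\<dots>\<bar> \<le> (\<Sum>l\<in>(UNIV::3 set). (\<Sum>k\<in>(UNIV::3 set). r i * 1) * s j)"
  proof (rule order_trans[OF sum_abs] sum_mono abs_mult_le N' N X)+
  qed
  also have "\<dots> = 9 * (r i * s j)" by (simp add: sum_3)
  also have "\<dots> \<le> 9 * (c\<^sup>2 * \<tau> ^ 3)"
  proof -
    define d where "d = c\<^sup>2 * \<tau> ^ 3"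
    have d: "d = u * v" by (simp add: d_def u_def v_def power2_eq_square power3_eq_cube)
    have uv: "1 \<le> u" "u \<le> v" using t1 t3 by (auto simp: u_def v_def)
    have f: "u * u \<le> d" "1 * v \<le> d" "u * v \<le> d" "v * u \<le> d"
      unfolding d using uv by (auto intro!: mult_left_mono mult_right_mono)
    have f': "v \<le> d" "u \<le> d" "1 \<le> d" using f uv by linarith+
    have "r i * s j \<le> d"
      using exhaust_3[of i] exhaust_3[of j] ij by (elim disjE) (use f f' in \<open>simp_all add: r_def s_def\<close>)
    then show ?thesis by (simp add: d_def)
  qed
  finally show ?thesis .
qed

context perturbed_measure begin

text \<open>All entries except (1,3) are cubic. The entry (1,3) and \<delta> are estimated together:
  multiplied by \<kappa> their sum is \<open>v\<close>, whose derivative has only cubic terms, so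
  one integration gives degree 4.\<close>

lemma differential_bound:
  obtains C where "C > 0" "\<And>t x X. x \<in> M \<Longrightarrow> X \<in> sl3 \<Longrightarrow> norm X \<le> 1 \<Longrightarrow>
    norm (differential \<Gamma> (h t) x X) \<le> C * (1 + \<bar>t\<bar>) ^ 4"
proof -
  obtain Bb where Bb: "Bb > 0" "\<And>x. x \<in> M \<Longrightarrow> \<bar>\<beta> x\<bar> \<le> Bb" using cM_bounded C1_cM[OF C1_\<beta>] by blast
  obtain Bk where Bk: "Bk > 0" "\<And>x. x \<in> M \<Longrightarrow> \<bar>\<kappa> x\<bar> \<le> Bk" using cM_bounded C1_cM[OF C1_\<kappa>] by blast
  obtain l0 where l0: "l0 > 0" "\<And>x. x \<in> M \<Longrightarrow> l0 \<le> \<kappa> x" using cM_pos_lower[OF C1_cM[OF C1_\<kappa>] \<kappa>_pos] by blast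
  obtain B where B: "B > 0" "\<And>x Y. x \<in> M \<Longrightarrow> \<bar>dM \<beta> x Y\<bar> \<le> B * norm Y" using dM_bound[OF C1_\<beta>] by blast
  \<comment> \<open>Dominates the coordinates of the conjugating element: \<open>P\<close> and
    \<open>Q\<close> by \<open>c * \<tau>\<close>, \<open>S\<close> and \<open>R\<close> by
    \<open>c * \<tau>\<^sup>2\<close>, their derivatives \<open>S'\<close> and \<open>R'\<close> by
    \<open>c * \<tau>\<close>.\<close>
  define c where "c = 1 + \<bar>p\<bar> + \<bar>q\<bar> + \<bar>w\<bar> + 2 * \<bar>p * q\<bar> + Bb"
  have c: "c \<ge> 1" using Bb by (simp add: c_def)
  \<comment> \<open>In 13, the terms of \<open>A'\<close> account for 2 + 3 + 2 + 3 + 2 and the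
    initial value \<open>v 0\<close> for one more. 81 is nine entries of size 9; dividing by
    \<open>l0\<close> removes the weight \<kappa>.\<close>
  define C0 where "C0 = Bk * (13 + 81 * B) * c\<^sup>2 / l0"
  define C where "C = 81 * c\<^sup>2 + C0"
  have C0: "C0 > 0" using Bk B c l0 by (simp add: C0_def)
  have C: "C > 0" using C0 by (simp add: C_def add_nonneg_pos)
  show ?thesis
  proof (rule that[OF C])
    fix t x X assume x: "x \<in> M" and X: "X \<in> sl3" and X1: "norm X \<le> 1"
    obtain g where g: "g \<in> SL" "x = pr g" using x M_cases by blast
    have gG: "g \<in> GP" using g SL_GP by blast
    have nrmg: "nrm g = g" using g nrm_id by blast
    have Xe: "\<bar>X $ i $ j\<bar> \<le> 1" for i j
      using component_le_norm_cart[of "X $ i" j] Finite_Cartesian_Product.norm_nth_le[of X i] X1 by linarith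
    define P where "P s = s * p" for s
    define Q where "Q s = s * q" for s
    define S where "S s = s * w + s\<^sup>2 * p * q / 2 + \<rho> s x" for s
    define R where "R s = P s * Q s - S s" for s
    define A where "A s = conj3 X (P s) (Q s) (R s) (S s)" for s
    have Ef: "Ef s (\<rho> s x) = u3 (P s) (Q s) (S s)" for s by (simp add: Ef_def P_def Q_def S_def)
    have A: "minv (Ef s (\<rho> s x)) ** X ** Ef s (\<rho> s x) = A s" for s
      by (simp add: Ef minv_u3 A_def conj3_def R_def)
    define S' where "S' s = w + s * (p * q) + \<beta> (h s x)" for s
    define R' where "R' s = p * Q s + P s * q - S' s" for s
    have dP: "(P has_real_derivative p) (at s)" "(Q has_real_derivative q) (at s)" for s
      unfolding P_def Q_def by (auto intro!: derivative_eq_intros)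
    have dS: "(S has_real_derivative S' s) (at s)" for s
      unfolding S_def S'_def by (auto intro!: derivative_eq_intros \<rho>_deriv x)
    have dR: "(R has_real_derivative R' s) (at s)" for s
      unfolding R_def[abs_def] R'_def by (rule derivative_eq_intros dP dS refl)+ (simp add: mult.commute)
    define A' where "A' s = ((- p * X$2$1 + R' s * X$3$1) * S s + (X$1$1 - P s * X$2$1 + R s * X$3$1) * S' s)
      + ((- p * X$2$2 + R' s * X$3$2) * Q s + (X$1$2 - P s * X$2$2 + R s * X$3$2) * q)
      + (- p * X$2$3 + R' s * X$3$3)" for s
    have dA: "((\<lambda>s. A s $ 1 $ 3) has_real_derivative A' s) (at s)" for s
      unfolding A_def conj3_13 A'_def
      by (rule derivative_eq_intros dP dS dR refl)+ (simp add: algebra_simps)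
    have rb: "\<bar>\<rho> s x\<bar> \<le> Bb * \<bar>s\<bar>" for s
      using MVT_abs[OF \<rho>_deriv[OF x], of s Bb] Bb h_M[OF x] by simp
    define \<tau> where "\<tau> s = 1 + \<bar>s\<bar>" for s :: real
    have tau: "\<tau> s \<ge> 1" for s by (simp add: \<tau>_def)
    have ts: "\<bar>s\<bar> \<le> \<tau> s" "\<bar>s\<bar> \<le> (\<tau> s)\<^sup>2" "s\<^sup>2 \<le> (\<tau> s)\<^sup>2" "\<tau> s \<le> (\<tau> s)\<^sup>2" for s
    proof -
      show 1: "\<bar>s\<bar> \<le> \<tau> s" by (simp add: \<tau>_def)
      show 2: "\<tau> s \<le> (\<tau> s)\<^sup>2" using tau[of s] by (simp add: self_le_power)
      show "\<bar>s\<bar> \<le> (\<tau> s)\<^sup>2" using 1 2 by linarith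
      show "s\<^sup>2 \<le> (\<tau> s)\<^sup>2" using power_mono[OF 1, of 2] by simp
    qed
    have cc: "\<bar>p\<bar> \<le> c" "\<bar>q\<bar> \<le> c" using Bb by (auto simp: c_def)
    have bP: "\<bar>P s\<bar> \<le> c * \<tau> s" "\<bar>Q s\<bar> \<le> c * \<tau> s" for s
      using abs_mult_le[OF ts(1) cc(1), of s] abs_mult_le[OF ts(1) cc(2), of s] by (simp_all add: P_def Q_def mult.commute)
    have three: "\<bar>s * w\<bar> \<le> (\<tau> s)\<^sup>2 * \<bar>w\<bar>" "\<bar>s\<^sup>2 * (p * q)\<bar> \<le> (\<tau> s)\<^sup>2 * \<bar>p * q\<bar>" "\<bar>\<rho> s x\<bar> \<le> (\<tau> s)\<^sup>2 * Bb" for s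
    proof -
      show "\<bar>s * w\<bar> \<le> (\<tau> s)\<^sup>2 * \<bar>w\<bar>" by (rule abs_mult_le[OF ts(2)]) simp
      show "\<bar>s\<^sup>2 * (p * q)\<bar> \<le> (\<tau> s)\<^sup>2 * \<bar>p * q\<bar>" by (rule abs_mult_le) (use ts(3) in auto)
      have "Bb * \<bar>s\<bar> \<le> Bb * (\<tau> s)\<^sup>2" using ts(2) Bb by (intro mult_left_mono) auto
      then show "\<bar>\<rho> s x\<bar> \<le> (\<tau> s)\<^sup>2 * Bb" using rb[of s] by (simp add: mult.commute)
    qed
    have ctau: "c * (\<tau> s)\<^sup>2 = (\<tau> s)\<^sup>2 + (\<tau> s)\<^sup>2 * \<bar>p\<bar> + (\<tau> s)\<^sup>2 * \<bar>q\<bar> + (\<tau> s)\<^sup>2 * \<bar>w\<bar> + 2 * ((\<tau> s)\<^sup>2 * \<bar>p * q\<bar>) + (\<tau> s)\<^sup>2 * Bb" for s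
      by (simp add: c_def algebra_simps)
    have nn: "0 \<le> (\<tau> s)\<^sup>2 * \<bar>p\<bar>" "0 \<le> (\<tau> s)\<^sup>2 * \<bar>q\<bar>" "0 \<le> (\<tau> s)\<^sup>2" "0 \<le> (\<tau> s)\<^sup>2 * \<bar>p * q\<bar>" for s by auto
    have Se: "S s = s * w + s\<^sup>2 * (p * q) / 2 + \<rho> s x" "R s = s\<^sup>2 * (p * q) / 2 - s * w - \<rho> s x" for s
      by (simp_all add: S_def R_def P_def Q_def power2_eq_square algebra_simps)
    have bS: "\<bar>S s\<bar> \<le> c * (\<tau> s)\<^sup>2" "\<bar>R s\<bar> \<le> c * (\<tau> s)\<^sup>2" for s
      unfolding Se using three[of s] ctau[of s] nn[of s] by linarith+
    have ctau1: "c * \<tau> s = \<tau> s + \<tau> s * \<bar>p\<bar> + \<tau> s * \<bar>q\<bar> + \<tau> s * \<bar>w\<bar> + 2 * (\<tau> s * \<bar>p * q\<bar>) + \<tau> s * Bb" for s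
      by (simp add: c_def algebra_simps)
    have nn1: "0 \<le> \<tau> s * \<bar>p\<bar>" "0 \<le> \<tau> s * \<bar>q\<bar>" "0 \<le> \<tau> s" "0 \<le> \<tau> s * \<bar>p * q\<bar>" "\<bar>w\<bar> \<le> \<tau> s * \<bar>w\<bar>" "Bb \<le> \<tau> s * Bb" for s
      using tau[of s] Bb mult_right_mono[OF tau[of s], of "\<bar>w\<bar>"] mult_right_mono[OF tau[of s], of Bb] by auto
    have pq: "\<bar>s * (p * q)\<bar> \<le> \<tau> s * \<bar>p * q\<bar>" for s by (rule abs_mult_le[OF ts(1)]) simp
    have bb: "\<bar>\<beta> (h s x)\<bar> \<le> Bb" for s using Bb h_M[OF x] by blast
    have R'e: "R' s = s * (p * q) - w - \<beta> (h s x)" for s by (simp add: R'_def P_def Q_def S'_def)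
    have bS': "\<bar>S' s\<bar> \<le> c * \<tau> s" "\<bar>R' s\<bar> \<le> c * \<tau> s" for s
      unfolding S'_def R'e using pq[of s] bb[of s] ctau1[of s] nn1[of s] by linarith+
    have cle: "\<bar>p\<bar> \<le> c * \<tau> s" "\<bar>q\<bar> \<le> c" "1 \<le> c * (\<tau> s)\<^sup>2" "c * \<tau> s \<le> c * (\<tau> s)\<^sup>2" for s
    proof -
      show "\<bar>q\<bar> \<le> c" by (rule cc)
      have "c * 1 \<le> c * \<tau> s" using tau c by (intro mult_left_mono) auto
      then show "\<bar>p\<bar> \<le> c * \<tau> s" using cc by simp
      show 3: "c * \<tau> s \<le> c * (\<tau> s)\<^sup>2" using ts(4) c by (intro mult_left_mono) auto
      show "1 \<le> c * (\<tau> s)\<^sup>2" using 3 \<open>c * 1 \<le> c * \<tau> s\<close> c by linarith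
    qed
    have b1: "\<bar>- p * X $ 2 $ j + R' s * X $ 3 $ j\<bar> \<le> 2 * (c * \<tau> s)" for s j
      using abs_mult_le[of "- p" "c * \<tau> s" "X $ 2 $ j" 1] abs_mult_le[OF bS'(2)[of s] Xe[of 3 j]] cle(1)[of s] Xe[of 2 j]
      by simp
    have b2: "\<bar>X $ 1 $ j - P s * X $ 2 $ j + R s * X $ 3 $ j\<bar> \<le> 3 * (c * (\<tau> s)\<^sup>2)" for s j
      using abs_mult_le[OF bP(1)[of s] Xe[of 2 j]] abs_mult_le[OF bS(2)[of s] Xe[of 3 j]] Xe[of 1 j] cle(3)[of s] cle(4)[of s]
      by (simp, linarith?)
    define d where "d s = c\<^sup>2 * (\<tau> s) ^ 3" for s
    have d: "(c * \<tau> s) * (c * (\<tau> s)\<^sup>2) = d s" for s by (simp add: d_def power2_eq_square power3_eq_cube)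
    have dle: "(c * \<tau> s) * (c * \<tau> s) \<le> d s" "c * (\<tau> s)\<^sup>2 * c \<le> d s" "c * \<tau> s \<le> d s" "1 \<le> d s" for s
    proof -
      have ct: "1 \<le> c * \<tau> s" using mult_mono[OF c tau[of s]] c tau[of s] by simp
      show 1: "(c * \<tau> s) * (c * \<tau> s) \<le> d s" unfolding d[symmetric]
        by (rule mult_left_mono[OF cle(4)]) (use ct in simp)
      have "c * (\<tau> s)\<^sup>2 * c \<le> (c * (\<tau> s)\<^sup>2) * (c * \<tau> s)" using cle(3)[of s] c tau[of s] by (intro mult_left_mono) auto
      then show "c * (\<tau> s)\<^sup>2 * c \<le> d s" unfolding d[symmetric] by (simp only: mult.commute)
      have "c * \<tau> s * 1 \<le> (c * \<tau> s) * (c * \<tau> s)" using ct by (intro mult_left_mono) auto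
      then show "c * \<tau> s \<le> d s" using 1 by linarith
      then show "1 \<le> d s" using ct by linarith
    qed
    have bA': "\<bar>A' s\<bar> \<le> 12 * d s" for s
    proof -
      have "\<bar>(- p * X$2$1 + R' s * X$3$1) * S s\<bar> \<le> 2 * d s"
        using abs_mult_le[OF b1[of 1 s] bS(1)[of s]] d[of s] by simp
      moreover have "\<bar>(X$1$1 - P s * X$2$1 + R s * X$3$1) * S' s\<bar> \<le> 3 * d s"
        using abs_mult_le[OF b2[of 1 s] bS'(1)[of s]] d[of s] by (simp add: mult_ac)
      moreover have "\<bar>(- p * X$2$2 + R' s * X$3$2) * Q s\<bar> \<le> 2 * d s"
        using abs_mult_le[OF b1[of 2 s] bP(2)[of s]] dle(1)[of s] by simp
      moreover have "\<bar>(X$1$2 - P s * X$2$2 + R s * X$3$2) * q\<bar> \<le> 3 * d s"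
        using abs_mult_le[OF b2[of 2 s] cle(2)] dle(2)[of s] by simp
      moreover have "\<bar>- p * X$2$3 + R' s * X$3$3\<bar> \<le> 2 * d s"
        using b1[of 3 s] dle(3)[of s] by linarith
      ultimately show ?thesis unfolding A'_def by linarith
    qed
    define A0 where "A0 s = A s - (A s $ 1 $ 3) *\<^sub>R E 1 3" for s
    have A0e: "\<bar>A0 s $ i $ j\<bar> \<le> 9 * d s" for s i j
    proof (cases "(i, j) = (1, 3)")
      case True
      then show ?thesis using dle(4)[of s] by (simp add: A0_def E_def)
    next
      case False
      then have "A0 s $ i $ j = A s $ i $ j" by (auto simp: A0_def E_def)
      then show ?thesis
        unfolding A_def d_def using conj3_bound[OF c tau bP bS Xe False] by simp
    qed
    have A0n: "norm (A0 s) \<le> 81 * d s" for s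
    proof -
      have "norm (A0 s) \<le> (\<Sum>i\<in>(UNIV::3 set). \<Sum>j\<in>(UNIV::3 set). 9 * d s)"
        by (rule order_trans[OF norm_matrix_le]) (intro sum_mono A0e)
      then show ?thesis by (simp add: sum_3)
    qed
    define J where "J s = lift \<kappa> (gf s g) * Dl \<beta> (gf s g) (g ** X ** Ef s (rh s g))" for s
    have Je: "J s = \<kappa> (h s x) * (dM \<beta> (h s x) (A0 s) + (A s $ 1 $ 3) * dM \<beta> (h s x) (E 1 3))" for s
    proof -
      have rg: "rh s g = \<rho> s x" using g nrmg by (simp add: rh_def)
      have "g ** X ** Ef s (rh s g) = gf s g ** A s"
      proof -
        have "gf s g ** A s = g ** (Ef s (\<rho> s x) ** (minv (Ef s (\<rho> s x)) ** (X ** Ef s (\<rho> s x))))"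
          by (simp only: gf_def rg A[symmetric] matrix_mul_assoc)
        also have "\<dots> = g ** (X ** Ef s (\<rho> s x))" by (simp only: minv_cancel(1)[OF Ef_SL])
        also have "\<dots> = g ** X ** Ef s (rh s g)" by (simp only: rg matrix_mul_assoc)
        finally show ?thesis by simp
      qed
      then have "J s = \<kappa> (h s x) * dM \<beta> (h s x) (A s)"
        using g nrmg by (simp add: J_def lift_gf gG Dl_nrm[OF C1_\<beta> gf_GP[OF gG]] pr_gf)
      moreover have "A s = A0 s + (A s $ 1 $ 3) *\<^sub>R E 1 3" by (simp add: A0_def)
      ultimately show ?thesis using dM_add[OF C1_\<beta> h_M[OF x]] dM_scaleR[OF C1_\<beta> h_M[OF x]] by metis
    qed
    have Jc: "continuous_on UNIV J" unfolding J_def by (rule \<delta>_integrand_continuous1[OF gG])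
    \<comment> \<open>The summand of \<open>J\<close> containing \<open>A s $ 1 $ 3\<close> cancels
      against the derivative of \<kappa> in the first term.\<close>
    define v where "v s = \<kappa> (h s x) * A s $ 1 $ 3 + oint J s" for s
    have dv: "(v has_real_derivative \<kappa> (h s x) * (A' s + dM \<beta> (h s x) (A0 s))) (at s)" for s
      unfolding v_def
      by (rule derivative_eq_intros \<kappa>_flow[OF x] dA oint_deriv[OF Jc] refl)+ (simp add: Je N3_E13 algebra_simps)
    have "\<bar>v t - v 0\<bar> \<le> (Bk * ((12 + 81 * B) * d t)) * \<bar>t\<bar>"
    proof (rule MVT_abs[OF dv])
      fix s assume s: "\<bar>s\<bar> \<le> \<bar>t\<bar>"
      have ds: "d s \<le> d t" unfolding d_def using s tau[of s] c
        by (intro mult_left_mono power_mono) (auto simp: \<tau>_def)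
      have "\<bar>dM \<beta> (h s x) (A0 s)\<bar> \<le> B * (81 * d s)"
        using B(2)[OF h_M[OF x, of s], of "A0 s"] A0n[of s] B(1) by (meson mult_left_mono order_trans less_imp_le)
      then have "\<bar>A' s + dM \<beta> (h s x) (A0 s)\<bar> \<le> (12 + 81 * B) * d s"
        using bA'[of s] by (simp add: algebra_simps)
      also have "\<dots> \<le> (12 + 81 * B) * d t" using ds B by (intro mult_left_mono) auto
      finally show "\<bar>\<kappa> (h s x) * (A' s + dM \<beta> (h s x) (A0 s))\<bar> \<le> Bk * ((12 + 81 * B) * d t)"
        by (intro abs_mult_le Bk h_M x)
    qed
    moreover have "\<bar>v 0\<bar> \<le> Bk"
    proof -
      have "v 0 = \<kappa> x * X $ 1 $ 3"
        using x by (simp add: v_def h_0 A_def conj3_13 P_def Q_def R_def S_def)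
      then show ?thesis using abs_mult_le[OF Bk(2)[OF x] Xe[of 1 3]] by simp
    qed
    ultimately have vb: "\<bar>v t\<bar> \<le> Bk + Bk * (12 + 81 * B) * d t * \<bar>t\<bar>" by (simp add: mult_ac)
    also have "\<dots> \<le> Bk * (13 + 81 * B) * (d t * \<tau> t)"
    proof -
      have 1: "1 \<le> d t * \<tau> t" using mult_mono[OF dle(4)[of t] tau[of t]] dle(4)[of t] by simp
      have 2: "d t * \<bar>t\<bar> \<le> d t * \<tau> t" using ts(1)[of t] dle(4)[of t] by (intro mult_left_mono) auto
      have "Bk * 1 + Bk * (12 + 81 * B) * (d t * \<bar>t\<bar>) \<le> Bk * (d t * \<tau> t) + Bk * (12 + 81 * B) * (d t * \<tau> t)"
        by (rule add_mono[OF mult_left_mono[OF 1] mult_left_mono[OF 2]]) (use Bk B in auto)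
      then show ?thesis by (simp add: algebra_simps)
    qed
    finally have vb: "\<bar>v t\<bar> \<le> Bk * (13 + 81 * B) * (d t * \<tau> t)" .
    define z where "z = A t $ 1 $ 3 + \<delta> t g (g ** X)"
    have k: "\<kappa> (h t x) > 0" "l0 \<le> \<kappa> (h t x)" using \<kappa>_pos l0 h_M[OF x] by auto
    have "\<delta> t g (g ** X) = oint J t / \<kappa> (h t x)"
      using g nrmg by (simp add: \<delta>_def J_def[abs_def] lift_gf gG)
    then have "\<kappa> (h t x) * z = v t" using k by (simp add: z_def v_def distrib_left)
    then have "l0 * \<bar>z\<bar> \<le> \<bar>v t\<bar>" using k l0(1) by (metis abs_ge_zero abs_mult abs_of_pos mult_right_mono)
    then have "l0 * \<bar>z\<bar> \<le> Bk * (13 + 81 * B) * (d t * \<tau> t)" using vb by linarith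
    then have zb: "\<bar>z\<bar> \<le> C0 * \<tau> t ^ 4" using l0(1)
      by (simp add: C0_def d_def pos_le_divide_eq mult_ac power4_eq_xxxx power3_eq_cube)
    have "differential \<Gamma> (h t) x X = A0 t + z *\<^sub>R E 1 3"
      using differential_h[OF g(1) X, of t, folded g(2)] by (simp add: A A0_def z_def scaleR_add_left)
    then have "norm (differential \<Gamma> (h t) x X) \<le> norm (A0 t) + \<bar>z\<bar>"
      using norm_triangle_ineq[of "A0 t" "z *\<^sub>R E 1 3"] by (simp add: norm_E)
    also have "\<dots> \<le> 81 * c\<^sup>2 * \<tau> t ^ 4 + C0 * \<tau> t ^ 4"
    proof -
      have "\<tau> t ^ 3 \<le> \<tau> t ^ 4" using tau[of t] by (intro power_increasing) auto
      then have "81 * d t \<le> 81 * c\<^sup>2 * \<tau> t ^ 4" by (simp add: d_def mult_left_mono)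
      then show ?thesis using A0n[of t] zb by linarith
    qed
    finally show "norm (differential \<Gamma> (h t) x X) \<le> C * (1 + \<bar>t\<bar>) ^ 4"
      by (simp add: C_def \<tau>_def distrib_right)
  qed
qed

lemma differential_growth_h: "differential_growth \<Gamma> h 4"
proof -
  obtain C where C: "C > 0" "\<And>t x X. x \<in> M \<Longrightarrow> X \<in> sl3 \<Longrightarrow> norm X \<le> 1 \<Longrightarrow>
    norm (differential \<Gamma> (h t) x X) \<le> C * (1 + \<bar>t\<bar>) ^ 4" using differential_bound by metis
  \<comment> \<open>16 is the fourth power of 2, as \<open>1 + \<bar>t\<bar>\<close> is at most
    \<open>2 * \<bar>t\<bar>\<close> here.\<close>
  have "differential_sup_norm \<Gamma> (h t) \<le> ennreal (C * 16 * \<bar>t\<bar> ^ 4)" if t: "1 \<le> norm t" for t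
    unfolding differential_sup_norm_def
  proof (intro SUP_least ennreal_leI)
    fix x X assume "x \<in> M" "X \<in> {X \<in> sl3. norm X \<le> 1}"
    then have "norm (differential \<Gamma> (h t) x X) \<le> C * (1 + \<bar>t\<bar>) ^ 4" using C(2) by simp
    also have "\<dots> \<le> C * (2 * \<bar>t\<bar>) ^ 4" using t C by (intro mult_left_mono power_mono) auto
    finally show "norm (differential \<Gamma> (h t) x X) \<le> C * 16 * \<bar>t\<bar> ^ 4" by (simp add: power_mult_distrib)
  qed
  then show ?thesis unfolding differential_growth_def eventually_at_infinity by blast
qed

end

section \<open>The mean ergodic theorem for bounded functions\<close>

locale measure_preserving_map = finite_measure N for N :: "'a measure" +
  fixes T :: "'a \<Rightarrow> 'a"
  assumes T_measurable: "T \<in> measurable N N" and T_distr: "distr N N T = N"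
begin

lemma Tn_measurable: "T ^^ n \<in> measurable N N"
proof (induction n)
  case (Suc n)
  then show ?case using measurable_comp[OF Suc T_measurable] by (simp only: funpow.simps)
qed (simp add: id_def)

lemma Tn_space: "x \<in> space N \<Longrightarrow> (T ^^ n) x \<in> space N"
  using Tn_measurable[of n] by (auto simp: measurable_def)

lemma integral_Tn:
  assumes "f \<in> borel_measurable N" shows "(\<integral>x. f ((T ^^ n) x) \<partial>N) = (\<integral>x. (f x :: real) \<partial>N)"
proof (induction n)
  case (Suc n)
  have m: "(\<lambda>x. f ((T ^^ n) x)) \<in> borel_measurable N" by (rule measurable_compose[OF Tn_measurable assms])
  have "(\<integral>x. f ((T ^^ n) (T x)) \<partial>N) = (\<integral>x. f ((T ^^ n) x) \<partial>N)"
    using integral_distr[OF T_measurable m] by (simp add: T_distr)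
  then show ?case using Suc by (simp add: funpow_swap1)
qed simp

definition avg :: "nat \<Rightarrow> ('a \<Rightarrow> real) \<Rightarrow> 'a \<Rightarrow> real" where
  "avg n f x = (\<Sum>j<n. f ((T ^^ j) x)) / real n"

lemma avg_measurable: "f \<in> borel_measurable N \<Longrightarrow> avg n f \<in> borel_measurable N"
  unfolding avg_def[abs_def]
  by (intro borel_measurable_divide borel_measurable_sum borel_measurable_const measurable_compose[OF Tn_measurable])

lemma avg_bounded:
  assumes "\<And>x. x \<in> space N \<Longrightarrow> \<bar>f x\<bar> \<le> B" "x \<in> space N" shows "\<bar>avg n f x\<bar> \<le> B"
proof (cases "n = 0")
  case True
  then show ?thesis using assms(1)[OF assms(2)] by (simp add: avg_def)
next
  case False
  have "\<bar>\<Sum>j<n. f ((T ^^ j) x)\<bar> \<le> (\<Sum>j<n. B)" by (rule order_trans[OF sum_abs sum_mono]) (use assms Tn_space in auto)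
  then show ?thesis using False by (simp add: avg_def field_simps)
qed

lemma bdd_integrable:
  assumes "f \<in> borel_measurable N" "\<And>x. x \<in> space N \<Longrightarrow> \<bar>f x\<bar> \<le> (B :: real)" shows "integrable N f"
  by (rule integrable_const_bound[of _ B]) (use assms in auto)

lemma bdd_integrable_sq:
  assumes "f \<in> borel_measurable N" "\<And>x. x \<in> space N \<Longrightarrow> \<bar>f x\<bar> \<le> (B :: real)" shows "integrable N (\<lambda>x. (f x)\<^sup>2)"
proof (rule bdd_integrable[where B = "B\<^sup>2"])
  show "(\<lambda>x. (f x)\<^sup>2) \<in> borel_measurable N" using assms(1) by measurable
  show "\<bar>(f x)\<^sup>2\<bar> \<le> B\<^sup>2" if "x \<in> space N" for x using power_mono[OF assms(2)[OF that], of 2] by simp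
qed

text \<open>Cauchy-Schwarz at each point, then invariance of the measure for each summand.\<close>

lemma avg_contraction:
  assumes f: "f \<in> borel_measurable N" "\<And>x. x \<in> space N \<Longrightarrow> \<bar>f x\<bar> \<le> B" and n: "n > 0"
  shows "(\<integral>x. (avg n f x)\<^sup>2 \<partial>N) \<le> (\<integral>x. (f x)\<^sup>2 \<partial>N)"
proof -
  have i: "integrable N (\<lambda>x. (f ((T ^^ j) x))\<^sup>2)" for j
    by (rule bdd_integrable_sq[where B = B]) (use f Tn_space measurable_compose[OF Tn_measurable f(1)] in auto)
  have p: "(avg n f x)\<^sup>2 \<le> (\<Sum>j<n. (f ((T ^^ j) x))\<^sup>2) / real n" for x
  proof -
    have "(\<Sum>j<n. f ((T ^^ j) x))\<^sup>2 \<le> (\<Sum>j<n. (f ((T ^^ j) x))\<^sup>2) * real n"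
      using sum_squared_le_sum_of_squares[of "\<lambda>j. f ((T ^^ j) x)" "{..<n}"] by (simp add: mult.commute)
    then show ?thesis using n by (simp add: avg_def power_divide field_simps power2_eq_square)
  qed
  have "(\<integral>x. (avg n f x)\<^sup>2 \<partial>N) \<le> (\<integral>x. (\<Sum>j<n. (f ((T ^^ j) x))\<^sup>2) / real n \<partial>N)"
    by (rule integral_mono[OF bdd_integrable_sq[OF avg_measurable[OF f(1)]]])
       (use avg_bounded f i p in \<open>auto intro!: Bochner_Integration.integrable_sum\<close>)
  also have "\<dots> = (\<Sum>j<n. (\<integral>x. (f ((T ^^ j) x))\<^sup>2 \<partial>N)) / real n"
    using i by (simp add: Bochner_Integration.integral_sum)
  also have "\<dots> = (\<integral>x. (f x)\<^sup>2 \<partial>N)"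
    using n integral_Tn[of "\<lambda>x. (f x)\<^sup>2"] f by simp
  finally show ?thesis .
qed

lemma sum_shift_bound:
  assumes "\<And>x. x \<in> space N \<Longrightarrow> \<bar>f x\<bar> \<le> B" "x \<in> space N"
  shows "\<bar>(\<Sum>j<S. f ((T ^^ (i + j)) x)) - (\<Sum>j<S. f ((T ^^ j) x))\<bar> \<le> 2 * real i * B"
proof (induction i)
  case (Suc i)
  have "(\<Sum>j<S. f ((T ^^ (Suc i + j)) x)) - (\<Sum>j<S. f ((T ^^ (i + j)) x)) = f ((T ^^ (i + S)) x) - f ((T ^^ i) x)"
    using sum_lessThan_telescope[of "\<lambda>j. f ((T ^^ (i + j)) x)" S] by (simp add: sum_subtractf[symmetric])
  moreover have "\<bar>f ((T ^^ (i + S)) x)\<bar> \<le> B" "\<bar>f ((T ^^ i) x)\<bar> \<le> B" using assms Tn_space by blast+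
  ultimately have "\<bar>(\<Sum>j<S. f ((T ^^ (Suc i + j)) x)) - (\<Sum>j<S. f ((T ^^ (i + j)) x))\<bar> \<le> 2 * B" by linarith
  then show ?case using Suc by (simp add: algebra_simps)
qed simp

text \<open>Averaging twice is a mean over i < n of the long average started at i, and each shift
  changes the long sum only by its boundary terms.\<close>

lemma avg_avg:
  assumes B: "\<And>x. x \<in> space N \<Longrightarrow> \<bar>f x\<bar> \<le> B" and x: "x \<in> space N" and n: "n > 0" and S: "S > 0"
  shows "\<bar>avg S (avg n f) x - avg S f x\<bar> \<le> 2 * real n * B / real S"
proof -
  have B0: "B \<ge> 0" using B[OF x] by linarith
  define D where "D i = (\<Sum>j<S. f ((T ^^ (i + j)) x)) - (\<Sum>j<S. f ((T ^^ j) x))" for i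
  have "avg S (avg n f) x = (\<Sum>j<S. \<Sum>i<n. f ((T ^^ (i + j)) x)) / real n / real S"
    by (simp add: avg_def sum_divide_distrib funpow_add)
  also have "(\<Sum>j<S. \<Sum>i<n. f ((T ^^ (i + j)) x)) = (\<Sum>i<n. \<Sum>j<S. f ((T ^^ (i + j)) x))" by (rule sum.swap)
  also have "\<dots> = (\<Sum>i<n. D i) + real n * (\<Sum>j<S. f ((T ^^ j) x))" by (simp add: D_def sum_subtractf)
  finally have "avg S (avg n f) x = ((\<Sum>i<n. D i) / real n + (\<Sum>j<S. f ((T ^^ j) x))) / real S"
    using n by (simp add: add_divide_distrib)
  then have e: "avg S (avg n f) x - avg S f x = (\<Sum>i<n. D i) / real n / real S"
    by (simp add: avg_def[of S f] add_divide_distrib)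
  have "\<bar>D i\<bar> \<le> 2 * real n * B" if "i < n" for i
  proof -
    have "\<bar>D i\<bar> \<le> 2 * real i * B" unfolding D_def by (rule sum_shift_bound[OF B x])
    also have "\<dots> \<le> 2 * real n * B" using that B0 by (intro mult_right_mono) auto
    finally show ?thesis .
  qed
  then have "\<bar>\<Sum>i<n. D i\<bar> \<le> (\<Sum>i<n. 2 * real n * B)" by (intro order_trans[OF sum_abs sum_mono]) auto
  then have "\<bar>\<Sum>i<n. D i\<bar> / real n \<le> 2 * real n * B" using n by (simp add: pos_divide_le_eq mult.commute)
  then have "\<bar>\<Sum>i<n. D i\<bar> / real n / real S \<le> 2 * real n * B / real S" by (rule divide_right_mono) simp
  then show ?thesis unfolding e by (simp only: abs_divide abs_of_nat)
qed

text \<open>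
  The averages are nearly norm minimising, and so is the midpoint of two of them; the parallelogram
  identity turns this into the Cauchy property.
\<close>
lemma mean_ergodic_cauchy:
  assumes f: "f \<in> borel_measurable N" "\<And>x. x \<in> space N \<Longrightarrow> \<bar>f x\<bar> \<le> B" and e: "e > 0"
  shows "\<exists>n0>0. \<forall>m\<ge>n0. \<forall>n\<ge>n0. (\<integral>x. (avg m f x - avg n f x)\<^sup>2 \<partial>N) < e"
proof -
  define q where "q n = (\<integral>x. (avg n f x)\<^sup>2 \<partial>N)" for n
  define d where "d = Inf (q ` {0<..})"
  define B1 where "B1 = max B 1"
  have B1: "B1 > 0" and fB: "\<And>x. x \<in> space N \<Longrightarrow> \<bar>f x\<bar> \<le> B1" using f(2) by (force simp: B1_def)+
  define V where "V = measure N (space N)"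
  have V: "V \<ge> 0" by (simp add: V_def)
  have bdd: "bdd_below (q ` {0<..})" by (rule bdd_belowI[of _ 0]) (auto simp: q_def)
  have dq: "d \<le> q n" if "n > 0" for n unfolding d_def using that bdd by (intro cInf_lower) auto
  \<comment> \<open>Averaging contracts the norm, so any \<open>v\<close> whose long averages follow
    those of \<open>f\<close> bounds \<open>q S\<close> up to O(1/S). Taking an average
    \<open>avg n1 f\<close> shows that \<open>q\<close> ends up near its infimum; taking the
    midpoint of two averages shows that this has norm at least the infimum.\<close>
  have close: "q S \<le> (\<integral>x. (v x)\<^sup>2 \<partial>N) + c * (2 * B1 * V) / real S"
    if v: "v \<in> borel_measurable N" "\<And>x. x \<in> space N \<Longrightarrow> \<bar>v x\<bar> \<le> B1" and S: "S > 0"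
      and c: "\<And>x. x \<in> space N \<Longrightarrow> \<bar>avg S v x - avg S f x\<bar> \<le> c / real S" for v c S
  proof -
    have p: "(avg S f x)\<^sup>2 \<le> (avg S v x)\<^sup>2 + c / real S * (2 * B1)" if x: "x \<in> space N" for x
    proof -
      have "(avg S f x)\<^sup>2 - (avg S v x)\<^sup>2 = - (avg S v x - avg S f x) * (avg S f x + avg S v x)"
        by (simp add: power2_eq_square algebra_simps)
      also have "\<dots> \<le> \<bar>- (avg S v x - avg S f x) * (avg S f x + avg S v x)\<bar>" by simp
      also have "\<dots> \<le> c / real S * (2 * B1)"
        using c[OF x] avg_bounded[of f B1 x S] avg_bounded[of v B1 x S] fB v(2) x
        by (intro abs_mult_le) auto
      finally show ?thesis by simp
    qed
    have "q S \<le> (\<integral>x. (avg S v x)\<^sup>2 + c / real S * (2 * B1) \<partial>N)"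
      unfolding q_def
      using bdd_integrable_sq[OF avg_measurable[OF f(1)] avg_bounded[OF fB], of S]
        bdd_integrable_sq[OF avg_measurable[OF v(1)] avg_bounded[OF v(2)], of S] p
      by (intro integral_mono) auto
    also have "\<dots> = (\<integral>x. (avg S v x)\<^sup>2 \<partial>N) + c / real S * (2 * B1) * V"
      using bdd_integrable_sq[OF avg_measurable[OF v(1)] avg_bounded[OF v(2)], of S] by (simp add: V_def)
    also have "\<dots> \<le> (\<integral>x. (v x)\<^sup>2 \<partial>N) + c * (2 * B1 * V) / real S"
      using avg_contraction[OF v S] by simp
    finally show ?thesis .
  qed
  have lim: "(\<lambda>S. a + c / real S) \<longlonglongrightarrow> a" for a c :: real
    using tendsto_add[OF tendsto_const tendsto_mult_right_zero[OF lim_inverse_n], of a c] by (simp add: divide_inverse)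
  have d4: "d < d + e / 4" using e by simp
  then obtain n1 where n1: "n1 > 0" "q n1 < d + e / 4"
    using cInf_lessD[of "q ` {0<..}" "d + e / 4"] unfolding d_def by auto
  define c1 where "c1 = 2 * real n1 * B1 * (2 * B1 * V)"
  have up: "q S \<le> q n1 + c1 / real S" if S: "S > 0" for S
    unfolding c1_def q_def[of n1]
    by (rule close[OF avg_measurable[OF f(1)] avg_bounded[OF fB] S]) (use avg_avg[OF fB _ n1(1) S] in auto)
  have "eventually (\<lambda>S. q n1 + c1 / real S < d + e / 4) sequentially"
    by (rule order_tendstoD(2)[OF lim n1(2)])
  then obtain n0 where n0: "\<And>S. S \<ge> n0 \<Longrightarrow> q n1 + c1 / real S < d + e / 4" by (auto simp: eventually_sequentially)
  have qS: "q S < d + e / 4" if "S \<ge> Suc n0" for S using up[of S] n0[of S] that by simp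
  show ?thesis
  proof (intro exI[of _ "Suc n0"] conjI allI impI)
    fix m n assume mn: "Suc n0 \<le> m" "Suc n0 \<le> n"
    define v where "v x = (avg m f x + avg n f x) / 2" for x
    have vm: "v \<in> borel_measurable N" unfolding v_def
      by (intro borel_measurable_divide borel_measurable_add borel_measurable_const avg_measurable f(1))
    have vB: "\<bar>v x\<bar> \<le> B1" if "x \<in> space N" for x
      using avg_bounded[of f B1 x m] avg_bounded[of f B1 x n] fB that by (simp add: v_def)
    have vS: "\<bar>avg S v x - avg S f x\<bar> \<le> 2 * real (m + n) * B1 / real S" if x: "x \<in> space N" and S: "S > 0" for x S
    proof -
      have "avg S v x = (avg S (avg m f) x + avg S (avg n f) x) / 2"
        by (simp add: avg_def[of S] v_def sum_divide_distrib[symmetric] sum.distrib add_divide_distrib)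
      moreover have "\<bar>avg S (avg m f) x - avg S f x\<bar> \<le> 2 * real m * B1 / real S"
        "\<bar>avg S (avg n f) x - avg S f x\<bar> \<le> 2 * real n * B1 / real S"
        using avg_avg[OF fB x _ S] mn by auto
      moreover have "2 * real (m + n) * B1 / real S = 2 * real m * B1 / real S + 2 * real n * B1 / real S"
        by (simp add: algebra_simps add_divide_distrib)
      ultimately show ?thesis by (simp add: abs_le_iff field_simps)
    qed
    define c2 where "c2 = 2 * real (m + n) * B1 * (2 * B1 * V)"
    have "d \<le> (\<integral>x. (v x)\<^sup>2 \<partial>N) + c2 / real S" if S: "S > 0" for S
      using dq[OF S] close[OF vm vB S vS[OF _ S]] by (simp add: c2_def)
    then have dv: "d \<le> (\<integral>x. (v x)\<^sup>2 \<partial>N)"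
      by (intro LIMSEQ_le_const[OF lim[of _ c2]] exI[of _ 1]) auto
    have i: "integrable N (\<lambda>x. (avg m f x)\<^sup>2)" "integrable N (\<lambda>x. (avg n f x)\<^sup>2)" "integrable N (\<lambda>x. (v x)\<^sup>2)"
      using bdd_integrable_sq[OF avg_measurable[OF f(1)] avg_bounded[OF fB]] bdd_integrable_sq[OF vm vB] by auto
    have "(\<integral>x. (avg m f x - avg n f x)\<^sup>2 \<partial>N) = (\<integral>x. 2 * (avg m f x)\<^sup>2 + 2 * (avg n f x)\<^sup>2 - 4 * (v x)\<^sup>2 \<partial>N)"
      by (rule Bochner_Integration.integral_cong) (simp_all add: v_def power2_eq_square field_simps)
    also have "\<dots> = 2 * q m + 2 * q n - 4 * (\<integral>x. (v x)\<^sup>2 \<partial>N)" using i by (simp add: q_def)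
    also have "\<dots> < e" using qS[OF mn(1)] qS[OF mn(2)] dv by simp
    finally show "(\<integral>x. (avg m f x - avg n f x)\<^sup>2 \<partial>N) < e" .
  qed simp
qed

text \<open>From the quadratic mean to the mean by Young's inequality with weight \<open>a\<close>;
  the choice of \<open>a\<close> keeps \<open>a * V\<close> below \<open>e\<close>.\<close>

lemma mean_ergodic_cauchy_L1:
  assumes f: "f \<in> borel_measurable N" "\<And>x. x \<in> space N \<Longrightarrow> \<bar>f x\<bar> \<le> B" and e: "e > 0"
  shows "\<exists>n0>0. \<forall>m\<ge>n0. \<forall>n\<ge>n0. (\<integral>x. \<bar>avg m f x - avg n f x\<bar> \<partial>N) < e"
proof -
  define V where "V = measure N (space N)"
  have V: "V \<ge> 0" by (simp add: V_def)
  define a where "a = e / (V + 1)"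
  have a: "a > 0" using e V by (simp add: a_def)
  obtain n0 where n0: "n0 > 0" "\<And>m n. m \<ge> n0 \<Longrightarrow> n \<ge> n0 \<Longrightarrow> (\<integral>x. (avg m f x - avg n f x)\<^sup>2 \<partial>N) < a * e"
    using mean_ergodic_cauchy[OF f, of "a * e"] a e by auto
  show ?thesis
  proof (intro exI[of _ n0] conjI allI impI n0(1))
    fix m n assume mn: "n0 \<le> m" "n0 \<le> n"
    define u where "u x = avg m f x - avg n f x" for x
    have um: "u \<in> borel_measurable N" unfolding u_def
      by (intro borel_measurable_diff avg_measurable f(1))
    have uB: "\<bar>u x\<bar> \<le> 2 * B" if "x \<in> space N" for x
      using avg_bounded[of f B x m] avg_bounded[of f B x n] f(2) that unfolding u_def by force
    have i: "integrable N (\<lambda>x. (u x)\<^sup>2)" "integrable N (\<lambda>x. \<bar>u x\<bar>)"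
      using bdd_integrable_sq[OF um uB] bdd_integrable[OF um uB] by auto
    have p: "\<bar>u x\<bar> \<le> a / 2 + (u x)\<^sup>2 / (2 * a)" for x
    proof -
      have "0 \<le> (\<bar>u x\<bar> - a)\<^sup>2" by simp
      then have "2 * a * \<bar>u x\<bar> \<le> a\<^sup>2 + (u x)\<^sup>2" by (simp add: power2_diff algebra_simps)
      then show ?thesis using a by (simp add: field_simps power2_eq_square)
    qed
    have "(\<integral>x. \<bar>u x\<bar> \<partial>N) \<le> (\<integral>x. a / 2 + (u x)\<^sup>2 / (2 * a) \<partial>N)"
      using i p by (intro integral_mono) auto
    also have "\<dots> = a / 2 * V + (\<integral>x. (u x)\<^sup>2 \<partial>N) / (2 * a)" using i by (simp add: V_def)
    also have "\<dots> < a / 2 * V + (a * e) / (2 * a)"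
      using n0(2)[OF mn] a by (intro add_strict_left_mono divide_strict_right_mono) (auto simp: u_def)
    also have "\<dots> \<le> e"
    proof -
      have "a * V \<le> a * (V + 1)" using a by simp
      also have "\<dots> = e" using V by (simp add: a_def)
      finally show ?thesis using a by simp
    qed
    finally show "(\<integral>x. \<bar>avg m f x - avg n f x\<bar> \<partial>N) < e" by (simp add: u_def)
  qed
qed

end

section \<open>Shearing of the W-arcs\<close>

lemma oint_lower:
  assumes "continuous_on UNIV f" "\<And>s. l \<le> f s" "l \<ge> 0" shows "l * \<bar>r\<bar> \<le> \<bar>oint f r\<bar>"
proof -
  have i: "(\<lambda>\<theta>. f (\<theta> * r)) integrable_on {0..1}"
    by (intro integrable_continuous_real continuous_on_compose2[OF assms(1)] continuous_intros) auto
  have "integral {0..1} (\<lambda>\<theta>::real. l) \<le> integral {0..1} (\<lambda>\<theta>. f (\<theta> * r))"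
    by (rule integral_le[OF _ i]) (use assms in auto)
  then have l: "l \<le> integral {0..1} (\<lambda>\<theta>. f (\<theta> * r))" by simp
  then have "l * \<bar>r\<bar> \<le> integral {0..1} (\<lambda>\<theta>. f (\<theta> * r)) * \<bar>r\<bar>" by (rule mult_right_mono) simp
  also have "\<dots> = \<bar>oint f r\<bar>" using l assms(3) by (simp add: oint_def abs_mult mult.commute)
  finally show ?thesis .
qed

text \<open>Writing \<open>W\<close> as \<open>N3 w1 w2 0\<close> treats both choices of W at once;
  \<open>w1 * w2 = 0\<close> makes \<open>u3 (s * w1) (s * w2) 0\<close> the one-parameter group
  exp(sW). The formula for \<open>c\<close> is the bracket relation in coordinates.\<close>

locale sheared = perturbed_measure \<Gamma> p q w \<beta> h \<omega> \<kappa>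
  for \<Gamma> p q w \<beta> h \<omega> \<kappa> +
  fixes w1 w2 c b :: real
  assumes W: "w1 * w2 = 0" "\<bar>w1\<bar> \<le> 1" "\<bar>w2\<bar> \<le> 1" and c_eq: "c = w1 * q - p * w2"
    and W\<beta>: "\<And>x. x \<in> M \<Longrightarrow> \<bar>dM \<beta> x (N3 w1 w2 0)\<bar> \<le> b" and b_less: "b < \<bar>c\<bar>"
begin

definition eW :: "real \<Rightarrow> real^3^3" where "eW s = u3 (s * w1) (s * w2) 0"

lemma eW_SL: "eW s \<in> SL" by (simp add: eW_def u3_SL)

lemma eW_u3: "eW s ** u3 0 0 r = u3 (s * w1) (s * w2) r" "u3 0 0 r ** eW s = u3 (s * w1) (s * w2) r"
  by (simp_all add: eW_def u3_mult)

lemma W_deriv: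
  assumes "x \<in> M" shows "((\<lambda>s. \<beta> (x \<star> eW s)) has_real_derivative dM \<beta> (x \<star> eW s) (N3 w1 w2 0)) (at s)"
proof -
  have "w1 = 0 \<or> w2 = 0" using W(1) by simp
  then show ?thesis unfolding eW_def
    by (intro dM_u3[OF C1_\<beta> assms]) (auto intro!: derivative_eq_intros)
qed

abbreviation W\<beta>' :: "(real^3^3) set \<Rightarrow> real" where "W\<beta>' x \<equiv> dM \<beta> x (N3 w1 w2 0)"

text \<open>The limiting rate of shear along Z per unit length of a W-arc, measured in the invariant
  length form.\<close>

definition G :: "(real^3^3) set \<Rightarrow> real" where "G x = \<kappa> x * (c + W\<beta>' x)"

lemma cM_G: "cM G" unfolding G_def by (intro cM_intros C1_cM[OF C1_\<kappa>] cM_dM[OF C1_\<beta>])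

text \<open>Central displacement between the images of the ends of a W-arc. The term
  \<open>c * s * t\<close> is the cost of commuting exp(sW) past exp(tU); the rest is the difference
  of the accumulated \<rho>.\<close>

definition rs :: "real \<Rightarrow> (real^3^3) set \<Rightarrow> real \<Rightarrow> real" where
  "rs s x t = \<rho> t (x \<star> eW s) - \<rho> t x + c * s * t"

lemma h_eW: assumes "x \<in> M" shows "h t (x \<star> eW s) = h t x \<star> u3 0 0 (rs s x t) \<star> eW s"
proof -
  define A where "A = t * w + t\<^sup>2 * p * q / 2"
  have r: "rs s x t = \<rho> t (x \<star> eW s) - \<rho> t x + (w1 * q - p * w2) * s * t"
    unfolding rs_def using c_eq by simp
  have "eW s ** Ef t (\<rho> t (x \<star> eW s)) = Ef t (\<rho> t x) ** (u3 0 0 (rs s x t) ** eW s)"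
    unfolding eW_u3 r unfolding eW_def Ef_def u3_mult A_def[symmetric] by (simp add: algebra_simps)
  then show ?thesis using assms by (simp add: h_eq act_M eW_SL act_act Ef_SL SL_mult u3_SL matrix_mul_assoc)
qed

lemma rs_0 [simp]: "rs s x 0 = 0" by (simp add: rs_def)

lemma rs_deriv:
  assumes "x \<in> M"
  shows "(rs s x has_real_derivative \<beta> (h t x \<star> u3 0 0 (rs s x t) \<star> eW s) - \<beta> (h t x) + c * s) (at t)"
proof -
  have "(rs s x has_real_derivative \<beta> (h t (x \<star> eW s)) - \<beta> (h t x) + c * s) (at t)"
    unfolding rs_def[abs_def]
    by (rule derivative_eq_intros \<rho>_deriv assms act_M eW_SL refl)+ simp
  then show ?thesis by (simp add: h_eW assms)
qed

text \<open>
  The central displacement, measured by the length form \<open>\<kappa> dr\<close> that the flow preserves: its growth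
  rate depends on \<open>\<beta>\<close> only through the increment of \<open>\<beta>\<close> along the \<open>W\<close>-arc.
\<close>
lemma Zav_rs_deriv:
  assumes x: "x \<in> M" and v: "\<And>t. v t = h t x \<star> u3 0 0 (rs s x t)"
  shows "((\<lambda>t. Zav (rs s x t) \<kappa> (h t x)) has_real_derivative
    \<kappa> (v t) * (\<beta> (v t \<star> eW s) - \<beta> (v t) + c * s)) (at t)"
proof -
  define r where "r = rs s x"
  define r' where "r' t = \<beta> (v t \<star> eW s) - \<beta> (h t x) + c * s" for t
  have dr: "(r has_real_derivative r' t) (at t)" for t
    unfolding r_def r'_def v by (rule rs_deriv[OF x])
  have cr: "continuous_on UNIV r"
    by (rule DERIV_continuous_on[OF has_field_derivative_at_within[OF dr]])
  have r'e: "r' t = \<beta> (h t (x \<star> eW s)) - \<beta> (h t x) + c * s" for t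
    by (simp add: r'_def v h_eW x)
  have c\<beta>: "continuous_on UNIV (\<lambda>t. \<beta> (h t y))" if "y \<in> M" for y by (rule h_continuous[OF C1_cM[OF C1_\<beta>] that])
  have cr': "continuous_on UNIV r'" unfolding r'e[abs_def]
    by (intro continuous_intros c\<beta> x act_M eW_SL)
  have c\<rho>: "continuous_on UNIV (\<lambda>t. \<rho> t x)"
    by (rule DERIV_continuous_on[OF has_field_derivative_at_within[OF \<rho>_deriv[OF x]]])
  \<comment> \<open>The point at fraction \<theta> of the central arc from \<open>h t x\<close> to
    \<open>v t\<close>.\<close>
  define u where "u t \<theta> = x \<star> Ef t (\<rho> t x + \<theta> * r t)" for t \<theta>
  have u: "u t \<theta> = h t x \<star> u3 0 0 (\<theta> * r t)" for t \<theta>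
    using x by (simp add: u_def h_eq act_act Ef_SL u3_SL Ef_u3)
  have uM: "u t \<theta> \<in> M" for t \<theta> using x by (simp add: u_def act_M Ef_SL)
  have u0: "u t 0 = h t x" "u t 1 = v t" for t
    using x by (simp_all add: u h_M u3_zero act_one v r_def)
  define F where "F t \<theta> = r t * \<kappa> (u t \<theta>)" for t \<theta>
  define F' where "F' t \<theta> = r' t * \<kappa> (u t \<theta>) + r t * dM \<kappa> (u t \<theta>) (N3 p q (w + (\<beta> (h t x) + \<theta> * r' t)))" for t \<theta>
  have dF: "((\<lambda>t. F t \<theta>) has_real_derivative F' t \<theta>) (at t)" for t \<theta>
  proof -
    have "((\<lambda>t. \<kappa> (u t \<theta>)) has_real_derivative dM \<kappa> (u t \<theta>) (N3 p q (w + (\<beta> (h t x) + \<theta> * r' t)))) (at t)"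
      unfolding u_def Ef_def
      by (rule dM_u3[OF C1_\<kappa> x]) (auto intro!: derivative_eq_intros \<rho>_deriv x dr simp: algebra_simps)
    from DERIV_mult[OF dr this] show ?thesis by (simp add: F_def[abs_def] F'_def mult.commute)
  qed
  have cu: "continuous_on (UNIV \<times> cbox 0 1) (\<lambda>z. f (u (fst z) (snd z)))" if f: "cM f" for f
  proof (rule M_cases[OF x])
    fix g assume g: "g \<in> SL" "x = pr g"
    have "continuous_on (UNIV \<times> cbox 0 1) (\<lambda>z. f (pr (g ** Ef (fst z) (\<rho> (fst z) x + snd z * r (fst z)))))"
      by (rule continuous_on_compose2[OF f[unfolded cM_def]])
         (auto intro!: continuous_intros SL_mult g Ef_SL continuous_on_compose2[OF c\<rho>] continuous_on_compose2[OF cr])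
    then show ?thesis by (simp add: u_def g pr_act Ef_SL)
  qed
  have F'e: "F' t \<theta> = r' t * \<kappa> (u t \<theta>) + r t * (dM \<kappa> (u t \<theta>) (N3 p q w) + (\<beta> (h t x) + \<theta> * r' t) * dM \<kappa> (u t \<theta>) (N3 0 0 1))" for t \<theta>
    using uM by (simp add: F'_def N3_split dM_add C1_\<kappa> dM_scaleR)
  have "continuous_on (UNIV \<times> cbox 0 1) (\<lambda>z. F' (fst z) (snd z))"
    unfolding F'e
    by (intro continuous_intros cu C1_cM[OF C1_\<kappa>] cM_dM[OF C1_\<kappa>]
        continuous_on_compose2[OF cr] continuous_on_compose2[OF cr'] continuous_on_compose2[OF c\<beta>[OF x]]) auto
  then have cF': "continuous_on (UNIV \<times> cbox 0 1) (\<lambda>(t, \<theta>). F' t \<theta>)" by (simp add: case_prod_beta)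
  have cF0: "continuous_on (UNIV \<times> cbox 0 1) (\<lambda>z. F (fst z) (snd z))"
    unfolding F_def by (intro continuous_intros cu C1_cM[OF C1_\<kappa>] continuous_on_compose2[OF cr]) auto
  have cF: "continuous_on (cbox 0 1) (F t)" for t
    by (rule continuous_on_compose2[OF cF0, of _ "\<lambda>\<theta>. (t, \<theta>)", simplified]) (auto intro!: continuous_intros)
  have 1: "((\<lambda>t. integral (cbox 0 1) (F t)) has_field_derivative integral (cbox 0 1) (F' t)) (at t within UNIV)"
    by (rule leibniz_rule_field_derivative[OF _ integrable_continuous[OF cF] cF']) (auto intro: has_field_derivative_at_within dF)
  \<comment> \<open>By the cohomological equation the time derivative of the length integrand is an
    exact derivative in \<theta> with primitive \<open>H\<close>, so only the end points of the arc
    contribute.\<close>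
  define H where "H \<theta> = r' t * \<theta> * \<kappa> (u t \<theta>) + \<kappa> (u t \<theta>) * (\<beta> (h t x) - \<beta> (u t \<theta>))" for \<theta>
  have dH: "(H has_real_derivative F' t \<theta>) (at \<theta>)" for \<theta>
  proof -
    have dk: "((\<lambda>\<theta>. f (u t \<theta>)) has_real_derivative r t * dM f (u t \<theta>) (N3 0 0 1)) (at \<theta>)" if f: "C1_fun \<Gamma> f" for f
    proof -
      have "((\<lambda>\<theta>. f (u t \<theta>)) has_real_derivative dM f (u t \<theta>) (N3 0 0 (r t))) (at \<theta>)"
        unfolding u by (rule dM_u3[OF f h_M[OF x]]) (auto intro!: derivative_eq_intros)
      moreover have "N3 0 0 (r t) = r t *\<^sub>R N3 0 0 1" by (simp add: N3_def)
      ultimately show ?thesis using dM_scaleR[OF f uM] by simp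
    qed
    have "dM \<kappa> (u t \<theta>) (N3 p q w) = - (\<beta> (u t \<theta>) * dM \<kappa> (u t \<theta>) (N3 0 0 1)) - \<kappa> (u t \<theta>) * dM \<beta> (u t \<theta>) (N3 0 0 1)"
      using cohomological_equation[OF uM[of t \<theta>]] by linarith
    note e = this
    show ?thesis unfolding H_def F'e
      by (rule derivative_eq_intros dk[OF C1_\<kappa>] dk[OF C1_\<beta>] refl)+ (simp add: e algebra_simps)
  qed
  have "(F' t has_integral H 1 - H 0) {0..1}"
    by (rule fundamental_theorem_of_calculus)
       (auto intro!: has_vector_derivative_at_within dH[unfolded has_real_derivative_iff_has_vector_derivative])
  then have 2: "integral (cbox 0 1) (F' t) = H 1 - H 0" by (simp add: integral_unique)
  have 3: "H 1 - H 0 = \<kappa> (v t) * (\<beta> (v t \<star> eW s) - \<beta> (v t) + c * s)"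
    by (simp add: H_def u0 r'_def algebra_simps)
  have 4: "integral (cbox 0 1) (F t) = Zav (rs s x t) \<kappa> (h t x)" for t
    by (simp add: F_def[abs_def] u Zav_def oint_def r_def mult.commute)
  show ?thesis using 1 unfolding 2 3 4 by simp
qed

text \<open>The accumulated shear: \<open>s * bt t x\<close> approximates the invariant length of
  the displacement of a W-arc of length \<open>s\<close>.\<close>

definition bt :: "real \<Rightarrow> (real^3^3) set \<Rightarrow> real" where "bt t x = oint (\<lambda>s. G (h s x)) t"

lemma bt_deriv: "x \<in> M \<Longrightarrow> ((\<lambda>t. bt t x) has_real_derivative G (h t x)) (at t)"
  unfolding bt_def by (rule oint_deriv[OF h_continuous[OF cM_G]])

lemma bt_0 [simp]: "bt 0 x = 0" by (simp add: bt_def)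

lemma cM_bt: "cM (bt t)" unfolding bt_def[abs_def] by (rule cM_oint_h[OF cM_G])

text \<open>Three errors of size e\<sigma>/3: the remaining step in direction W, the first-order
  expansion along the centre, and the replacement of the invariant displacement by its
  linearisation. Controlling the last two relative to \<sigma> asks the sheared arc to stay short at
  all times up to t, which fixes \<sigma>; the first is then handled by large t.\<close>

lemma shear_estimate:
  assumes f: "hasZ f f'" and e: "e > 0"
  shows "\<exists>\<sigma>>0. \<exists>t0\<ge>1. \<forall>t\<ge>t0. \<forall>x\<in>M.
    \<bar>f (h t (x \<star> eW (\<sigma> / t))) - f (h t x) - \<sigma> * (bt t x / t * (f' (h t x) / \<kappa> (h t x)))\<bar> \<le> e * \<sigma>"
proof -
  define F where "F x = f' x / \<kappa> x" for x
  have cF: "cM F" unfolding F_def using \<kappa>_pos by (intro cM_divide hasZ_cM[OF f] C1_cM[OF C1_\<kappa>]) force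
  obtain BF where BF: "BF > 0" "\<And>x. x \<in> M \<Longrightarrow> \<bar>F x\<bar> \<le> BF" using cM_bounded[OF cF] by blast
  obtain Bk where Bk: "Bk > 0" "\<And>x. x \<in> M \<Longrightarrow> \<bar>\<kappa> x\<bar> \<le> Bk" using cM_bounded C1_cM[OF C1_\<kappa>] by blast
  obtain l0 where l0: "l0 > 0" "\<And>x. x \<in> M \<Longrightarrow> l0 \<le> \<kappa> x" using cM_pos_lower[OF C1_cM[OF C1_\<kappa>] \<kappa>_pos] by blast
  have b0: "b \<ge> 0" using W\<beta> M_not_empty by force
  \<comment> \<open>\<open>C1 * \<sigma>\<close> bounds the central displacement up to time
    \<open>t\<close>: the invariant length grows at rate at most
    \<open>Bk * (\<bar>c\<bar> + b) * s\<close>, and dividing by \<open>l0\<close> returns to the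
    parameter of the centre.\<close>
  define C1 where "C1 = Bk * (\<bar>c\<bar> + b) / l0"
  have C1: "C1 \<ge> 0" using Bk b0 l0 by (simp add: C1_def)
  define Q where "Q = Bk + \<bar>c\<bar> + b"
  have Q: "Q > 0" using Bk b0 by (simp add: Q_def)
  \<comment> \<open>Chosen so that \<open>BF * (\<sigma> * (e2 * Q))\<close> is a third of the
    allowed error; \<open>e3\<close> below does the same for the expansion along the centre.\<close>
  define e2 where "e2 = e / (3 * BF * Q)"
  have e2: "e2 > 0" using e BF Q by (simp add: e2_def)
  define C2 where "C2 = C1 + 1"
  have C2: "C2 > 0" using C1 by (simp add: C2_def)
  define e3 where "e3 = e / (3 * Bk * C2)"
  have e3: "e3 > 0" using e Bk C2 by (simp add: e3_def)
  obtain d1 where d1: "d1 > 0" "\<And>x k. x \<in> M \<Longrightarrow> k \<in> SL \<Longrightarrow> norm (k - mat 1) < d1 \<Longrightarrow> \<bar>\<kappa> (x \<star> k) - \<kappa> x\<bar> < e2"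
    using cM_uniform[OF C1_cM[OF C1_\<kappa>] e2] by blast
  obtain d2 where d2: "d2 > 0" "\<And>x k. x \<in> M \<Longrightarrow> k \<in> SL \<Longrightarrow> norm (k - mat 1) < d2 \<Longrightarrow> \<bar>W\<beta>' (x \<star> k) - W\<beta>' x\<bar> < e2"
    using cM_uniform[OF cM_dM[OF C1_\<beta>] e2] by blast
  obtain d3 where d3: "d3 > 0" "\<And>x k. x \<in> M \<Longrightarrow> k \<in> SL \<Longrightarrow> norm (k - mat 1) < d3 \<Longrightarrow> \<bar>F (x \<star> k) - F x\<bar> < e3"
    using cM_uniform[OF cF e3] by blast
  define d where "d = min d1 (min d2 d3)"
  have d: "d > 0" using d1 d2 d3 by (simp add: d_def)
  define C3 where "C3 = 3 + C1"
  have C3: "C3 > 0" using C1 by (simp add: C3_def)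
  \<comment> \<open>Keeps the whole sheared arc within \<open>d\<close> of the reference orbit: at
    most \<open>2 * \<sigma>\<close> in direction W and \<open>C1 * \<sigma>\<close> along the
    centre.\<close>
  define \<sigma> where "\<sigma> = d / (2 * C3)"
  have \<sigma>: "\<sigma> > 0" using d C3 by (simp add: \<sigma>_def)
  have \<sigma>d: "2 * \<sigma> + C1 * \<sigma> < d"
  proof -
    have "2 * \<sigma> + C1 * \<sigma> < 2 * (C3 * \<sigma>)"
      using \<sigma> mult_nonneg_nonneg[OF C1 less_imp_le[OF \<sigma>]] by (simp add: C3_def algebra_simps)
    also have "\<dots> = d" using C3 by (simp add: \<sigma>_def)
    finally show ?thesis .
  qed
  obtain d4 where d4: "d4 > 0" "\<And>x k. x \<in> M \<Longrightarrow> k \<in> SL \<Longrightarrow> norm (k - mat 1) < d4 \<Longrightarrow> \<bar>f (x \<star> k) - f x\<bar> < e * \<sigma> / 3"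
    using cM_uniform[OF hasZ_cM(1)[OF f], of "e * \<sigma> / 3"] e \<sigma> by auto
  \<comment> \<open>Beyond \<open>t0\<close> the arc length \<open>\<sigma> / t\<close> is at most
    \<open>d4 / 3\<close>, so the step in direction W hardly changes \<open>f\<close>.\<close>
  define t0 where "t0 = max 1 (3 * \<sigma> / d4)"
  have nW: "norm (u3 (s * w1) (s * w2) r - mat 1) \<le> 2 * \<bar>s\<bar> + \<bar>r\<bar>" for s r
  proof -
    have "\<bar>s * w1\<bar> \<le> \<bar>s\<bar>" "\<bar>s * w2\<bar> \<le> \<bar>s\<bar>" unfolding abs_mult using W mult_left_le by force+
    then show ?thesis using norm_u3[of "s * w1" "s * w2" r] by linarith
  qed
  show ?thesis
  proof (rule exI[of _ \<sigma>], rule conjI[OF \<sigma>], rule exI[of _ t0], intro conjI allI impI ballI)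
    show "1 \<le> t0" by (simp add: t0_def)
    fix t x assume t: "t0 \<le> t" and x: "x \<in> M"
    have t1: "t \<ge> 1" using t by (simp add: t0_def)
    define s where "s = \<sigma> / t"
    have s: "s > 0" "s \<le> \<sigma>" "s * t = \<sigma>" using t1 \<sigma> by (auto simp: s_def field_simps)
    have sd4: "2 * s < d4"
    proof -
      have "3 * \<sigma> / d4 \<le> t" using t by (simp add: t0_def)
      then have "3 * \<sigma> \<le> t * d4" using d4(1) by (simp add: pos_divide_le_eq)
      then have "3 * s \<le> d4" using t1 by (simp add: s_def pos_divide_le_eq mult.commute)
      then show ?thesis using s by linarith
    qed
    define r where "r = rs s x"
    define v where "v \<tau> = h \<tau> x \<star> u3 0 0 (r \<tau>)" for \<tau>
    have hM: "h \<tau> x \<in> M" and vM: "v \<tau> \<in> M" for \<tau> using x by (simp_all add: h_M v_def act_M u3_SL)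
    define R where "R \<tau> = Zav (r \<tau>) \<kappa> (h \<tau> x)" for \<tau>
    define R' where "R' \<tau> = \<kappa> (v \<tau>) * (\<beta> (v \<tau> \<star> eW s) - \<beta> (v \<tau>) + c * s)" for \<tau>
    have dR: "(R has_real_derivative R' \<tau>) (at \<tau>)" for \<tau>
      using Zav_rs_deriv[OF x, of v s \<tau>] by (simp add: R_def[abs_def] R'_def v_def r_def)
    have R0: "R 0 = 0" by (simp add: R_def r_def Zav_def)
    have inc: "\<bar>\<beta> (y \<star> eW s) - \<beta> y\<bar> \<le> b * s" if "y \<in> M" for y
      using MVT_abs[OF W_deriv[OF that], of s b] W\<beta> act_M[OF that eW_SL] s that by (simp add: eW_def u3_zero act_one)
    have bR': "\<bar>R' \<tau>\<bar> \<le> Bk * ((\<bar>c\<bar> + b) * s)" for \<tau>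
      unfolding R'_def
    proof (rule abs_mult_le[OF Bk(2)[OF vM]])
      have "\<bar>c * s\<bar> = \<bar>c\<bar> * s" using s by (simp add: abs_mult)
      then show "\<bar>\<beta> (v \<tau> \<star> eW s) - \<beta> (v \<tau>) + c * s\<bar> \<le> (\<bar>c\<bar> + b) * s"
        using inc[OF vM[of \<tau>]] by (simp add: distrib_right)
    qed
    have rb: "\<bar>r \<tau>\<bar> \<le> C1 * \<sigma>" if \<tau>: "\<bar>\<tau>\<bar> \<le> \<bar>t\<bar>" for \<tau>
    proof -
      have "\<bar>R \<tau>\<bar> \<le> Bk * ((\<bar>c\<bar> + b) * s) * \<bar>\<tau>\<bar>" using MVT_abs[OF dR bR', of \<tau>] R0 by simp
      also have "\<dots> \<le> Bk * ((\<bar>c\<bar> + b) * s) * t" using \<tau> t1 Bk b0 s by (intro mult_left_mono) auto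
      also have "\<dots> = Bk * (\<bar>c\<bar> + b) * \<sigma>" using s by (simp add: mult.assoc)
      finally have 1: "\<bar>R \<tau>\<bar> \<le> Bk * (\<bar>c\<bar> + b) * \<sigma>" .
      have "l0 * \<bar>r \<tau>\<bar> \<le> \<bar>R \<tau>\<bar>" unfolding R_def Zav_def
        by (rule oint_lower) (use l0 hM act_M u3_SL in \<open>auto intro!: u3_continuous C1_cM[OF C1_\<kappa>] continuous_intros\<close>)
      then have "l0 * \<bar>r \<tau>\<bar> \<le> Bk * (\<bar>c\<bar> + b) * \<sigma>" using 1 by linarith
      then show ?thesis using l0(1) by (simp add: C1_def field_simps)
    qed
    have near: "\<bar>\<kappa> (h \<tau> x \<star> u3 (z * w1) (z * w2) r1) - \<kappa> (h \<tau> x)\<bar> \<le> e2"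
      "\<bar>W\<beta>' (h \<tau> x \<star> u3 (z * w1) (z * w2) r1) - W\<beta>' (h \<tau> x)\<bar> \<le> e2"
      "\<bar>F (h \<tau> x \<star> u3 (z * w1) (z * w2) r1) - F (h \<tau> x)\<bar> \<le> e3"
      if "\<bar>z\<bar> \<le> s" "\<bar>r1\<bar> \<le> C1 * \<sigma>" for \<tau> z r1
    proof -
      have "norm (u3 (z * w1) (z * w2) r1 - mat 1) < d"
        using nW[of z r1] that s \<sigma>d by linarith
      then show "\<bar>\<kappa> (h \<tau> x \<star> u3 (z * w1) (z * w2) r1) - \<kappa> (h \<tau> x)\<bar> \<le> e2"
        "\<bar>W\<beta>' (h \<tau> x \<star> u3 (z * w1) (z * w2) r1) - W\<beta>' (h \<tau> x)\<bar> \<le> e2"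
        "\<bar>F (h \<tau> x \<star> u3 (z * w1) (z * w2) r1) - F (h \<tau> x)\<bar> \<le> e3"
        using d1(2)[OF hM u3_SL] d2(2)[OF hM u3_SL] d3(2)[OF hM u3_SL] by (auto simp: d_def less_imp_le)
    qed
    have R'G: "\<bar>R' \<tau> - s * G (h \<tau> x)\<bar> \<le> s * (e2 * Q)" if \<tau>: "\<bar>\<tau>\<bar> \<le> \<bar>t\<bar>" for \<tau>
    proof -
      define I where "I = \<beta> (v \<tau> \<star> eW s) - \<beta> (v \<tau>) - s * W\<beta>' (h \<tau> x)"
      have "\<bar>(\<beta> (v \<tau> \<star> eW s) - s * W\<beta>' (h \<tau> x)) - (\<beta> (v \<tau> \<star> eW 0) - 0 * W\<beta>' (h \<tau> x))\<bar> \<le> e2 * \<bar>s\<bar>"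
      proof (rule MVT_abs[where f' = "\<lambda>z. W\<beta>' (v \<tau> \<star> eW z) - 1 * W\<beta>' (h \<tau> x)"])
        show "((\<lambda>z. \<beta> (v \<tau> \<star> eW z) - z * W\<beta>' (h \<tau> x)) has_real_derivative W\<beta>' (v \<tau> \<star> eW z) - 1 * W\<beta>' (h \<tau> x)) (at z)" for z
          by (rule DERIV_diff[OF W_deriv[OF vM] DERIV_cmult_right[OF DERIV_ident]])
        fix z assume z: "\<bar>z\<bar> \<le> \<bar>s\<bar>"
        have "v \<tau> \<star> eW z = h \<tau> x \<star> u3 (z * w1) (z * w2) (r \<tau>)"
          by (simp add: v_def act_act hM u3_SL eW_SL eW_u3)
        then show "\<bar>W\<beta>' (v \<tau> \<star> eW z) - 1 * W\<beta>' (h \<tau> x)\<bar> \<le> e2" using near(2)[OF _ rb[OF \<tau>]] z s by simp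
      qed
      then have I: "\<bar>I\<bar> \<le> e2 * s" using s vM by (simp add: I_def eW_def u3_zero act_one algebra_simps)
      have k: "\<bar>\<kappa> (v \<tau>) - \<kappa> (h \<tau> x)\<bar> \<le> e2" using near(1)[of 0 "r \<tau>" \<tau>] rb[OF \<tau>] s by (simp add: v_def)
      have e: "R' \<tau> - s * G (h \<tau> x) = \<kappa> (v \<tau>) * I + (\<kappa> (v \<tau>) - \<kappa> (h \<tau> x)) * (s * (c + W\<beta>' (h \<tau> x)))"
        by (simp add: R'_def G_def I_def algebra_simps)
      have "\<bar>\<kappa> (v \<tau>) * I\<bar> \<le> Bk * (e2 * s)" by (rule abs_mult_le[OF Bk(2)[OF vM] I])
      moreover have "\<bar>(\<kappa> (v \<tau>) - \<kappa> (h \<tau> x)) * (s * (c + W\<beta>' (h \<tau> x)))\<bar> \<le> e2 * (s * (\<bar>c\<bar> + b))"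
        by (intro abs_mult_le k) (use W\<beta>[OF hM, of \<tau>] s in auto)
      ultimately show ?thesis unfolding e by (simp add: Q_def algebra_simps)
    qed
    have "\<bar>(R t - s * bt t x) - (R 0 - s * bt 0 x)\<bar> \<le> s * (e2 * Q) * \<bar>t\<bar>"
      by (rule MVT_abs[OF DERIV_diff[OF dR DERIV_cmult[OF bt_deriv[OF x]]] R'G])
    then have Rt: "\<bar>R t - s * bt t x\<bar> \<le> \<sigma> * (e2 * Q)" using R0 s(3) t1 by (simp add: mult_ac)
    have rt: "\<bar>r t\<bar> \<le> C1 * \<sigma>" by (rule rb) simp
    define y where "y = h t x"
    have y: "y \<in> M" using hM by (simp add: y_def)
    have 1: "\<bar>f (h t (x \<star> eW s)) - f (v t)\<bar> \<le> e * \<sigma> / 3"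
    proof -
      have "norm (eW s - mat 1) < d4" using nW[of s 0] sd4 s by (simp add: eW_def)
      then have "\<bar>f (v t \<star> eW s) - f (v t)\<bar> < e * \<sigma> / 3" by (rule d4(2)[OF vM eW_SL])
      then show ?thesis by (simp add: h_eW[OF x] v_def r_def less_imp_le)
    qed
    have 2: "\<bar>f (v t) - f y - F y * R t\<bar> \<le> e * \<sigma> / 3"
    proof -
      have dZ: "((\<lambda>r. Zav r \<kappa> y) has_real_derivative \<kappa> (y \<star> u3 0 0 z)) (at z)" for z
        unfolding Zav_def by (rule oint_deriv) (intro u3_continuous C1_cM[OF C1_\<kappa>] y continuous_intros)
      have "\<bar>(f (y \<star> u3 0 0 (r t)) - F y * Zav (r t) \<kappa> y) - (f (y \<star> u3 0 0 0) - F y * Zav 0 \<kappa> y)\<bar> \<le> (Bk * e3) * \<bar>r t\<bar>"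
      proof (rule MVT_abs)
        show "((\<lambda>z. f (y \<star> u3 0 0 z) - F y * Zav z \<kappa> y) has_real_derivative f' (y \<star> u3 0 0 z) - F y * \<kappa> (y \<star> u3 0 0 z)) (at z)" for z
          by (rule DERIV_diff[OF hasZ_deriv[OF f y] DERIV_cmult[OF dZ]])
        fix z assume z: "\<bar>z\<bar> \<le> \<bar>r t\<bar>"
        have yz: "y \<star> u3 0 0 z \<in> M" using y by (simp add: act_M u3_SL)
        have "f' (y \<star> u3 0 0 z) - F y * \<kappa> (y \<star> u3 0 0 z) = \<kappa> (y \<star> u3 0 0 z) * (F (y \<star> u3 0 0 z) - F y)"
          using \<kappa>_pos[OF yz] by (simp add: F_def right_diff_distrib)
        also have "\<bar>\<dots>\<bar> \<le> Bk * e3"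
          by (rule abs_mult_le[OF Bk(2)[OF yz]]) (use near(3)[of 0 z t] z rt s in \<open>simp add: y_def\<close>)
        finally show "\<bar>f' (y \<star> u3 0 0 z) - F y * \<kappa> (y \<star> u3 0 0 z)\<bar> \<le> Bk * e3" .
      qed
      then have "\<bar>f (v t) - f y - F y * R t\<bar> \<le> (Bk * e3) * \<bar>r t\<bar>"
        using y by (simp add: v_def y_def[symmetric] R_def u3_zero act_one Zav_def algebra_simps)
      also have "\<dots> \<le> (Bk * e3) * (C2 * \<sigma>)"
        using rt \<sigma> Bk e3 by (intro mult_left_mono) (auto simp: C2_def distrib_right)
      also have "\<dots> = e * \<sigma> / 3" using Bk C2 by (simp add: e3_def)
      finally show ?thesis .
    qed
    have 3: "\<bar>F y * (R t - s * bt t x)\<bar> \<le> e * \<sigma> / 3"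
    proof -
      have "\<bar>F y * (R t - s * bt t x)\<bar> \<le> BF * (\<sigma> * (e2 * Q))" by (rule abs_mult_le[OF BF(2)[OF y] Rt])
      also have "\<dots> = e * \<sigma> / 3" using BF Q by (simp add: e2_def)
      finally show ?thesis .
    qed
    have 4: "\<sigma> * (bt t x / t * (f' (h t x) / \<kappa> (h t x))) = F y * (s * bt t x)"
      by (simp add: F_def y_def s_def mult_ac)
    show "\<bar>f (h t (x \<star> eW (\<sigma> / t))) - f (h t x) - \<sigma> * (bt t x / t * (f' (h t x) / \<kappa> (h t x)))\<bar> \<le> e * \<sigma>"
      unfolding 4 using 1 2 3 unfolding s_def[symmetric] y_def[symmetric] right_diff_distrib by linarith
  qed
qed

end

section \<open>Mixing for derivatives along the centre\<close>

context perturbed_measure begin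

lemma finite_\<mu>: "finite_measure \<mu>"
proof (rule finite_measureI)
  have "emeasure \<mu> (space \<mu>) = (\<integral>\<^sup>+x. ennreal (\<kappa> x) * indicator (space \<omega>) x \<partial>\<omega>)"
    using \<kappa>_measurable by (subst emeasure_density) auto
  also have "\<dots> = (\<integral>\<^sup>+x. ennreal (\<kappa> x) \<partial>\<omega>)" by (rule nn_integral_cong) simp
  also have "\<dots> = ennreal (\<integral>x. \<kappa> x \<partial>\<omega>)"
    using \<kappa>_pos by (intro nn_integral_eq_integral cM_integrable C1_cM C1_\<kappa> AE_I2) (simp add: space_\<omega> less_imp_le)
  finally show "emeasure \<mu> (space \<mu>) \<noteq> \<infinity>" by simp
qed

lemma h1_power: "x \<in> M \<Longrightarrow> (h 1 ^^ n) x = h (real n) x"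
  by (induction n) (simp_all add: h_0 h_add[symmetric] add.commute)

end

context sheared begin

text \<open>Multiplied by \<sigma>, the integral is up to a small error the change of the
  correlation when the argument of \<open>f\<close> after flowing is pre-translated by
  exp(\<sigma>W/t). Invariance of \<omega> moves this translation onto \<open>g\<close>, which
  hardly changes because the translation tends to 1.\<close>

lemma shear_integral:
  assumes f: "hasZ f f'" and g: "cM g"
  shows "((\<lambda>t. \<integral>x. bt t x / t * (f' (h t x) / \<kappa> (h t x)) * g x \<partial>\<omega>) \<longlongrightarrow> 0) at_top"
proof (rule tendstoI)
  fix e :: real assume e: "e > 0"
  note cf = hasZ_cM[OF f]
  have cF: "cM (\<lambda>x. f' x / \<kappa> x)" using \<kappa>_pos by (intro cM_divide cf C1_cM[OF C1_\<kappa>]) force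
  obtain Bf where Bf: "Bf > 0" "\<And>x. x \<in> M \<Longrightarrow> \<bar>f x\<bar> \<le> Bf" using cM_bounded[OF cf(1)] by blast
  obtain Bg where Bg: "Bg > 0" "\<And>x. x \<in> M \<Longrightarrow> \<bar>g x\<bar> \<le> Bg" using cM_bounded[OF g] by blast
  obtain \<sigma> t0 where st: "\<sigma> > 0" "t0 \<ge> 1" "\<And>t x. t \<ge> t0 \<Longrightarrow> x \<in> M \<Longrightarrow>
    \<bar>f (h t (x \<star> eW (\<sigma> / t))) - f (h t x) - \<sigma> * (bt t x / t * (f' (h t x) / \<kappa> (h t x)))\<bar> \<le> e / (4 * Bg) * \<sigma>"
    using shear_estimate[OF f, of "e / (4 * Bg)"] e Bg by auto
  obtain d where d: "d > 0" "\<And>x k. x \<in> M \<Longrightarrow> k \<in> SL \<Longrightarrow> norm (k - mat 1) < d \<Longrightarrow> \<bar>g (x \<star> k) - g x\<bar> < e * \<sigma> / (4 * Bf)"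
    using cM_uniform[OF g, of "e * \<sigma> / (4 * Bf)"] e st Bf by auto
  have "\<bar>\<integral>x. bt t x / t * (f' (h t x) / \<kappa> (h t x)) * g x \<partial>\<omega>\<bar> < e" if t: "t \<ge> max t0 (3 * \<sigma> / d)" for t
  proof -
    define k where "k = eW (\<sigma> / t)"
    have t1: "t \<ge> 1" using t st by simp
    have k: "k \<in> SL" by (simp add: k_def eW_SL)
    have nk: "norm (k - mat 1) < d"
    proof -
      have a: "\<sigma> / t > 0" using st t1 by simp
      have "\<bar>\<sigma> / t * w1\<bar> \<le> \<sigma> / t" "\<bar>\<sigma> / t * w2\<bar> \<le> \<sigma> / t"
        using abs_mult_le[of "\<sigma> / t" "\<sigma> / t" w1 1] abs_mult_le[of "\<sigma> / t" "\<sigma> / t" w2 1] a W by auto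
      then have "norm (k - mat 1) \<le> 2 * (\<sigma> / t)" unfolding k_def eW_def
        using norm_u3[of "\<sigma> / t * w1" "\<sigma> / t * w2" 0] by linarith
      moreover have "3 * (\<sigma> / t) \<le> d" using t d t1 by (simp add: field_simps)
      ultimately show ?thesis using a by linarith
    qed
    define \<phi> where "\<phi> x = f (h t x)" for x
    define \<psi> where "\<psi> x = bt t x / t * (f' (h t x) / \<kappa> (h t x))" for x
    have c\<phi>: "cM \<phi>" unfolding \<phi>_def by (rule cM_h[OF cf(1)])
    have c\<psi>: "cM \<psi>" unfolding \<psi>_def divide_inverse[of _ t] using cM_h[OF cF] by (intro cM_mult cM_bt cM_const) (simp add: divide_inverse)
    have c: "cM (\<lambda>x. \<phi> (x \<star> k) * g x)" "cM (\<lambda>x. \<phi> (x \<star> k) * g (x \<star> k))" "cM (\<lambda>x. \<phi> x * g x)" "cM (\<lambda>x. \<psi> x * g x)"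
      by (intro cM_intros c\<phi> c\<psi> g k)+
    note i = c[THEN cM_integrable]
    have 1: "(\<integral>x. \<phi> (x \<star> k) * g (x \<star> k) \<partial>\<omega>) = (\<integral>x. \<phi> x * g x \<partial>\<omega>)"
      by (rule integral_act[OF k cM_measurable[OF c(3)]])
    have 2: "\<bar>\<integral>x. \<phi> (x \<star> k) * g x - \<phi> (x \<star> k) * g (x \<star> k) \<partial>\<omega>\<bar> \<le> e * \<sigma> / 4"
    proof (rule integral_bounded)
      show "(\<lambda>x. \<phi> (x \<star> k) * g x - \<phi> (x \<star> k) * g (x \<star> k)) \<in> borel_measurable \<omega>"
        by (intro cM_measurable cM_diff c)
      fix x assume x: "x \<in> M"
      have "\<bar>\<phi> (x \<star> k) * (g x - g (x \<star> k))\<bar> \<le> Bf * (e * \<sigma> / (4 * Bf))"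
        using d(2)[OF x k nk] Bf(2)[OF h_M[OF act_M[OF x k]], of t]
        by (intro abs_mult_le) (simp_all add: \<phi>_def abs_minus_commute less_imp_le)
      then show "\<bar>\<phi> (x \<star> k) * g x - \<phi> (x \<star> k) * g (x \<star> k)\<bar> \<le> e * \<sigma> / 4"
        using Bf(1) by (simp add: right_diff_distrib)
    qed
    have 3: "\<bar>\<integral>x. \<phi> (x \<star> k) * g x - \<phi> x * g x - \<sigma> * (\<psi> x * g x) \<partial>\<omega>\<bar> \<le> e * \<sigma> / 4"
    proof (rule integral_bounded)
      show "(\<lambda>x. \<phi> (x \<star> k) * g x - \<phi> x * g x - \<sigma> * (\<psi> x * g x)) \<in> borel_measurable \<omega>"
        by (intro cM_measurable cM_diff cM_mult[OF cM_const] c)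
      fix x assume x: "x \<in> M"
      have "\<bar>(\<phi> (x \<star> k) - \<phi> x - \<sigma> * \<psi> x) * g x\<bar> \<le> (e / (4 * Bg) * \<sigma>) * Bg"
        using st(3)[OF _ x, of t] t by (intro abs_mult_le Bg(2) x) (simp add: \<phi>_def \<psi>_def k_def)
      then show "\<bar>\<phi> (x \<star> k) * g x - \<phi> x * g x - \<sigma> * (\<psi> x * g x)\<bar> \<le> e * \<sigma> / 4"
        using Bg(1) by (simp add: algebra_simps)
    qed
    have "\<sigma> * (\<integral>x. \<psi> x * g x \<partial>\<omega>) = (\<integral>x. \<phi> (x \<star> k) * g x - \<phi> (x \<star> k) * g (x \<star> k) \<partial>\<omega>)
      - (\<integral>x. \<phi> (x \<star> k) * g x - \<phi> x * g x - \<sigma> * (\<psi> x * g x) \<partial>\<omega>)"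
      using i 1 by simp
    then have "\<bar>\<sigma> * (\<integral>x. \<psi> x * g x \<partial>\<omega>)\<bar> \<le> e * \<sigma> / 4 + e * \<sigma> / 4"
      using 2 3 by linarith
    then have "\<sigma> * \<bar>\<integral>x. \<psi> x * g x \<partial>\<omega>\<bar> \<le> \<sigma> * (e / 2)"
      using st(1) by (simp add: abs_mult mult.commute)
    then have "\<bar>\<integral>x. \<psi> x * g x \<partial>\<omega>\<bar> \<le> e / 2" using st(1) mult_le_cancel_left_pos by blast
    then show ?thesis using e by (simp add: \<psi>_def)
  qed
  then show "\<forall>\<^sub>F t in at_top. dist (\<integral>x. bt t x / t * (f' (h t x) / \<kappa> (h t x)) * g x \<partial>\<omega>) 0 < e"
    unfolding eventually_at_top_linorder dist_real_def by (intro exI[of _ "max t0 (3 * \<sigma> / d)"]) simp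
qed

lemma bt_add: assumes x: "x \<in> M" shows "bt (s + t) x = bt s x + bt t (h s x)"
proof -
  have "((\<lambda>t. bt (s + t) x - bt t (h s x)) has_real_derivative 0) (at t)" for t
  proof -
    have "((\<lambda>t. bt (t + s) x) has_real_derivative G (h (t + s) x)) (at t)"
      by (rule DERIV_shift[THEN iffD1, OF bt_deriv[OF x]])
    moreover have "((\<lambda>t. bt t (h s x)) has_real_derivative G (h (t + s) x)) (at t)"
      using bt_deriv[OF h_M[OF x], of s t] by (simp add: h_add[OF x])
    ultimately have "((\<lambda>t. bt (t + s) x - bt t (h s x)) has_real_derivative G (h (t + s) x) - G (h (t + s) x)) (at t)"
      by (rule DERIV_diff)
    then show ?thesis by (simp add: add.commute)
  qed
  then have "bt (s + t) x - bt t (h s x) = bt (s + 0) x - bt 0 (h s x)"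
    using DERIV_isconst_all[of "\<lambda>t. bt (s + t) x - bt t (h s x)"] by blast
  then show ?thesis by simp
qed

text \<open>The strict bound on W\<beta> makes \<open>c + W\<beta>'\<close> keep the sign of
  \<open>c\<close>, so multiplication by \<open>sgn c\<close> makes the integrand uniformly
  positive.\<close>

lemma bt_lower:
  obtains g0 where "g0 > 0" "\<And>x t. x \<in> M \<Longrightarrow> g0 * \<bar>t\<bar> \<le> \<bar>bt t x\<bar>"
proof -
  obtain l0 where l0: "l0 > 0" "\<And>x. x \<in> M \<Longrightarrow> l0 \<le> \<kappa> x" using cM_pos_lower[OF C1_cM[OF C1_\<kappa>] \<kappa>_pos] by blast
  define g0 where "g0 = l0 * (\<bar>c\<bar> - b)"
  have g0: "g0 > 0" using l0 b_less by (simp add: g0_def)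
  have b0: "b \<ge> 0" using W\<beta> M_not_empty by force
  have c0: "c \<noteq> 0" using b0 b_less by auto
  have low: "g0 \<le> sgn c * G x" if x: "x \<in> M" for x
  proof -
    have "\<bar>c\<bar> - b \<le> sgn c * (c + W\<beta>' x)"
      using W\<beta>[OF x] c0 by (cases "c > 0") (auto simp: sgn_if distrib_left)
    moreover have "0 \<le> \<kappa> x" using \<kappa>_pos[OF x] by simp
    ultimately have "l0 * (\<bar>c\<bar> - b) \<le> \<kappa> x * (sgn c * (c + W\<beta>' x))"
      using l0(2)[OF x] b_less by (intro mult_mono) auto
    then show ?thesis by (simp add: g0_def G_def mult.left_commute)
  qed
  show ?thesis
  proof (rule that[OF g0])
    fix x t assume x: "x \<in> M"
    have "g0 * \<bar>t\<bar> \<le> \<bar>oint (\<lambda>s. sgn c * G (h s x)) t\<bar>"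
      using g0 low h_M[OF x] by (intro oint_lower continuous_intros h_continuous[OF cM_G x]) auto
    also have "oint (\<lambda>s. sgn c * G (h s x)) t = sgn c * bt t x" by (simp add: bt_def oint_def)
    also have "\<bar>sgn c * bt t x\<bar> = \<bar>bt t x\<bar>" using c0 by (simp add: abs_mult abs_sgn_eq)
    finally show "g0 * \<bar>t\<bar> \<le> \<bar>bt t x\<bar>" .
  qed
qed

text \<open>
  The slopes \<open>bt t x / t\<close> are Birkhoff averages, so by the mean ergodic theorem they may be replaced by a
  single continuous function without zeros, which is then absorbed into \<open>g\<close>.
\<close>
lemma Z_mixing:
  assumes f: "hasZ f f'" and g: "cM g"
  shows "((\<lambda>t. \<integral>x. f' (h t x) / \<kappa> (h t x) * g x \<partial>\<omega>) \<longlongrightarrow> 0) at_top"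
proof (rule tendstoI)
  fix e :: real assume e: "e > 0"
  define F where "F x = f' x / \<kappa> x" for x
  have cF: "cM F" unfolding F_def using \<kappa>_pos by (intro cM_divide hasZ_cM[OF f] C1_cM[OF C1_\<kappa>]) force
  obtain F0 where F0: "F0 > 0" "\<And>x. x \<in> M \<Longrightarrow> \<bar>F x\<bar> \<le> F0" using cM_bounded[OF cF] by blast
  obtain Bg where Bg: "Bg > 0" "\<And>x. x \<in> M \<Longrightarrow> \<bar>g x\<bar> \<le> Bg" using cM_bounded[OF g] by blast
  obtain CG where CG: "CG > 0" "\<And>x. x \<in> M \<Longrightarrow> \<bar>G x\<bar> \<le> CG" using cM_bounded[OF cM_G] by blast
  obtain l0 where l0: "l0 > 0" "\<And>x. x \<in> M \<Longrightarrow> l0 \<le> \<kappa> x" using cM_pos_lower[OF C1_cM[OF C1_\<kappa>] \<kappa>_pos] by blast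
  obtain g0 where g0: "g0 > 0" "\<And>x t. x \<in> M \<Longrightarrow> g0 * \<bar>t\<bar> \<le> \<bar>bt t x\<bar>" using bt_lower by blast
  have lip: "\<bar>bt s x - bt t x\<bar> \<le> CG * \<bar>s - t\<bar>" if x: "x \<in> M" for s t x
  proof -
    have "norm (bt s x - bt t x) \<le> CG * norm (s - t)"
      by (rule field_differentiable_bound[of UNIV _ "\<lambda>s. G (h s x)"])
         (use CG(2)[OF h_M[OF x]] bt_deriv[OF x] in auto)
    then show ?thesis by simp
  qed
  \<comment> \<open>A bound for \<open>F (h t x) * gB x\<close>, where \<open>gB\<close> is
    \<open>g\<close> divided by a slope of absolute value at least \<open>g0\<close>.\<close>
  define K0 where "K0 = F0 * (Bg / g0)"
  have K0: "K0 > 0" using F0 Bg g0 by (simp add: K0_def)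
  \<comment> \<open>The ergodic theorem is applied to the time-one map and to \<open>bt 1\<close>;
    by the cocycle relation the averages are \<open>bt n / n\<close>.\<close>
  interpret P: measure_preserving_map \<mu> "h 1"
    using finite_\<mu> preserved
    by (simp add: measure_preserving_map_def measure_preserving_map_axioms_def preserves_measure_def)
  have av: "P.avg n (bt 1) x = bt (real n) x / real n" if x: "x \<in> M" for n x
  proof -
    have "(\<Sum>j<n. bt 1 ((h 1 ^^ j) x)) = bt (real n) x"
    proof (induction n)
      case (Suc n)
      have "bt (real (Suc n)) x = bt (real n) x + bt 1 (h (real n) x)" using bt_add[OF x, of "real n" 1] by (simp add: add.commute)
      then show ?case using Suc by (simp add: h1_power x)
    qed simp
    then show ?thesis by (simp add: P.avg_def)
  qed
  have "\<bar>bt 1 x\<bar> \<le> CG" if "x \<in> space \<mu>" for x using lip[of x 1 0] that by (simp add: space_\<omega>)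
  moreover have "bt 1 \<in> borel_measurable \<mu>" using cM_measurable[OF cM_bt] by simp
  \<comment> \<open>The factor \<open>l0\<close> turns closeness in mean for \<mu> into closeness in
    mean for \<omega>.\<close>
  ultimately obtain N where N: "N > 0" "\<And>m n. m \<ge> N \<Longrightarrow> n \<ge> N \<Longrightarrow>
      (\<integral>x. \<bar>P.avg m (bt 1) x - P.avg n (bt 1) x\<bar> \<partial>\<mu>) < l0 * (e / (4 * K0))"
    using P.mean_ergodic_cauchy_L1[of "bt 1" CG "l0 * (e / (4 * K0))"] e l0 K0 by auto
  define A where "A n x = bt (real n) x / real n" for n x
  have cA: "cM (A n)" for n unfolding A_def divide_inverse by (intro cM_mult cM_bt cM_const)
  have close: "(\<integral>x. \<bar>A N x - A n x\<bar> \<partial>\<omega>) \<le> e / (4 * K0)" if n: "n \<ge> N" for n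
  proof -
    define u where "u x = \<bar>A N x - A n x\<bar>" for x
    have cu: "cM u" unfolding u_def by (intro cM_intros cA)
    have "(\<integral>x. u x \<partial>\<mu>) = (\<integral>x. \<bar>P.avg N (bt 1) x - P.avg n (bt 1) x\<bar> \<partial>\<mu>)"
      by (rule Bochner_Integration.integral_cong) (simp_all add: u_def A_def av space_\<omega>)
    then have 1: "(\<integral>x. u x * \<kappa> x \<partial>\<omega>) < l0 * (e / (4 * K0))"
      using N(2)[OF order_refl n] integral_\<mu>[OF cM_measurable[OF cu]] by simp
    have "l0 * (\<integral>x. u x \<partial>\<omega>) = (\<integral>x. u x * l0 \<partial>\<omega>)" by (simp add: mult.commute)
    also have "\<dots> \<le> (\<integral>x. u x * \<kappa> x \<partial>\<omega>)"
      by (intro integral_mono cM_integrable cM_intros cu C1_cM[OF C1_\<kappa>] mult_left_mono) (auto simp: space_\<omega> l0 u_def)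
    finally have "l0 * (\<integral>x. u x \<partial>\<omega>) \<le> l0 * (e / (4 * K0))" using 1 by linarith
    then show ?thesis using l0(1) mult_le_cancel_left_pos unfolding u_def by blast
  qed
  have Apos: "g0 \<le> \<bar>A N x\<bar>" if "x \<in> M" for x
    using g0(2)[OF that, of "real N"] N(1) by (simp add: A_def pos_le_divide_eq)
  have An0: "A N x \<noteq> 0" if "x \<in> M" for x using Apos[OF that] g0 by auto
  define gB where "gB x = g x / A N x" for x
  have cgB: "cM gB" unfolding gB_def by (intro cM_divide g cA An0)
  have gBb: "\<bar>gB x\<bar> \<le> Bg / g0" if "x \<in> M" for x
    unfolding gB_def abs_divide using Bg Apos[OF that] g0 that by (intro frac_le) auto
  have "\<forall>\<^sub>F t in at_top. \<bar>\<integral>x. bt t x / t * F (h t x) * gB x \<partial>\<omega>\<bar> < e / 2"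
    using tendstoD[OF shear_integral[OF f cgB], of "e / 2"] e by (simp add: F_def)
  \<comment> \<open>The first bound makes the integer part of \<open>t\<close> at least
    \<open>N\<close>; the second brings the error \<open>2 * CG / t\<close> of replacing
    \<open>t\<close> by its integer part below \<open>e / (4 * K0)\<close>.\<close>
  moreover have "\<forall>\<^sub>F t in at_top. t \<ge> max (real N + 1) (8 * K0 * CG / e)" by (rule eventually_ge_at_top)
  ultimately show "\<forall>\<^sub>F t in at_top. dist (\<integral>x. f' (h t x) / \<kappa> (h t x) * g x \<partial>\<omega>) 0 < e"
  proof eventually_elim
    case (elim t)
    define n where "n = nat \<lfloor>t\<rfloor>"
    have t: "t \<ge> real N + 1" "t \<ge> 8 * K0 * CG / e" using elim by auto
    have nt: "real n \<le> t" "t \<le> real n + 1" "n \<ge> N" "n > 0" using t N(1) unfolding n_def by linarith+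
    have t0: "t > 0" using t by linarith
    have slope: "\<bar>A n x - bt t x / t\<bar> \<le> e / (4 * K0)" if x: "x \<in> M" for x
    proof -
      have s1: "\<bar>bt n x - bt t x\<bar> \<le> CG * 1" using lip[OF x, of "real n" t] nt CG
        by (intro order_trans[OF lip[OF x]] mult_left_mono) auto
      have s2: "A n x - bt t x / t = (bt n x * (t - real n) / real n + (bt n x - bt t x)) / t"
        using nt t0 by (simp add: A_def field_simps)
      have s3: "\<bar>bt n x * (t - real n) / real n\<bar> \<le> CG"
      proof -
        have "\<bar>bt n x * (t - real n)\<bar> \<le> (CG * real n) * 1"
          using nt lip[OF x, of "real n" 0] by (intro abs_mult_le) auto
        then show ?thesis using nt(4) by (simp add: abs_divide pos_divide_le_eq)
      qed
      have "\<bar>bt n x * (t - real n) / real n + (bt n x - bt t x)\<bar> \<le> 2 * CG" using s1 s3 by linarith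
      then have "\<bar>A n x - bt t x / t\<bar> \<le> (2 * CG) / t"
        unfolding s2 abs_divide using t0 by (simp add: divide_right_mono)
      also have "\<dots> \<le> e / (4 * K0)"
        using t(2) t0 e K0 by (simp add: field_simps)
      finally show ?thesis .
    qed
    define D where "D x = \<bar>A N x - bt t x / t\<bar>" for x
    have cbt: "cM (\<lambda>x. bt t x / t)" unfolding divide_inverse by (intro cM_mult cM_bt cM_const)
    have cD: "cM D" unfolding D_def by (intro cM_intros cA cbt)
    have "(\<integral>x. D x \<partial>\<omega>) \<le> (\<integral>x. \<bar>A N x - A n x\<bar> + e / (4 * K0) \<partial>\<omega>)"
    proof (intro integral_mono cM_integrable cM_intros cD cA)
      fix x assume "x \<in> space \<omega>"
      then show "D x \<le> \<bar>A N x - A n x\<bar> + e / (4 * K0)" using slope[of x] by (simp add: D_def space_\<omega>)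
    qed
    also have "\<dots> = (\<integral>x. \<bar>A N x - A n x\<bar> \<partial>\<omega>) + e / (4 * K0)"
      using cM_integrable[OF cM_abs[OF cM_diff[OF cA cA]]] by (simp add: space_\<omega> measure_\<omega>)
    also have "\<dots> \<le> e / (4 * K0) + e / (4 * K0)" using close[OF nt(3)] by simp
    finally have Dl: "K0 * (\<integral>x. D x \<partial>\<omega>) \<le> e / 2" using K0 by (simp add: field_simps)
    define I where "I x = F (h t x) * (A N x - bt t x / t) * gB x" for x
    have cI: "cM I" unfolding I_def by (intro cM_intros cA cbt cgB cM_h[OF cF])
    have cJ: "cM (\<lambda>x. bt t x / t * F (h t x) * gB x)" by (intro cM_intros cbt cgB cM_h[OF cF])
    have "\<bar>\<integral>x. I x \<partial>\<omega>\<bar> \<le> (\<integral>x. \<bar>I x\<bar> \<partial>\<omega>)" by (rule integral_abs_bound)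
    also have "\<dots> \<le> (\<integral>x. K0 * D x \<partial>\<omega>)"
    proof (intro integral_mono cM_integrable cM_intros cI cD)
      fix x assume "x \<in> space \<omega>"
      then have x: "x \<in> M" by (simp add: space_\<omega>)
      have "\<bar>F (h t x) * (A N x - bt t x / t) * gB x\<bar> \<le> F0 * D x * (Bg / g0)"
        by (intro abs_mult_le F0 gBb x h_M) (simp add: D_def)
      then show "\<bar>I x\<bar> \<le> K0 * D x" by (simp add: I_def K0_def mult_ac)
    qed
    also have "\<dots> \<le> e / 2" using Dl by simp
    finally have 2: "\<bar>\<integral>x. I x \<partial>\<omega>\<bar> \<le> e / 2" .
    have "(\<integral>x. F (h t x) * g x \<partial>\<omega>) = (\<integral>x. bt t x / t * F (h t x) * gB x + I x \<partial>\<omega>)"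
    proof (rule Bochner_Integration.integral_cong)
      fix x assume "x \<in> space \<omega>"
      then have "g x = A N x * gB x" using An0 by (simp add: gB_def space_\<omega>)
      then show "F (h t x) * g x = bt t x / t * F (h t x) * gB x + I x"
        by (simp only: I_def) (simp add: algebra_simps)
    qed simp
    also have "\<dots> = (\<integral>x. bt t x / t * F (h t x) * gB x \<partial>\<omega>) + (\<integral>x. I x \<partial>\<omega>)"
      using cM_integrable[OF cI] cM_integrable[OF cJ] by simp
    finally show ?case using elim(1) 2 by (simp add: F_def)
  qed
qed

end

section \<open>The Mautner phenomenon\<close>

definition em :: "3 \<Rightarrow> 3 \<Rightarrow> real \<Rightarrow> real^3^3" where "em i j s = mat 1 + s *\<^sub>R E i j"

text \<open>A diagonal subgroup whose conjugation scales every elementary matrix: by t or 1/t next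
  to the diagonal and by the square of that factor in the two corners.\<close>

definition dg :: "real \<Rightarrow> real^3^3" where
  "dg t = vector [vector [t, 0, 0], vector [0, 1, 0], vector [0, 0, 1 / t]]"

definition blk :: "real \<Rightarrow> real \<Rightarrow> real \<Rightarrow> real \<Rightarrow> real^3^3" where
  "blk p q r s = vector [vector [1, 0, 0], vector [0, p, q], vector [0, r, s]]"

lemmas mat3_simps = vec_eq_iff forall_3 matrix_matrix_mult_def sum_3 mat_def E_def

lemma em_SL: assumes "i \<noteq> j" shows "em i j s \<in> SL"
  using assms exhaust_3[of i] exhaust_3[of j]
  by (auto simp: em_def carrier_SL3 det_3 mat_def E_def)

lemma dg_SL: "t \<noteq> 0 \<Longrightarrow> dg t \<in> SL" by (simp add: dg_def carrier_SL3 det_3)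

lemma minv_em: assumes "i \<noteq> j" shows "minv (em i j s) = em i j (- s)"
proof (rule minv_eqI[OF em_SL[OF assms]])
  show "em i j (- s) ** em i j s = mat 1"
    using assms exhaust_3[of i] exhaust_3[of j] by (auto simp: em_def mat3_simps)
qed

lemma minv_dg: "t \<noteq> 0 \<Longrightarrow> minv (dg t) = dg (1 / t)"
  by (rule minv_eqI[OF dg_SL]) (simp_all add: dg_def mat3_simps)

text \<open>Gaussian elimination. A nonzero entry in position (2,1) lets one row operation make the
  corner entry 1, after which row and column are cleared. Inverses of elementary matrices are
  elementary, so closure under products suffices.\<close>

lemma elementary_generation:
  assumes mult: "\<And>a b. a \<in> P \<Longrightarrow> b \<in> P \<Longrightarrow> a ** b \<in> P" and em: "\<And>i j s. i \<noteq> j \<Longrightarrow> em i j s \<in> P"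
    and g: "g \<in> SL"
  shows "g \<in> P"
proof -
  \<comment> \<open>With a nonzero lower left entry, a 2 by 2 matrix of determinant 1 is a product
    of three elementary ones.\<close>
  have blk1: "blk p q r s \<in> P" if "r \<noteq> 0" "p * s - q * r = 1" for p q r s
  proof -
    define x y where "x = (p - 1) / r" and "y = (s - 1) / r"
    have p: "p = 1 + x * r" and s: "s = 1 + r * y" using that(1) by (simp_all add: x_def y_def)
    have "r * q = r * (x + y + x * r * y)" using that(2) unfolding p s by (simp add: algebra_simps)
    then have q: "q = x + y + x * r * y" using that(1) by simp
    have "blk p q r s = em 2 3 x ** em 3 2 r ** em 2 3 y"
      unfolding p q s by (simp add: blk_def em_def mat3_simps algebra_simps)
    then show ?thesis using mult em by simp
  qed
  have blk: "blk p q r s \<in> P" if d: "p * s - q * r = 1" for p q r s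
  proof (cases "r = 0")
    case True
    then have p: "p \<noteq> 0" using d by auto
    have "blk p q r s = em 3 2 (- 1) ** blk p q p (s + q)"
      using True by (simp add: blk_def em_def mat3_simps)
    moreover have "blk p q p (s + q) \<in> P" using blk1[OF p, of p "s + q" q] d True by (simp add: algebra_simps)
    ultimately show ?thesis using mult em[of 3 2] by simp
  qed (use blk1 d in blast)
  have one: "g \<in> P" if g: "g \<in> SL" "g$1$1 = 1" for g
  proof -
    define p q r s where "p = g$2$2 - g$2$1 * g$1$2" and "q = g$2$3 - g$2$1 * g$1$3"
      and "r = g$3$2 - g$3$1 * g$1$2" and "s = g$3$3 - g$3$1 * g$1$3"
    have "g = em 2 1 (g$2$1) ** em 3 1 (g$3$1) ** blk p q r s ** em 1 2 (g$1$2) ** em 1 3 (g$1$3)"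
      using g(2) by (simp add: blk_def em_def mat3_simps p_def q_def r_def s_def)
    moreover have "p * s - q * r = 1"
      using g by (simp add: carrier_SL3 det_3 p_def q_def r_def s_def algebra_simps)
    moreover have "em 2 1 (g$2$1) ** em 3 1 (g$3$1) ** blk p q r s ** em 1 2 (g$1$2) ** em 1 3 (g$1$3) \<in> P"
      if "p * s - q * r = 1" by (intro mult em blk that) auto
    ultimately show ?thesis by metis
  qed
  have two: "g \<in> P" if g: "g \<in> SL" "g$2$1 \<noteq> 0" for g
  proof -
    define s where "s = (1 - g$1$1) / g$2$1"
    define g' where "g' = em 1 2 s ** g"
    have "g' \<in> SL" using g by (simp add: g'_def SL_mult em_SL)
    moreover have "g' $ 1 $ 1 = 1" using g(2) by (simp add: g'_def em_def mat3_simps s_def)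
    ultimately have "g' \<in> P" using one by blast
    moreover have "g = em 1 2 (- s) ** g'"
      using minv_cancel(2)[OF em_SL, of 1 2 s g] by (simp add: minv_em g'_def)
    ultimately show ?thesis using mult em[of 1 2] by simp
  qed
  have three: "g \<in> P" if g: "g \<in> SL" "g$1$1 \<noteq> 0" for g
  proof (cases "g$2$1 = 0")
    case True
    define g' where "g' = em 2 1 1 ** g"
    have "g' \<in> SL" using g by (simp add: g'_def SL_mult em_SL)
    moreover have "g' $ 2 $ 1 \<noteq> 0" using g(2) True by (simp add: g'_def em_def mat3_simps)
    ultimately have "g' \<in> P" using two by blast
    moreover have "g = em 2 1 (- 1) ** g'"
      using minv_cancel(2)[OF em_SL, of 2 1 1 g] by (simp add: minv_em g'_def)
    ultimately show ?thesis using mult em[of 2 1] by simp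
  qed (use g two in blast)
  show ?thesis
  proof (cases "g$1$1 = 0")
    case True
    show ?thesis
    proof (cases "g$2$1 = 0")
      case F: True
      have g3: "g$3$1 \<noteq> 0" using g True F by (auto simp: carrier_SL3 det_3)
      define g' where "g' = em 1 3 1 ** g"
      have "g' \<in> SL" using g by (simp add: g'_def SL_mult em_SL)
      moreover have "g' $ 1 $ 1 \<noteq> 0" using g3 True by (simp add: g'_def em_def mat3_simps)
      ultimately have "g' \<in> P" using three by blast
      moreover have "g = em 1 3 (- 1) ** g'"
        using minv_cancel(2)[OF em_SL, of 1 3 1 g] by (simp add: minv_em g'_def)
      ultimately show ?thesis using mult em[of 1 3] by simp
    qed (use g two in blast)
  qed (use g three in blast)
qed

text \<open>The Mautner argument in abstract form: \<open>N g\<close> stands for the mean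
  displacement of a bounded function under translation by \<open>g\<close>, and
  \<open>Z_zero\<close> says that the function is invariant under exp Z.\<close>

locale length_function =
  fixes N :: "real^3^3 \<Rightarrow> real"
  assumes nonneg: "g \<in> SL \<Longrightarrow> 0 \<le> N g"
    and mult_le: "g \<in> SL \<Longrightarrow> k \<in> SL \<Longrightarrow> N (g ** k) \<le> N g + N k"
    and inv_eq: "g \<in> SL \<Longrightarrow> N (minv g) = N g"
    and continuous_one: "e > 0 \<Longrightarrow> \<exists>d>0. \<forall>g\<in>SL. norm (g - mat 1) < d \<longrightarrow> N g < e"
    and Z_zero: "N (em 1 3 1) = 0"
begin

lemma zero_mult: "g \<in> SL \<Longrightarrow> k \<in> SL \<Longrightarrow> N g = 0 \<Longrightarrow> N k = 0 \<Longrightarrow> N (g ** k) = 0"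
  using mult_le[of g k] nonneg[OF SL_mult, of g k] by simp

lemma zero_conj: assumes "a \<in> SL" "k \<in> SL" "N a = 0" shows "N (a ** k ** minv a) \<le> N k"
  using mult_le[of "a ** k" "minv a"] mult_le[of a k] assms by (simp add: SL_mult minv inv_eq)

lemma em_tendsto:
  assumes ij: "i \<noteq> j" and s: "s \<longlonglongrightarrow> 0" shows "(\<lambda>n. N (em i j (s n))) \<longlonglongrightarrow> 0"
proof (rule LIMSEQ_I)
  fix e :: real assume "e > 0"
  then obtain d where d: "d > 0" "\<forall>g\<in>SL. norm (g - mat 1) < d \<longrightarrow> N g < e" using continuous_one by blast
  obtain n0 where n0: "\<And>n. n \<ge> n0 \<Longrightarrow> \<bar>s n\<bar> < d" using LIMSEQ_D[OF s d(1)] by auto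
  show "\<exists>no. \<forall>n\<ge>no. norm (N (em i j (s n)) - 0) < e"
  proof (intro exI[of _ n0] allI impI)
    fix n assume "n \<ge> n0"
    then have "norm (em i j (s n) - mat 1) < d" using n0 by (simp add: em_def norm_E)
    then show "norm (N (em i j (s n)) - 0) < e" using d(2) em_SL[OF ij] nonneg[OF em_SL[OF ij]] by simp
  qed
qed

text \<open>Only natural multiples: the averages are taken along the powers of exp Z, so invariance
  is at first known for these alone.\<close>

lemma Z_power: "N (em 1 3 (real n)) = 0"
proof (induction n)
  case 0
  have "N (mat 1) < e" if "e > 0" for e
    using continuous_one[OF that] SL_one by (metis diff_self norm_zero)
  then have "N (mat 1) \<le> 0" by (meson not_le less_irrefl)
  then show ?case using nonneg[OF SL_one] by (simp add: em_def)
next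
  case (Suc n)
  have "em 1 3 (real (Suc n)) = em 1 3 (real n) ** em 1 3 1" by (simp add: em_def mat3_simps)
  then show ?case using Suc Z_zero zero_mult[OF em_SL em_SL] by simp
qed

text \<open>The diagonal element is a limit of products \<open>z g z'\<close> with \<open>g \<rightarrow> 1\<close> and \<open>z, z'\<close> powers of \<open>exp Z\<close>.\<close>
lemma dg2_zero: "N (dg 2) = 0"
proof -
  have b: "N (dg 2) \<le> N (em 3 1 (1 / (2 * real (Suc n)))) + N (em 3 1 (- (1 / real (Suc n))))" for n
  proof -
    define m where "m = real (Suc n)"
    have m: "m > 0" by (simp add: m_def)
    \<comment> \<open>Both \<open>2 * m\<close> and \<open>m\<close> are integers, so the two upper
      factors have length zero, while the lower ones tend to 1.\<close>
    have e: "dg 2 = em 1 3 (2 * m) ** em 3 1 (1 / (2 * m)) ** em 1 3 (- m) ** em 3 1 (- (1 / m))"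
      using m by (simp add: dg_def em_def mat3_simps field_simps)
    have z1: "N (em 1 3 (2 * m)) = 0" using Z_power[of "2 * Suc n"] by (simp add: m_def)
    have z2: "N (em 1 3 (- m)) = 0" using Z_power[of "Suc n"] inv_eq[OF em_SL, of 1 3 m] by (simp add: m_def minv_em)
    have S: "em 1 3 r \<in> SL" "em 3 1 r \<in> SL" for r by (simp_all add: em_SL)
    have "N (dg 2) \<le> N (em 1 3 (2 * m)) + N (em 3 1 (1 / (2 * m))) + N (em 1 3 (- m)) + N (em 3 1 (- (1 / m)))"
      unfolding e
      using mult_le[OF SL_mult[OF SL_mult[OF S(1) S(2)] S(1)] S(2), of "2 * m" "1 / (2 * m)" "- m" "- (1 / m)"]
        mult_le[OF SL_mult[OF S(1) S(2)] S(1), of "2 * m" "1 / (2 * m)" "- m"]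
        mult_le[OF S(1) S(2), of "2 * m" "1 / (2 * m)"] by linarith
    then show ?thesis using z1 z2 by (simp add: m_def)
  qed
  have l: "(\<lambda>n. 1 / real (Suc n)) \<longlonglongrightarrow> 0" using LIMSEQ_inverse_real_of_nat by (simp add: inverse_eq_divide)
  have "(\<lambda>n. (1 / 2) * (1 / real (Suc n))) \<longlonglongrightarrow> (1 / 2) * 0" by (rule tendsto_mult_left[OF l])
  then have l1: "(\<lambda>n. 1 / (2 * real (Suc n))) \<longlonglongrightarrow> 0" by simp
  have l2: "(\<lambda>n. - (1 / real (Suc n))) \<longlonglongrightarrow> 0" using tendsto_minus[OF l] by simp
  have "(\<lambda>n. N (em 3 1 (1 / (2 * real (Suc n)))) + N (em 3 1 (- (1 / real (Suc n))))) \<longlonglongrightarrow> 0 + 0"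
    by (intro tendsto_add em_tendsto l1 l2) auto
  then have "N (dg 2) \<le> 0 + 0" by (rule LIMSEQ_le_const) (use b in blast)
  then show ?thesis using nonneg[OF dg_SL, of 2] by simp
qed

lemma dg_zero: "N (dg (2 ^ n)) = 0" "N (dg (1 / 2 ^ n)) = 0"
proof -
  show 1: "N (dg (2 ^ n)) = 0"
  proof (induction n)
    case 0
    have "dg 1 = em 1 3 0" by (simp add: dg_def em_def mat3_simps)
    then show ?case using Z_power[of 0] by simp
  next
    case (Suc n)
    have "dg (2 ^ Suc n) = dg 2 ** dg (2 ^ n)" by (simp add: dg_def mat3_simps)
    then show ?case using Suc dg2_zero zero_mult[OF dg_SL dg_SL, of 2 "2 ^ n"] by simp
  qed
  show "N (dg (1 / 2 ^ n)) = 0" using 1 inv_eq[OF dg_SL, of "2 ^ n"] by (simp add: minv_dg)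
qed

text \<open>Conjugation by diagonal elements of length zero does not increase the length, and it
  relates \<open>em i j s\<close> to elementary matrices whose parameter tends to 0. Position (i,j)
  decides between the diagonal element and its inverse.\<close>

lemma em_zero: assumes ij: "i \<noteq> j" shows "N (em i j s) = 0"
proof -
  have contract: "\<exists>a. a \<in> SL \<and> N a = 0 \<and> em i j s = a ** em i j (s / 2 ^ n) ** minv a
    \<or> a \<in> SL \<and> N a = 0 \<and> em i j s = a ** em i j (s / 2 ^ n / 2 ^ n) ** minv a" for n
  proof -
    define T :: real where "T = 2 ^ n"
    have T: "T \<noteq> 0" by (simp add: T_def)
    have a: "dg T \<in> SL" "dg (1 / T) \<in> SL" "minv (dg T) = dg (1 / T)" "minv (dg (1 / T)) = dg T"
      using T by (simp_all add: dg_SL minv_dg)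
    have z: "N (dg T) = 0" "N (dg (1 / T)) = 0" using dg_zero[of n] by (simp_all add: T_def)
    have e: "em 1 2 s = dg T ** em 1 2 (s / T) ** dg (1 / T)" "em 2 3 s = dg T ** em 2 3 (s / T) ** dg (1 / T)"
      "em 2 1 s = dg (1 / T) ** em 2 1 (s / T) ** dg T" "em 3 2 s = dg (1 / T) ** em 3 2 (s / T) ** dg T"
      "em 1 3 s = dg T ** em 1 3 (s / T / T) ** dg (1 / T)" "em 3 1 s = dg (1 / T) ** em 3 1 (s / T / T) ** dg T"
      using T by (simp_all add: dg_def em_def mat3_simps)
    have "(i, j) = (1, 2) \<or> (i, j) = (2, 3) \<or> (i, j) = (2, 1) \<or> (i, j) = (3, 2) \<or> (i, j) = (1, 3) \<or> (i, j) = (3, 1)"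
      using ij exhaust_3[of i] exhaust_3[of j] by auto
    then show ?thesis unfolding T_def[symmetric] using e a z by (elim disjE) (metis prod.inject)+
  qed
  have b: "N (em i j s) \<le> N (em i j (s / 2 ^ n)) + N (em i j (s / 2 ^ n / 2 ^ n))" for n
    using contract[of n] zero_conj em_SL[OF ij] nonneg by (smt (verit))
  have l: "(\<lambda>n. (1 / 2 :: real) ^ n) \<longlonglongrightarrow> 0" by (rule LIMSEQ_realpow_zero) auto
  have "(\<lambda>n. s * (1 / 2) ^ n) \<longlonglongrightarrow> 0" by (rule tendsto_mult_right_zero[OF l])
  then have l1: "(\<lambda>n. s / 2 ^ n) \<longlonglongrightarrow> 0" by (simp add: power_divide)
  have "(\<lambda>n. (s / 2 ^ n) * (1 / 2) ^ n) \<longlonglongrightarrow> 0 * 0" by (rule tendsto_mult[OF l1 l])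
  then have l2: "(\<lambda>n. s / 2 ^ n / 2 ^ n) \<longlonglongrightarrow> 0" by (simp add: power_divide)
  have "(\<lambda>n. N (em i j (s / 2 ^ n)) + N (em i j (s / 2 ^ n / 2 ^ n))) \<longlonglongrightarrow> 0 + 0"
    by (intro tendsto_add em_tendsto ij l1 l2)
  then have "N (em i j s) \<le> 0 + 0" by (rule LIMSEQ_le_const) (use b in blast)
  then show ?thesis using nonneg[OF em_SL[OF ij], of s] by linarith
qed

lemma length_zero: assumes "g \<in> SL" shows "N g = 0"
proof -
  have "g \<in> {g \<in> SL. N g = 0}"
    by (rule elementary_generation[OF _ _ assms]) (auto simp: SL_mult zero_mult em_SL em_zero)
  then show ?thesis by simp
qed

end

section \<open>Ergodicity of the centre\<close>

text \<open>Left multiplication is an invertible linear map of the matrix space, and differentiable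
  images of null sets are null.\<close>

lemma AE_lborel_linear_image:
  assumes "AE a in lborel. Q a" "k \<in> SL"
  shows "negligible {a. \<not> Q (k ** a)}"
proof -
  obtain A where A: "{a. \<not> Q a} \<subseteq> A" "A \<in> null_sets lborel"
    using assms(1) unfolding eventually_ae_filter by auto
  then have "A \<in> null_sets lebesgue" using null_sets_completionI by blast
  then have "negligible A" by (simp add: negligible_iff_null_sets)
  then have n: "negligible {a. \<not> Q a}" using A(1) negligible_subset by blast
  have "(\<lambda>a. minv k ** a) differentiable_on {a. \<not> Q a}"
    by (intro bounded_linear_imp_differentiable_on bounded_linear_mmult_right)
  then have "negligible ((\<lambda>a. minv k ** a) ` {a. \<not> Q a})"
    by (rule negligible_differentiable_image_negligible[OF order_refl n])
  moreover have "{a. \<not> Q (k ** a)} \<subseteq> (\<lambda>a. minv k ** a) ` {a. \<not> Q a}"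
  proof
    fix a assume "a \<in> {a. \<not> Q (k ** a)}"
    then show "a \<in> (\<lambda>a. minv k ** a) ` {a. \<not> Q a}"
      using minv_cancel(2)[OF assms(2), of a] by (intro image_eqI[of _ _ "k ** a"]) auto
  qed
  ultimately show ?thesis by (rule negligible_subset)
qed

context haar begin

sublocale pair: pair_sigma_finite \<omega> "lborel :: (real^3^3) measure" ..

text \<open>Approximating the matrix by simple functions reduces joint measurability to finitely
  many fixed translations at a time; continuity of \<open>v\<close> passes to the limit.\<close>

lemma joint_measurable:
  assumes v: "cM v"
  shows "(\<lambda>z. if snd z \<in> GP then v (fst z \<star> nrm (snd z)) else 0) \<in> borel_measurable (\<omega> \<Otimes>\<^sub>M (lborel :: (real^3^3) measure))"
proof -
  let ?P = "\<omega> \<Otimes>\<^sub>M (lborel :: (real^3^3) measure)"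
  obtain S where S: "\<And>i. simple_function lborel (S i)" "\<And>a :: real^3^3. (\<lambda>i. S i a) \<longlonglongrightarrow> a"
    using borel_measurable_implies_sequence_metric[of "\<lambda>a. a" "lborel :: (real^3^3) measure" 0] by auto
  define nr where "nr a = (if a \<in> GP then nrm a else mat 1)" for a
  have nr: "nr a \<in> SL" for a by (simp add: nr_def nrm_SL SL_one)
  have GPm: "{z \<in> space ?P. snd z \<in> GP} \<in> sets ?P"
  proof -
    have "GP \<in> sets lborel" using open_GP by simp
    then have "snd -` GP \<inter> space ?P \<in> sets ?P" by (rule measurable_sets[OF measurable_snd])
    moreover have "snd -` GP \<inter> space ?P = {z \<in> space ?P. snd z \<in> GP}" by auto
    ultimately show ?thesis by simp
  qed
  have s: "(\<lambda>z. v (fst z \<star> nr (S i (snd z)))) \<in> borel_measurable ?P" for i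
  proof -
    have sm: "simple_function lborel (S i)" by (rule S)
    have fin: "finite (range (S i))" using simple_functionD(1)[OF sm] by simp
    have c: "S i \<in> measurable lborel (count_space (range (S i)))"
      using simple_functionD(2)[OF sm] by (simp add: measurable_count_space_eq2[OF fin])
    show ?thesis
    proof (rule measurable_compose_countable'[where f = "\<lambda>b z. v (fst z \<star> nr b)" and g = "\<lambda>z. S i (snd z)"])
      show "(\<lambda>z. v (fst z \<star> nr b)) \<in> borel_measurable ?P" for b
        using measurable_compose[OF measurable_fst cM_measurable[OF cM_act[OF v nr]]] .
      show "(\<lambda>z. S i (snd z)) \<in> measurable ?P (count_space (range (S i)))"
        by (rule measurable_compose[OF measurable_snd c])
      show "countable (range (S i))" using fin by (rule countable_finite)
    qed
  qed
  show ?thesis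
  proof (rule borel_measurable_LIMSEQ_real)
    show "(\<lambda>z. if snd z \<in> GP then v (fst z \<star> nr (S i (snd z))) else 0) \<in> borel_measurable ?P" for i
      by (rule measurable_If[OF s _ GPm]) simp
    fix z assume z: "z \<in> space ?P"
    show "(\<lambda>i. if snd z \<in> GP then v (fst z \<star> nr (S i (snd z))) else 0) \<longlonglongrightarrow> (if snd z \<in> GP then v (fst z \<star> nrm (snd z)) else 0)"
    proof (cases "snd z \<in> GP")
      case True
      define a where "a = snd z"
      have a: "a \<in> GP" using True by (simp add: a_def)
      have "fst z \<in> M" using z by (auto simp: space_pair_measure space_\<omega>)
      then obtain g where g: "g \<in> SL" "fst z = pr g" using M_cases by blast
      have ev: "\<forall>\<^sub>F i in sequentially. S i a \<in> GP"
        using S(2)[of a] open_GP a by (rule topological_tendstoD)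
      have "(\<lambda>i. nrm (S i a)) \<longlonglongrightarrow> nrm a"
        by (rule continuous_on_tendsto_compose[OF C1_on_continuous[OF C1_on_nrm] S(2) a ev])
      then have "(\<lambda>i. g ** nrm (S i a)) \<longlonglongrightarrow> g ** nrm a" by (intro tendsto_intros)
      then have "(\<lambda>i. v (pr (g ** nrm (S i a)))) \<longlonglongrightarrow> v (pr (g ** nrm a))"
        by (rule continuous_on_tendsto_compose[OF v[unfolded cM_def]])
           (use ev a g in \<open>auto simp: SL_mult nrm_SL elim!: eventually_mono\<close>)
      then have "(\<lambda>i. v (fst z \<star> nr (S i a))) \<longlonglongrightarrow> v (fst z \<star> nrm a)"
      proof (rule Lim_transform_eventually[of _ _ _ "\<lambda>i. v (fst z \<star> nr (S i a))", THEN subst[of _ _ "\<lambda>y. _ \<longlonglongrightarrow> y", rotated]])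
        show "v (pr (g ** nrm a)) = v (fst z \<star> nrm a)" using g a by (simp add: pr_act nrm_SL)
        show "\<forall>\<^sub>F i in sequentially. v (pr (g ** nrm (S i a))) = v (fst z \<star> nr (S i a))"
          using ev by eventually_elim (use g in \<open>simp add: nr_def pr_act nrm_SL\<close>)
      qed
      then show ?thesis using True by (simp add: a_def)
    qed simp
  qed
qed

lemma Z_power_act: "x \<in> M \<Longrightarrow> ((\<lambda>x. x \<star> u3 0 0 1) ^^ n) x = x \<star> u3 0 0 (real n)"
  by (induction n) (simp_all add: u3_zero act_one act_u3 add.commute)

lemma em13: "em 1 3 s = u3 0 0 s" by (simp add: em_def u3_eq)

lemma hasZ_cong: "hasZ f f' \<Longrightarrow> (\<And>x. x \<in> M \<Longrightarrow> f' x = g' x) \<Longrightarrow> hasZ f g'"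
  unfolding hasZ_def using cM_cong by (auto simp: act_M u3_SL)

text \<open>
  A limit of ergodic averages along \<open>exp Z\<close> is invariant under \<open>exp Z\<close>, so its displacement under
  translations is a length function that vanishes identically by the Mautner phenomenon. Hence the limit
  is almost invariant under every translation, and transitivity makes it constant.
\<close>
lemma Z_coboundary_dense:
  assumes k: "cM k" "(\<integral>x. k x \<partial>\<omega>) = 0" and e: "e > 0"
  shows "\<exists>f f'. hasZ f f' \<and> (\<integral>x. \<bar>k x - f' x\<bar> \<partial>\<omega>) < e"
proof -
  interpret P: measure_preserving_map \<omega> "\<lambda>x. x \<star> u3 0 0 1"
    by unfold_locales (simp_all add: act_measurable u3_SL distr_act)
  obtain B where B: "B > 0" "\<And>x. x \<in> M \<Longrightarrow> \<bar>k x\<bar> \<le> B" using cM_bounded[OF k(1)] by blast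
  have av: "P.avg n k x = (\<Sum>j<n. k (x \<star> u3 0 0 (real j))) / real n" if "x \<in> M" for n x
    by (simp add: P.avg_def Z_power_act that)
  have avB: "\<bar>P.avg n k x\<bar> \<le> B" if "x \<in> M" for n x
    using P.avg_bounded[of k B x n] B(2) that by (simp add: space_\<omega>)
  have cav: "cM (P.avg n k)" for n
  proof (rule cM_cong)
    show "cM (\<lambda>x. (1 / real n) * (\<Sum>j<n. k (x \<star> u3 0 0 (real j))))" by (intro cM_intros k u3_SL)
  qed (simp add: av)
  have km: "k \<in> borel_measurable \<omega>" by (rule cM_measurable[OF k(1)])
  have "\<forall>i. \<exists>n0>0. \<forall>m\<ge>n0. \<forall>n\<ge>n0. (\<integral>x. \<bar>P.avg m k x - P.avg n k x\<bar> \<partial>\<omega>) < (1 / 2) ^ i"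
  proof
    fix i :: nat
    show "\<exists>n0>0. \<forall>m\<ge>n0. \<forall>n\<ge>n0. (\<integral>x. \<bar>P.avg m k x - P.avg n k x\<bar> \<partial>\<omega>) < (1 / 2) ^ i"
      using P.mean_ergodic_cauchy_L1[OF km, of B "(1 / 2) ^ i"] B(2) by (simp add: space_\<omega>)
  qed
  from choice[OF this] obtain n0 where n0': "\<forall>i. n0 i > 0 \<and> (\<forall>m\<ge>n0 i. \<forall>n\<ge>n0 i.
    (\<integral>x. \<bar>P.avg m k x - P.avg n k x\<bar> \<partial>\<omega>) < (1 / 2) ^ i)" by (elim exE)
  have n0: "\<And>i. n0 i > 0" "\<And>i m n. m \<ge> n0 i \<Longrightarrow> n \<ge> n0 i \<Longrightarrow>
    (\<integral>x. \<bar>P.avg m k x - P.avg n k x\<bar> \<partial>\<omega>) < (1 / 2) ^ i" using n0' by simp_all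
  \<comment> \<open>The sum passes all thresholds up to \<open>i\<close>, so consecutive averages
    differ by less than 2^(-i) in mean; the extra \<open>i\<close> makes the lengths tend to
    infinity.\<close>
  define ni where "ni i = (\<Sum>j\<le>i. n0 j) + i" for i
  have ni: "ni i \<ge> n0 i" "ni (Suc i) \<ge> n0 i" "ni i \<ge> i" "ni i > 0" for i
  proof -
    have "n0 i \<le> (\<Sum>j\<le>i. n0 j)" by (rule member_le_sum) auto
    then show "ni i \<ge> n0 i" "ni (Suc i) \<ge> n0 i" "ni i \<ge> i" by (simp_all add: ni_def)
    then show "ni i > 0" using n0(1)[of i] by linarith
  qed
  define v where "v i = P.avg (ni i) k" for i
  have cv: "cM (v i)" for i by (simp add: v_def cav)
  have vm: "v i \<in> borel_measurable \<omega>" for i by (rule cM_measurable[OF cv])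
  have vB: "\<bar>v i x\<bar> \<le> B" if "x \<in> M" for i x by (simp add: v_def avB that)
  have step: "(\<integral>x. \<bar>v (Suc i) x - v i x\<bar> \<partial>\<omega>) < (1 / 2) ^ i" for i unfolding v_def by (rule n0(2)) (rule ni)+
  have conv: "AE x in \<omega>. convergent (\<lambda>i. v i x)"
  proof -
    have i: "integrable \<omega> (\<lambda>x. \<bar>v (Suc i) x - v i x\<bar>)" for i by (intro cM_integrable cM_intros cv)
    have "(\<integral>\<^sup>+x. (\<Sum>i. ennreal \<bar>v (Suc i) x - v i x\<bar>) \<partial>\<omega>) = (\<Sum>i. \<integral>\<^sup>+x. ennreal \<bar>v (Suc i) x - v i x\<bar> \<partial>\<omega>)"
      by (rule nn_integral_suminf) (use vm in measurable)
    also have "\<dots> \<le> (\<Sum>i. ennreal ((1 / 2) ^ i))"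
      using step i by (intro suminf_le) (auto simp: nn_integral_eq_integral intro!: ennreal_leI less_imp_le)
    also have "\<dots> = ennreal (\<Sum>i. (1 / 2) ^ i)" by (rule suminf_ennreal2) (auto intro: summable_geometric)
    also have "\<dots> < \<infinity>" by simp
    finally have "AE x in \<omega>. (\<Sum>i. ennreal \<bar>v (Suc i) x - v i x\<bar>) \<noteq> \<infinity>"
      by (intro nn_integral_PInf_AE) (use vm in \<open>auto\<close>)
    then show ?thesis
    proof eventually_elim
      case (elim x)
      have "summable (\<lambda>i. \<bar>v (Suc i) x - v i x\<bar>)"
        using elim by (intro summable_suminf_not_top) auto
      then have "summable (\<lambda>i. v (Suc i) x - v i x)" by (rule summable_rabs_cancel)
      then have "convergent (\<lambda>n. \<Sum>i<n. v (Suc i) x - v i x)" by (simp add: summable_iff_convergent)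
      moreover have "(\<Sum>i<n. v (Suc i) x - v i x) = v n x - v 0 x" for n
        by (rule sum_lessThan_telescope[of "\<lambda>i. v i x"])
      ultimately have "convergent (\<lambda>n. v n x - v 0 x)" by simp
      then have "convergent (\<lambda>n. (v n x - v 0 x) + v 0 x)" by (intro convergent_add convergent_const)
      then show ?case by simp
    qed
  qed
  \<comment> \<open>Clamping bounds \<open>u\<close> everywhere, also at the points where the
    averages diverge and \<open>lim\<close> has no useful value.\<close>
  define cl where "cl r = max (- B) (min B r)" for r :: real
  have cl: "\<bar>cl r\<bar> \<le> B" for r using B(1) by (auto simp: cl_def)
  have clm: "cl \<in> borel_measurable borel" unfolding cl_def by measurable
  define u where "u x = cl (lim (\<lambda>i. v i x))" for x
  have um: "u \<in> borel_measurable \<omega>"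
    unfolding u_def by (intro measurable_compose[OF borel_measurable_lim_metric clm] vm)
  have uB: "\<bar>u x\<bar> \<le> B" for x by (simp add: u_def cl)
  have uu: "\<bar>\<bar>u x - u y\<bar>\<bar> \<le> 2 * B" for x y using uB[of x] uB[of y] by simp
  have vu2: "\<bar>\<bar>v i x - u x\<bar>\<bar> \<le> 2 * B" if "x \<in> M" for i x using uB[of x] vB[OF that, of i] by simp
  have vu: "AE x in \<omega>. (\<lambda>i. v i x) \<longlonglongrightarrow> u x"
    using conv AE_space
  proof eventually_elim
    case (elim x)
    then have l: "(\<lambda>i. v i x) \<longlonglongrightarrow> lim (\<lambda>i. v i x)" and x: "x \<in> M"
      by (simp_all add: convergent_LIMSEQ_iff space_\<omega>)
    have "\<bar>lim (\<lambda>i. v i x)\<bar> \<le> B"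
      using tendsto_rabs[OF l] by (rule LIMSEQ_le_const2) (use vB[OF x] in blast)
    then show ?case using l by (simp add: u_def cl_def abs_le_iff)
  qed
  have L1: "(\<lambda>i. \<integral>x. \<bar>v i x - u x\<bar> \<partial>\<omega>) \<longlonglongrightarrow> 0"
  proof -
    have "(\<lambda>i. \<integral>x. \<bar>v i x - u x\<bar> \<partial>\<omega>) \<longlonglongrightarrow> (\<integral>x. 0 \<partial>\<omega>)"
    proof (rule integral_dominated_convergence[where w = "\<lambda>x. 2 * B"])
      show "AE x in \<omega>. (\<lambda>i. \<bar>v i x - u x\<bar>) \<longlonglongrightarrow> 0"
        using vu by eventually_elim (simp add: LIM_zero tendsto_rabs_zero)
      show "AE x in \<omega>. norm \<bar>v i x - u x\<bar> \<le> 2 * B" for i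
      proof (rule AE_I2)
        fix x assume "x \<in> space \<omega>"
        then have "\<bar>v i x\<bar> \<le> B" using vB by (simp add: space_\<omega>)
        then show "norm \<bar>v i x - u x\<bar> \<le> 2 * B" using uB[of x] by simp
      qed
    qed (use um vm in \<open>auto\<close>)
    then show ?thesis by simp
  qed
  define N where "N g = (\<integral>x. \<bar>u (x \<star> g) - u x\<bar> \<partial>\<omega>)" for g
  have uact: "(\<lambda>x. u (x \<star> g)) \<in> borel_measurable \<omega>" if "g \<in> SL" for g
    by (rule measurable_compose[OF act_measurable[OF that] um])
  have iN: "integrable \<omega> (\<lambda>x. \<bar>a (x \<star> g) - b x\<bar>)"
    if "g \<in> SL" "a \<in> borel_measurable \<omega>" "b \<in> borel_measurable \<omega>" "\<And>x. x \<in> M \<Longrightarrow> \<bar>a x\<bar> \<le> B" "\<And>x. x \<in> M \<Longrightarrow> \<bar>b x\<bar> \<le> B" for g a b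
  proof (rule bounded_integrable[where B = "2 * B"])
    show "(\<lambda>x. \<bar>a (x \<star> g) - b x\<bar>) \<in> borel_measurable \<omega>"
      using measurable_compose[OF act_measurable[OF that(1)] that(2)] that(3) by measurable
    show "\<bar>\<bar>a (x \<star> g) - b x\<bar>\<bar> \<le> 2 * B" if x: "x \<in> M" for x
      using \<open>\<And>x. x \<in> M \<Longrightarrow> \<bar>a x\<bar> \<le> B\<close>[OF act_M[OF x \<open>g \<in> SL\<close>]] \<open>\<And>x. x \<in> M \<Longrightarrow> \<bar>b x\<bar> \<le> B\<close>[OF x] by simp
  qed
  have iu: "integrable \<omega> (\<lambda>x. \<bar>u (x \<star> g) - u x\<bar>)" if "g \<in> SL" for g by (rule iN[OF that um um uB uB])
  \<comment> \<open>Compares with the continuous average \<open>v i\<close>; by invariance of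
    \<omega> the errors at \<open>x\<close> and at its translate have the same integral.\<close>
  have approx: "N g \<le> (\<integral>x. \<bar>v i (x \<star> g) - v i x\<bar> \<partial>\<omega>) + 2 * (\<integral>x. \<bar>v i x - u x\<bar> \<partial>\<omega>)" if g: "g \<in> SL" for g i
  proof -
    have d: "(\<lambda>x. \<bar>v i x - u x\<bar>) \<in> borel_measurable \<omega>" using vm um by measurable
    have i0: "integrable \<omega> (\<lambda>x. \<bar>v i x - u x\<bar>)"
      by (rule bounded_integrable[OF d]) (rule vu2)
    have i1: "integrable \<omega> (\<lambda>x. \<bar>v i (x \<star> g) - u (x \<star> g)\<bar>)"
      by (rule bounded_integrable[OF measurable_compose[OF act_measurable[OF g] d]]) (rule vu2[OF act_M[OF _ g]])
    have i2: "integrable \<omega> (\<lambda>x. \<bar>v i (x \<star> g) - v i x\<bar>)" by (intro cM_integrable cM_intros cv g)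
    have "N g \<le> (\<integral>x. (\<bar>v i (x \<star> g) - v i x\<bar> + \<bar>v i (x \<star> g) - u (x \<star> g)\<bar>) + \<bar>v i x - u x\<bar> \<partial>\<omega>)"
      unfolding N_def by (intro integral_mono iu g Bochner_Integration.integrable_add i0 i1 i2) linarith
    also have "\<dots> = (\<integral>x. \<bar>v i (x \<star> g) - v i x\<bar> \<partial>\<omega>) + (\<integral>x. \<bar>v i (x \<star> g) - u (x \<star> g)\<bar> \<partial>\<omega>) + (\<integral>x. \<bar>v i x - u x\<bar> \<partial>\<omega>)"
      using i0 i1 i2 by simp
    also have "(\<integral>x. \<bar>v i (x \<star> g) - u (x \<star> g)\<bar> \<partial>\<omega>) = (\<integral>x. \<bar>v i x - u x\<bar> \<partial>\<omega>)" by (rule integral_act[OF g d])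
    finally show ?thesis by simp
  qed
  interpret length_function N
  proof
    fix g assume g: "g \<in> SL"
    show "0 \<le> N g" unfolding N_def by simp
    have "(\<integral>x. \<bar>u (x \<star> g \<star> minv g) - u (x \<star> g)\<bar> \<partial>\<omega>) = N (minv g)"
      unfolding N_def by (rule integral_act[OF g borel_measurable_integrable[OF iu[OF minv(1)[OF g]]]])
    moreover have "(\<integral>x. \<bar>u (x \<star> g \<star> minv g) - u (x \<star> g)\<bar> \<partial>\<omega>) = N g"
      unfolding N_def by (rule Bochner_Integration.integral_cong) (simp_all add: space_\<omega> act_minv g abs_minus_commute)
    ultimately show "N (minv g) = N g" by simp
    fix l assume l: "l \<in> SL"
    have i1: "integrable \<omega> (\<lambda>x. \<bar>u (x \<star> g \<star> l) - u (x \<star> g)\<bar>)"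
      by (rule bounded_integrable[OF measurable_compose[OF act_measurable[OF g] borel_measurable_integrable[OF iu[OF l]]]])
         (rule uu)
    have "N (g ** l) \<le> (\<integral>x. \<bar>u (x \<star> g \<star> l) - u (x \<star> g)\<bar> + \<bar>u (x \<star> g) - u x\<bar> \<partial>\<omega>)"
      unfolding N_def
    proof (intro integral_mono iu SL_mult g l Bochner_Integration.integrable_add i1)
      fix x assume "x \<in> space \<omega>"
      then show "\<bar>u (x \<star> (g ** l)) - u x\<bar> \<le> \<bar>u (x \<star> g \<star> l) - u (x \<star> g)\<bar> + \<bar>u (x \<star> g) - u x\<bar>"
        by (simp add: act_act g l space_\<omega>)
    qed
    also have "\<dots> = (\<integral>x. \<bar>u (x \<star> g \<star> l) - u (x \<star> g)\<bar> \<partial>\<omega>) + N g"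
      unfolding N_def using i1 iu[OF g] by simp
    also have "(\<integral>x. \<bar>u (x \<star> g \<star> l) - u (x \<star> g)\<bar> \<partial>\<omega>) = N l"
      unfolding N_def by (rule integral_act[OF g borel_measurable_integrable[OF iu[OF l]]])
    finally show "N (g ** l) \<le> N g + N l" by simp
  next
    fix e :: real assume e: "e > 0"
    obtain i where i: "(\<integral>x. \<bar>v i x - u x\<bar> \<partial>\<omega>) < e / 4"
      using LIMSEQ_D[OF L1, of "e / 4"] e by fastforce
    obtain d where d: "d > 0" "\<And>x k. x \<in> M \<Longrightarrow> k \<in> SL \<Longrightarrow> norm (k - mat 1) < d \<Longrightarrow> \<bar>v i (x \<star> k) - v i x\<bar> < e / 2"
      using cM_uniform[OF cv, of "e / 2" i] e by auto
    show "\<exists>d>0. \<forall>g\<in>SL. norm (g - mat 1) < d \<longrightarrow> N g < e"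
    proof (intro exI[of _ d] conjI ballI impI d(1))
      fix g assume g: "g \<in> SL" "norm (g - mat 1) < d"
      have "\<bar>\<integral>x. \<bar>v i (x \<star> g) - v i x\<bar> \<partial>\<omega>\<bar> \<le> e / 2"
        by (rule integral_bounded) (use d(2)[OF _ g] in \<open>auto intro!: cM_measurable cM_intros cv g simp: less_imp_le\<close>)
      then show "N g < e" using approx[OF g(1), of i] i by linarith
    qed
  next
    \<comment> \<open>Translation by exp Z changes an average of length at least i + 1 only by two
      boundary terms.\<close>
    have b: "N (u3 0 0 1) \<le> 2 * B / real (Suc i) + 2 * (\<integral>x. \<bar>v (Suc i) x - u x\<bar> \<partial>\<omega>)" for i
    proof -
      have "\<bar>\<integral>x. \<bar>v (Suc i) (x \<star> u3 0 0 1) - v (Suc i) x\<bar> \<partial>\<omega>\<bar> \<le> 2 * B / real (Suc i)"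
      proof (rule integral_bounded)
        show "(\<lambda>x. \<bar>v (Suc i) (x \<star> u3 0 0 1) - v (Suc i) x\<bar>) \<in> borel_measurable \<omega>"
          by (intro cM_measurable cM_intros cv u3_SL)
        fix x assume x: "x \<in> M"
        define n where "n = ni (Suc i)"
        have n: "n \<ge> Suc i" using ni(3)[of "Suc i"] by (simp add: n_def)
        have sw: "((\<lambda>x. x \<star> u3 0 0 1) ^^ j) (x \<star> u3 0 0 1) = ((\<lambda>x. x \<star> u3 0 0 1) ^^ j) x \<star> u3 0 0 1" for j
          using funpow_swap1[of "\<lambda>x. x \<star> u3 0 0 1" j x] by simp
        have "P.avg n k (x \<star> u3 0 0 1) - P.avg n k x =
          ((\<Sum>j<n. k (((\<lambda>x. x \<star> u3 0 0 1) ^^ (1 + j)) x)) - (\<Sum>j<n. k (((\<lambda>x. x \<star> u3 0 0 1) ^^ j) x))) / real n"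
          by (simp add: P.avg_def diff_divide_distrib sw)
        moreover have "\<bar>(\<Sum>j<n. k (((\<lambda>x. x \<star> u3 0 0 1) ^^ (1 + j)) x)) - (\<Sum>j<n. k (((\<lambda>x. x \<star> u3 0 0 1) ^^ j) x))\<bar> \<le> 2 * real 1 * B"
          by (rule P.sum_shift_bound) (use B(2) x in \<open>auto simp: space_\<omega>\<close>)
        ultimately have "\<bar>P.avg n k (x \<star> u3 0 0 1) - P.avg n k x\<bar> \<le> 2 * B / real n"
          using n by (simp only: abs_divide) (simp add: divide_right_mono)
        also have "\<dots> \<le> 2 * B / real (Suc i)" using n B(1) by (intro divide_left_mono) auto
        finally show "\<bar>\<bar>v (Suc i) (x \<star> u3 0 0 1) - v (Suc i) x\<bar>\<bar> \<le> 2 * B / real (Suc i)"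
          by (simp add: v_def n_def)
      qed
      then show ?thesis using approx[OF u3_SL, of 0 0 1 "Suc i"] by linarith
    qed
    have "(\<lambda>i. 2 * B * (1 / real (Suc i)) + 2 * (\<integral>x. \<bar>v (Suc i) x - u x\<bar> \<partial>\<omega>)) \<longlonglongrightarrow> 2 * B * 0 + 2 * 0"
      by (intro tendsto_add tendsto_mult_left LIMSEQ_Suc[OF L1])
         (use LIMSEQ_inverse_real_of_nat in \<open>simp add: inverse_eq_divide\<close>)
    then have "N (u3 0 0 1) \<le> 2 * B * 0 + 2 * 0" by (rule LIMSEQ_le_const) (use b in auto)
    moreover have "0 \<le> N (u3 0 0 1)" unfolding N_def by simp
    ultimately show "N (em 1 3 1) = 0" by (simp add: em13)
  qed
  have inv: "AE x in \<omega>. u (x \<star> g) = u x" if g: "g \<in> SL" for g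
  proof -
    have "AE x in \<omega>. \<bar>u (x \<star> g) - u x\<bar> = 0"
      using length_zero[OF g] integral_nonneg_eq_0_iff_AE[OF iu[OF g]] by (simp add: N_def)
    then show ?thesis by eventually_elim simp
  qed
  \<comment> \<open>Lebesgue measure on \<open>GP\<close>, seen through \<open>nrm\<close>, stands
    in for Haar measure on SL(3,R). Fubini then exchanges "for each translation, at almost every
    point" with "at almost every point, for almost every translation".\<close>
  define Q where "Q x a \<longleftrightarrow> (a \<in> GP \<longrightarrow> u (x \<star> nrm a) = u x)" for x a
  have Qm: "{z \<in> space (\<omega> \<Otimes>\<^sub>M lborel). Q (fst z) (snd z)} \<in> sets (\<omega> \<Otimes>\<^sub>M lborel)"
  proof -
    \<comment> \<open>On \<open>GP\<close> the value of \<open>u\<close> at the translated point is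
      the clamped limit of the jointly measurable functions \<open>v i\<close>.\<close>
    define L where "L z = lim (\<lambda>i. if snd z \<in> GP then v i (fst z \<star> nrm (snd z)) else 0)" for z
    have Lm: "L \<in> borel_measurable (\<omega> \<Otimes>\<^sub>M lborel)"
      unfolding L_def by (intro borel_measurable_lim_metric joint_measurable cv)
    have "GP \<in> sets lborel" using open_GP by simp
    then have g: "snd -` GP \<inter> space (\<omega> \<Otimes>\<^sub>M lborel) \<in> sets (\<omega> \<Otimes>\<^sub>M lborel)" by (rule measurable_sets[OF measurable_snd])
    have e: "{z \<in> space (\<omega> \<Otimes>\<^sub>M lborel). cl (L z) = u (fst z)} \<in> sets (\<omega> \<Otimes>\<^sub>M lborel)"
      by (rule measurable_equality_set[OF measurable_compose[OF Lm clm] measurable_compose[OF measurable_fst um]])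
    have "{z \<in> space (\<omega> \<Otimes>\<^sub>M lborel). Q (fst z) (snd z)} =
      (space (\<omega> \<Otimes>\<^sub>M lborel) - snd -` GP \<inter> space (\<omega> \<Otimes>\<^sub>M lborel)) \<union> {z \<in> space (\<omega> \<Otimes>\<^sub>M lborel). cl (L z) = u (fst z)} \<inter> (snd -` GP \<inter> space (\<omega> \<Otimes>\<^sub>M lborel))"
      by (auto simp: Q_def L_def u_def)
    then show ?thesis by (simp only:) (intro sets.Un sets.Diff sets.Int sets.top g e)
  qed
  have "AE a in lborel. AE x in \<omega>. Q x a"
    by (rule AE_I2) (use inv nrm_SL in \<open>auto simp: Q_def\<close>)
  then have AEQ: "AE x in \<omega>. AE a in lborel. Q x a" using pair.AE_commute[OF Qm] by simp
  have "\<exists>x\<in>M. AE a in lborel. Q x a"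
  proof (rule ccontr)
    assume "\<not> ?thesis"
    then have "AE x in \<omega>. False" using AEQ AE_space by (auto simp: space_\<omega> elim!: eventually_rev_mp)
    then have "emeasure \<omega> (space \<omega>) = 0" by (simp add: AE_iff_measurable[OF sets.top])
    then show False by (simp add: space_\<omega> emeasure_\<omega>)
  qed
  then obtain x0 where x0: "x0 \<in> M" "AE a in lborel. Q x0 a" by blast
  \<comment> \<open>For two good points the exceptional sets, one of them shifted by
    \<open>l\<close>, are null, so some \<open>a\<close> in \<open>GP\<close> avoids both. Its
    translate of \<open>x\<close> is also a translate of \<open>x0\<close>, which links the two
    values.\<close>
  have const: "u x = u x0" if x: "x \<in> M" "AE a in lborel. Q x a" for x
  proof -
    obtain l where l: "l \<in> SL" "x = x0 \<star> l" using transitive[OF x0(1) x(1)] by blast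
    have 1: "negligible {a. \<not> Q x0 (l ** a)}" by (rule AE_lborel_linear_image[OF x0(2) l(1)])
    have 2: "negligible {a. \<not> Q x a}" using AE_lborel_linear_image[OF x(2) SL_one] by simp
    have "\<not> GP \<subseteq> {a. \<not> Q x0 (l ** a)} \<union> {a. \<not> Q x a}"
      using negligible_subset[OF negligible_Un[OF 1 2]] open_not_negligible[OF open_GP] SL_GP[OF SL_one] by blast
    then obtain a where a: "a \<in> GP" "Q x0 (l ** a)" "Q x a" by blast
    have "u (x0 \<star> nrm (l ** a)) = u x0" using a GP_mult(2)[OF a(1) l(1)] by (simp add: Q_def)
    moreover have "x0 \<star> nrm (l ** a) = x \<star> nrm a" using l x0 a by (simp add: nrm_mult act_act nrm_SL)
    ultimately show ?thesis using a by (simp add: Q_def)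
  qed
  have uc: "AE x in \<omega>. u x = u x0"
    using AEQ AE_space by eventually_elim (use const in \<open>simp add: space_\<omega>\<close>)
  have iu0: "integrable \<omega> u" by (rule bounded_integrable[OF um uB])
  have iv0: "integrable \<omega> (v i)" for i by (rule cM_integrable[OF cv])
  have uint: "(\<integral>x. u x \<partial>\<omega>) = u x0"
    using integral_cong_AE[OF um, of "\<lambda>x. u x0"] uc by (simp add: space_\<omega> measure_\<omega>)
  have vint: "(\<integral>x. v i x \<partial>\<omega>) = 0" for i
  proof -
    have "(\<integral>x. v i x \<partial>\<omega>) = (\<integral>x. (\<Sum>j<ni i. k (x \<star> u3 0 0 (real j))) / real (ni i) \<partial>\<omega>)"
      by (rule Bochner_Integration.integral_cong) (simp_all add: v_def av space_\<omega>)
    also have "\<dots> = (\<Sum>j<ni i. \<integral>x. k (x \<star> u3 0 0 (real j)) \<partial>\<omega>) / real (ni i)"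
      by (simp add: Bochner_Integration.integral_sum cM_integrable cM_act k u3_SL)
    also have "\<dots> = 0" using k(2) by (simp add: integral_act[OF u3_SL km])
    finally show ?thesis .
  qed
  have "\<bar>u x0\<bar> \<le> (\<integral>x. \<bar>v i x - u x\<bar> \<partial>\<omega>)" for i
  proof -
    have "(\<integral>x. v i x - u x \<partial>\<omega>) = - u x0" using iu0 iv0 vint uint by simp
    then show ?thesis using integral_abs_bound[of \<omega> "\<lambda>x. v i x - u x"] by simp
  qed
  then have "\<bar>u x0\<bar> \<le> 0" using LIMSEQ_le_const[OF L1] by blast
  then have u0: "u x0 = 0" by simp
  obtain i where i: "(\<integral>x. \<bar>v i x - u x\<bar> \<partial>\<omega>) < e" using LIMSEQ_D[OF L1 e] by fastforce
  have "(\<integral>x. \<bar>v i x - u x\<bar> \<partial>\<omega>) = (\<integral>x. \<bar>v i x\<bar> \<partial>\<omega>)"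
    by (rule integral_cong_AE) (use um vm uc u0 in auto)
  then have vi: "(\<integral>x. \<bar>v i x\<bar> \<partial>\<omega>) < e" using i by simp
  define n where "n = ni i"
  have n: "n > 0" using ni by (simp add: n_def)
  \<comment> \<open>\<open>k\<close> minus its n-th average is the mean of the differences between
    \<open>k\<close> and its translates by exp(jZ), and each of these is a Z-derivative.\<close>
  have "hasZ (\<lambda>x. (- 1 / real n) * (\<Sum>j<n. Zav (real j) k x)) (\<lambda>x. (- 1 / real n) * (\<Sum>j<n. k (x \<star> u3 0 0 (real j)) - k x))"
    by (intro hasZ_cmult hasZ_sum hasZ_Zav k)
  then have "hasZ (\<lambda>x. (- 1 / real n) * (\<Sum>j<n. Zav (real j) k x)) (\<lambda>x. k x - v i x)"
    by (rule hasZ_cong) (use n in \<open>simp add: v_def n_def[symmetric] av sum_subtractf field_simps\<close>)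
  then show ?thesis using vi by (intro exI[of _ "\<lambda>x. (- 1 / real n) * (\<Sum>j<n. Zav (real j) k x)"] exI[of _ "\<lambda>x. k x - v i x"]) simp
qed

end

section \<open>Mixing\<close>

context haar begin

text \<open>The approximants take values in [0,1] so that products of two of them can be estimated
  later.\<close>

definition approximable :: "(real^3^3) set set \<Rightarrow> bool" where
  "approximable A \<longleftrightarrow> (\<forall>e>0. \<exists>f. cM f \<and> (\<forall>x\<in>M. 0 \<le> f x \<and> f x \<le> 1) \<and> (\<integral>x. \<bar>indicator A x - f x\<bar> \<partial>\<omega>) < e)"

lemma indicator_integrable:
  assumes "A \<in> sets \<omega>" "f \<in> borel_measurable \<omega>" "\<And>x. x \<in> M \<Longrightarrow> \<bar>f x\<bar> \<le> (B :: real)"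
  shows "integrable \<omega> (\<lambda>x. \<bar>indicator A x - f x\<bar>)"
proof (rule bounded_integrable[where B = "1 + B"])
  show "(\<lambda>x. \<bar>indicator A x - f x\<bar>) \<in> borel_measurable \<omega>"
    by (intro borel_measurable_abs borel_measurable_diff borel_measurable_indicator assms)
  show "\<bar>\<bar>indicator A x - f x\<bar>\<bar> \<le> 1 + B" if "x \<in> M" for x
    using assms(3)[OF that] by (auto simp: indicator_def)
qed

text \<open>Truncated multiples of the displacement to the complement increase to the
  indicator.\<close>

lemma approximable_open:
  assumes S: "openin (hspace_topology \<Gamma>) S" shows "approximable S"
  unfolding approximable_def
proof (intro allI impI)
  fix e :: real assume e: "e > 0"
  define f where "f n x = min 1 (real n * dC (M - S) x)" for n x
  have cf: "cM (f n)" for n unfolding f_def by (intro cM_intros cM_dC)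
  have f01: "0 \<le> f n x \<and> f n x \<le> 1" for n x using dC_nonneg by (simp add: f_def)
  have SM: "S \<subseteq> M" using S by (simp add: openin_hspace_topology)
  have "(\<lambda>n. \<integral>x. \<bar>indicator S x - f n x\<bar> \<partial>\<omega>) \<longlonglongrightarrow> (\<integral>x. 0 \<partial>\<omega>)"
  proof (rule bounded_convergence[where B = 2])
    show "(\<lambda>x. \<bar>indicator S x - f n x\<bar>) \<in> borel_measurable \<omega>" for n
      by (intro borel_measurable_abs borel_measurable_diff borel_measurable_indicator open_sets[OF S] cM_measurable[OF cf])
    show "\<bar>\<bar>indicator S x - f n x\<bar>\<bar> \<le> 2" for n x using f01[of n x] by (auto simp: indicator_def)
    fix x assume x: "x \<in> M"
    have "(\<lambda>n. f n x) \<longlonglongrightarrow> indicator S x"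
    proof (cases "x \<in> S")
      case True
      have d: "dC (M - S) x > 0" by (rule dC_pos[OF S True])
      obtain n0 where n0: "1 / dC (M - S) x < real n0" using reals_Archimedean2 by blast
      have "\<forall>\<^sub>F n in sequentially. f n x = 1"
      proof (rule eventually_sequentiallyI[of n0])
        fix n assume "n0 \<le> n"
        then have "1 / dC (M - S) x < real n" using n0 by linarith
        then show "f n x = 1" using d by (simp add: f_def field_simps)
      qed
      then show ?thesis using True by (simp add: tendsto_eventually)
    next
      case False
      then have "f n x = 0" for n using dC_zero[of x "M - S"] x by (simp add: f_def)
      then show ?thesis using False by simp
    qed
    then have "(\<lambda>n. \<bar>indicator S x - f n x\<bar>) \<longlonglongrightarrow> \<bar>indicator S x - indicator S x\<bar>" by (intro tendsto_intros)
    then show "(\<lambda>n. \<bar>indicator S x - f n x\<bar>) \<longlonglongrightarrow> 0" by simp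
  qed
  then have "(\<lambda>n. \<integral>x. \<bar>indicator S x - f n x\<bar> \<partial>\<omega>) \<longlonglongrightarrow> 0" by simp
  from LIMSEQ_D[OF this e] obtain n where "\<bar>\<integral>x. \<bar>indicator S x - f n x\<bar> \<partial>\<omega>\<bar> < e" by auto
  then show "\<exists>f. cM f \<and> (\<forall>x\<in>M. 0 \<le> f x \<and> f x \<le> 1) \<and> (\<integral>x. \<bar>indicator S x - f x\<bar> \<partial>\<omega>) < e"
    using cf f01 by (intro exI[of _ "f n"]) auto
qed

lemma approximable_Un:
  assumes A: "A \<in> sets \<omega>" "approximable A" and B: "B \<in> sets \<omega>" "approximable B"
  shows "approximable (A \<union> B)"
  unfolding approximable_def
proof (intro allI impI)
  fix e :: real assume e: "e > 0"
  obtain f where f: "cM f" "\<forall>x\<in>M. 0 \<le> f x \<and> f x \<le> 1" "(\<integral>x. \<bar>indicator A x - f x\<bar> \<partial>\<omega>) < e / 2"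
    using A(2) e unfolding approximable_def by (meson half_gt_zero)
  obtain g where g: "cM g" "\<forall>x\<in>M. 0 \<le> g x \<and> g x \<le> 1" "(\<integral>x. \<bar>indicator B x - g x\<bar> \<partial>\<omega>) < e / 2"
    using B(2) e unfolding approximable_def by (meson half_gt_zero)
  define m where "m x = max (f x) (g x)" for x
  have cm: "cM m" unfolding m_def by (intro cM_intros f g)
  have i: "integrable \<omega> (\<lambda>x. \<bar>indicator A x - f x\<bar>)" "integrable \<omega> (\<lambda>x. \<bar>indicator B x - g x\<bar>)"
    "integrable \<omega> (\<lambda>x. \<bar>indicator (A \<union> B) x - m x\<bar>)"
  proof -
    have b: "\<bar>f x\<bar> \<le> 1" "\<bar>g x\<bar> \<le> 1" "\<bar>m x\<bar> \<le> 1" if "x \<in> M" for x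
      using f(2) g(2) that by (auto simp: m_def max_def)
    show "integrable \<omega> (\<lambda>x. \<bar>indicator A x - f x\<bar>)" "integrable \<omega> (\<lambda>x. \<bar>indicator B x - g x\<bar>)"
      "integrable \<omega> (\<lambda>x. \<bar>indicator (A \<union> B) x - m x\<bar>)"
      by (rule indicator_integrable[OF _ cM_measurable b(1)] indicator_integrable[OF _ cM_measurable b(2)]
          indicator_integrable[OF _ cM_measurable b(3)]; use A B f g cm in auto)+
  qed
  have "(\<integral>x. \<bar>indicator (A \<union> B) x - m x\<bar> \<partial>\<omega>) \<le> (\<integral>x. \<bar>indicator A x - f x\<bar> + \<bar>indicator B x - g x\<bar> \<partial>\<omega>)"
  proof (intro integral_mono i Bochner_Integration.integrable_add)
    fix x assume "x \<in> space \<omega>"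
    then have "0 \<le> f x \<and> f x \<le> 1" "0 \<le> g x \<and> g x \<le> 1" using f g by (auto simp: space_\<omega>)
    then show "\<bar>indicator (A \<union> B) x - m x\<bar> \<le> \<bar>indicator A x - f x\<bar> + \<bar>indicator B x - g x\<bar>"
      by (auto simp: m_def indicator_def max_def)
  qed
  also have "\<dots> < e" using f(3) g(3) i by simp
  finally show "\<exists>f. cM f \<and> (\<forall>x\<in>M. 0 \<le> f x \<and> f x \<le> 1) \<and> (\<integral>x. \<bar>indicator (A \<union> B) x - f x\<bar> \<partial>\<omega>) < e"
    using cm f(2) g(2) by (intro exI[of _ m]) (auto simp: m_def max_def)
qed

text \<open>Induction over the generated sigma-algebra: complements by \<open>1 - f\<close>, finite
  unions by the maximum, countable unions as limits in mean of finite ones.\<close>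

lemma approximable_sets:
  assumes "A \<in> sets \<omega>" shows "approximable A"
proof -
  have "A \<in> sigma_sets M {S. openin (hspace_topology \<Gamma>) S}" using assms by (simp add: sets_\<omega>)
  then show ?thesis
  proof induction
    case (Basic A)
    then show ?case using approximable_open by simp
  next
    case Empty
    show ?case unfolding approximable_def by (intro allI impI exI[of _ "\<lambda>x. 0"]) (simp add: cM_const)
  next
    case (Compl A)
    show ?case unfolding approximable_def
    proof (intro allI impI)
      fix e :: real assume "e > 0"
      then obtain f where f: "cM f" "\<forall>x\<in>M. 0 \<le> f x \<and> f x \<le> 1" "(\<integral>x. \<bar>indicator A x - f x\<bar> \<partial>\<omega>) < e"
        using Compl.IH unfolding approximable_def by blast
      have "(\<integral>x. \<bar>indicator (M - A) x - (1 - f x)\<bar> \<partial>\<omega>) = (\<integral>x. \<bar>indicator A x - f x\<bar> \<partial>\<omega>)"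
        by (rule Bochner_Integration.integral_cong) (auto simp: space_\<omega> indicator_def)
      then show "\<exists>f. cM f \<and> (\<forall>x\<in>M. 0 \<le> f x \<and> f x \<le> 1) \<and> (\<integral>x. \<bar>indicator (M - A) x - f x\<bar> \<partial>\<omega>) < e"
        using f by (intro exI[of _ "\<lambda>x. 1 - f x"]) (auto intro: cM_diff cM_const)
    qed
  next
    case (Union A)
    have Am: "A i \<in> sets \<omega>" for i using Union.hyps by (simp add: sets_\<omega>)
    define C where "C n = (\<Union>i<n. A i)" for n
    have Cm: "C n \<in> sets \<omega>" for n using Am by (auto simp: C_def)
    have ap: "approximable (C n)" for n
    proof (induction n)
      case 0
      show ?case unfolding approximable_def by (intro allI impI exI[of _ "\<lambda>x. 0"]) (simp add: cM_const C_def)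
    next
      case (Suc n)
      have "C (Suc n) = C n \<union> A n" by (auto simp: C_def lessThan_Suc)
      then show ?case using approximable_Un[OF Cm Suc Am Union.IH] by simp
    qed
    have Um: "(\<Union>i. A i) \<in> sets \<omega>" using Am by auto
    show ?case unfolding approximable_def
    proof (intro allI impI)
      fix e :: real assume e: "e > 0"
      have "(\<lambda>n. \<integral>x. \<bar>indicator (\<Union>i. A i) x - indicator (C n) x :: real\<bar> \<partial>\<omega>) \<longlonglongrightarrow> (\<integral>x. 0 \<partial>\<omega>)"
      proof (rule bounded_convergence[where B = 2])
        show "(\<lambda>x. \<bar>indicator (\<Union>i. A i) x - indicator (C n) x\<bar> :: real) \<in> borel_measurable \<omega>" for n
          by (intro borel_measurable_abs borel_measurable_diff borel_measurable_indicator Um Cm)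
        show "\<bar>\<bar>indicator (\<Union>i. A i) x - indicator (C n) x :: real\<bar>\<bar> \<le> 2" for n x by (auto simp: indicator_def)
        fix x
        have "\<exists>n0. \<forall>n\<ge>n0. \<bar>indicator (\<Union>i. A i) x - indicator (C n) x :: real\<bar> = 0"
        proof (cases "x \<in> (\<Union>i. A i)")
          case True
          then obtain i where "x \<in> A i" by blast
          then have "x \<in> C n" if "n \<ge> Suc i" for n using that by (auto simp: C_def)
          then show ?thesis using True by (intro exI[of _ "Suc i"]) (auto simp: indicator_def)
        next
          case False
          then show ?thesis by (auto simp: C_def indicator_def)
        qed
        then show "(\<lambda>n. \<bar>indicator (\<Union>i. A i) x - indicator (C n) x :: real\<bar>) \<longlonglongrightarrow> 0"
          by (intro tendsto_eventually) (simp add: eventually_sequentially)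
      qed
      then have "(\<lambda>n. \<integral>x. \<bar>indicator (\<Union>i. A i) x - indicator (C n) x :: real\<bar> \<partial>\<omega>) \<longlonglongrightarrow> 0" by simp
      from LIMSEQ_D[OF this half_gt_zero[OF e]] obtain n where
        n: "\<bar>\<integral>x. \<bar>indicator (\<Union>i. A i) x - indicator (C n) x :: real\<bar> \<partial>\<omega>\<bar> < e / 2" by auto
      obtain f where f: "cM f" "\<forall>x\<in>M. 0 \<le> f x \<and> f x \<le> 1" "(\<integral>x. \<bar>indicator (C n) x - f x\<bar> \<partial>\<omega>) < e / 2"
        using ap e unfolding approximable_def by (meson half_gt_zero)
      have fb: "\<bar>f x\<bar> \<le> 1" if "x \<in> M" for x using f(2) that by auto
      have i: "integrable \<omega> (\<lambda>x. \<bar>indicator (C n) x - f x\<bar>)" "integrable \<omega> (\<lambda>x. \<bar>indicator (\<Union>i. A i) x - f x\<bar>)"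
        by (rule indicator_integrable[OF Cm cM_measurable[OF f(1)] fb] indicator_integrable[OF Um cM_measurable[OF f(1)] fb], assumption)+
      have i2: "integrable \<omega> (\<lambda>x. \<bar>indicator (\<Union>i. A i) x - indicator (C n) x :: real\<bar>)"
        by (rule indicator_integrable[OF Um borel_measurable_indicator[OF Cm], where B = 1]) (simp add: indicator_def)
      have "(\<integral>x. \<bar>indicator (\<Union>i. A i) x - f x\<bar> \<partial>\<omega>) \<le>
        (\<integral>x. \<bar>indicator (\<Union>i. A i) x - indicator (C n) x\<bar> + \<bar>indicator (C n) x - f x\<bar> \<partial>\<omega>)"
        by (intro integral_mono i i2 Bochner_Integration.integrable_add) linarith
      also have "\<dots> < e" using n f(3) i i2 by simp
      finally show "\<exists>f. cM f \<and> (\<forall>x\<in>M. 0 \<le> f x \<and> f x \<le> 1) \<and> (\<integral>x. \<bar>indicator (\<Union>i. A i) x - f x\<bar> \<partial>\<omega>) < e"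
        using f by blast
    qed
  qed
qed

end

section \<open>Decay of correlations, first for continuous functions and then for sets\<close>

context sheared begin

text \<open>After subtracting the \<mu>-mean, \<open>k0 * \<kappa>\<close> has \<omega>-mean zero
  and is close to a Z-derivative \<open>f'\<close>; dividing by \<kappa>, \<open>k0\<close> is close
  to \<open>f' / \<kappa>\<close> in mean for \<mu>. The flow preserves \<mu>, so this error does
  not grow with time.\<close>

lemma continuous_mixing:
  assumes k: "cM k" and g: "cM g"
  shows "((\<lambda>t. \<integral>x. k (h t x) * g x \<partial>\<omega>) \<longlongrightarrow> (\<integral>x. k x * \<kappa> x \<partial>\<omega>) * (\<integral>x. g x \<partial>\<omega>) / (\<integral>x. \<kappa> x \<partial>\<omega>)) at_top"
proof -
  note c\<kappa> = C1_cM[OF C1_\<kappa>]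
  obtain l0 where l0: "l0 > 0" "\<And>x. x \<in> M \<Longrightarrow> l0 \<le> \<kappa> x" using cM_pos_lower[OF c\<kappa> \<kappa>_pos] by blast
  obtain Bg where Bg: "Bg > 0" "\<And>x. x \<in> M \<Longrightarrow> \<bar>g x\<bar> \<le> Bg" using cM_bounded[OF g] by blast
  define V where "V = (\<integral>x. \<kappa> x \<partial>\<omega>)"
  have "(\<integral>x. l0 \<partial>\<omega>) \<le> V" unfolding V_def
    by (intro integral_mono cM_integrable c\<kappa> cM_const) (simp add: l0 space_\<omega>)
  then have V: "V > 0" using l0(1) by (simp add: space_\<omega> measure_\<omega>)
  define a where "a = (\<integral>x. k x * \<kappa> x \<partial>\<omega>) / V"
  define k0 where "k0 x = k x - a" for x
  have ck0: "cM k0" unfolding k0_def by (intro cM_intros k)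
  have "(\<integral>x. k0 x * \<kappa> x \<partial>\<omega>) = (\<integral>x. k x * \<kappa> x - a * \<kappa> x \<partial>\<omega>)"
    by (rule Bochner_Integration.integral_cong) (simp_all add: k0_def algebra_simps)
  also have "\<dots> = (\<integral>x. k x * \<kappa> x \<partial>\<omega>) - a * V"
    by (simp add: cM_integrable cM_mult k c\<kappa> V_def)
  also have "\<dots> = 0" using V by (simp add: a_def)
  finally have k00: "(\<integral>x. k0 x * \<kappa> x \<partial>\<omega>) = 0" .
  have "((\<lambda>t. \<integral>x. k0 (h t x) * g x \<partial>\<omega>) \<longlongrightarrow> 0) at_top"
  proof (rule tendstoI)
    fix e :: real assume e: "e > 0"
    obtain f f' where f: "hasZ f f'" "(\<integral>x. \<bar>k0 x * \<kappa> x - f' x\<bar> \<partial>\<omega>) < e * l0 / (2 * Bg)"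
      using Z_coboundary_dense[OF cM_mult[OF ck0 c\<kappa>] k00, of "e * l0 / (2 * Bg)"] e l0 Bg by auto
    define F where "F x = f' x / \<kappa> x" for x
    have cF: "cM F" unfolding F_def using \<kappa>_pos by (intro cM_divide hasZ_cM[OF f(1)] c\<kappa>) force
    define D where "D x = \<bar>k0 x - F x\<bar>" for x
    have cD: "cM D" unfolding D_def by (intro cM_intros ck0 cF)
    have D1: "(\<integral>x. D x * \<kappa> x \<partial>\<omega>) < e * l0 / (2 * Bg)"
    proof -
      have "(\<integral>x. D x * \<kappa> x \<partial>\<omega>) = (\<integral>x. \<bar>k0 x * \<kappa> x - f' x\<bar> \<partial>\<omega>)"
      proof (rule Bochner_Integration.integral_cong)
        fix x assume "x \<in> space \<omega>"
        then have kx: "\<kappa> x > 0" using \<kappa>_pos by (simp add: space_\<omega>)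
        have "D x * \<kappa> x = \<bar>(k0 x - F x) * \<kappa> x\<bar>" using kx by (simp add: D_def abs_mult)
        also have "(k0 x - F x) * \<kappa> x = k0 x * \<kappa> x - f' x" using kx by (simp add: F_def left_diff_distrib)
        finally show "D x * \<kappa> x = \<bar>k0 x * \<kappa> x - f' x\<bar>" .
      qed simp
      then show ?thesis using f(2) by simp
    qed
    have "\<forall>\<^sub>F t in at_top. \<bar>\<integral>x. F (h t x) * g x \<partial>\<omega>\<bar> < e / 2"
      using tendstoD[OF Z_mixing[OF f(1) g], of "e / 2"] e by (simp add: F_def)
    then show "\<forall>\<^sub>F t in at_top. dist (\<integral>x. k0 (h t x) * g x \<partial>\<omega>) 0 < e"
    proof eventually_elim
      case (elim t)
      define I where "I x = (k0 (h t x) - F (h t x)) * g x" for x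
      have cI: "cM I" unfolding I_def by (intro cM_intros g cM_h[OF ck0] cM_h[OF cF])
      have "\<bar>\<integral>x. I x \<partial>\<omega>\<bar> \<le> (\<integral>x. \<bar>I x\<bar> \<partial>\<omega>)" by (rule integral_abs_bound)
      also have "\<dots> \<le> (\<integral>x. Bg / l0 * (D (h t x) * \<kappa> x) \<partial>\<omega>)"
      proof (intro integral_mono cM_integrable cM_intros cI cM_h[OF cD] c\<kappa>)
        fix x assume "x \<in> space \<omega>"
        then have x: "x \<in> M" by (simp add: space_\<omega>)
        have "\<bar>I x\<bar> \<le> D (h t x) * Bg" unfolding I_def by (rule abs_mult_le[OF _ Bg(2)[OF x]]) (simp add: D_def)
        also have "\<dots> \<le> D (h t x) * (Bg / l0 * \<kappa> x)"
          using l0(1) l0(2)[OF x] Bg(1) by (intro mult_left_mono) (auto simp: D_def field_simps)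
        finally show "\<bar>I x\<bar> \<le> Bg / l0 * (D (h t x) * \<kappa> x)" by (simp add: mult_ac)
      qed
      also have "\<dots> = Bg / l0 * (\<integral>x. D x * \<kappa> x \<partial>\<omega>)"
        by (simp add: integral_h[OF cM_measurable[OF cD]])
      also have "\<dots> < Bg / l0 * (e * l0 / (2 * Bg))" using D1 Bg l0 by (intro mult_strict_left_mono) auto
      also have "\<dots> = e / 2" using Bg l0 by simp
      finally have 1: "\<bar>\<integral>x. I x \<partial>\<omega>\<bar> < e / 2" .
      have cJ: "cM (\<lambda>x. F (h t x) * g x)" by (intro cM_intros g cM_h[OF cF])
      have "(\<integral>x. k0 (h t x) * g x \<partial>\<omega>) = (\<integral>x. F (h t x) * g x + I x \<partial>\<omega>)"
        by (rule Bochner_Integration.integral_cong) (simp_all add: I_def algebra_simps)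
      also have "\<dots> = (\<integral>x. F (h t x) * g x \<partial>\<omega>) + (\<integral>x. I x \<partial>\<omega>)"
        using cM_integrable[OF cI] cM_integrable[OF cJ] by simp
      finally show ?case using elim 1 by simp
    qed
  qed
  then have "((\<lambda>t. (\<integral>x. k0 (h t x) * g x \<partial>\<omega>) + a * (\<integral>x. g x \<partial>\<omega>)) \<longlongrightarrow> 0 + a * (\<integral>x. g x \<partial>\<omega>)) at_top"
    by (intro tendsto_intros)
  moreover have "(\<integral>x. k0 (h t x) * g x \<partial>\<omega>) + a * (\<integral>x. g x \<partial>\<omega>) = (\<integral>x. k (h t x) * g x \<partial>\<omega>)" for t
  proof -
    have "(\<integral>x. k0 (h t x) * g x \<partial>\<omega>) + a * (\<integral>x. g x \<partial>\<omega>) = (\<integral>x. k0 (h t x) * g x + a * g x \<partial>\<omega>)"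
      by (simp add: cM_integrable cM_mult cM_h ck0 g)
    also have "\<dots> = (\<integral>x. k (h t x) * g x \<partial>\<omega>)"
      by (rule Bochner_Integration.integral_cong) (simp_all add: k0_def algebra_simps)
    finally show ?thesis .
  qed
  ultimately show ?thesis by (simp add: a_def V_def)
qed

lemma measure_\<mu>: assumes "A \<in> sets \<omega>" shows "measure \<mu> A = (\<integral>x. indicator A x * \<kappa> x \<partial>\<omega>)"
proof -
  have "A \<inter> space \<mu> = A" using assms sets.sets_into_space by fastforce
  then show ?thesis using integral_\<mu>[OF borel_measurable_indicator[OF assms]] by simp
qed

text \<open>Indicators are replaced by continuous functions. Since \<open>continuous_mixing\<close>
  integrates against \<omega>, the density is absorbed into the second function.\<close>

lemma mixing_h: "mixing_flow \<mu> h"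
  unfolding mixing_flow_def
proof (intro conjI finite_\<mu> ballI)
  fix A B assume "A \<in> sets \<mu>" "B \<in> sets \<mu>"
  then have A: "A \<in> sets \<omega>" and B: "B \<in> sets \<omega>" by simp_all
  note c\<kappa> = C1_cM[OF C1_\<kappa>]
  obtain Bk where Bk: "Bk > 0" "\<And>x. x \<in> M \<Longrightarrow> \<bar>\<kappa> x\<bar> \<le> Bk" using cM_bounded[OF c\<kappa>] by blast
  obtain l0 where l0: "l0 > 0" "\<And>x. x \<in> M \<Longrightarrow> l0 \<le> \<kappa> x" using cM_pos_lower[OF c\<kappa> \<kappa>_pos] by blast
  define V where "V = (\<integral>x. \<kappa> x \<partial>\<omega>)"
  have Ve: "measure \<mu> (space \<mu>) = V"
  proof -
    have "measure \<mu> (space \<mu>) = (\<integral>x. indicator (space \<omega>) x * \<kappa> x \<partial>\<omega>)" using measure_\<mu>[OF sets.top] by simp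
    also have "\<dots> = V" unfolding V_def by (rule Bochner_Integration.integral_cong) simp_all
    finally show ?thesis .
  qed
  have "(\<integral>x. l0 \<partial>\<omega>) \<le> V" unfolding V_def
    by (intro integral_mono cM_integrable c\<kappa> cM_const) (simp add: l0 space_\<omega>)
  then have V: "V > 0" using l0(1) by (simp add: space_\<omega> measure_\<omega>)
  define iA :: "(real^3^3) set \<Rightarrow> real" where "iA = indicator A"
  define iB :: "(real^3^3) set \<Rightarrow> real" where "iB = indicator B"
  have im: "iA \<in> borel_measurable \<omega>" "iB \<in> borel_measurable \<omega>" using A B by (simp_all add: iA_def iB_def)
  have i01: "0 \<le> iA x" "iA x \<le> 1" "0 \<le> iB x" "iB x \<le> 1" for x by (simp_all add: iA_def iB_def indicator_def)
  have hA: "h t -` A \<inter> B \<in> sets \<omega>" for t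
  proof -
    have "(h t -` A \<inter> space \<omega>) \<inter> B \<in> sets \<omega>" using measurable_sets[OF h_measurable A] B by auto
    moreover have "(h t -` A \<inter> space \<omega>) \<inter> B = h t -` A \<inter> B" using sets.sets_into_space[OF B] by auto
    ultimately show ?thesis by simp
  qed
  have mt: "measure \<mu> (h t -` A \<inter> B) = (\<integral>x. iA (h t x) * iB x * \<kappa> x \<partial>\<omega>)" for t
    unfolding measure_\<mu>[OF hA]
    by (rule Bochner_Integration.integral_cong) (auto simp: iA_def iB_def indicator_def)
  have mA: "measure \<mu> A = (\<integral>x. iA x * \<kappa> x \<partial>\<omega>)" "measure \<mu> B = (\<integral>x. iB x * \<kappa> x \<partial>\<omega>)"
    using measure_\<mu> A B by (simp_all add: iA_def iB_def)
  have bi: "integrable \<omega> (\<lambda>x. u x * \<kappa> x)" if "u \<in> borel_measurable \<omega>" "\<And>x. x \<in> M \<Longrightarrow> \<bar>u x\<bar> \<le> 1" for u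
    by (rule bounded_integrable[where B = "1 * Bk"])
       (use that \<kappa>_measurable Bk in \<open>auto intro!: abs_mult_le[where A = 1 and B = Bk, simplified]\<close>)
  have mV: "\<bar>\<integral>x. u x * \<kappa> x \<partial>\<omega>\<bar> \<le> V" if "u \<in> borel_measurable \<omega>" "\<And>x. x \<in> M \<Longrightarrow> \<bar>u x\<bar> \<le> 1" for u
  proof -
    have "\<bar>\<integral>x. u x * \<kappa> x \<partial>\<omega>\<bar> \<le> (\<integral>x. \<bar>u x * \<kappa> x\<bar> \<partial>\<omega>)" by (rule integral_abs_bound)
    also have "\<dots> \<le> V" unfolding V_def
    proof (rule integral_mono[OF integrable_abs[OF bi[OF that]] cM_integrable[OF c\<kappa>]])
      fix x assume "x \<in> space \<omega>"
      then have x: "x \<in> M" by (simp add: space_\<omega>)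
      then show "\<bar>u x * \<kappa> x\<bar> \<le> \<kappa> x" using abs_mult_le[OF that(2)[OF x], of "\<kappa> x" "\<kappa> x"] \<kappa>_pos[OF x] by simp
    qed assumption
    finally show ?thesis .
  qed
  have dist\<kappa>: "(\<integral>x. \<bar>u x - f x\<bar> * \<kappa> x \<partial>\<omega>) \<le> Bk * e"
    if u: "u \<in> borel_measurable \<omega>" "\<And>x. \<bar>u x\<bar> \<le> 1" and f: "cM f" "\<And>x. x \<in> M \<Longrightarrow> \<bar>f x\<bar> \<le> 1"
      and e: "(\<integral>x. \<bar>u x - f x\<bar> \<partial>\<omega>) < e" for u f e
  proof -
    have um: "(\<lambda>x. \<bar>u x - f x\<bar>) \<in> borel_measurable \<omega>"
      by (intro borel_measurable_abs borel_measurable_diff u cM_measurable f)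
    have ub: "\<bar>\<bar>u x - f x\<bar>\<bar> \<le> 2" if "x \<in> M" for x using u(2)[of x] f(2)[OF that] by simp
    have "(\<integral>x. \<bar>u x - f x\<bar> * \<kappa> x \<partial>\<omega>) \<le> (\<integral>x. Bk * \<bar>u x - f x\<bar> \<partial>\<omega>)"
    proof (rule integral_mono)
      show "integrable \<omega> (\<lambda>x. \<bar>u x - f x\<bar> * \<kappa> x)"
        by (rule bounded_integrable[OF borel_measurable_times[OF um \<kappa>_measurable], of "2 * Bk"])
           (rule abs_mult_le[OF ub Bk(2)])
      show "integrable \<omega> (\<lambda>x. Bk * \<bar>u x - f x\<bar>)" using bounded_integrable[OF um ub] by simp
      fix x assume "x \<in> space \<omega>"
      then have "\<kappa> x \<le> Bk" using Bk(2)[of x] by (simp add: space_\<omega>)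
      then show "\<bar>u x - f x\<bar> * \<kappa> x \<le> Bk * \<bar>u x - f x\<bar>" by (simp add: mult.commute mult_right_mono)
    qed
    also have "\<dots> = Bk * (\<integral>x. \<bar>u x - f x\<bar> \<partial>\<omega>)" by simp
    also have "\<dots> \<le> Bk * e" using e Bk(1) by (intro mult_left_mono) auto
    finally show ?thesis .
  qed
  show "((\<lambda>t. measure \<mu> (h t -` A \<inter> B)) \<longlongrightarrow> measure \<mu> A * measure \<mu> B / measure \<mu> (space \<mu>)) at_top"
    unfolding Ve mt mA
  proof (rule tendstoI)
    fix e :: real assume e: "e > 0"
    \<comment> \<open>Five shares of the error: two for the correlation at time \<open>t\<close>,
      two for its limit, one for the convergence of the continuous correlation.\<close>
    define e1 where "e1 = e / (5 * Bk)"
    have e1: "e1 > 0" "Bk * e1 = e / 5" using e Bk by (simp_all add: e1_def)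
    obtain f where f: "cM f" "\<forall>x\<in>M. 0 \<le> f x \<and> f x \<le> 1" "(\<integral>x. \<bar>iA x - f x\<bar> \<partial>\<omega>) < e1"
      using approximable_sets[OF A] e1 unfolding approximable_def iA_def by blast
    obtain g where g: "cM g" "\<forall>x\<in>M. 0 \<le> g x \<and> g x \<le> 1" "(\<integral>x. \<bar>iB x - g x\<bar> \<partial>\<omega>) < e1"
      using approximable_sets[OF B] e1 unfolding approximable_def iB_def by blast
    have fb: "\<bar>f x\<bar> \<le> 1" and gb: "\<bar>g x\<bar> \<le> 1" if "x \<in> M" for x using f(2) g(2) that by auto
    have ib: "\<bar>iA x\<bar> \<le> 1" "\<bar>iB x\<bar> \<le> 1" for x using i01[of x] by auto
    have dA: "(\<integral>x. \<bar>iA x - f x\<bar> * \<kappa> x \<partial>\<omega>) \<le> e / 5" using dist\<kappa>[OF im(1) ib(1) f(1) fb f(3)] e1 by simp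
    have dB: "(\<integral>x. \<bar>iB x - g x\<bar> * \<kappa> x \<partial>\<omega>) \<le> e / 5" using dist\<kappa>[OF im(2) ib(2) g(1) gb g(3)] e1 by simp
    define a a' b b' where "a = (\<integral>x. iA x * \<kappa> x \<partial>\<omega>)" and "a' = (\<integral>x. f x * \<kappa> x \<partial>\<omega>)"
      and "b = (\<integral>x. iB x * \<kappa> x \<partial>\<omega>)" and "b' = (\<integral>x. g x * \<kappa> x \<partial>\<omega>)"
    have fm: "f \<in> borel_measurable \<omega>" "g \<in> borel_measurable \<omega>" using f g cM_measurable by auto
    have V4: "\<bar>a'\<bar> \<le> V" "\<bar>b\<bar> \<le> V" unfolding a'_def b_def using mV[OF fm(1) fb] mV[OF im(2) ib(2)] by auto
    have close: "\<bar>(\<integral>x. u x * \<kappa> x \<partial>\<omega>) - (\<integral>x. v x * \<kappa> x \<partial>\<omega>)\<bar> \<le> (\<integral>x. \<bar>u x - v x\<bar> * \<kappa> x \<partial>\<omega>)"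
      if "u \<in> borel_measurable \<omega>" "\<And>x. x \<in> M \<Longrightarrow> \<bar>u x\<bar> \<le> 1" "v \<in> borel_measurable \<omega>" "\<And>x. x \<in> M \<Longrightarrow> \<bar>v x\<bar> \<le> 1" for u v
    proof -
      have "(\<integral>x. u x * \<kappa> x \<partial>\<omega>) - (\<integral>x. v x * \<kappa> x \<partial>\<omega>) = (\<integral>x. u x * \<kappa> x - v x * \<kappa> x \<partial>\<omega>)"
        by (rule Bochner_Integration.integral_diff[symmetric]) (rule bi, rule that, rule that, assumption)+
      also have "\<bar>\<dots>\<bar> \<le> (\<integral>x. \<bar>u x * \<kappa> x - v x * \<kappa> x\<bar> \<partial>\<omega>)" by (rule integral_abs_bound)
      also have "\<dots> = (\<integral>x. \<bar>u x - v x\<bar> * \<kappa> x \<partial>\<omega>)"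
      proof (rule Bochner_Integration.integral_cong)
        fix x assume "x \<in> space \<omega>"
        then have "\<kappa> x > 0" using \<kappa>_pos by (simp add: space_\<omega>)
        then show "\<bar>u x * \<kappa> x - v x * \<kappa> x\<bar> = \<bar>u x - v x\<bar> * \<kappa> x"
          by (simp add: left_diff_distrib[symmetric] abs_mult)
      qed simp
      finally show ?thesis .
    qed
    have aa: "\<bar>a - a'\<bar> \<le> e / 5" unfolding a_def a'_def using close[OF im(1) ib(1) fm(1) fb] dA by linarith
    have bb: "\<bar>b - b'\<bar> \<le> e / 5" unfolding b_def b'_def using close[OF im(2) ib(2) fm(2) gb] dB by linarith
    have lim: "\<bar>a * b / V - a' * b' / V\<bar> \<le> 2 * e / 5"
    proof -
      have "a * b - a' * b' = (a - a') * b + a' * (b - b')" by (simp add: algebra_simps)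
      moreover have "\<bar>(a - a') * b\<bar> \<le> e / 5 * V" "\<bar>a' * (b - b')\<bar> \<le> V * (e / 5)"
        by (intro abs_mult_le aa bb V4)+
      moreover have "e / 5 * V + V * (e / 5) = 2 * e / 5 * V" by simp
      ultimately have "\<bar>a * b - a' * b'\<bar> \<le> 2 * e / 5 * V" by linarith
      then show ?thesis using V by (simp add: diff_divide_distrib[symmetric] abs_divide pos_divide_le_eq)
    qed
    have "((\<lambda>t. \<integral>x. f (h t x) * (g x * \<kappa> x) \<partial>\<omega>) \<longlongrightarrow> a' * b' / V) at_top"
      unfolding a'_def b'_def V_def by (rule continuous_mixing[OF f(1) cM_mult[OF g(1) c\<kappa>]])
    then have "\<forall>\<^sub>F t in at_top. dist (\<integral>x. f (h t x) * (g x * \<kappa> x) \<partial>\<omega>) (a' * b' / V) < e / 5"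
      using e by (intro tendstoD) auto
    then show "\<forall>\<^sub>F t in at_top. dist (\<integral>x. iA (h t x) * iB x * \<kappa> x \<partial>\<omega>) (a * b / V) < e"
      unfolding a_def b_def
    proof eventually_elim
      case (elim t)
      have hm: "(\<lambda>x. u (h t x)) \<in> borel_measurable \<omega>" if "u \<in> borel_measurable \<omega>" for u :: "_ \<Rightarrow> real"
        by (rule measurable_compose[OF h_measurable that])
      have m1: "(\<lambda>x. iA (h t x) * iB x) \<in> borel_measurable \<omega>" "(\<lambda>x. f (h t x) * g x) \<in> borel_measurable \<omega>"
        by (intro borel_measurable_times hm im fm)+
      have b1: "\<bar>iA (h t x) * iB x\<bar> \<le> 1" "\<bar>f (h t x) * g x\<bar> \<le> 1" if "x \<in> M" for x
        using abs_mult_le[OF ib(1)[of "h t x"] ib(2)[of x]] abs_mult_le[OF fb[OF h_M[OF that, of t]] gb[OF that]] by simp_all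
      define DA where "DA x = \<bar>iA x - f x\<bar>" for x
      define DB where "DB x = \<bar>iB x - g x\<bar>" for x
      have Dm: "DA \<in> borel_measurable \<omega>" "DB \<in> borel_measurable \<omega>" unfolding DA_def DB_def
        by (intro borel_measurable_abs borel_measurable_diff im fm)+
      have Db: "\<bar>DA x\<bar> \<le> 1" "\<bar>DB x\<bar> \<le> 1" if "x \<in> M" for x
        using f(2) g(2) i01[of x] that by (auto simp: DA_def DB_def abs_le_iff dest!: bspec[of _ _ x])
      have Di: "integrable \<omega> (\<lambda>x. DA (h t x) * \<kappa> x)" "integrable \<omega> (\<lambda>x. DB x * \<kappa> x)"
        using bi[OF hm[OF Dm(1)] Db(1)[OF h_M]] bi[OF Dm(2) Db(2)] by auto
      have "\<bar>(\<integral>x. (iA (h t x) * iB x) * \<kappa> x \<partial>\<omega>) - (\<integral>x. (f (h t x) * g x) * \<kappa> x \<partial>\<omega>)\<bar>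
        \<le> (\<integral>x. \<bar>iA (h t x) * iB x - f (h t x) * g x\<bar> * \<kappa> x \<partial>\<omega>)"
        by (rule close[OF m1(1) b1(1) m1(2) b1(2)])
      also have "\<dots> \<le> (\<integral>x. DA (h t x) * \<kappa> x + DB x * \<kappa> x \<partial>\<omega>)"
      proof (rule integral_mono)
        show "integrable \<omega> (\<lambda>x. DA (h t x) * \<kappa> x + DB x * \<kappa> x)" using Di by simp
        show "integrable \<omega> (\<lambda>x. \<bar>iA (h t x) * iB x - f (h t x) * g x\<bar> * \<kappa> x)"
        proof (rule bounded_integrable[where B = "2 * Bk"])
          show "(\<lambda>x. \<bar>iA (h t x) * iB x - f (h t x) * g x\<bar> * \<kappa> x) \<in> borel_measurable \<omega>"
            by (intro borel_measurable_times[OF _ \<kappa>_measurable] borel_measurable_abs borel_measurable_diff m1)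
          fix x assume x: "x \<in> M"
          show "\<bar>\<bar>iA (h t x) * iB x - f (h t x) * g x\<bar> * \<kappa> x\<bar> \<le> 2 * Bk"
            by (rule abs_mult_le[OF _ Bk(2)[OF x]]) (use b1[OF x] in linarith)
        qed
        fix x assume "x \<in> space \<omega>"
        then have x: "x \<in> M" by (simp add: space_\<omega>)
        have "iA (h t x) * iB x - f (h t x) * g x = (iA (h t x) - f (h t x)) * iB x + f (h t x) * (iB x - g x)"
          by (simp add: algebra_simps)
        moreover have "\<bar>(iA (h t x) - f (h t x)) * iB x\<bar> \<le> DA (h t x) * 1" "\<bar>f (h t x) * (iB x - g x)\<bar> \<le> 1 * DB x"
          by (intro abs_mult_le ib fb h_M x; simp add: DA_def DB_def)+
        ultimately have "\<bar>iA (h t x) * iB x - f (h t x) * g x\<bar> \<le> DA (h t x) + DB x" by linarith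
        then have "\<bar>iA (h t x) * iB x - f (h t x) * g x\<bar> * \<kappa> x \<le> (DA (h t x) + DB x) * \<kappa> x"
          using \<kappa>_pos[OF x] by (intro mult_right_mono) auto
        then show "\<bar>iA (h t x) * iB x - f (h t x) * g x\<bar> * \<kappa> x \<le> DA (h t x) * \<kappa> x + DB x * \<kappa> x"
          by (simp add: distrib_right)
      qed
      also have "\<dots> = (\<integral>x. DA x * \<kappa> x \<partial>\<omega>) + (\<integral>x. DB x * \<kappa> x \<partial>\<omega>)"
        using Di integral_h[OF Dm(1)] by simp
      also have "\<dots> \<le> 2 * e / 5" using dA dB by (simp add: DA_def DB_def)
      finally have "\<bar>(\<integral>x. (iA (h t x) * iB x) * \<kappa> x \<partial>\<omega>) - (\<integral>x. f (h t x) * (g x * \<kappa> x) \<partial>\<omega>)\<bar> \<le> 2 * e / 5"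
        by (simp add: mult.assoc)
      then show ?case using elim lim e unfolding dist_real_def a_def[symmetric] b_def[symmetric] by linarith
    qed
  qed
qed

end

text \<open>The correlation of an invariant set with itself is constant in time, so its measure m
  satisfies m = m^2 / V with V the total mass.\<close>

lemma mixing_imp_ergodic:
  assumes mix: "mixing_flow \<mu> \<phi>" shows "ergodic_flow \<mu> \<phi>"
  unfolding ergodic_flow_def
proof (intro ballI impI)
  fix A assume A: "A \<in> sets \<mu>" and inv: "\<forall>t. \<phi> t -` A \<inter> space \<mu> = A"
  interpret finite_measure \<mu> using mix by (simp add: mixing_flow_def)
  have "\<phi> t -` A \<inter> A = A" for t using inv sets.sets_into_space[OF A] by blast
  moreover have "((\<lambda>t. measure \<mu> (\<phi> t -` A \<inter> A)) \<longlongrightarrow> measure \<mu> A * measure \<mu> A / measure \<mu> (space \<mu>)) at_top"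
    using mix A unfolding mixing_flow_def by blast
  ultimately have "((\<lambda>t::real. measure \<mu> A) \<longlongrightarrow> measure \<mu> A * measure \<mu> A / measure \<mu> (space \<mu>)) at_top" by simp
  then have e: "measure \<mu> A = measure \<mu> A * measure \<mu> A / measure \<mu> (space \<mu>)"
    by (rule tendsto_unique[OF trivial_limit_at_top_linorder tendsto_const])
  have "measure \<mu> A = 0 \<or> measure \<mu> A = measure \<mu> (space \<mu>)"
    using e by (cases "measure \<mu> (space \<mu>) = 0") (auto simp: field_simps)
  then show "emeasure \<mu> A = 0 \<or> emeasure \<mu> (space \<mu> - A) = 0"
    using finite_measure_compl[OF A] by (auto simp: emeasure_eq_measure)
qed

theorem theorem2:
  fixes \<Gamma> :: "(real^3^3) set"
    and \<omega> :: "(real^3^3) set measure"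
    and U W :: "real^3^3"
    and c :: real
    and \<beta> dens :: "(real^3^3) set \<Rightarrow> real"
    and h :: "real \<Rightarrow> (real^3^3) set \<Rightarrow> (real^3^3) set"
  assumes "cocompact_lattice \<Gamma>"
    and "normalised_haar \<Gamma> \<omega>"
    and "U \<in> nilp - span {E 1 3}"
    and "W \<in> {E 1 2, E 2 3}"
    and "c \<noteq> 0"
    and "lie_bracket U W = - (c *\<^sub>R E 1 3)"
    and "C1_fun \<Gamma> \<beta>"
    and "(SUP x\<in>hspace \<Gamma>. \<bar>lie_deriv W \<beta> x\<bar>) < \<bar>c\<bar>"
    and "flow_of \<Gamma> (\<lambda>x. U + \<beta> x *\<^sub>R E 1 3) h"
    and "C1_fun \<Gamma> dens"
    and "\<forall>x\<in>hspace \<Gamma>. dens x > 0"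
    and "preserves_measure (density \<omega> (\<lambda>x. ennreal (dens x))) h"
  shows "parabolic \<Gamma> h \<and> differential_growth \<Gamma> h 4 \<and>
    ergodic_flow (density \<omega> (\<lambda>x. ennreal (dens x))) h \<and>
    mixing_flow (density \<omega> (\<lambda>x. ennreal (dens x))) h"
proof -
  obtain p q w where U: "U = N3 p q w" using assms(3) N3_nilp by blast
  have "E 1 2 = N3 1 0 0" "E 2 3 = N3 0 1 0" by (simp_all add: N3_def)
  then have "W = N3 1 0 0 \<or> W = N3 0 1 0" using assms(4) by auto
  then obtain w1 w2 :: real where W: "W = N3 w1 w2 0" "w1 * w2 = 0" "\<bar>w1\<bar> \<le> 1" "\<bar>w2\<bar> \<le> 1"
    using that[of 1 0] that[of 0 1] by auto
  have "(lie_bracket U W) $ 1 $ 3 = - c" using assms(6) by (simp add: E_def)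
  moreover have "(lie_bracket U W) $ 1 $ 3 = p * w2 - w1 * q"
    by (simp add: U W lie_bracket_def N3_def E_def matrix_matrix_mult_def sum_3)
  ultimately have c: "c = w1 * q - p * w2" by simp
  interpret cocompact \<Gamma> by unfold_locales (rule assms(1))
  define b where "b = (SUP x\<in>M. \<bar>lie_deriv W \<beta> x\<bar>)"
  have ld: "lie_deriv W \<beta> x = dM \<beta> x (N3 w1 w2 0)" if "x \<in> M" for x
    unfolding W by (rule lie_deriv_dM[OF assms(7) that N3_sl3])
  obtain B where B: "\<And>x. x \<in> M \<Longrightarrow> \<bar>dM \<beta> x (N3 w1 w2 0)\<bar> \<le> B" using cM_bounded[OF cM_dM[OF assms(7)]] by blast
  \<comment> \<open>A real supremum bounds its members once the family is bounded above; continuity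
    on the compact quotient provides this.\<close>
  have "bdd_above ((\<lambda>x. \<bar>lie_deriv W \<beta> x\<bar>) ` M)" by (rule bdd_aboveI[of _ B]) (auto simp: ld B)
  then have bb: "\<bar>dM \<beta> x (N3 w1 w2 0)\<bar> \<le> b" if "x \<in> M" for x
    using cSUP_upper[OF that, of "\<lambda>x. \<bar>lie_deriv W \<beta> x\<bar>"] ld[OF that] by (simp add: b_def)
  interpret sheared \<Gamma> p q w \<beta> h \<omega> dens w1 w2 c b
    using assms U W c bb by unfold_locales (auto simp: b_def)
  show ?thesis
    using C1_flow_h differential_growth_h mixing_h mixing_imp_ergodic[OF mixing_h] by (auto simp: parabolic_def)
qed

end
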